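(* Let $\mathcal V$ be a braided rigid monoidal category admitting a coend $C$, and let $(H,\mathfrak R)$ be a quasitriangular Hopf algebra in $\mathcal V$. Products and powers of $C$-elements are taken in $\mathrm{Hom}(C,H)$ with the convolution product. (a) The $C$-Drinfeld element $\mathfrak u$ induces a bijection $\mathsf{CBal}(H)\cong\mathsf{CPiv}(H)$ between $C$-balanced and $C$-pivotal elements of $H$, via $\mathfrak t\mapsto\mathfrak t\mathfrak u$. (b) Under this correspondence, a $C$-balanced element $\mathfrak t$ is ribbon if and only if one of the following two equivalent conditions is satisfied: (i) $\mathfrak t^{-2}=\mathfrak c_\mu$; (ii) the corresponding pivotal element $\mathfrak p=\mathfrak t\mathfrak u$ satisfies $\mathfrak p^2=\mathfrak q_\mu$.
   Context: **Categories.** Monoidal categories are strict, with product $\otimes$ and unit $\mathbf 1$; the braiding of $\mathcal V$ is $\sigma_{X,Y}:X\otimes Y\to Y\otimes X$. $\mathrm{Nat}(F,G)$ is the set of natural transformations and $\mathrm{End}(F)=\mathrm{Nat}(F,F)$. Rigid means every $X$ has a left dual ${}^\vee X$ with $\mathrm{ev}^l_X:{}^\vee X\otimes X\to\mathbf 1$, $\mathrm{coev}^l_X:\mathbf 1\to X\otimes{}^\vee X$ and a right dual $X^\vee$ with $\mathrm{ev}^r_X:X\otimes X^\vee\to\mathbf 1$, $\mathrm{coev}^r_X:\mathbf 1\to X^\vee\otimes X$ satisfying the snake identities; ${}^\vee f$, $f^\vee$ denote dual morphisms. The canonical isomorphisms $({}^\vee X)^\vee\cong X\cong{}^\vee(X^\vee)$,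 $(X\otimes Y)^\vee\cong Y^\vee\otimes X^\vee$, etc. are suppressed. The Drinfeld morphism of a braided rigid category $(\mathcal C,c)$ is $(\mathrm{id}_{X^{\vee\vee}}\otimes\mathrm{ev}^r_X)(\mathrm{id}_{X^{\vee\vee}}\otimes c_{X^\vee,X})(\mathrm{coev}^r_{X^\vee}\otimes\mathrm{id}_X):X\to X^{\vee\vee}$ (an isomorphism); $\mu$ denotes the Drinfeld morphism of $(\mathcal V,\sigma)$ and $\bar\mu=\mu^{-1}$. Put $\mu^!_X={}^\vee(\mu_{X^\vee}):X^{\vee\vee}\to X$ and $c_0=\mu^!\mu\in\mathrm{End}(1_{\mathcal V})$, an automorphism. **Hopf algebra.** $H=(H,m,u_H,\Delta_H,\epsilon_H,S_H)$ is a Hopf algebra in $(\mathcal V,\sigma)$ with invertible antipode. $\mathcal V_H$ is the category of right $H$-modules $(M,r)$, $r:M\otimes H\to M$. It is monoidal: $(M,r)\otimes(N,s)$ has action $(r\otimes s)(\mathrm{id}_M\otimes\sigma_{N,H}\otimes\mathrm{id}_H)(\mathrm{id}_{M\otimes N}\otimes\Delta_H)$, and $\mathbf 1$ has action $\epsilon_H$. It is rigid, with duals those of the underlying objects, the actions being the unique ones making (co)evaluations $H$-linear. $U_H:\mathcal V_H\to\mathcal V$ is the forgetful functor. For $h\in\mathrm{Nat}(1_{\mathcal V},1_{\mathcal V}\otimes H)$ put $h^\sharp_{(M,r)}=r\,h_M$; $h\mapsto h^\sharp$ is a bijection $\mathrm{Nat}(1_{\mathcal V},1_{\mathcal V}\otimes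 H)\to\mathrm{End}(U_H)$ with inverse $f\mapsto f^\flat$, $f^\flat_X=f_{(X\otimes H,\mathrm{id}_X\otimes m)}(\mathrm{id}_X\otimes u_H)$. **Coend.** $\mathcal V$ admits a coend if the functor $(X,Y)\mapsto{}^\vee X\otimes Y$, $\mathcal V^{op}\times\mathcal V\to\mathcal V$, has a coend $(C,\iota)$. The universal coaction is $\delta_X=(\mathrm{id}_X\otimes\iota_X)(\mathrm{coev}^l_X\otimes\mathrm{id}_X):X\to X\otimes C$. For each $D$, $f\mapsto((\mathrm{id}_X\otimes f)\delta_X)_X$ is a bijection $\mathrm{Hom}(C,D)\to\mathrm{Nat}(1_{\mathcal V},1_{\mathcal V}\otimes D)$; for $D=H$ it is denoted $\Sigma$. Put $\delta^{(2)}_{X,Y}=(\mathrm{id}_X\otimes\sigma_{C,Y}\otimes\mathrm{id}_C)(\delta_X\otimes\delta_Y)$; similarly $f\mapsto((\mathrm{id}_{X\otimes Y}\otimes f)\delta^{(2)}_{X,Y})_{X,Y}$ is a bijection from $\mathrm{Hom}(C\otimes C,D)$ to natural transformations $X\otimes Y\to X\otimes Y\otimes D$. $C$ is a Hopf algebra with structure determined by $(\mathrm{id}\otimes m_C)\delta^{(2)}_{X,Y}=\delta_{X\otimes Y}$, $u_C=\delta_{\mathbf 1}$, $(\mathrm{id}_X\otimes\Delta_C)\delta_X=(\delta_X\otimes\mathrm{id}_C)\delta_X$, $(\mathrm{id}_X\otimes\epsilon_C)\delta_X=\mathrm{id}_X$. The pairings $\omega,\underline\omega:C\otimes C\to\mathbf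 1$ are determined by $(\mathrm{id}\otimes\omega)\delta^{(2)}_{X,Y}=\sigma_{Y,X}\sigma_{X,Y}$ and $(\mathrm{id}\otimes\underline\omega)\delta^{(2)}_{X,Y}=(\sigma_{Y,X}\sigma_{X,Y})^{-1}$. A $C$-element of $H$ is a morphism $C\to H$; $\mathrm{Hom}(C,H)$ is a monoid under $\mathfrak a\mathfrak b=m(\mathfrak a\otimes\mathfrak b)\Delta_C$ with unit $u_H\epsilon_C$. **$C$-pivotal elements.** A $C$-element $\mathfrak p$ is twisted grouplike if $\epsilon_H\mathfrak p u_C=\mathrm{id}_{\mathbf 1}$ and $$\Delta_H\mathfrak p\,m_C=\Big(\big[(\mathfrak p\otimes\mathfrak p)(\mathrm{id}_C\otimes\underline\omega\otimes\mathrm{id}_C)(\delta_C\otimes\Delta_C)\big]\otimes\omega\Big)(\mathrm{id}_C\otimes\sigma_{C,C}\otimes\mathrm{id}_C)(\Delta_C\otimes\Delta_C).$$ It is $C$-pivotal if moreover, as morphisms $C\otimes H\to H$, $$m(\mathrm{id}_H\otimes\mathfrak p\,m_C)(\sigma_{C,H}\otimes\mathrm{id}_C)(\mathrm{id}_C\otimes\delta_H)=m(\mathfrak p\otimes\mathrm{id}_H\otimes\omega)(\mathrm{id}_C\otimes\sigma_{C,H}\otimes\mathrm{id}_C)(\Delta_C\otimes\delta_H S_H^2).$$ **$R$-matrices.** For $\mathfrak R:C\otimes C\to H\otimes H$ put $R_{X,Y}=(\sigma_{X,Y\otimes H}\otimes\mathrm{id}_H)(\mathrm{id}_{X\otimes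 Y}\otimes\mathfrak R)\delta^{(2)}_{X,Y}:X\otimes Y\to Y\otimes H\otimes X\otimes H$. $\mathfrak R$ is an $R$-matrix if for all $X,Y,Z\in\mathcal V$ (writing objects for identities): 1. $(Y\otimes m\otimes X\otimes m)R_{X\otimes H,Y\otimes H}(X\otimes\sigma_{Y,H}\otimes H)(X\otimes Y\otimes\Delta_H)=(Y\otimes m\otimes X\otimes m)(Y\otimes H\otimes\sigma_{X\otimes H,H}\otimes H)(R_{X,Y}\otimes\Delta_H)$; 2. $(Y\otimes\sigma_{Z,H}\otimes H\otimes X\otimes H)(Y\otimes Z\otimes\Delta_H\otimes X\otimes H)R_{X,Y\otimes Z}=(Y\otimes H\otimes Z\otimes H\otimes X\otimes m)(Y\otimes H\otimes R_{X\otimes H,Z})(R_{X,Y}\otimes Z)$; 3. $(Z\otimes H\otimes X\otimes\sigma_{Y,H}\otimes H)(Z\otimes H\otimes X\otimes Y\otimes\Delta_H)R_{X\otimes Y,Z}=(Z\otimes m\otimes X\otimes H\otimes Y\otimes H)(R_{X,Z\otimes H}\otimes Y\otimes H)(X\otimes R_{Y,Z})$; 4. $(\epsilon_H\otimes X\otimes H)R_{X,\mathbf 1}=X\otimes u_H=(X\otimes H\otimes\epsilon_H)R_{\mathbf 1,X}$. Then $c^{\mathfrak R}_{(M,r),(N,s)}=(s\otimes r)R_{M,N}$ is a braiding on $\mathcal V_H$. A quasitriangular Hopf algebra is a Hopf algebra with an $R$-matrix. **$C$-balanced and $C$-ribbon elements.** A $C$-element $\mathfrak t$ with $t=\Sigma(\mathfrak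 t)$ is $C$-balanced if: (CT1) it is central, i.e. $m(\mathrm{id}_H\otimes\mathfrak t\,m_C)(\sigma_{C,H}\otimes\mathrm{id}_C)(\mathrm{id}_C\otimes\delta_H)=m(\mathfrak t\otimes\mathrm{id}_H)$ as morphisms $C\otimes H\to H$; (CT2) $\epsilon_H\mathfrak t u_C=\mathrm{id}_{\mathbf 1}$; (CT3) for all $X,Y$, $$(X\otimes\sigma_{Y,H}\otimes H)(X\otimes Y\otimes\Delta_H)\,t_{X\otimes Y}=(L_{t,X}\otimes L_{t,Y})(X\otimes m\otimes Y\otimes m)R_{Y\otimes H,X\otimes H}R_{X,Y},$$ where $L_{t,X}=(\mathrm{id}_X\otimes m)t_{X\otimes H}$. Such elements are convolution invertible. It is $C$-ribbon if also (CT4) $S(\mathfrak t)=\mathfrak t$, where for a $C$-element $\mathfrak a$, $S(\mathfrak a)$ is the unique $C$-element with $\Sigma(S(\mathfrak a))^\sharp_M=\big(\Sigma(\mathfrak a)^\sharp_{{}^\vee M}\big)^\vee$ for all $M\in\mathcal V_H$. **Special elements.** Let $\nu$ be the Drinfeld morphism of $(\mathcal V_H,c^{\mathfrak R})$. The $C$-Drinfeld element is $\mathfrak u=\Sigma^{-1}((\bar\mu\nu)^\flat)$, where $\bar\mu\nu\in\mathrm{End}(U_H)$ is $M\mapsto\bar\mu_M\nu_M$. It is convolution invertible with inverse $\bar{\mathfrak u}$. Let $\mathfrak c_0:C\to\mathbf 1$ be determined by $(\mathrm{id}_X\otimes\mathfrak c_0)\delta_X=(c_0)_X$ and let $\bar{\mathfrak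 c}_0$ be its convolution inverse (equivalently the morphism corresponding to $c_0^{-1}$). Put $\mathfrak q_\mu=(\mathfrak uS(\bar{\mathfrak u})\otimes\bar{\mathfrak c}_0)\Delta_C$ and $\mathfrak c_\mu=(\mathfrak uS(\mathfrak u)\otimes\mathfrak c_0)\Delta_C$. *)

theory Defs
  imports "HOL-Algebra.Group"
begin

section \<open>Braided rigid strict monoidal categories\<close>

text \<open>
  Categories have a set of objects and a set of arrows with source and target. The arrow
  \<open>\<langle>X\<rangle>\<close> is the identity of the object \<open>X\<close>; \<open>g \<cdot> f\<close> is \<open>g\<close> after \<open>f\<close>;
  \<open>\<otimes>\<^sub>o\<close> and \<open>\<otimes>\<^sub>a\<close> are the tensor products of objects and of arrows.
  The values of all operations outside the carriers are irrelevant.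
  Chosen duals are part of the structure:
  \<open>evl X : \<^sup>\<or>X \<otimes> X \<rightarrow> 1\<close>, \<open>coevl X : 1 \<rightarrow> X \<otimes> \<^sup>\<or>X\<close>,
  \<open>evr X : X \<otimes> X\<^sup>\<or> \<rightarrow> 1\<close>, \<open>coevr X : 1 \<rightarrow> X\<^sup>\<or> \<otimes> X\<close>.
\<close>

record ('o, 'm) braided_rigid =
  Ob :: "'o set"
  Ar :: "'m set"
  src :: "'m \<Rightarrow> 'o"
  tgt :: "'m \<Rightarrow> 'o"
  ident :: "'o \<Rightarrow> 'm"  ("\<langle>_\<rangle>\<index>")
  cmp :: "'m \<Rightarrow> 'm \<Rightarrow> 'm"  (infixr "\<cdot>\<index>" 60)
  tensor_ob :: "'o \<Rightarrow> 'o \<Rightarrow> 'o"  (infixr "\<otimes>\<^sub>o\<index>" 75)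
  tensor_ar :: "'m \<Rightarrow> 'm \<Rightarrow> 'm"  (infixr "\<otimes>\<^sub>a\<index>" 70)
  unit_ob :: 'o  ("\<^bold>1\<index>")
  braid :: "'o \<Rightarrow> 'o \<Rightarrow> 'm"  ("\<sigma>\<index>")
  ldual :: "'o \<Rightarrow> 'o"
  evl :: "'o \<Rightarrow> 'm"
  coevl :: "'o \<Rightarrow> 'm"
  rdual :: "'o \<Rightarrow> 'o"
  evr :: "'o \<Rightarrow> 'm"
  coevr :: "'o \<Rightarrow> 'm"

context
  fixes V :: "('o, 'm) braided_rigid" (structure)
begin

definition Hom :: "'o \<Rightarrow> 'o \<Rightarrow> 'm set" where
  "Hom X Y = {f \<in> Ar V. src V f = X \<and> tgt V f = Y}"

definition is_inverse :: "'m \<Rightarrow> 'm \<Rightarrow> bool" where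
  "is_inverse f g \<longleftrightarrow> g \<in> Hom (tgt V f) (src V f)
     \<and> g \<cdot> f = \<langle>src V f\<rangle> \<and> f \<cdot> g = \<langle>tgt V f\<rangle>"

definition is_iso :: "'m \<Rightarrow> bool" where
  "is_iso f \<longleftrightarrow> f \<in> Ar V \<and> (\<exists>g. is_inverse f g)"

definition arr_inv :: "'m \<Rightarrow> 'm" where
  "arr_inv f = (THE g. is_inverse f g)"

definition ldual_arr :: "'m \<Rightarrow> 'm" where
  "ldual_arr f = (let X = src V f; Y = tgt V f in
     (evl V Y \<otimes>\<^sub>a \<langle>ldual V X\<rangle>)
     \<cdot> (\<langle>ldual V Y\<rangle> \<otimes>\<^sub>a f \<otimes>\<^sub>a \<langle>ldual V X\<rangle>)
     \<cdot> (\<langle>ldual V Y\<rangle> \<otimes>\<^sub>a coevl V X))"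

definition rdual_arr :: "'m \<Rightarrow> 'm" where
  "rdual_arr f = (let X = src V f; Y = tgt V f in
     (\<langle>rdual V X\<rangle> \<otimes>\<^sub>a evr V Y)
     \<cdot> (\<langle>rdual V X\<rangle> \<otimes>\<^sub>a f \<otimes>\<^sub>a \<langle>rdual V Y\<rangle>)
     \<cdot> (coevr V X \<otimes>\<^sub>a \<langle>rdual V Y\<rangle>))"

text \<open>The canonical isomorphisms \<open>\<^sup>\<or>(X\<^sup>\<or>) \<rightarrow> X\<close> and \<open>(\<^sup>\<or>X)\<^sup>\<or> \<rightarrow> X\<close>, which exist
  because \<open>X\<close> is a left dual of \<open>X\<^sup>\<or>\<close> and a right dual of \<open>\<^sup>\<or>X\<close>.\<close>

definition can_lr :: "'o \<Rightarrow> 'm" where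
  "can_lr X = (evl V (rdual V X) \<otimes>\<^sub>a \<langle>X\<rangle>) \<cdot> (\<langle>ldual V (rdual V X)\<rangle> \<otimes>\<^sub>a coevr V X)"

definition can_rl :: "'o \<Rightarrow> 'm" where
  "can_rl X = (\<langle>X\<rangle> \<otimes>\<^sub>a evr V (ldual V X)) \<cdot> (coevl V X \<otimes>\<^sub>a \<langle>rdual V (ldual V X)\<rangle>)"

definition drinfeld :: "'o \<Rightarrow> 'm" where
  "drinfeld X = (let X' = rdual V X; X'' = rdual V X' in
     (\<langle>X''\<rangle> \<otimes>\<^sub>a evr V X) \<cdot> (\<langle>X''\<rangle> \<otimes>\<^sub>a \<sigma> X' X) \<cdot> (coevr V X' \<otimes>\<^sub>a \<langle>X\<rangle>))"

text \<open>\<open>\<mu>\<^sup>!\<^sub>X = \<^sup>\<or>(\<mu>\<^bsub>X\<^sup>\<or>\<^esub>) : X\<^sup>\<or>\<^sup>\<or> \<rightarrow> X\<close>, with source \<open>\<^sup>\<or>(X\<^sup>\<or>\<^sup>\<or>\<^sup>\<or>)\<close> and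
  target \<open>\<^sup>\<or>(X\<^sup>\<or>)\<close> of the left dual arrow identified with \<open>X\<^sup>\<or>\<^sup>\<or>\<close> and \<open>X\<close>.\<close>

definition drinfeld_shriek :: "'o \<Rightarrow> 'm" where
  "drinfeld_shriek X =
     can_lr X \<cdot> ldual_arr (drinfeld (rdual V X)) \<cdot> arr_inv (can_lr (rdual V (rdual V X)))"

definition c0 :: "'o \<Rightarrow> 'm" where
  "c0 X = drinfeld_shriek X \<cdot> drinfeld X"

end

locale strict_monoidal_category =
  fixes V :: "('o, 'm) braided_rigid" (structure)
  assumes src_tgt: "f \<in> Ar V \<Longrightarrow> src V f \<in> Ob V \<and> tgt V f \<in> Ob V"
    and ident_hom: "X \<in> Ob V \<Longrightarrow> \<langle>X\<rangle> \<in> Hom V X X"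
    and cmp_hom: "\<lbrakk>f \<in> Hom V X Y; g \<in> Hom V Y Z\<rbrakk> \<Longrightarrow> g \<cdot> f \<in> Hom V X Z"
    and cmp_ident: "f \<in> Hom V X Y \<Longrightarrow> f \<cdot> \<langle>X\<rangle> = f \<and> \<langle>Y\<rangle> \<cdot> f = f"
    and cmp_assoc:
      "\<lbrakk>f \<in> Hom V W X; g \<in> Hom V X Y; h \<in> Hom V Y Z\<rbrakk> \<Longrightarrow> (h \<cdot> g) \<cdot> f = h \<cdot> (g \<cdot> f)"
    and unit_closed: "\<^bold>1 \<in> Ob V"
    and tensor_closed: "\<lbrakk>X \<in> Ob V; Y \<in> Ob V\<rbrakk> \<Longrightarrow> X \<otimes>\<^sub>o Y \<in> Ob V"
    and tensor_ob_assoc: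
      "\<lbrakk>X \<in> Ob V; Y \<in> Ob V; Z \<in> Ob V\<rbrakk> \<Longrightarrow> (X \<otimes>\<^sub>o Y) \<otimes>\<^sub>o Z = X \<otimes>\<^sub>o (Y \<otimes>\<^sub>o Z)"
    and tensor_ob_unit: "X \<in> Ob V \<Longrightarrow> \<^bold>1 \<otimes>\<^sub>o X = X \<and> X \<otimes>\<^sub>o \<^bold>1 = X"
    and tensor_hom:
      "\<lbrakk>f \<in> Hom V X Y; g \<in> Hom V X' Y'\<rbrakk> \<Longrightarrow> f \<otimes>\<^sub>a g \<in> Hom V (X \<otimes>\<^sub>o X') (Y \<otimes>\<^sub>o Y')"
    and tensor_ident: "\<lbrakk>X \<in> Ob V; Y \<in> Ob V\<rbrakk> \<Longrightarrow> \<langle>X\<rangle> \<otimes>\<^sub>a \<langle>Y\<rangle> = \<langle>X \<otimes>\<^sub>o Y\<rangle>"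
    and interchange:
      "\<lbrakk>f \<in> Hom V X Y; g \<in> Hom V Y Z; f' \<in> Hom V X' Y'; g' \<in> Hom V Y' Z'\<rbrakk>
       \<Longrightarrow> (g \<cdot> f) \<otimes>\<^sub>a (g' \<cdot> f') = (g \<otimes>\<^sub>a g') \<cdot> (f \<otimes>\<^sub>a f')"
    and tensor_ar_assoc:
      "\<lbrakk>f \<in> Ar V; g \<in> Ar V; h \<in> Ar V\<rbrakk> \<Longrightarrow> (f \<otimes>\<^sub>a g) \<otimes>\<^sub>a h = f \<otimes>\<^sub>a (g \<otimes>\<^sub>a h)"
    and tensor_ar_unit: "f \<in> Ar V \<Longrightarrow> \<langle>\<^bold>1\<rangle> \<otimes>\<^sub>a f = f \<and> f \<otimes>\<^sub>a \<langle>\<^bold>1\<rangle> = f"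

locale braided_category = strict_monoidal_category +
  assumes braid_hom: "\<lbrakk>X \<in> Ob V; Y \<in> Ob V\<rbrakk> \<Longrightarrow> \<sigma> X Y \<in> Hom V (X \<otimes>\<^sub>o Y) (Y \<otimes>\<^sub>o X)"
    and braid_iso: "\<lbrakk>X \<in> Ob V; Y \<in> Ob V\<rbrakk> \<Longrightarrow> is_iso V (\<sigma> X Y)"
    and braid_natural:
      "\<lbrakk>f \<in> Hom V X X'; g \<in> Hom V Y Y'\<rbrakk>
       \<Longrightarrow> \<sigma> X' Y' \<cdot> (f \<otimes>\<^sub>a g) = (g \<otimes>\<^sub>a f) \<cdot> \<sigma> X Y"
    and hexagon_left:
      "\<lbrakk>X \<in> Ob V; Y \<in> Ob V; Z \<in> Ob V\<rbrakk>
       \<Longrightarrow> \<sigma> (X \<otimes>\<^sub>o Y) Z = (\<sigma> X Z \<otimes>\<^sub>a \<langle>Y\<rangle>) \<cdot> (\<langle>X\<rangle> \<otimes>\<^sub>a \<sigma> Y Z)"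
    and hexagon_right:
      "\<lbrakk>X \<in> Ob V; Y \<in> Ob V; Z \<in> Ob V\<rbrakk>
       \<Longrightarrow> \<sigma> X (Y \<otimes>\<^sub>o Z) = (\<langle>Y\<rangle> \<otimes>\<^sub>a \<sigma> X Z) \<cdot> (\<sigma> X Y \<otimes>\<^sub>a \<langle>Z\<rangle>)"

locale braided_rigid_category = braided_category +
  assumes ldual_closed: "X \<in> Ob V \<Longrightarrow> ldual V X \<in> Ob V"
    and evl_hom: "X \<in> Ob V \<Longrightarrow> evl V X \<in> Hom V (ldual V X \<otimes>\<^sub>o X) \<^bold>1"
    and coevl_hom: "X \<in> Ob V \<Longrightarrow> coevl V X \<in> Hom V \<^bold>1 (X \<otimes>\<^sub>o ldual V X)"
    and snake_l1:
      "X \<in> Ob V \<Longrightarrow> (\<langle>X\<rangle> \<otimes>\<^sub>a evl V X) \<cdot> (coevl V X \<otimes>\<^sub>a \<langle>X\<rangle>) = \<langle>X\<rangle>"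
    and snake_l2:
      "X \<in> Ob V \<Longrightarrow>
       (evl V X \<otimes>\<^sub>a \<langle>ldual V X\<rangle>) \<cdot> (\<langle>ldual V X\<rangle> \<otimes>\<^sub>a coevl V X) = \<langle>ldual V X\<rangle>"
    and rdual_closed: "X \<in> Ob V \<Longrightarrow> rdual V X \<in> Ob V"
    and evr_hom: "X \<in> Ob V \<Longrightarrow> evr V X \<in> Hom V (X \<otimes>\<^sub>o rdual V X) \<^bold>1"
    and coevr_hom: "X \<in> Ob V \<Longrightarrow> coevr V X \<in> Hom V \<^bold>1 (rdual V X \<otimes>\<^sub>o X)"
    and snake_r1:
      "X \<in> Ob V \<Longrightarrow> (evr V X \<otimes>\<^sub>a \<langle>X\<rangle>) \<cdot> (\<langle>X\<rangle> \<otimes>\<^sub>a coevr V X) = \<langle>X\<rangle>"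
    and snake_r2:
      "X \<in> Ob V \<Longrightarrow>
       (\<langle>rdual V X\<rangle> \<otimes>\<^sub>a evr V X) \<cdot> (coevr V X \<otimes>\<^sub>a \<langle>rdual V X\<rangle>) = \<langle>rdual V X\<rangle>"


section \<open>Hopf algebras and their modules\<close>

record ('o, 'm) hopf =
  obj :: 'o
  mul :: 'm
  uni :: 'm
  com :: 'm
  cou :: 'm
  ant :: 'm

locale hopf_algebra = braided_rigid_category V
  for V :: "('o, 'm) braided_rigid" (structure) +
  fixes H :: "('o, 'm) hopf"
  assumes obj_closed: "obj H \<in> Ob V"
    and mul_hom: "mul H \<in> Hom V (obj H \<otimes>\<^sub>o obj H) (obj H)"
    and uni_hom: "uni H \<in> Hom V \<^bold>1 (obj H)"
    and com_hom: "com H \<in> Hom V (obj H) (obj H \<otimes>\<^sub>o obj H)"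
    and cou_hom: "cou H \<in> Hom V (obj H) \<^bold>1"
    and ant_hom: "ant H \<in> Hom V (obj H) (obj H)"
    and mul_assoc: "mul H \<cdot> (mul H \<otimes>\<^sub>a \<langle>obj H\<rangle>) = mul H \<cdot> (\<langle>obj H\<rangle> \<otimes>\<^sub>a mul H)"
    and mul_uni: "mul H \<cdot> (uni H \<otimes>\<^sub>a \<langle>obj H\<rangle>) = \<langle>obj H\<rangle>"
      "mul H \<cdot> (\<langle>obj H\<rangle> \<otimes>\<^sub>a uni H) = \<langle>obj H\<rangle>"
    and com_coassoc: "(com H \<otimes>\<^sub>a \<langle>obj H\<rangle>) \<cdot> com H = (\<langle>obj H\<rangle> \<otimes>\<^sub>a com H) \<cdot> com H"
    and com_cou: "(cou H \<otimes>\<^sub>a \<langle>obj H\<rangle>) \<cdot> com H = \<langle>obj H\<rangle>"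
      "(\<langle>obj H\<rangle> \<otimes>\<^sub>a cou H) \<cdot> com H = \<langle>obj H\<rangle>"
    and com_mul: "com H \<cdot> mul H =
      (mul H \<otimes>\<^sub>a mul H) \<cdot> (\<langle>obj H\<rangle> \<otimes>\<^sub>a \<sigma> (obj H) (obj H) \<otimes>\<^sub>a \<langle>obj H\<rangle>) \<cdot> (com H \<otimes>\<^sub>a com H)"
    and com_uni: "com H \<cdot> uni H = uni H \<otimes>\<^sub>a uni H"
    and cou_mul: "cou H \<cdot> mul H = cou H \<otimes>\<^sub>a cou H"
    and cou_uni: "cou H \<cdot> uni H = \<langle>\<^bold>1\<rangle>"
    and antipode: "mul H \<cdot> (ant H \<otimes>\<^sub>a \<langle>obj H\<rangle>) \<cdot> com H = uni H \<cdot> cou H"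
      "mul H \<cdot> (\<langle>obj H\<rangle> \<otimes>\<^sub>a ant H) \<cdot> com H = uni H \<cdot> cou H"
    and ant_iso: "is_iso V (ant H)"

context
  fixes V :: "('o, 'm) braided_rigid" (structure)
    and H :: "('o, 'm) hopf"
begin

definition right_module :: "'o \<times> 'm \<Rightarrow> bool" where
  "right_module A \<longleftrightarrow> (case A of (M, r) \<Rightarrow>
     M \<in> Ob V \<and> r \<in> Hom V (M \<otimes>\<^sub>o obj H) M
     \<and> r \<cdot> (r \<otimes>\<^sub>a \<langle>obj H\<rangle>) = r \<cdot> (\<langle>M\<rangle> \<otimes>\<^sub>a mul H)
     \<and> r \<cdot> (\<langle>M\<rangle> \<otimes>\<^sub>a uni H) = \<langle>M\<rangle>)"

definition H_linear :: "'o \<times> 'm \<Rightarrow> 'm \<Rightarrow> 'o \<times> 'm \<Rightarrow> bool" where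
  "H_linear A f B \<longleftrightarrow> f \<in> Hom V (fst A) (fst B)
     \<and> f \<cdot> snd A = snd B \<cdot> (f \<otimes>\<^sub>a \<langle>obj H\<rangle>)"

definition mod_tensor :: "'o \<times> 'm \<Rightarrow> 'o \<times> 'm \<Rightarrow> 'o \<times> 'm" where
  "mod_tensor A B = (case A of (M, r) \<Rightarrow> case B of (N, s) \<Rightarrow>
     (M \<otimes>\<^sub>o N,
      (r \<otimes>\<^sub>a s) \<cdot> (\<langle>M\<rangle> \<otimes>\<^sub>a \<sigma> N (obj H) \<otimes>\<^sub>a \<langle>obj H\<rangle>) \<cdot> (\<langle>M \<otimes>\<^sub>o N\<rangle> \<otimes>\<^sub>a com H)))"

definition mod_unit :: "'o \<times> 'm" where
  "mod_unit = (\<^bold>1, cou H)"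

text \<open>There is at most one action on the dual making both (co)evaluations linear, by the snake
  identities; it exists because the antipode is invertible.\<close>

definition mod_ldual :: "'o \<times> 'm \<Rightarrow> 'o \<times> 'm" where
  "mod_ldual A = (let M = fst A; D = ldual V M in
     (D, THE s. right_module (D, s)
       \<and> H_linear (mod_tensor (D, s) A) (evl V M) mod_unit
       \<and> H_linear mod_unit (coevl V M) (mod_tensor A (D, s))))"

definition mod_rdual :: "'o \<times> 'm \<Rightarrow> 'o \<times> 'm" where
  "mod_rdual A = (let M = fst A; D = rdual V M in
     (D, THE s. right_module (D, s)
       \<and> H_linear (mod_tensor A (D, s)) (evr V M) mod_unit
       \<and> H_linear mod_unit (coevr V M) (mod_tensor (D, s) A)))"

text \<open>The category of right modules, with \<open>c\<close> giving the underlying arrows of its braiding.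
  An arrow \<open>A \<rightarrow> B\<close> is a triple \<open>(A, f, B)\<close> with \<open>f\<close> an \<open>H\<close>-linear arrow of \<open>V\<close>, so
  \<open>fst\<close> on objects and \<open>fst \<circ> snd\<close> on arrows is the forgetful functor.\<close>

definition module_category ::
    "('o \<times> 'm \<Rightarrow> 'o \<times> 'm \<Rightarrow> 'm) \<Rightarrow> ('o \<times> 'm, ('o \<times> 'm) \<times> 'm \<times> ('o \<times> 'm)) braided_rigid" where
  "module_category c = \<lparr>
     Ob = {A. right_module A},
     Ar = {(A, f, B). right_module A \<and> right_module B \<and> H_linear A f B},
     src = (\<lambda>(A, f, B). A),
     tgt = (\<lambda>(A, f, B). B),
     ident = (\<lambda>A. (A, \<langle>fst A\<rangle>, A)),
     cmp = (\<lambda>(B', g, D) (A, f, B). (A, g \<cdot> f, D)),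
     tensor_ob = mod_tensor,
     tensor_ar = (\<lambda>(A, f, B) (A', f', B'). (mod_tensor A A', f \<otimes>\<^sub>a f', mod_tensor B B')),
     unit_ob = mod_unit,
     braid = (\<lambda>A B. (mod_tensor A B, c A B, mod_tensor B A)),
     ldual = mod_ldual,
     evl = (\<lambda>A. (mod_tensor (mod_ldual A) A, evl V (fst A), mod_unit)),
     coevl = (\<lambda>A. (mod_unit, coevl V (fst A), mod_tensor A (mod_ldual A))),
     rdual = mod_rdual,
     evr = (\<lambda>A. (mod_tensor A (mod_rdual A), evr V (fst A), mod_unit)),
     coevr = (\<lambda>A. (mod_unit, coevr V (fst A), mod_tensor (mod_rdual A) A))\<rparr>"

text \<open>Natural transformations \<open>1 \<rightarrow> 1 \<otimes> H\<close> are families indexed by objects of \<open>V\<close>;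
  endomorphisms of the forgetful functor are families indexed by modules.\<close>

definition sharp :: "('o \<Rightarrow> 'm) \<Rightarrow> 'o \<times> 'm \<Rightarrow> 'm" where
  "sharp h A = snd A \<cdot> h (fst A)"

definition flat :: "('o \<times> 'm \<Rightarrow> 'm) \<Rightarrow> 'o \<Rightarrow> 'm" where
  "flat f X = f (X \<otimes>\<^sub>o obj H, \<langle>X\<rangle> \<otimes>\<^sub>a mul H) \<cdot> (\<langle>X\<rangle> \<otimes>\<^sub>a uni H)"

end


section \<open>The coend\<close>

text \<open>\<open>(C, \<iota>)\<close> is a coend of the functor \<open>(X, Y) \<mapsto> \<^sup>\<or>X \<otimes> Y\<close>.\<close>

definition dinatural :: "('o, 'm) braided_rigid \<Rightarrow> 'o \<Rightarrow> ('o \<Rightarrow> 'm) \<Rightarrow> bool" where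
  "dinatural V D j \<longleftrightarrow>
     (\<forall>X \<in> Ob V. j X \<in> Hom V (ldual V X \<otimes>\<^sub>o\<^bsub>V\<^esub> X) D)
     \<and> (\<forall>X \<in> Ob V. \<forall>Y \<in> Ob V. \<forall>f \<in> Hom V X Y.
          j Y \<cdot>\<^bsub>V\<^esub> (\<langle>ldual V Y\<rangle>\<^bsub>V\<^esub> \<otimes>\<^sub>a\<^bsub>V\<^esub> f) = j X \<cdot>\<^bsub>V\<^esub> (ldual_arr V f \<otimes>\<^sub>a\<^bsub>V\<^esub> \<langle>X\<rangle>\<^bsub>V\<^esub>))"

locale coend = braided_rigid_category V
  for V :: "('o, 'm) braided_rigid" (structure) +
  fixes C :: 'o and \<iota> :: "'o \<Rightarrow> 'm"
  assumes coend_closed: "C \<in> Ob V"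
    and coend_dinatural: "dinatural V C \<iota>"
    and coend_universal: "\<lbrakk>D \<in> Ob V; dinatural V D j\<rbrakk>
      \<Longrightarrow> \<exists>!f. f \<in> Hom V C D \<and> (\<forall>X \<in> Ob V. f \<cdot> \<iota> X = j X)"

context
  fixes V :: "('o, 'm) braided_rigid" (structure)
    and C :: 'o and \<iota> :: "'o \<Rightarrow> 'm"
    and H :: "('o, 'm) hopf"
    and R :: 'm
begin

definition delta :: "'o \<Rightarrow> 'm" where
  "delta X = (\<langle>X\<rangle> \<otimes>\<^sub>a \<iota> X) \<cdot> (coevl V X \<otimes>\<^sub>a \<langle>X\<rangle>)"

definition delta2 :: "'o \<Rightarrow> 'o \<Rightarrow> 'm" where
  "delta2 X Y = (\<langle>X\<rangle> \<otimes>\<^sub>a \<sigma> C Y \<otimes>\<^sub>a \<langle>C\<rangle>) \<cdot> (delta X \<otimes>\<^sub>a delta Y)"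

text \<open>The universal properties of \<open>\<delta>\<close> and \<open>\<delta>\<^sup>(\<^sup>2\<^sup>)\<close>: the arrow from \<open>C\<close>, resp. from
  \<open>C \<otimes> C\<close>, to \<open>D\<close> corresponding to a natural family.\<close>

definition from_nat :: "'o \<Rightarrow> ('o \<Rightarrow> 'm) \<Rightarrow> 'm" where
  "from_nat D h = (THE f. f \<in> Hom V C D \<and> (\<forall>X \<in> Ob V. (\<langle>X\<rangle> \<otimes>\<^sub>a f) \<cdot> delta X = h X))"

definition from_nat2 :: "'o \<Rightarrow> ('o \<Rightarrow> 'o \<Rightarrow> 'm) \<Rightarrow> 'm" where
  "from_nat2 D h = (THE f. f \<in> Hom V (C \<otimes>\<^sub>o C) D
     \<and> (\<forall>X \<in> Ob V. \<forall>Y \<in> Ob V. (\<langle>X \<otimes>\<^sub>o Y\<rangle> \<otimes>\<^sub>a f) \<cdot> delta2 X Y = h X Y))"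

definition mulC :: 'm where
  "mulC = from_nat2 C (\<lambda>X Y. delta (X \<otimes>\<^sub>o Y))"

definition uniC :: 'm where
  "uniC = delta \<^bold>1"

definition comC :: 'm where
  "comC = from_nat (C \<otimes>\<^sub>o C) (\<lambda>X. (delta X \<otimes>\<^sub>a \<langle>C\<rangle>) \<cdot> delta X)"

definition couC :: 'm where
  "couC = from_nat \<^bold>1 (\<lambda>X. \<langle>X\<rangle>)"

definition omega :: 'm where
  "omega = from_nat2 \<^bold>1 (\<lambda>X Y. \<sigma> Y X \<cdot> \<sigma> X Y)"

definition omega_bar :: 'm where
  "omega_bar = from_nat2 \<^bold>1 (\<lambda>X Y. arr_inv V (\<sigma> Y X \<cdot> \<sigma> X Y))"

definition C_elements :: "'m monoid" where
  "C_elements = \<lparr>carrier = Hom V C (obj H),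
     mult = (\<lambda>a b. mul H \<cdot> (a \<otimes>\<^sub>a b) \<cdot> comC), one = uni H \<cdot> couC\<rparr>"

definition C_scalars :: "'m monoid" where
  "C_scalars = \<lparr>carrier = Hom V C \<^bold>1,
     mult = (\<lambda>a b. (a \<otimes>\<^sub>a b) \<cdot> comC), one = couC\<rparr>"

definition Sig :: "'m \<Rightarrow> 'o \<Rightarrow> 'm" where
  "Sig a X = (\<langle>X\<rangle> \<otimes>\<^sub>a a) \<cdot> delta X"


section \<open>Pivotal elements\<close>

text \<open>Note \<open>delta C\<close>: the universal coaction on the object \<open>C\<close>, not the coproduct \<open>comC\<close>.\<close>

definition twisted_grouplike :: "'m \<Rightarrow> bool" where
  "twisted_grouplike p \<longleftrightarrow> p \<in> carrier C_elements
     \<and> cou H \<cdot> p \<cdot> uniC = \<langle>\<^bold>1\<rangle>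
     \<and> com H \<cdot> p \<cdot> mulC =
         (((p \<otimes>\<^sub>a p) \<cdot> (\<langle>C\<rangle> \<otimes>\<^sub>a omega_bar \<otimes>\<^sub>a \<langle>C\<rangle>) \<cdot> (delta C \<otimes>\<^sub>a comC)) \<otimes>\<^sub>a omega)
         \<cdot> (\<langle>C\<rangle> \<otimes>\<^sub>a \<sigma> C C \<otimes>\<^sub>a \<langle>C\<rangle>) \<cdot> (comC \<otimes>\<^sub>a comC)"

definition C_pivotal :: "'m \<Rightarrow> bool" where
  "C_pivotal p \<longleftrightarrow> twisted_grouplike p
     \<and> mul H \<cdot> (\<langle>obj H\<rangle> \<otimes>\<^sub>a (p \<cdot> mulC)) \<cdot> (\<sigma> C (obj H) \<otimes>\<^sub>a \<langle>C\<rangle>) \<cdot> (\<langle>C\<rangle> \<otimes>\<^sub>a delta (obj H))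
       = mul H \<cdot> (p \<otimes>\<^sub>a \<langle>obj H\<rangle> \<otimes>\<^sub>a omega) \<cdot> (\<langle>C\<rangle> \<otimes>\<^sub>a \<sigma> C (obj H) \<otimes>\<^sub>a \<langle>C\<rangle>)
         \<cdot> (comC \<otimes>\<^sub>a (delta (obj H) \<cdot> ant H \<cdot> ant H))"


section \<open>R-matrices\<close>

definition Rnat :: "'o \<Rightarrow> 'o \<Rightarrow> 'm" where
  "Rnat X Y = (\<sigma> X (Y \<otimes>\<^sub>o obj H) \<otimes>\<^sub>a \<langle>obj H\<rangle>) \<cdot> (\<langle>X \<otimes>\<^sub>o Y\<rangle> \<otimes>\<^sub>a R) \<cdot> delta2 X Y"

definition R_matrix :: bool where
  "R_matrix \<longleftrightarrow> R \<in> Hom V (C \<otimes>\<^sub>o C) (obj H \<otimes>\<^sub>o obj H)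
   \<and> (\<forall>X \<in> Ob V. \<forall>Y \<in> Ob V.
        (\<langle>Y\<rangle> \<otimes>\<^sub>a mul H \<otimes>\<^sub>a \<langle>X\<rangle> \<otimes>\<^sub>a mul H) \<cdot> Rnat (X \<otimes>\<^sub>o obj H) (Y \<otimes>\<^sub>o obj H)
          \<cdot> (\<langle>X\<rangle> \<otimes>\<^sub>a \<sigma> Y (obj H) \<otimes>\<^sub>a \<langle>obj H\<rangle>) \<cdot> (\<langle>X\<rangle> \<otimes>\<^sub>a \<langle>Y\<rangle> \<otimes>\<^sub>a com H)
        = (\<langle>Y\<rangle> \<otimes>\<^sub>a mul H \<otimes>\<^sub>a \<langle>X\<rangle> \<otimes>\<^sub>a mul H)
          \<cdot> (\<langle>Y\<rangle> \<otimes>\<^sub>a \<langle>obj H\<rangle> \<otimes>\<^sub>a \<sigma> (X \<otimes>\<^sub>o obj H) (obj H) \<otimes>\<^sub>a \<langle>obj H\<rangle>) \<cdot> (Rnat X Y \<otimes>\<^sub>a com H))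
   \<and> (\<forall>X \<in> Ob V. \<forall>Y \<in> Ob V. \<forall>Z \<in> Ob V.
        (\<langle>Y\<rangle> \<otimes>\<^sub>a \<sigma> Z (obj H) \<otimes>\<^sub>a \<langle>obj H\<rangle> \<otimes>\<^sub>a \<langle>X\<rangle> \<otimes>\<^sub>a \<langle>obj H\<rangle>)
          \<cdot> (\<langle>Y\<rangle> \<otimes>\<^sub>a \<langle>Z\<rangle> \<otimes>\<^sub>a com H \<otimes>\<^sub>a \<langle>X\<rangle> \<otimes>\<^sub>a \<langle>obj H\<rangle>) \<cdot> Rnat X (Y \<otimes>\<^sub>o Z)
        = (\<langle>Y\<rangle> \<otimes>\<^sub>a \<langle>obj H\<rangle> \<otimes>\<^sub>a \<langle>Z\<rangle> \<otimes>\<^sub>a \<langle>obj H\<rangle> \<otimes>\<^sub>a \<langle>X\<rangle> \<otimes>\<^sub>a mul H)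
          \<cdot> (\<langle>Y\<rangle> \<otimes>\<^sub>a \<langle>obj H\<rangle> \<otimes>\<^sub>a Rnat (X \<otimes>\<^sub>o obj H) Z) \<cdot> (Rnat X Y \<otimes>\<^sub>a \<langle>Z\<rangle>))
   \<and> (\<forall>X \<in> Ob V. \<forall>Y \<in> Ob V. \<forall>Z \<in> Ob V.
        (\<langle>Z\<rangle> \<otimes>\<^sub>a \<langle>obj H\<rangle> \<otimes>\<^sub>a \<langle>X\<rangle> \<otimes>\<^sub>a \<sigma> Y (obj H) \<otimes>\<^sub>a \<langle>obj H\<rangle>)
          \<cdot> (\<langle>Z\<rangle> \<otimes>\<^sub>a \<langle>obj H\<rangle> \<otimes>\<^sub>a \<langle>X\<rangle> \<otimes>\<^sub>a \<langle>Y\<rangle> \<otimes>\<^sub>a com H) \<cdot> Rnat (X \<otimes>\<^sub>o Y) Z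
        = (\<langle>Z\<rangle> \<otimes>\<^sub>a mul H \<otimes>\<^sub>a \<langle>X\<rangle> \<otimes>\<^sub>a \<langle>obj H\<rangle> \<otimes>\<^sub>a \<langle>Y\<rangle> \<otimes>\<^sub>a \<langle>obj H\<rangle>)
          \<cdot> (Rnat X (Z \<otimes>\<^sub>o obj H) \<otimes>\<^sub>a \<langle>Y\<rangle> \<otimes>\<^sub>a \<langle>obj H\<rangle>) \<cdot> (\<langle>X\<rangle> \<otimes>\<^sub>a Rnat Y Z))
   \<and> (\<forall>X \<in> Ob V.
        (cou H \<otimes>\<^sub>a \<langle>X\<rangle> \<otimes>\<^sub>a \<langle>obj H\<rangle>) \<cdot> Rnat X \<^bold>1 = \<langle>X\<rangle> \<otimes>\<^sub>a uni H
        \<and> \<langle>X\<rangle> \<otimes>\<^sub>a uni H = (\<langle>X\<rangle> \<otimes>\<^sub>a \<langle>obj H\<rangle> \<otimes>\<^sub>a cou H) \<cdot> Rnat \<^bold>1 X)"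

definition qt_modules :: "('o \<times> 'm, ('o \<times> 'm) \<times> 'm \<times> ('o \<times> 'm)) braided_rigid" where
  "qt_modules = module_category V H (\<lambda>A B. (snd B \<otimes>\<^sub>a snd A) \<cdot> Rnat (fst A) (fst B))"


section \<open>Balanced and ribbon elements\<close>

definition Lmul :: "('o \<Rightarrow> 'm) \<Rightarrow> 'o \<Rightarrow> 'm" where
  "Lmul t X = (\<langle>X\<rangle> \<otimes>\<^sub>a mul H) \<cdot> t (X \<otimes>\<^sub>o obj H)"

definition C_balanced :: "'m \<Rightarrow> bool" where
  "C_balanced t \<longleftrightarrow> t \<in> carrier C_elements
     \<and> mul H \<cdot> (\<langle>obj H\<rangle> \<otimes>\<^sub>a (t \<cdot> mulC)) \<cdot> (\<sigma> C (obj H) \<otimes>\<^sub>a \<langle>C\<rangle>) \<cdot> (\<langle>C\<rangle> \<otimes>\<^sub>a delta (obj H))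
       = mul H \<cdot> (t \<otimes>\<^sub>a \<langle>obj H\<rangle>)
     \<and> cou H \<cdot> t \<cdot> uniC = \<langle>\<^bold>1\<rangle>
     \<and> (\<forall>X \<in> Ob V. \<forall>Y \<in> Ob V.
          (\<langle>X\<rangle> \<otimes>\<^sub>a \<sigma> Y (obj H) \<otimes>\<^sub>a \<langle>obj H\<rangle>) \<cdot> (\<langle>X\<rangle> \<otimes>\<^sub>a \<langle>Y\<rangle> \<otimes>\<^sub>a com H) \<cdot> Sig t (X \<otimes>\<^sub>o Y)
          = (Lmul (Sig t) X \<otimes>\<^sub>a Lmul (Sig t) Y) \<cdot> (\<langle>X\<rangle> \<otimes>\<^sub>a mul H \<otimes>\<^sub>a \<langle>Y\<rangle> \<otimes>\<^sub>a mul H)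
            \<cdot> Rnat (Y \<otimes>\<^sub>o obj H) (X \<otimes>\<^sub>o obj H) \<cdot> Rnat X Y)"

text \<open>In the defining property of \<open>S(a)\<close> the right dual of an endomorphism of \<open>\<^sup>\<or>M\<close> is an
  endomorphism of \<open>(\<^sup>\<or>M)\<^sup>\<or>\<close>, transported to \<open>M\<close>.\<close>

definition S_elem :: "'m \<Rightarrow> 'm" where
  "S_elem a = (THE b. b \<in> carrier C_elements \<and>
     (\<forall>A. right_module V H A \<longrightarrow>
        sharp V (Sig b) A =
          can_rl V (fst A) \<cdot> rdual_arr V (sharp V (Sig a) (mod_ldual V H A))
            \<cdot> arr_inv V (can_rl V (fst A))))"

definition C_ribbon :: "'m \<Rightarrow> bool" where
  "C_ribbon t \<longleftrightarrow> C_balanced t \<and> S_elem t = t"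

definition CPiv :: "'m set" where
  "CPiv = {p. C_pivotal p}"

definition CBal :: "'m set" where
  "CBal = {t. C_balanced t}"


section \<open>Special elements\<close>

definition drinfeld_elem :: 'm where
  "drinfeld_elem = from_nat (obj H)
     (flat V H (\<lambda>A. arr_inv V (drinfeld V (fst A)) \<cdot> fst (snd (drinfeld qt_modules A))))"

definition c0_elem :: 'm where
  "c0_elem = from_nat \<^bold>1 (c0 V)"

definition q_mu :: 'm where
  "q_mu = ((drinfeld_elem \<otimes>\<^bsub>C_elements\<^esub> S_elem (inv\<^bsub>C_elements\<^esub> drinfeld_elem))
            \<otimes>\<^sub>a inv\<^bsub>C_scalars\<^esub> c0_elem) \<cdot> comC"

definition c_mu :: 'm where
  "c_mu = ((drinfeld_elem \<otimes>\<^bsub>C_elements\<^esub> S_elem drinfeld_elem) \<otimes>\<^sub>a c0_elem) \<cdot> comC"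

end

end

theory Submission
  imports Defs
begin

text \<open>
  A \<open>C\<close>-element \<open>a\<close> acts on every right module, by the arrow \<open>sh a A\<close> below, and this identifies the
  monoid of \<open>C\<close>-elements with the opposite of the endomorphism monoid of the forgetful functor. Under
  this identification \<open>t\<close> is balanced iff its family is \<open>H\<close>-linear, trivial on the unit, and
  \<open>t\<^bsub>A\<otimes>B\<^esub> = (t\<^sub>A \<otimes> t\<^sub>B) c\<^bsub>B,A\<^esub> c\<^bsub>A,B\<^esub>\<close>; and \<open>p\<close> is pivotal iff its family is trivial on the
  unit, \<open>p\<^bsub>A\<otimes>B\<^esub> = (p\<^sub>A \<otimes> p\<^sub>B) \<sigma>\<^bsub>B,A\<^esub> \<sigma>\<^bsub>A,B\<^esub>\<close>, and it is linear up to \<open>S\<^sup>2\<close> and a double braiding.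
  The Drinfeld element is characterised by \<open>e \<sigma>\<^bsub>D,A\<^esub> (D \<otimes> u\<^sub>A) = e c\<^bsub>D,A\<^esub>\<close> for all linear pairings
  \<open>e : A \<otimes> D \<rightarrow> 1\<close>. Comparing pairings yields
  \<open>u\<^bsub>A\<otimes>B\<^esub> c\<^bsub>B,A\<^esub> c\<^bsub>A,B\<^esub> = (u\<^sub>A \<otimes> u\<^sub>B) \<sigma>\<^bsub>B,A\<^esub> \<sigma>\<^bsub>A,B\<^esub>\<close> and the twisted linearity of \<open>u\<close>, so that
  multiplication by the invertible element \<open>u\<close> exchanges the two classes. In the same way
  \<open>e (D \<otimes> k\<^sub>A) = e c\<^bsub>A,D\<^esub> c\<^bsub>D,A\<^esub>\<close> for \<open>k = c\<^sub>\<mu>\<close>. Hence \<open>k\<close> is central, \<open>t k S(t) = 1\<close> for balanced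
  \<open>t\<close>, and \<open>k q\<^sub>\<mu> = u\<^sup>2\<close>; since \<open>t\<close> is central too, \<open>S(t) = t\<close> amounts to \<open>t\<^sup>2 k = 1\<close> and to
  \<open>(t u)\<^sup>2 = q\<^sub>\<mu>\<close>.
\<close>

section \<open>Wires\<close>

text \<open>Drinfeld morphisms, \<open>S\<close> and c_0 are defined through chosen (double) duals,
  and the chosen dual of a tensor product is not assumed to be the product of the chosen duals.
  Testing arrows against arbitrary pairings removes both difficulties: evaluations are
  nondegenerate, and a linear pairing factors through an evaluation by a linear arrow, along which
  naturality applies.

  Modules and C-elements are matched through the free modules \<open>X \<otimes> H\<close>:
  inserting the unit recovers the natural family of a C-element, and the action presents every
  module as a quotient of a free one.

  The modules with the braiding of \<open>R\<close> form an instance \<open>W\<close> of the same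
  locale as \<open>V\<close>, so the lemmas on pairings and Drinfeld morphisms are proved once and
  used for both braidings. An R-matrix comes without an inverse; rigidity supplies that of the
  braiding. The factor c_0 of \<open>c_mu\<close> is forced: after \<open>u\<close> has been
  transposed, two crossings of \<open>\<sigma>\<close> are missing from the pairing laws of
  \<open>u\<close>, and c_0 provides exactly a double braiding.

  Equality of composite arrows is decided by rewriting on lists of wires, because strictness hides
  how the ends of an arrow factor.\<close>

context strict_monoidal_category
begin

definition tob :: "'o list \<Rightarrow> 'o" where
  "tob L = foldr (\<otimes>\<^sub>o) L \<^bold>1"

lemma tob_Nil [simp]: "tob [] = \<^bold>1"
  by (simp add: tob_def)

lemma tob_Cons: "tob (X # L) = X \<otimes>\<^sub>o tob L"
  by (simp add: tob_def)

lemma tob_closed: "set L \<subseteq> Ob V \<Longrightarrow> tob L \<in> Ob V"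
  by (induction L) (auto simp: tob_Cons unit_closed tensor_closed)

lemma tob_append: "\<lbrakk>set L \<subseteq> Ob V; set L' \<subseteq> Ob V\<rbrakk> \<Longrightarrow> tob (L @ L') = tob L \<otimes>\<^sub>o tob L'"
  by (induction L) (auto simp: tob_Cons tensor_ob_unit tensor_ob_assoc tob_closed)

lemma tob_single [simp]: "X \<in> Ob V \<Longrightarrow> tob [X] = X"
  by (simp add: tob_Cons tensor_ob_unit)

lemma hom_Ob: "f \<in> Hom V X Y \<Longrightarrow> f \<in> Ar V \<and> X \<in> Ob V \<and> Y \<in> Ob V"
  using src_tgt by (auto simp: Hom_def)

lemma hom_Ar: "f \<in> Hom V X Y \<Longrightarrow> f \<in> Ar V"
  by (simp add: Hom_def)

text \<open>Strictness makes \<open>tob [X \<otimes>\<^sub>o Y] = tob [X, Y]\<close>, so the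
  factorisation of an end cannot be read off the arrow and is carried separately. One arrow may be
  typed by several pairs of lists.\<close>

definition typed :: "'m \<Rightarrow> 'o list \<Rightarrow> 'o list \<Rightarrow> bool" where
  "typed f ss ts \<longleftrightarrow> set ss \<subseteq> Ob V \<and> set ts \<subseteq> Ob V \<and> f \<in> Hom V (tob ss) (tob ts)"

definition lay :: "'o list \<Rightarrow> 'm \<Rightarrow> 'o list \<Rightarrow> 'm" where
  "lay A f B = \<langle>tob A\<rangle> \<otimes>\<^sub>a f \<otimes>\<^sub>a \<langle>tob B\<rangle>"

lemma lay_hom:
  assumes "set A \<subseteq> Ob V" "set B \<subseteq> Ob V" "typed f ss ts"
  shows "lay A f B \<in> Hom V (tob (A @ ss @ B)) (tob (A @ ts @ B))"
  using assms unfolding lay_def typed_def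
  by (simp add: tob_append tensor_hom ident_hom tob_closed)

type_synonym ('a, 'b) state = "('a list \<times> 'b) option"

text \<open>A state is an arrow together with a factorisation of its target into wires. \<open>app n ss f ts\<close>
  postcomposes with \<open>f\<close> acting on the wires \<open>n, n + 1, \<dots>\<close>. Ill-typed applications give \<open>None\<close>.\<close>

definition shp :: "('o, 'm) state \<Rightarrow> 'o list option" where
  "shp st = (case st of None \<Rightarrow> None | Some (L, x) \<Rightarrow>
     if set L \<subseteq> Ob V \<and> x \<in> Ar V \<and> tgt V x = tob L then Some L else None)"

definition app :: "nat \<Rightarrow> 'o list \<Rightarrow> 'm \<Rightarrow> 'o list \<Rightarrow> ('o, 'm) state \<Rightarrow> ('o, 'm) state" where
  "app n ss f ts st = (case shp st of None \<Rightarrow> None | Some L \<Rightarrow>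
     if n \<le> length L \<and> take (length ss) (drop n L) = ss \<and> typed f ss ts
     then Some (take n L @ ts @ drop (n + length ss) L,
                lay (take n L) f (drop (n + length ss) L) \<cdot> snd (the st)) else None)"

text \<open>The guard of every rewrite rule. It is a condition on \<open>shp st\<close> alone, so
  the simplifier can discharge it by computing shapes.\<close>

definition has :: "nat \<Rightarrow> 'o list \<Rightarrow> ('o, 'm) state \<Rightarrow> bool" where
  "has n ss st \<longleftrightarrow> (case shp st of None \<Rightarrow> False | Some L \<Rightarrow>
     n \<le> length L \<and> take (length ss) (drop n L) = ss)"

definition init :: "'o list \<Rightarrow> ('o, 'm) state" where
  "init ss = Some (ss, \<langle>tob ss\<rangle>)"

lemma has_iff: "has n ss st \<longleftrightarrow> (\<exists>A B x Z. st = Some (A @ ss @ B, x) \<and> length A = n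
    \<and> set A \<subseteq> Ob V \<and> set ss \<subseteq> Ob V \<and> set B \<subseteq> Ob V \<and> x \<in> Hom V Z (tob (A @ ss @ B)))"
  (is "?l = ?r")
proof
  assume ?l
  then obtain L x where 1: "st = Some (L, x)" "set L \<subseteq> Ob V" "x \<in> Ar V" "tgt V x = tob L"
    "n \<le> length L" "take (length ss) (drop n L) = ss"
    by (auto simp: has_def shp_def split: option.splits if_splits)
  define A B where "A = take n L" and "B = drop (length ss) (drop n L)"
  have L: "L = A @ ss @ B"
    unfolding A_def B_def using 1(6) by (metis append_take_drop_id)
  have "length A = n"
    using 1(5) by (simp add: A_def)
  moreover have "set (A @ ss @ B) \<subseteq> Ob V" "x \<in> Hom V (src V x) (tob L)"
    using 1 by (simp_all add: L[symmetric] Hom_def)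
  ultimately have "set A \<subseteq> Ob V" "set ss \<subseteq> Ob V" "set B \<subseteq> Ob V" "length A = n"
    "x \<in> Hom V (src V x) (tob (A @ ss @ B))"
    using L by simp_all
  then show ?r
    using 1(1) L by blast
next
  assume ?r
  then show ?l
    by (auto simp: has_def shp_def Hom_def)
qed

lemma hasE:
  assumes "has n ss st"
  obtains A B x Z where "st = Some (A @ ss @ B, x)" "length A = n"
    "set A \<subseteq> Ob V" "set ss \<subseteq> Ob V" "set B \<subseteq> Ob V" "x \<in> Hom V Z (tob (A @ ss @ B))"
  using assms[unfolded has_iff] by (elim exE conjE) (rule that)

lemma app_Some:
  assumes "set A \<subseteq> Ob V" "set B \<subseteq> Ob V" "typed f ss ts" "x \<in> Hom V Z (tob (A @ ss @ B))"
    "length A = n"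
  shows "app n ss f ts (Some (A @ ss @ B, x)) = Some (A @ ts @ B, lay A f B \<cdot> x)"
  using assms by (auto simp: app_def shp_def typed_def Hom_def)

lemma app_hom:
  assumes "set A \<subseteq> Ob V" "set B \<subseteq> Ob V" "typed f ss ts" "x \<in> Hom V Z (tob (A @ ss @ B))"
  shows "lay A f B \<cdot> x \<in> Hom V Z (tob (A @ ts @ B))"
  using assms lay_hom cmp_hom by blast

text \<open>The shape after a step is determined by the shape before it and the typing of
  \<open>f\<close>; the arrow carried along does not enter. This makes the side conditions of the
  rewrite rules computable.\<close>

lemma shp_app: "shp (app n ss f ts st) = (case shp st of None \<Rightarrow> None | Some L \<Rightarrow>
    if n \<le> length L \<and> take (length ss) (drop n L) = ss \<and> typed f ss ts
    then Some (take n L @ ts @ drop (n + length ss) L) else None)"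
proof (cases "has n ss st \<and> typed f ss ts")
  case True
  then have "has n ss st" by simp
  then obtain A B x Z where h: "st = Some (A @ ss @ B, x)" "length A = n"
    "set A \<subseteq> Ob V" "set ss \<subseteq> Ob V" "set B \<subseteq> Ob V" "x \<in> Hom V Z (tob (A @ ss @ B))"
    by (rule hasE)
  have "app n ss f ts st = Some (A @ ts @ B, lay A f B \<cdot> x)"
    "lay A f B \<cdot> x \<in> Hom V Z (tob (A @ ts @ B))"
    using app_Some[OF h(3,5) _ h(6,2), of f ts] app_hom[OF h(3,5) _ h(6), of f ts] True h(1) by simp_all
  then show ?thesis
    using h True by (simp add: shp_def typed_def Hom_def)
next
  case False
  then have "app n ss f ts st = None" "shp st = None \<or> (\<exists>L. shp st = Some L
      \<and> \<not> (n \<le> length L \<and> take (length ss) (drop n L) = ss \<and> typed f ss ts))"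
    by (cases "shp st"; simp add: app_def has_def; fail)+
  moreover have "shp None = None"
    by (simp add: shp_def)
  ultimately show ?thesis
    by (elim disjE exE conjE) simp_all
qed

lemma shp_init: "set ss \<subseteq> Ob V \<Longrightarrow> shp (init ss) = Some ss"
  using ident_hom[OF tob_closed] by (auto simp: shp_def init_def Hom_def)

lemma tensor_Ar: "\<lbrakk>f \<in> Ar V; g \<in> Ar V\<rbrakk> \<Longrightarrow> f \<otimes>\<^sub>a g \<in> Ar V"
  using tensor_hom[of f "src V f" "tgt V f" g "src V g" "tgt V g"] by (simp add: Hom_def)

lemma ident_Ar: "X \<in> Ob V \<Longrightarrow> \<langle>X\<rangle> \<in> Ar V"
  using ident_hom hom_Ar by blast

lemma lay_tensor_left:
  assumes "set A \<subseteq> Ob V" "set A' \<subseteq> Ob V" "set B \<subseteq> Ob V" "f \<in> Ar V"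
  shows "lay (A @ A') f B = \<langle>tob A\<rangle> \<otimes>\<^sub>a lay A' f B"
proof -
  have "\<langle>tob (A @ A')\<rangle> = \<langle>tob A\<rangle> \<otimes>\<^sub>a \<langle>tob A'\<rangle>"
    using assms by (simp add: tob_append tensor_ident tob_closed)
  then show ?thesis
    using assms by (simp add: lay_def tensor_ar_assoc ident_Ar tob_closed tensor_Ar)
qed

lemma interchange_l:
  assumes "f \<in> Hom V X Y" "g \<in> Hom V X' Y'"
  shows "(\<langle>Y\<rangle> \<otimes>\<^sub>a g) \<cdot> (f \<otimes>\<^sub>a \<langle>X'\<rangle>) = f \<otimes>\<^sub>a g"
    and "(f \<otimes>\<^sub>a \<langle>Y'\<rangle>) \<cdot> (\<langle>X\<rangle> \<otimes>\<^sub>a g) = f \<otimes>\<^sub>a g"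
  using assms interchange[of f X Y "\<langle>Y\<rangle>" Y "\<langle>X'\<rangle>" X' X' g Y']
    interchange[of "\<langle>X\<rangle>" X X f Y g X' Y' "\<langle>Y'\<rangle>" Y'] hom_Ob[OF assms(1)] hom_Ob[OF assms(2)]
  by (simp_all add: ident_hom cmp_ident)

lemma lay_exchange:
  assumes "set A \<subseteq> Ob V" "set B \<subseteq> Ob V" "set D \<subseteq> Ob V" "typed i is it" "typed o' os ot"
  shows "lay (A @ it @ B) o' D \<cdot> lay A i (B @ os @ D) = lay A i (B @ ot @ D) \<cdot> lay (A @ is @ B) o' D"
proof -
  have i: "set is \<subseteq> Ob V" "set it \<subseteq> Ob V" "i \<in> Hom V (tob is) (tob it)"
    and o: "set os \<subseteq> Ob V" "set ot \<subseteq> Ob V" "o' \<in> Hom V (tob os) (tob ot)"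
    using assms by (auto simp: typed_def)
  \<comment> \<open>Absorbing \<open>A\<close> into the left arrow and \<open>B\<close>,
    \<open>D\<close> into the right one leaves the plain interchange law for \<open>F\<close> and
    \<open>G\<close>.\<close>
  define F where "F = \<langle>tob A\<rangle> \<otimes>\<^sub>a i"
  define G where "G = lay B o' D"
  have F: "F \<in> Hom V (tob (A @ is)) (tob (A @ it))"
    unfolding F_def using assms i by (simp add: tob_append tensor_hom ident_hom tob_closed)
  have G: "G \<in> Hom V (tob (B @ os @ D)) (tob (B @ ot @ D))"
    unfolding G_def by (rule lay_hom) (use assms in auto)
  have o1: "lay (A @ it @ B) o' D = \<langle>tob (A @ it)\<rangle> \<otimes>\<^sub>a G"
    using lay_tensor_left[of "A @ it" B D o'] assms i o hom_Ar unfolding G_def by auto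
  have o2: "lay (A @ is @ B) o' D = \<langle>tob (A @ is)\<rangle> \<otimes>\<^sub>a G"
    using lay_tensor_left[of "A @ is" B D o'] assms i o hom_Ar unfolding G_def by auto
  have i1: "lay A i E = F \<otimes>\<^sub>a \<langle>tob E\<rangle>" if "set E \<subseteq> Ob V" for E
    unfolding lay_def F_def using assms i that
    by (simp add: tensor_ar_assoc hom_Ar[OF ident_hom] tob_closed hom_Ar)
  have "set (B @ os @ D) \<subseteq> Ob V" "set (B @ ot @ D) \<subseteq> Ob V"
    using assms o by auto
  then show ?thesis
    unfolding o1 o2 i1[OF \<open>set (B @ os @ D) \<subseteq> Ob V\<close>] i1[OF \<open>set (B @ ot @ D) \<subseteq> Ob V\<close>]
    using interchange_l[OF F G] by simp
qed

text \<open>The splittings of the lists are hypotheses because the exchange law has to split one and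
  the same list around either of two arrows.\<close>

lemma app_Some':
  assumes "typed f ss ts" "L = A @ ss @ B" "L' = A @ ts @ B" "n = length A"
    "set L \<subseteq> Ob V" "x \<in> Hom V Z (tob L)"
  shows "app n ss f ts (Some (L, x)) = Some (L', lay A f B \<cdot> x)"
    and "lay A f B \<cdot> x \<in> Hom V Z (tob L')" and "set L' \<subseteq> Ob V"
proof -
  have s: "set A \<subseteq> Ob V" "set B \<subseteq> Ob V" "set ts \<subseteq> Ob V"
    using assms(1,2,5) by (simp_all add: typed_def)
  note x = assms(6)[unfolded assms(2)]
  show "app n ss f ts (Some (L, x)) = Some (L', lay A f B \<cdot> x)"
    unfolding assms(2,3) by (rule app_Some[OF s(1,2) assms(1) x assms(4)[symmetric]])
  show "lay A f B \<cdot> x \<in> Hom V Z (tob L')"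
    unfolding assms(3) by (rule app_hom[OF s(1,2) assms(1) x])
  show "set L' \<subseteq> Ob V"
    unfolding assms(3) using s by simp
qed

lemma app_exchange_split:
  assumes t: "typed i is it" "typed o' os ot"
    and L: "L = A @ is @ B @ os @ D" and S: "set L \<subseteq> Ob V" and x: "x \<in> Hom V Z (tob L)"
  shows "app (length (A @ it @ B)) os o' ot (app (length A) is i it (Some (L, x)))
       = app (length A) is i it (app (length (A @ is @ B)) os o' ot (Some (L, x)))"
proof -
  have o: "set A \<subseteq> Ob V" "set B \<subseteq> Ob V" "set D \<subseteq> Ob V"
    using S unfolding L by simp_all
  have ty: "set is \<subseteq> Ob V" "set it \<subseteq> Ob V" "set os \<subseteq> Ob V" "set ot \<subseteq> Ob V"
    using t by (simp_all add: typed_def)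
  define f1 f2 g1 g2 where d: "f1 = lay A i (B @ os @ D)" "f2 = lay A i (B @ ot @ D)"
    "g1 = lay (A @ it @ B) o' D" "g2 = lay (A @ is @ B) o' D"
  define L1 L2 L3 where l: "L1 = A @ it @ B @ os @ D" "L2 = A @ is @ B @ ot @ D" "L3 = A @ it @ B @ ot @ D"
  have eq: "L = A @ is @ (B @ os @ D)" "L1 = A @ it @ (B @ os @ D)" "L2 = A @ is @ (B @ ot @ D)"
    "L3 = A @ it @ (B @ ot @ D)" "L = (A @ is @ B) @ os @ D" "L1 = (A @ it @ B) @ os @ D"
    "L2 = (A @ is @ B) @ ot @ D" "L3 = (A @ it @ B) @ ot @ D"
    unfolding L l by simp_all
  note a = app_Some'[OF t(1) eq(1,2) refl S x]
  note b = app_Some'[OF t(2) eq(6,8) refl a(3) a(2)]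
  note a' = app_Some'[OF t(2) eq(5,7) refl S x]
  note b' = app_Some'[OF t(1) eq(3,4) refl a'(3) a'(2)]
  have f: "f1 \<in> Hom V (tob L) (tob L1)" "f2 \<in> Hom V (tob L2) (tob L3)"
    unfolding d eq(1-4) by (rule lay_hom[OF _ _ t(1)]; simp add: o ty)+
  have g: "g1 \<in> Hom V (tob L1) (tob L3)" "g2 \<in> Hom V (tob L) (tob L2)"
    unfolding d eq(5-8) by (rule lay_hom[OF _ _ t(2)]; simp add: o ty)+
  have "g1 \<cdot> f1 \<cdot> x = f2 \<cdot> g2 \<cdot> x"
    using cmp_assoc[OF x f(1) g(1)] cmp_assoc[OF x g(2) f(2)] lay_exchange[OF o t] d by simp
  then show ?thesis
    unfolding a(1) b(1) a'(1) b'(1) d by simp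
qed

text \<open>\<open>n\<close> counts wires after \<open>i\<close> has been applied. Before it, the
  wires of \<open>o'\<close> start at \<open>n + length is - length it\<close>; the subtraction is
  harmless because \<open>m + length it \<le> n\<close>.\<close>

lemma app_exchange:
  assumes le: "m + length it \<le> n" and h: "has m is st" "has (n + length is - length it) os st"
    and t: "typed i is it" "typed o' os ot"
  shows "app n os o' ot (app m is i it st)
       = app m is i it (app (n + length is - length it) os o' ot st)"
proof -
  obtain A E x Z where 1: "st = Some (A @ is @ E, x)" "length A = m"
    "set A \<subseteq> Ob V" "set is \<subseteq> Ob V" "set E \<subseteq> Ob V" "x \<in> Hom V Z (tob (A @ is @ E))"
    by (rule hasE[OF h(1)])
  obtain A' D x' Z' where 2: "st = Some (A' @ os @ D, x')" "length A' = n + length is - length it"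
    "set A' \<subseteq> Ob V" "set os \<subseteq> Ob V" "set D \<subseteq> Ob V" "x' \<in> Hom V Z' (tob (A' @ os @ D))"
    by (rule hasE[OF h(2)])
  \<comment> \<open>The untouched wires between the two arrows: the length bound makes
    \<open>A @ is\<close> a prefix of \<open>A'\<close>, and \<open>B\<close> is what
    remains.\<close>
  define B where "B = drop (length (A @ is)) A'"
  have len: "length (A @ is) \<le> length A'"
    using le 2(2) 1(2) by simp
  have eq: "(A @ is) @ E = A' @ os @ D"
    using 1(1) 2(1) by simp
  have "take (length (A @ is)) A' = take (length (A @ is)) (A' @ os @ D)"
    using len by simp
  also have "\<dots> = A @ is"
    unfolding eq[symmetric] by simp
  finally have A': "A' = (A @ is) @ B"
    unfolding B_def by (metis append_take_drop_id)
  have n: "n = length (A @ it @ B)" "n + length is - length it = length (A @ is @ B)"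
    using 2(2) 1(2) le unfolding A' by simp_all
  have L: "A' @ os @ D = A @ is @ B @ os @ D" "set (A' @ os @ D) \<subseteq> Ob V"
    using 2(3-5) by (simp_all add: A')
  show ?thesis
    unfolding n(2) unfolding n(1) 2(1) 1(2)[symmetric] by (rule app_exchange_split[OF t L 2(6)])
qed

text \<open>\<open>den f ss ts F\<close>: applying \<open>f\<close> to adjacent wires \<open>ss\<close> of a state is the transformation \<open>F\<close>. Two
  composite arrows are equal as soon as their transformations agree on the initial state, which is
  decided by rewriting modulo exchange of disjoint layers; strict associativity is built in.\<close>

definition den :: "'m \<Rightarrow> 'o list \<Rightarrow> 'o list \<Rightarrow> (nat \<Rightarrow> ('o, 'm) state \<Rightarrow> ('o, 'm) state) \<Rightarrow> bool" where
  "den f ss ts F \<longleftrightarrow> typed f ss ts \<and> (\<forall>n st. has n ss st \<longrightarrow> app n ss f ts st = F n st)"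

lemma den_typed: "den f ss ts F \<Longrightarrow> typed f ss ts"
  by (simp add: den_def)

lemma den_gen: "typed f ss ts \<Longrightarrow> den f ss ts (\<lambda>n. app n ss f ts)"
  by (simp add: den_def)

lemma has_init: "set ss \<subseteq> Ob V \<Longrightarrow> has 0 ss (init ss)"
  by (simp add: has_def shp_init)

text \<open>The reason why a transformation determines its arrow: applied to the identity state, it
  returns the arrow itself.\<close>

lemma app_init:
  assumes "typed f ss ts"
  shows "app 0 ss f ts (init ss) = Some (ts, f)"
proof -
  have f: "set ss \<subseteq> Ob V" "f \<in> Hom V (tob ss) (tob ts)"
    using assms by (simp_all add: typed_def)
  have "app 0 ss f ts (Some (ss, \<langle>tob ss\<rangle>)) = Some (ts, lay [] f [] \<cdot> \<langle>tob ss\<rangle>)"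
    by (rule app_Some'(1)[OF assms, where A = "[]" and B = "[]"])
      (simp_all add: f(1), rule ident_hom[OF tob_closed[OF f(1)]])
  moreover have "lay [] f [] = f"
    by (simp add: lay_def tensor_ar_unit hom_Ar[OF f(2)])
  ultimately show ?thesis
    by (simp add: init_def cmp_ident[OF f(2)])
qed

text \<open>The entry point for diagram proofs. The lists of both sides are separate variables, so
  that \<open>den_intro\<close> computes each side on its own and the lists are compared
  afterwards.\<close>

lemma den_eqI:
  assumes "den f ss ts F" "den g ss' ts' G" "ss = ss'" "ts = ts'" "F 0 (init ss) = G 0 (init ss)"
  shows "f = g"
proof -
  have "set ss \<subseteq> Ob V"
    using assms(1) by (simp add: den_def typed_def)
  then have h: "has 0 ss (init ss)"
    by (rule has_init)
  have "app 0 ss f ts (init ss) = F 0 (init ss)"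
    using assms(1) h by (simp add: den_def)
  moreover have "app 0 ss g ts (init ss) = G 0 (init ss)"
    using assms(2-4) h by (simp add: den_def)
  ultimately have "app 0 ss f ts (init ss) = app 0 ss g ts (init ss)"
    using assms(5) by simp
  moreover have "typed f ss ts" "typed g ss ts"
    using assms(1-4) by (simp_all add: den_def)
  ultimately show ?thesis
    by (simp add: app_init)
qed

text \<open>The opposite direction: an equation of arrows becomes a rewrite rule for states, valid
  next to any surrounding wires.\<close>

lemma den_lift:
  assumes "f = g" "den f ss ts F" "den g ss ts G" "has n ss st"
  shows "F n st = G n st"
proof -
  have "app n ss f ts st = F n st" "app n ss g ts st = G n st"
    using assms(2-4) by (simp_all add: den_def)
  then show ?thesis
    using assms(1) by simp
qed

lemma den_hom: "den f ss ts F \<Longrightarrow> f \<in> Hom V (tob ss) (tob ts)"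
  by (simp add: den_def typed_def)

lemma typed_cmp: "\<lbrakk>typed f ss ts; typed g ts us\<rbrakk> \<Longrightarrow> typed (g \<cdot> f) ss us"
  using cmp_hom by (auto simp: typed_def)

lemma den_cmp:
  assumes g: "den g ts' us G" and f: "den f ss ts F" and "ts = ts'"
  shows "den (g \<cdot> f) ss us (\<lambda>n st. G n (F n st))"
  unfolding den_def
proof (intro conjI allI impI)
  show t: "typed (g \<cdot> f) ss us"
    using assms typed_cmp by (auto simp: den_def)
  fix n st
  assume hs: "has n ss st"
  then obtain A B x Z where h: "st = Some (A @ ss @ B, x)" "length A = n"
    "set A \<subseteq> Ob V" "set ss \<subseteq> Ob V" "set B \<subseteq> Ob V" "x \<in> Hom V Z (tob (A @ ss @ B))"
    by (rule hasE)
  have tf: "typed f ss ts" and tg: "typed g ts us"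
    using assms by (simp_all add: den_def)
  have 1: "app n ss f ts st = Some (A @ ts @ B, lay A f B \<cdot> x)"
    using app_Some[OF h(3,5) tf h(6,2)] h(1) by blast
  have hx: "lay A f B \<cdot> x \<in> Hom V Z (tob (A @ ts @ B))"
    using app_hom[OF h(3,5) tf h(6)] .
  have "has n ts (app n ss f ts st)"
    unfolding 1 has_iff using h hx tf
    by (intro exI[of _ A] exI[of _ B] exI[of _ "lay A f B \<cdot> x"] exI[of _ Z]) (simp add: typed_def)
  then have "G n (F n st) = app n ts g us (app n ss f ts st)"
    using g f \<open>ts = ts'\<close> hs by (simp add: den_def)
  also have "\<dots> = Some (A @ us @ B, lay A g B \<cdot> lay A f B \<cdot> x)"
    unfolding 1 using app_Some[OF h(3,5) tg hx h(2)] .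
  also have "lay A g B \<cdot> lay A f B \<cdot> x = (lay A g B \<cdot> lay A f B) \<cdot> x"
    using cmp_assoc[OF h(6) lay_hom[OF h(3,5) tf] lay_hom[OF h(3,5) tg]] by simp
  also have "lay A g B \<cdot> lay A f B = lay A (g \<cdot> f) B"
  proof -
    have i: "\<langle>tob A\<rangle> \<in> Hom V (tob A) (tob A)" "\<langle>tob B\<rangle> \<in> Hom V (tob B) (tob B)"
      and fg: "f \<in> Hom V (tob ss) (tob ts)" "g \<in> Hom V (tob ts) (tob us)"
      using h ident_hom tob_closed tf tg by (auto simp: typed_def)
    have "(g \<cdot> f) \<otimes>\<^sub>a \<langle>tob B\<rangle> = (g \<otimes>\<^sub>a \<langle>tob B\<rangle>) \<cdot> (f \<otimes>\<^sub>a \<langle>tob B\<rangle>)"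
      using interchange[OF fg i(2) i(2)] i(2) cmp_ident by metis
    then show ?thesis
      unfolding lay_def
      using interchange[OF i(1) i(1) tensor_hom[OF fg(1) i(2)] tensor_hom[OF fg(2) i(2)]]
        i(1) cmp_ident by metis
  qed
  also have "Some (A @ us @ B, lay A (g \<cdot> f) B \<cdot> x) = app n ss (g \<cdot> f) us st"
    using app_Some[OF h(3,5) t h(6,2)] h(1) by simp
  finally show "app n ss (g \<cdot> f) us st = G n (F n st)" by simp
qed

lemma typed_tensor: "\<lbrakk>typed f ss ts; typed g ss' ts'\<rbrakk> \<Longrightarrow> typed (f \<otimes>\<^sub>a g) (ss @ ss') (ts @ ts')"
  using tensor_hom by (auto simp: typed_def tob_append)

text \<open>The right factor acts first. At that moment the wires of \<open>f\<close> are still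
  \<open>ss\<close>, so the position of \<open>g\<close> is \<open>n + length ss\<close>,
  independently of \<open>ts\<close>.\<close>

lemma den_tensor:
  assumes f: "den f ss ts F" and g: "den g ss' ts' G"
  shows "den (f \<otimes>\<^sub>a g) (ss @ ss') (ts @ ts') (\<lambda>n st. F n (G (n + length ss) st))"
  unfolding den_def
proof (intro conjI allI impI)
  have tf: "typed f ss ts" and tg: "typed g ss' ts'"
    using assms by (simp_all add: den_def)
  show t: "typed (f \<otimes>\<^sub>a g) (ss @ ss') (ts @ ts')"
    using tf tg typed_tensor by auto
  fix n st
  assume "has n (ss @ ss') st"
  then obtain A B x Z where h0: "st = Some (A @ (ss @ ss') @ B, x)" "length A = n"
    "set A \<subseteq> Ob V" "set (ss @ ss') \<subseteq> Ob V" "set B \<subseteq> Ob V"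
    "x \<in> Hom V Z (tob (A @ (ss @ ss') @ B))"
    by (rule hasE)
  have h: "st = Some (A @ ss @ ss' @ B, x)" "length A = n"
    "set A \<subseteq> Ob V" "set ss \<subseteq> Ob V" "set ss' \<subseteq> Ob V" "set B \<subseteq> Ob V"
    "x \<in> Hom V Z (tob (A @ ss @ ss' @ B))"
    using h0 by auto
  have o: "set ts \<subseteq> Ob V" "set ts' \<subseteq> Ob V"
    using tf tg by (auto simp: typed_def)
  have x2: "x \<in> Hom V Z (tob ((A @ ss) @ ss' @ B))" using h by simp
  have a1: "app (n + length ss) ss' g ts' st = Some ((A @ ss) @ ts' @ B, lay (A @ ss) g B \<cdot> x)"
    using app_Some[of "A @ ss" B, OF _ _ tg x2] h by simp
  have hx: "lay (A @ ss) g B \<cdot> x \<in> Hom V Z (tob (A @ ss @ (ts' @ B)))"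
    using app_hom[of "A @ ss" B, OF _ _ tg x2] h by simp
  have "has (n + length ss) ss' st"
    unfolding has_iff using h x2 by (intro exI[of _ "A @ ss"] exI[of _ B] exI[of _ x] exI[of _ Z]) simp
  then have "G (n + length ss) st = app (n + length ss) ss' g ts' st"
    using g by (simp add: den_def)
  moreover have "has n ss (app (n + length ss) ss' g ts' st)"
    unfolding a1 has_iff using h hx o
    by (intro exI[of _ A] exI[of _ "ts' @ B"] exI[of _ "lay (A @ ss) g B \<cdot> x"] exI[of _ Z]) simp
  ultimately have "F n (G (n + length ss) st) = app n ss f ts (app (n + length ss) ss' g ts' st)"
    using f by (simp add: den_def)
  also have "\<dots> = Some (A @ ts @ (ts' @ B), lay A f (ts' @ B) \<cdot> lay (A @ ss) g B \<cdot> x)"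
    unfolding a1 using app_Some[of A "ts' @ B", OF _ _ tf hx] h o by simp
  also have "lay A f (ts' @ B) \<cdot> lay (A @ ss) g B \<cdot> x = (lay A f (ts' @ B) \<cdot> lay (A @ ss) g B) \<cdot> x"
    using cmp_assoc[OF x2 lay_hom[of "A @ ss" B, OF _ _ tg], of "lay A f (ts' @ B)"]
      lay_hom[of A "ts' @ B" f ss ts] tf h o by simp
  also have "lay A f (ts' @ B) \<cdot> lay (A @ ss) g B = lay A (f \<otimes>\<^sub>a g) B"
  proof -
    have i: "\<langle>tob A\<rangle> \<in> Hom V (tob A) (tob A)" "\<langle>tob B\<rangle> \<in> Hom V (tob B) (tob B)"
      and fg: "f \<in> Hom V (tob ss) (tob ts)" "g \<in> Hom V (tob ss') (tob ts')"
      using h ident_hom tob_closed tf tg by (auto simp: typed_def)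
    have ar: "f \<in> Ar V" "g \<in> Ar V" "\<langle>tob A\<rangle> \<in> Ar V" "\<langle>tob B\<rangle> \<in> Ar V" "\<langle>tob ss\<rangle> \<in> Ar V" "\<langle>tob ts'\<rangle> \<in> Ar V"
      using fg i hom_Ar ident_hom tob_closed h o by blast+
    have gB: "g \<otimes>\<^sub>a \<langle>tob B\<rangle> \<in> Hom V (tob (ss' @ B)) (tob (ts' @ B))"
      using tensor_hom[OF fg(2) i(2)] h o by (simp add: tob_append)
    have fA: "\<langle>tob A\<rangle> \<otimes>\<^sub>a f \<in> Hom V (tob (A @ ss)) (tob (A @ ts))"
      using tensor_hom[OF i(1) fg(1)] h o by (simp add: tob_append)
    have "lay A f (ts' @ B) = (\<langle>tob A\<rangle> \<otimes>\<^sub>a f) \<otimes>\<^sub>a \<langle>tob (ts' @ B)\<rangle>"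
      unfolding lay_def using ar h o
      by (simp add: tensor_ar_assoc hom_Ar[OF ident_hom] tob_closed)
    moreover have "lay (A @ ss) g B = \<langle>tob (A @ ss)\<rangle> \<otimes>\<^sub>a (g \<otimes>\<^sub>a \<langle>tob B\<rangle>)"
      by (simp add: lay_def)
    ultimately have "lay A f (ts' @ B) \<cdot> lay (A @ ss) g B = (\<langle>tob A\<rangle> \<otimes>\<^sub>a f) \<otimes>\<^sub>a (g \<otimes>\<^sub>a \<langle>tob B\<rangle>)"
      using interchange_l(2)[OF fA gB] by simp
    then show ?thesis
      unfolding lay_def using ar hom_Ar[OF gB] by (simp add: tensor_ar_assoc)
  qed
  also have "Some (A @ ts @ ts' @ B, lay A (f \<otimes>\<^sub>a g) B \<cdot> x) = app n (ss @ ss') (f \<otimes>\<^sub>a g) (ts @ ts') st"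
    using app_Some[of A B "f \<otimes>\<^sub>a g" "ss @ ss'" "ts @ ts'" x Z n] t h by simp
  finally show "app n (ss @ ss') (f \<otimes>\<^sub>a g) (ts @ ts') st = F n (G (n + length ss) st)" by simp
qed

text \<open>A composite object with the list of its factors. The rules \<open>den_intro\<close>
  build such lists bottom up, which is how identities and braidings of composite objects get split
  into wires.\<close>

definition obl :: "'o \<Rightarrow> 'o list \<Rightarrow> bool" where
  "obl A L \<longleftrightarrow> set L \<subseteq> Ob V \<and> A = tob L"

lemma obl_tensor: "obl A L \<Longrightarrow> obl B M \<Longrightarrow> obl (A \<otimes>\<^sub>o B) (L @ M)"
  by (simp add: obl_def tob_append)

lemma obl_unit: "obl \<^bold>1 []"
  by (simp add: obl_def)

lemma obl_single: "A \<in> Ob V \<Longrightarrow> obl A [A]"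
  by (simp add: obl_def)

lemma obl_tob: "set L \<subseteq> Ob V \<Longrightarrow> obl (tob L) L"
  by (simp add: obl_def)

lemma den_ident: "obl A L \<Longrightarrow> den \<langle>A\<rangle> L L (\<lambda>n st. st)"
  unfolding den_def
proof (intro conjI allI impI)
  assume a: "obl A L"
  then show t: "typed \<langle>A\<rangle> L L"
    by (auto simp: obl_def typed_def intro!: ident_hom tob_closed)
  fix n st
  assume "has n L st"
  then obtain D B x Z where h: "st = Some (D @ L @ B, x)" "length D = n"
    "set D \<subseteq> Ob V" "set L \<subseteq> Ob V" "set B \<subseteq> Ob V" "x \<in> Hom V Z (tob (D @ L @ B))"
    by (rule hasE)
  have "lay D \<langle>A\<rangle> B = \<langle>tob (D @ L @ B)\<rangle>"
    using a h by (simp add: lay_def obl_def tensor_ident tob_closed tob_append tensor_closed)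
  then show "app n L \<langle>A\<rangle> L st = st"
    using app_Some[OF h(3,5) t h(6,2)] h(1,6) cmp_ident by simp
qed

named_theorems den_intro
named_theorems tyi

lemmas [den_intro] = den_cmp den_tensor den_ident obl_tensor obl_unit obl_single

text \<open>The exchange law read backwards: if \<open>o'\<close> goes first, the position of
  \<open>i\<close> shifts by the change in the number of wires to its left.\<close>

lemma app_exchange_left:
  assumes le: "n + length os \<le> m" and t: "typed i is it" "typed o' os ot"
    and h: "has m is st" "has n os st"
  shows "app n os o' ot (app m is i it st)
       = app (m + length ot - length os) is i it (app n os o' ot st)"
proof -
  have "has (m + length ot - length os) is (app n os o' ot st)"
    using assms by (auto simp: has_def shp_app split: option.splits)
  moreover have "m + length ot - length os + length os - length ot = m"
    "n + length ot \<le> m + length ot - length os"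
    using le by linarith+
  ultimately show ?thesis
    using app_exchange[of n ot "m + length ot - length os" os st "is" o' i it] t h by simp
qed

text \<open>Two normal forms for disjoint layers: arrows into the unit are applied as early as possible,
  arrows out of the unit as late as possible, and otherwise the leftmost (in the primed variant, the
  rightmost) arrow is applied last.\<close>

lemma exch_right:
  assumes "m + length it \<le> n \<and> (if ot = [] then True else if os = [] then is = [] else it \<noteq> [])"
    and "typed i is it" "typed o' os ot"
    and "has m is st" "has (n + length is - length it) os st"
  shows "app n os o' ot (app m is i it st)
       = app m is i it (app (n + length is - length it) os o' ot st)"
  using app_exchange assms by blast

lemma exch_left:
  assumes "n + length os \<le> m \<and> (if ot = [] then it \<noteq> [] else if os = [] then False else it \<noteq> [] \<and> is = [])"
    and "typed i is it" "typed o' os ot" "has m is st" "has n os st"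
  shows "app n os o' ot (app m is i it st)
       = app (m + length ot - length os) is i it (app n os o' ot st)"
  using app_exchange_left assms by blast

lemma exch_right':
  assumes "m + length it \<le> n \<and> (if ot = [] then it \<noteq> [] else if os = [] then False else it \<noteq> [] \<and> is = [])"
    and "typed i is it" "typed o' os ot"
    and "has m is st" "has (n + length is - length it) os st"
  shows "app n os o' ot (app m is i it st)
       = app m is i it (app (n + length is - length it) os o' ot st)"
  using app_exchange assms by blast

lemma exch_left':
  assumes "n + length os \<le> m \<and> (if ot = [] then True else if os = [] then is = [] else it \<noteq> [])"
    and "typed i is it" "typed o' os ot" "has m is st" "has n os st"
  shows "app n os o' ot (app m is i it st)
       = app (m + length ot - length os) is i it (app n os o' ot st)"
  using app_exchange_left assms by blast

lemma den_conv:
  assumes "den f ss ts F" "ss = ss'" "ts = ts'" "\<And>n st. F n st = G n st"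
  shows "den f ss' ts' G"
  using assms by (simp add: den_def)

text \<open>\<open>den_lift\<close> with everything computed moved into premises: resolving with an
  axiom and then with \<open>den_intro\<close> produces the rewrite rule of that axiom.\<close>

lemma den_rule:
  assumes "f = g" "den f ss ts F" "den g ss' ts' G" "has n us st" "ss = us" "ss' = us" "ts' = ts"
    "F n st = x" "G n st = y"
  shows "x = y"
  using den_lift[OF assms(1,2) _, of G n st] assms(3-9) by simp

text \<open>Inverses are unique, so the description in \<open>arr_inv\<close> denotes the
  inverse.\<close>

lemma arr_inv_eqs:
  assumes "is_iso V f" "f \<in> Hom V X Y"
  shows "arr_inv V f \<in> Hom V Y X" "arr_inv V f \<cdot> f = \<langle>X\<rangle>" "f \<cdot> arr_inv V f = \<langle>Y\<rangle>"
proof -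
  obtain g where g: "is_inverse V f g"
    using assms by (auto simp: is_iso_def)
  have st: "src V f = X" "tgt V f = Y"
    using assms by (auto simp: Hom_def)
  have "g' = g" if "is_inverse V f g'" for g'
  proof -
    have a: "g' \<in> Hom V Y X" "g \<in> Hom V Y X" "g' \<cdot> f = \<langle>X\<rangle>" "f \<cdot> g = \<langle>Y\<rangle>"
      using that g st by (auto simp: is_inverse_def)
    have "g' = g' \<cdot> (f \<cdot> g)"
      using a(4) cmp_ident[OF a(1)] by simp
    also have "\<dots> = (g' \<cdot> f) \<cdot> g"
      by (rule cmp_assoc[OF a(2) assms(2) a(1), symmetric])
    also have "\<dots> = g"
      using a(3) cmp_ident[OF a(2)] by simp
    finally show ?thesis .
  qed
  then have "arr_inv V f = g"
    unfolding arr_inv_def using g by blast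
  then show "arr_inv V f \<in> Hom V Y X" "arr_inv V f \<cdot> f = \<langle>X\<rangle>" "f \<cdot> arr_inv V f = \<langle>Y\<rangle>"
    using g st by (auto simp: is_inverse_def)
qed

lemma is_isoI:
  assumes "f \<in> Hom V X Y" "g \<in> Hom V Y X" "g \<cdot> f = \<langle>X\<rangle>" "f \<cdot> g = \<langle>Y\<rangle>"
  shows "is_iso V f"
  using assms by (auto simp: is_iso_def is_inverse_def Hom_def)

lemma arr_inv_unique:
  assumes "f \<in> Hom V X Y" "g \<in> Hom V Y X" "g \<cdot> f = \<langle>X\<rangle>" "f \<cdot> g = \<langle>Y\<rangle>"
  shows "arr_inv V f = g"
proof -
  note i = arr_inv_eqs[OF is_isoI[OF assms] assms(1)]
  have "arr_inv V f = (g \<cdot> f) \<cdot> arr_inv V f"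
    using assms(3) cmp_ident[OF i(1)] by simp
  also have "\<dots> = g \<cdot> (f \<cdot> arr_inv V f)"
    by (rule cmp_assoc[OF i(1) assms(1,2)])
  finally show ?thesis
    using i(3) cmp_ident[OF assms(2)] by simp
qed

end

section \<open>Braidings of composite objects as crossings of single wires\<close>

context braided_category
begin

text \<open>A hexagon with two units makes the braiding with the unit idempotent, and an invertible
  idempotent is the identity.\<close>

lemma braid_unit:
  assumes "X \<in> Ob V"
  shows "\<sigma> \<^bold>1 X = \<langle>X\<rangle>" "\<sigma> X \<^bold>1 = \<langle>X\<rangle>"
proof -
  have l: "\<sigma> \<^bold>1 X \<in> Hom V X X" and r: "\<sigma> X \<^bold>1 \<in> Hom V X X"
    using braid_hom[of "\<^bold>1" X] braid_hom[of X "\<^bold>1"] assms unit_closed tensor_ob_unit by auto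
  have idem: "f = \<langle>X\<rangle>" if f: "f \<in> Hom V X X" "is_iso V f" "f = f \<cdot> f" for f
  proof -
    note i = arr_inv_eqs[OF f(2,1)]
    have "\<langle>X\<rangle> = arr_inv V f \<cdot> (f \<cdot> f)"
      using i(2) f(3)[symmetric] by simp
    also have "\<dots> = (arr_inv V f \<cdot> f) \<cdot> f"
      by (rule cmp_assoc[OF f(1,1) i(1), symmetric])
    also have "\<dots> = f"
      using i(2) cmp_ident[OF f(1)] by simp
    finally show ?thesis by simp
  qed
  show "\<sigma> \<^bold>1 X = \<langle>X\<rangle>"
    using hexagon_left[of "\<^bold>1" "\<^bold>1" X] assms unit_closed l tensor_ob_unit[of "\<^bold>1"]
    by (intro idem[OF l braid_iso]) (simp_all add: tensor_ar_unit hom_Ar)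
  show "\<sigma> X \<^bold>1 = \<langle>X\<rangle>"
    using hexagon_right[of X "\<^bold>1" "\<^bold>1"] assms unit_closed r tensor_ob_unit[of "\<^bold>1"]
    by (intro idem[OF r braid_iso]) (simp_all add: tensor_ar_unit hom_Ar)
qed

lemma typed_braid [tyi]: "\<lbrakk>X \<in> Ob V; Y \<in> Ob V\<rbrakk> \<Longrightarrow> typed (\<sigma> X Y) [X, Y] [Y, X]"
  using braid_hom[of X Y] by (simp add: typed_def tob_Cons tensor_ob_unit)

text \<open>The hexagons resolve a braiding of blocks into crossings of single wires.
  \<open>brR\<close> brings \<open>y\<close> to the left across \<open>ss\<close>,
  \<open>brL\<close> brings \<open>x\<close> to the right across \<open>ts\<close>, and
  \<open>brLR\<close> interchanges two blocks.\<close>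

fun brR :: "nat \<Rightarrow> 'a list \<Rightarrow> 'a \<Rightarrow> ('a, 'b) state \<Rightarrow> ('a, 'b) state" where
  "brR n [] y st = st"
| "brR n (s # ss) y st = app n [s, y] (\<sigma> s y) [y, s] (brR (Suc n) ss y st)"

fun brL :: "nat \<Rightarrow> 'a \<Rightarrow> 'a list \<Rightarrow> ('a, 'b) state \<Rightarrow> ('a, 'b) state" where
  "brL n x [] st = st"
| "brL n x (t # ts) st = brL (Suc n) x ts (app n [x, t] (\<sigma> x t) [t, x] st)"

fun brLR :: "nat \<Rightarrow> 'a list \<Rightarrow> 'a list \<Rightarrow> ('a, 'b) state \<Rightarrow> ('a, 'b) state" where
  "brLR n [] ts st = st"
| "brLR n (s # ss) ts st = brL n s ts (brLR (Suc n) ss ts st)"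

lemma den_brR: "\<lbrakk>set ss \<subseteq> Ob V; y \<in> Ob V\<rbrakk> \<Longrightarrow> den (\<sigma> (tob ss) y) (ss @ [y]) (y # ss) (\<lambda>n. brR n ss y)"
proof (induction ss)
  case Nil
  then show ?case
    using den_ident[OF obl_single[of y]] by (simp add: braid_unit)
next
  case (Cons s ss)
  have "den ((\<sigma> s y \<otimes>\<^sub>a \<langle>tob ss\<rangle>) \<cdot> (\<langle>s\<rangle> \<otimes>\<^sub>a \<sigma> (tob ss) y)) ([s] @ (ss @ [y])) ([y, s] @ ss)
     (\<lambda>n st. app n [s, y] (\<sigma> s y) [y, s] (brR (n + length [s]) ss y st))"
    using Cons by (intro den_cmp[OF den_tensor[OF den_gen[OF typed_braid] den_ident[OF obl_tob]]
      den_tensor[OF den_ident[OF obl_single] Cons.IH]]) auto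
  then show ?case
    using Cons.prems hexagon_left[of s "tob ss" y] by (simp add: tob_Cons tob_closed)
qed

lemma den_brL: "\<lbrakk>set ts \<subseteq> Ob V; x \<in> Ob V\<rbrakk> \<Longrightarrow> den (\<sigma> x (tob ts)) (x # ts) (ts @ [x]) (\<lambda>n. brL n x ts)"
proof (induction ts)
  case Nil
  then show ?case
    using den_ident[OF obl_single[of x]] by (simp add: braid_unit)
next
  case (Cons t ts)
  have "den ((\<langle>t\<rangle> \<otimes>\<^sub>a \<sigma> x (tob ts)) \<cdot> (\<sigma> x t \<otimes>\<^sub>a \<langle>tob ts\<rangle>)) ([x, t] @ ts) ([t] @ (ts @ [x]))
     (\<lambda>n st. brL (n + length [t]) x ts (app n [x, t] (\<sigma> x t) [t, x] st))"
    using Cons by (intro den_cmp[OF den_tensor[OF den_ident[OF obl_single] Cons.IH]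
      den_tensor[OF den_gen[OF typed_braid] den_ident[OF obl_tob]]]) auto
  then show ?case
    using Cons.prems hexagon_right[of x t "tob ts"] by (simp add: tob_Cons tob_closed)
qed

lemma den_braid [den_intro]:
  assumes "obl A LA" "obl B LB"
  shows "den (\<sigma> A B) (LA @ LB) (LB @ LA) (\<lambda>n. brLR n LA LB)"
proof -
  have "\<lbrakk>set LA \<subseteq> Ob V; set LB \<subseteq> Ob V\<rbrakk>
    \<Longrightarrow> den (\<sigma> (tob LA) (tob LB)) (LA @ LB) (LB @ LA) (\<lambda>n. brLR n LA LB)"
  proof (induction LA)
    case Nil
    then show ?case
      using den_ident[OF obl_tob[of LB]] by (simp add: braid_unit tob_closed)
  next
    case (Cons a LA)
    have "den ((\<sigma> a (tob LB) \<otimes>\<^sub>a \<langle>tob LA\<rangle>) \<cdot> (\<langle>a\<rangle> \<otimes>\<^sub>a \<sigma> (tob LA) (tob LB)))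
      ([a] @ (LA @ LB)) ((LB @ [a]) @ LA) (\<lambda>n st. brL n a LB (brLR (n + length [a]) LA LB st))"
      using Cons by (intro den_cmp[OF den_tensor[OF den_brL den_ident[OF obl_tob]]
        den_tensor[OF den_ident[OF obl_single] Cons.IH]]) auto
    then show ?case
      using Cons.prems hexagon_left[of a "tob LA" "tob LB"] by (simp add: tob_Cons tob_closed)
  qed
  then show ?thesis
    using assms by (simp add: obl_def)
qed

text \<open>Naturality for states: an arrow is pulled through the crossings that follow it. The
  variants below fix the number of its outputs, so that the recursion unfolds into a pattern that
  the simplifier can match.\<close>

lemma nat_R:
  assumes "typed f ss ts" "has n (ss @ [y]) st"
  shows "brR n ts y (app n ss f ts st) = app (Suc n) ss f ts (brR n ss y st)"
proof -
  have y: "y \<in> Ob V"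
    using assms(2) by (rule hasE) auto
  have o: "set ss \<subseteq> Ob V" "set ts \<subseteq> Ob V" and f: "f \<in> Hom V (tob ss) (tob ts)"
    using assms by (auto simp: typed_def)
  note iy = den_ident[OF obl_single[OF y]]
  have "den (\<sigma> (tob ts) y \<cdot> (f \<otimes>\<^sub>a \<langle>y\<rangle>)) (ss @ [y]) (y # ts) (\<lambda>n st. brR n ts y (app n ss f ts st))"
    using den_cmp[OF den_brR[OF o(2) y] den_tensor[OF den_gen[OF assms(1)] iy]] by simp
  moreover have "den ((\<langle>y\<rangle> \<otimes>\<^sub>a f) \<cdot> \<sigma> (tob ss) y) (ss @ [y]) (y # ts)
      (\<lambda>n st. app (n + length [y]) ss f ts (brR n ss y st))"
    using den_cmp[OF den_tensor[OF iy den_gen[OF assms(1)]] den_brR[OF o(1) y]] by simp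
  ultimately show ?thesis
    using den_lift[OF braid_natural[OF f ident_hom[OF y]] _ _ assms(2)] by force
qed

lemma nat_L:
  assumes "typed f ss ts" "has n (x # ss) st"
  shows "brL n x ts (app (Suc n) ss f ts st) = app n ss f ts (brL n x ss st)"
proof -
  have x: "x \<in> Ob V"
    using assms(2) by (rule hasE) auto
  have o: "set ss \<subseteq> Ob V" "set ts \<subseteq> Ob V" and f: "f \<in> Hom V (tob ss) (tob ts)"
    using assms by (auto simp: typed_def)
  note ix = den_ident[OF obl_single[OF x]]
  have "den (\<sigma> x (tob ts) \<cdot> (\<langle>x\<rangle> \<otimes>\<^sub>a f)) (x # ss) (ts @ [x]) (\<lambda>n st. brL n x ts (app (n + length [x]) ss f ts st))"
    using den_cmp[OF den_brL[OF o(2) x] den_tensor[OF ix den_gen[OF assms(1)]]] by simp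
  moreover have "den ((f \<otimes>\<^sub>a \<langle>x\<rangle>) \<cdot> \<sigma> x (tob ss)) (x # ss) (ts @ [x])
      (\<lambda>n st. app n ss f ts (brL n x ss st))"
    using den_cmp[OF den_tensor[OF den_gen[OF assms(1)] ix] den_brL[OF o(1) x]] by simp
  ultimately show ?thesis
    using den_lift[OF braid_natural[OF ident_hom[OF x] f] _ _ assms(2)] by force
qed

lemma natR1: "\<lbrakk>typed f ss [t]; has n (ss @ [y]) st\<rbrakk> \<Longrightarrow>
    app n [t, y] (\<sigma> t y) [y, t] (app n ss f [t] st) = app (Suc n) ss f [t] (brR n ss y st)"
  using nat_R[of f ss "[t]"] by simp

lemma natR2: "\<lbrakk>typed f ss [t, u]; has n (ss @ [y]) st\<rbrakk> \<Longrightarrow>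
    app n [t, y] (\<sigma> t y) [y, t] (app (Suc n) [u, y] (\<sigma> u y) [y, u] (app n ss f [t, u] st))
  = app (Suc n) ss f [t, u] (brR n ss y st)"
  using nat_R[of f ss "[t, u]"] by simp

lemma natL1: "\<lbrakk>typed f ss [t]; has n (x # ss) st\<rbrakk> \<Longrightarrow>
    app n [x, t] (\<sigma> x t) [t, x] (app (Suc n) ss f [t] st) = app n ss f [t] (brL n x ss st)"
  using nat_L[of f ss "[t]"] by simp

lemma natL2: "\<lbrakk>typed f ss [t, u]; has n (x # ss) st\<rbrakk> \<Longrightarrow>
    app (Suc n) [x, u] (\<sigma> x u) [u, x] (app n [x, t] (\<sigma> x t) [t, x] (app (Suc n) ss f [t, u] st))
  = app n ss f [t, u] (brL n x ss st)"
  using nat_L[of f ss "[t, u]"] by simp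

text \<open>Opposite orientation: for an arrow into the unit no crossing remains on one side of
  naturality, so the rule removes the crossings in front of a counit or a pairing.\<close>

lemma natR0:
  "\<lbrakk>typed f [s] []; has n [s, y] st\<rbrakk> \<Longrightarrow>
    app (Suc n) [s] f [] (app n [s, y] (\<sigma> s y) [y, s] st) = app n [s] f [] st"
  "\<lbrakk>typed f [s, t] []; has n [s, t, y] st\<rbrakk> \<Longrightarrow>
    app (Suc n) [s, t] f [] (app n [s, y] (\<sigma> s y) [y, s] (app (Suc n) [t, y] (\<sigma> t y) [y, t] st)) = app n [s, t] f [] st"
  using nat_R[of f "[s]" "[]" n y st] nat_R[of f "[s, t]" "[]" n y st] by simp_all

lemma natL0:
  "\<lbrakk>typed f [s] []; has n [x, s] st\<rbrakk> \<Longrightarrow>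
    app n [s] f [] (app n [x, s] (\<sigma> x s) [s, x] st) = app (Suc n) [s] f [] st"
  "\<lbrakk>typed f [s, t] []; has n [x, s, t] st\<rbrakk> \<Longrightarrow>
    app n [s, t] f [] (app (Suc n) [x, t] (\<sigma> x t) [t, x] (app n [x, s] (\<sigma> x s) [s, x] st)) = app (Suc n) [s, t] f [] st"
  using nat_L[of f "[s]" "[]" n x st] nat_L[of f "[s, t]" "[]" n x st] by simp_all

lemmas nat_simps = natR1 natR2 natL1 natL2 natR0 natL0
lemmas diag0 = nat_simps has_def shp_app shp_init
lemmas diag = exch_right exch_left diag0
lemmas diag' = exch_right' exch_left' diag0

end

section \<open>Hopf algebra and module axioms as rewrite rules on wires\<close>

context hopf_algebra
begin

abbreviation "h \<equiv> obj H"

lemma obj_closed_simp [simp]: "h \<in> Ob V" by (rule obj_closed)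

lemma typed_hopf [tyi]:
  "typed (mul H) [h, h] [h]" "typed (uni H) [] [h]" "typed (com H) [h] [h, h]"
  "typed (cou H) [h] []" "typed (ant H) [h] [h]"
  using obj_closed mul_hom uni_hom com_hom cou_hom ant_hom
  by (simp_all add: typed_def tob_Cons tensor_ob_unit)

lemmas [den_intro] = typed_hopf[THEN den_gen]

lemma mul_assoc_r:
  "has n [h, h, h] st \<Longrightarrow> app n [h,h] (mul H) [h] (app n [h,h] (mul H) [h] st)
     = app n [h,h] (mul H) [h] (app (Suc n) [h,h] (mul H) [h] st)"
  by ((rule den_rule[OF mul_assoc], (rule den_intro | (simp; fail))+)[1])

lemma mul_uni_r:
  "has n [h] st \<Longrightarrow> app n [h,h] (mul H) [h] (app n [] (uni H) [h] st) = st"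
  "has n [h] st \<Longrightarrow> app n [h,h] (mul H) [h] (app (Suc n) [] (uni H) [h] st) = st"
  apply -
  apply ((rule den_rule[OF mul_uni(1)], (rule den_intro | (simp; fail))+)[1])
  apply ((rule den_rule[OF mul_uni(2)], (rule den_intro | (simp; fail))+)[1])
  done

lemma com_mul_r:
  "has n [h,h] st \<Longrightarrow> app n [h] (com H) [h,h] (app n [h,h] (mul H) [h] st)
   = app n [h,h] (mul H) [h] (app (Suc (Suc n)) [h,h] (mul H) [h] (app (Suc n) [h,h] (\<sigma> h h) [h,h]
     (app n [h] (com H) [h,h] (app (Suc n) [h] (com H) [h,h] st))))"
  by ((rule den_rule[OF com_mul], (rule den_intro | (simp; fail))+)[1])

lemma com_coassoc_r:
  "has n [h] st \<Longrightarrow> app n [h] (com H) [h,h] (app n [h] (com H) [h,h] st)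
     = app (Suc n) [h] (com H) [h,h] (app n [h] (com H) [h,h] st)"
  by ((rule den_rule[OF com_coassoc], (rule den_intro | (simp; fail))+)[1])

lemma com_cou_r:
  "has n [h] st \<Longrightarrow> app n [h] (cou H) [] (app n [h] (com H) [h,h] st) = st"
  "has n [h] st \<Longrightarrow> app (Suc n) [h] (cou H) [] (app n [h] (com H) [h,h] st) = st"
  apply -
  apply ((rule den_rule[OF com_cou(1)], (rule den_intro | (simp; fail))+)[1])
  apply ((rule den_rule[OF com_cou(2)], (rule den_intro | (simp; fail))+)[1])
  done

lemma com_uni_r:
  "has n [] st \<Longrightarrow> app n [h] (com H) [h,h] (app n [] (uni H) [h] st)
    = app n [] (uni H) [h] (app n [] (uni H) [h] st)"
  by ((rule den_rule[OF com_uni], (rule den_intro | (simp; fail))+)[1])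

lemma cou_mul_r:
  "has n [h,h] st \<Longrightarrow> app n [h] (cou H) [] (app n [h,h] (mul H) [h] st)
    = app n [h] (cou H) [] (app (Suc n) [h] (cou H) [] st)"
  by ((rule den_rule[OF cou_mul], (rule den_intro | (simp; fail))+)[1])

lemma cou_uni_r:
  "has n [] st \<Longrightarrow> app n [h] (cou H) [] (app n [] (uni H) [h] st) = st"
  by ((rule den_rule[OF cou_uni], (rule den_intro | (simp; fail))+)[1])

lemma antipode_r:
  "has n [h] st \<Longrightarrow> app n [h,h] (mul H) [h] (app n [h] (ant H) [h] (app n [h] (com H) [h,h] st))
    = app n [] (uni H) [h] (app n [h] (cou H) [] st)"
  "has n [h] st \<Longrightarrow> app n [h,h] (mul H) [h] (app (Suc n) [h] (ant H) [h] (app n [h] (com H) [h,h] st))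
    = app n [] (uni H) [h] (app n [h] (cou H) [] st)"
  apply -
  apply ((rule den_rule[OF antipode(1)], (rule den_intro | (simp; fail))+)[1])
  apply ((rule den_rule[OF antipode(2)], (rule den_intro | (simp; fail))+)[1])
  done

lemma right_moduleD:
  assumes "right_module V H (M, r)"
  shows "M \<in> Ob V" "typed r [M, h] [M]"
    and "has n [M, h, h] st \<Longrightarrow> app n [M, h] r [M] (app n [M, h] r [M] st)
      = app n [M, h] r [M] (app (Suc n) [h, h] (mul H) [h] st)"
    and "has n [M] st \<Longrightarrow> app n [M, h] r [M] (app (Suc n) [] (uni H) [h] st) = st"
proof -
  show M [simp]: "M \<in> Ob V" and t: "typed r [M, h] [M]"
    using assms obj_closed by (auto simp: right_module_def typed_def tob_Cons tensor_ob_unit)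
  have e: "r \<cdot> (r \<otimes>\<^sub>a \<langle>obj H\<rangle>) = r \<cdot> (\<langle>M\<rangle> \<otimes>\<^sub>a mul H)" "r \<cdot> (\<langle>M\<rangle> \<otimes>\<^sub>a uni H) = \<langle>M\<rangle>"
    using assms by (auto simp: right_module_def)
  note [den_intro] = t[THEN den_gen]
  show "has n [M, h, h] st \<Longrightarrow> app n [M, h] r [M] (app n [M, h] r [M] st)
      = app n [M, h] r [M] (app (Suc n) [h, h] (mul H) [h] st)"
    by ((rule den_rule[OF e(1)], (rule den_intro | (simp; fail))+)[1])
  show "has n [M] st \<Longrightarrow> app n [M, h] r [M] (app (Suc n) [] (uni H) [h] st) = st"
    by ((rule den_rule[OF e(2)], (rule den_intro | (simp; fail))+)[1])
qed

lemma right_module_iff: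
  "right_module V H (M, r) \<longleftrightarrow> M \<in> Ob V \<and> typed r [M, h] [M] \<and>
     r \<cdot> (r \<otimes>\<^sub>a \<langle>obj H\<rangle>) = r \<cdot> (\<langle>M\<rangle> \<otimes>\<^sub>a mul H) \<and> r \<cdot> (\<langle>M\<rangle> \<otimes>\<^sub>a uni H) = \<langle>M\<rangle>"
  using obj_closed by (auto simp: right_module_def typed_def tob_Cons tensor_ob_unit)

lemmas hopf_simps = com_mul_r com_uni_r cou_mul_r cou_uni_r com_cou_r mul_uni_r

end

context strict_monoidal_category
begin

lemma cancel_epi:
  assumes "f \<cdot> t = g \<cdot> t" "t \<cdot> t' = \<langle>Y\<rangle>" "f \<in> Hom V Y Z" "g \<in> Hom V Y Z" "t \<in> Hom V X Y" "t' \<in> Hom V Y X"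
  shows "f = g"
proof -
  have "f = f \<cdot> (t \<cdot> t')"
    using assms(2) cmp_ident[OF assms(3)] by simp
  also have "\<dots> = (f \<cdot> t) \<cdot> t'"
    by (rule cmp_assoc[OF assms(6,5,3), symmetric])
  also have "\<dots> = g \<cdot> (t \<cdot> t')"
    unfolding assms(1) by (rule cmp_assoc[OF assms(6,5,4)])
  finally show ?thesis
    using assms(2) cmp_ident[OF assms(4)] by simp
qed

end

section \<open>Snake identities and nondegeneracy of evaluations\<close>

context braided_rigid_category
begin

lemma dual_closed [simp]: "X \<in> Ob V \<Longrightarrow> ldual V X \<in> Ob V" "X \<in> Ob V \<Longrightarrow> rdual V X \<in> Ob V"
  by (rule ldual_closed rdual_closed, assumption)+

lemma typed_dual [tyi]:
  assumes "X \<in> Ob V"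
  shows "typed (evl V X) [ldual V X, X] []" "typed (coevl V X) [] [X, ldual V X]"
    "typed (evr V X) [X, rdual V X] []" "typed (coevr V X) [] [rdual V X, X]"
  using assms evl_hom coevl_hom evr_hom coevr_hom by (simp_all add: typed_def tob_Cons tensor_ob_unit)

lemmas [den_intro] = typed_dual[THEN den_gen]

lemma snake_l_r:
  "X \<in> Ob V \<Longrightarrow> has n [X] st \<Longrightarrow>
    app (Suc n) [ldual V X, X] (evl V X) [] (app n [] (coevl V X) [X, ldual V X] st) = st"
  "X \<in> Ob V \<Longrightarrow> has n [ldual V X] st \<Longrightarrow>
    app n [ldual V X, X] (evl V X) [] (app (Suc n) [] (coevl V X) [X, ldual V X] st) = st"
  apply -
  apply ((rule den_rule[OF snake_l1], (rule den_intro | (simp; fail))+)[1])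
  apply ((rule den_rule[OF snake_l2], (rule den_intro | (simp; fail))+)[1])
  done

lemma snake_r_r:
  "X \<in> Ob V \<Longrightarrow> has n [X] st \<Longrightarrow>
    app n [X, rdual V X] (evr V X) [] (app (Suc n) [] (coevr V X) [rdual V X, X] st) = st"
  "X \<in> Ob V \<Longrightarrow> has n [rdual V X] st \<Longrightarrow>
    app (Suc n) [X, rdual V X] (evr V X) [] (app n [] (coevr V X) [rdual V X, X] st) = st"
  apply -
  apply ((rule den_rule[OF snake_r1], (rule den_intro | (simp; fail))+)[1])
  apply ((rule den_rule[OF snake_r2], (rule den_intro | (simp; fail))+)[1])
  done

lemmas snakes = snake_l_r snake_r_r

text \<open>Bending the evaluated wire back with \<open>coevr\<close> recovers the arrow. The
  spectator \<open>W\<close> allows arrows into a product, such as coevaluations, to be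
  compared.\<close>

lemma evr_cancel:
  assumes [simp]: "X \<in> Ob V" "Z \<in> Ob V" "W \<in> Ob V"
    and f: "typed f [Z] [rdual V X, W]" "typed g [Z] [rdual V X, W]"
    and e: "(evr V X \<otimes>\<^sub>a \<langle>W\<rangle>) \<cdot> (\<langle>X\<rangle> \<otimes>\<^sub>a f) = (evr V X \<otimes>\<^sub>a \<langle>W\<rangle>) \<cdot> (\<langle>X\<rangle> \<otimes>\<^sub>a g)"
  shows "f = g"
proof -
  have "f' = (\<langle>rdual V X\<rangle> \<otimes>\<^sub>a ((evr V X \<otimes>\<^sub>a \<langle>W\<rangle>) \<cdot> (\<langle>X\<rangle> \<otimes>\<^sub>a f'))) \<cdot> (coevr V X \<otimes>\<^sub>a \<langle>Z\<rangle>)"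
    if f': "typed f' [Z] [rdual V X, W]" for f'
  proof -
    note [den_intro] = f'[THEN den_gen]
    show ?thesis
      by (rule den_eqI, (rule den_intro | (simp; fail))+, simp add: diag tyi f' snakes)
  qed
  from this[OF f(1)] this[OF f(2)] show ?thesis
    using e by simp
qed

lemma evl_cancel:
  assumes [simp]: "X \<in> Ob V" "Z \<in> Ob V" "W \<in> Ob V"
    and f: "typed f [Z] [X, W]" "typed g [Z] [X, W]"
    and e: "(evl V X \<otimes>\<^sub>a \<langle>W\<rangle>) \<cdot> (\<langle>ldual V X\<rangle> \<otimes>\<^sub>a f) = (evl V X \<otimes>\<^sub>a \<langle>W\<rangle>) \<cdot> (\<langle>ldual V X\<rangle> \<otimes>\<^sub>a g)"
  shows "f = g"
proof -
  have "f' = (\<langle>X\<rangle> \<otimes>\<^sub>a ((evl V X \<otimes>\<^sub>a \<langle>W\<rangle>) \<cdot> (\<langle>ldual V X\<rangle> \<otimes>\<^sub>a f'))) \<cdot> (coevl V X \<otimes>\<^sub>a \<langle>Z\<rangle>)"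
    if f': "typed f' [Z] [X, W]" for f'
  proof -
    note [den_intro] = f'[THEN den_gen]
    show ?thesis
      by (rule den_eqI, (rule den_intro | (simp; fail))+, simp add: diag tyi f' snakes)
  qed
  from this[OF f(1)] this[OF f(2)] show ?thesis
    using e by simp
qed

lemma evl_cancel_left:
  assumes [simp]: "X \<in> Ob V" "Z \<in> Ob V" "W \<in> Ob V"
    and f: "typed f [Z] [W, ldual V X]" "typed g [Z] [W, ldual V X]"
    and e: "(\<langle>W\<rangle> \<otimes>\<^sub>a evl V X) \<cdot> (f \<otimes>\<^sub>a \<langle>X\<rangle>) = (\<langle>W\<rangle> \<otimes>\<^sub>a evl V X) \<cdot> (g \<otimes>\<^sub>a \<langle>X\<rangle>)"
  shows "f = g"
proof -
  have "f' = (((\<langle>W\<rangle> \<otimes>\<^sub>a evl V X) \<cdot> (f' \<otimes>\<^sub>a \<langle>X\<rangle>)) \<otimes>\<^sub>a \<langle>ldual V X\<rangle>) \<cdot> (\<langle>Z\<rangle> \<otimes>\<^sub>a coevl V X)"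
    if f': "typed f' [Z] [W, ldual V X]" for f'
  proof -
    note [den_intro] = f'[THEN den_gen]
    show ?thesis
      by (rule den_eqI, (rule den_intro | (simp; fail))+, simp add: diag tyi f' snakes)
  qed
  from this[OF f(1)] this[OF f(2)] show ?thesis
    using e by simp
qed

end

section \<open>Modules over a Hopf algebra\<close>

context hopf_algebra
begin

lemma mod_tensor_module:
  assumes m: "right_module V H (M, r)" "right_module V H (N, s)"
  shows "right_module V H (mod_tensor V H (M, r) (N, s))"
proof -
  define R where R: "R = (r \<otimes>\<^sub>a s) \<cdot> (\<langle>M\<rangle> \<otimes>\<^sub>a \<sigma> N (obj H) \<otimes>\<^sub>a \<langle>obj H\<rangle>) \<cdot> (\<langle>M \<otimes>\<^sub>o N\<rangle> \<otimes>\<^sub>a com H)"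
  note [simp] = right_moduleD(1)[OF m(1)] right_moduleD(1)[OF m(2)]
  note [den_intro] = right_moduleD(2)[OF m(1), THEN den_gen] right_moduleD(2)[OF m(2), THEN den_gen]
  have d: "den R [M,N,h] [M,N] (\<lambda>n st. app n [M,h] r [M] (app (Suc (Suc n)) [N,h] s [N]
    (app (Suc n) [N,h] (\<sigma> N h) [h,N] (app (Suc (Suc n)) [h] (com H) [h,h] st))))"
    unfolding R by (rule den_conv, (rule den_intro | (simp; fail))+)
  note [den_intro] = d
  have "R \<cdot> (R \<otimes>\<^sub>a \<langle>obj H\<rangle>) = R \<cdot> (\<langle>M \<otimes>\<^sub>o N\<rangle> \<otimes>\<^sub>a mul H)"
    apply (rule den_eqI)
    apply (rule den_intro | (simp; fail))+
    apply (simp add: diag tyi mul_assoc_r hopf_simps right_moduleD[OF m(1)] right_moduleD[OF m(2)])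
    done
  moreover have "R \<cdot> (\<langle>M \<otimes>\<^sub>o N\<rangle> \<otimes>\<^sub>a uni H) = \<langle>M \<otimes>\<^sub>o N\<rangle>"
    apply (rule den_eqI)
    apply (rule den_intro | (simp; fail))+
    apply (simp add: diag tyi mul_assoc_r hopf_simps right_moduleD[OF m(1)] right_moduleD[OF m(2)])
    done
  ultimately show ?thesis
    using den_hom[OF d] by (simp add: right_module_def mod_tensor_def R[symmetric] tob_Cons tensor_ob_unit
       tensor_closed tensor_ob_assoc)
qed

lemma mod_tensor_assoc:
  assumes m: "right_module V H (M, r)" "right_module V H (N, s)" "right_module V H (P, q)"
  shows "mod_tensor V H (mod_tensor V H (M, r) (N, s)) (P, q) = mod_tensor V H (M, r) (mod_tensor V H (N, s) (P, q))"
proof -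
  note [simp] = right_moduleD(1)[OF m(1)] right_moduleD(1)[OF m(2)] right_moduleD(1)[OF m(3)]
  note [den_intro] = right_moduleD(2)[OF m(1), THEN den_gen] right_moduleD(2)[OF m(2), THEN den_gen] right_moduleD(2)[OF m(3), THEN den_gen]
  show ?thesis
    apply (simp add: mod_tensor_def tensor_ob_assoc)
    apply (rule den_eqI)
    apply (rule den_intro | (simp; fail))+
    apply (simp add: diag tyi com_coassoc_r[symmetric] right_moduleD[OF m(1)] right_moduleD[OF m(2)] right_moduleD[OF m(3)])
    done
qed

lemma mod_unit_module: "right_module V H (mod_unit V H)"
proof -
  have "cou H \<cdot> (cou H \<otimes>\<^sub>a \<langle>obj H\<rangle>) = cou H \<cdot> (\<langle>\<^bold>1\<rangle> \<otimes>\<^sub>a mul H)"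
    by (rule den_eqI, (rule den_intro | (simp; fail))+, simp add: diag tyi cou_mul_r)
  then show ?thesis
    using obj_closed unit_closed cou_hom uni_hom cou_uni hom_Ar[OF uni_hom]
    by (simp add: right_module_def mod_unit_def tensor_ob_unit tensor_ar_unit)
qed

lemma mod_tensor_unit:
  assumes m: "right_module V H (M, r)"
  shows "mod_tensor V H (mod_unit V H) (M, r) = (M, r)" "mod_tensor V H (M, r) (mod_unit V H) = (M, r)"
proof -
  note [simp] = right_moduleD(1)[OF m(1)]
  note [den_intro] = right_moduleD(2)[OF m(1), THEN den_gen]
  show "mod_tensor V H (mod_unit V H) (M, r) = (M, r)"
    apply (simp add: mod_tensor_def mod_unit_def tensor_ob_unit)
    apply (rule den_eqI, (rule den_intro | (simp; fail))+, simp add: diag tyi hopf_simps right_moduleD[OF m(1)])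
    done
  show "mod_tensor V H (M, r) (mod_unit V H) = (M, r)"
    apply (simp add: mod_tensor_def mod_unit_def tensor_ob_unit)
    apply (rule den_eqI, (rule den_intro | (simp; fail))+, simp add: diag tyi hopf_simps right_moduleD[OF m(1)])
    done
qed

lemma H_linear_tensor:
  assumes m: "right_module V H (M, r)" "right_module V H (N, s)" "right_module V H (M', r')" "right_module V H (N', s')"
    and f: "H_linear V H (M, r) f (M', r')" and g: "H_linear V H (N, s) g (N', s')"
  shows "H_linear V H (mod_tensor V H (M, r) (N, s)) (f \<otimes>\<^sub>a g) (mod_tensor V H (M', r') (N', s'))"
proof -
  note [simp] = m[THEN right_moduleD(1)]
  note t = m[THEN right_moduleD(2)]
  have tf: "typed f [M] [M']" "typed g [N] [N']" and
    e: "f \<cdot> r = r' \<cdot> (f \<otimes>\<^sub>a \<langle>obj H\<rangle>)"  "g \<cdot> s = s' \<cdot> (g \<otimes>\<^sub>a \<langle>obj H\<rangle>)"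
    using f g by (simp_all add: H_linear_def typed_def)
  note [den_intro] = t[THEN den_gen] tf[THEN den_gen]
  have rf: "has n [M,h] st \<Longrightarrow> app n [M] f [M'] (app n [M,h] r [M] st) = app n [M',h] r' [M'] (app n [M] f [M'] st)" for n st
    by ((rule den_rule[OF e(1)], (rule den_intro | (simp; fail))+)[1])
  have rg: "has n [N,h] st \<Longrightarrow> app n [N] g [N'] (app n [N,h] s [N] st) = app n [N',h] s' [N'] (app n [N] g [N'] st)" for n st
    by ((rule den_rule[OF e(2)], (rule den_intro | (simp; fail))+)[1])
  have "(f \<otimes>\<^sub>a g) \<cdot> snd (mod_tensor V H (M, r) (N, s)) = snd (mod_tensor V H (M', r') (N', s')) \<cdot> ((f \<otimes>\<^sub>a g) \<otimes>\<^sub>a \<langle>obj H\<rangle>)"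
    apply (simp add: mod_tensor_def)
    apply (rule den_eqI, (rule den_intro | (simp; fail))+, simp add: diag tyi t tf rf rg)
    done
  moreover have "f \<otimes>\<^sub>a g \<in> Hom V (M \<otimes>\<^sub>o N) (M' \<otimes>\<^sub>o N')"
    using f g tensor_hom by (simp add: H_linear_def)
  ultimately show ?thesis
    by (simp add: H_linear_def mod_tensor_def)
qed

lemma H_linear_comp:
  assumes m: "right_module V H (M, r)" "right_module V H (N, s)" "right_module V H (P, q)"
    and f: "H_linear V H (M, r) f (N, s)" and g: "H_linear V H (N, s) g (P, q)"
  shows "H_linear V H (M, r) (g \<cdot> f) (P, q)"
proof -
  note [simp] = m[THEN right_moduleD(1)]
  note t = m[THEN right_moduleD(2)]
  have tf: "typed f [M] [N]" "typed g [N] [P]" and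
    e: "f \<cdot> r = s \<cdot> (f \<otimes>\<^sub>a \<langle>obj H\<rangle>)"  "g \<cdot> s = q \<cdot> (g \<otimes>\<^sub>a \<langle>obj H\<rangle>)"
    using f g by (simp_all add: H_linear_def typed_def)
  note [den_intro] = t[THEN den_gen] tf[THEN den_gen]
  have rf: "has n [M,h] st \<Longrightarrow> app n [M] f [N] (app n [M,h] r [M] st) = app n [N,h] s [N] (app n [M] f [N] st)" for n st
    by ((rule den_rule[OF e(1)], (rule den_intro | (simp; fail))+)[1])
  have rg: "has n [N,h] st \<Longrightarrow> app n [N] g [P] (app n [N,h] s [N] st) = app n [P,h] q [P] (app n [N] g [P] st)" for n st
    by ((rule den_rule[OF e(2)], (rule den_intro | (simp; fail))+)[1])
  have "(g \<cdot> f) \<cdot> r = q \<cdot> ((g \<cdot> f) \<otimes>\<^sub>a \<langle>obj H\<rangle>)"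
    by (rule den_eqI, (rule den_intro | (simp; fail))+, simp add: diag tyi t tf rf rg)
  then show ?thesis
    using f g cmp_hom by (auto simp: H_linear_def)
qed

lemma H_linear_ident: "right_module V H A \<Longrightarrow> H_linear V H A \<langle>fst A\<rangle> A"
  using tensor_ident[of "fst A" h] ident_hom[of "fst A"]
  by (auto simp: H_linear_def right_module_def obj_closed cmp_ident)

text \<open>The antipode axiom with a spectator: \<open>S(x_1) (x_2 y)\<close> and
  \<open>x_1 (S(x_2) y)\<close> both equal the counit of \<open>x\<close> times \<open>y\<close>. It
  is needed because \<open>mul_assoc_r\<close> brackets products to the right and thereby hides the
  redex of \<open>antipode_r\<close>.\<close>

lemma antipode_z:
  "has n [h, h] st \<Longrightarrow> app n [h,h] (mul H) [h] (app n [h] (ant H) [h]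
     (app (Suc n) [h,h] (mul H) [h] (app n [h] (com H) [h,h] st))) = app n [h] (cou H) [] st"
  "has n [h, h] st \<Longrightarrow> app n [h,h] (mul H) [h] (app (Suc n) [h,h] (mul H) [h]
     (app (Suc n) [h] (ant H) [h] (app n [h] (com H) [h,h] st))) = app n [h] (cou H) [] st"
proof -
  have e: "mul H \<cdot> (ant H \<otimes>\<^sub>a \<langle>h\<rangle>) \<cdot> (\<langle>h\<rangle> \<otimes>\<^sub>a mul H) \<cdot> (com H \<otimes>\<^sub>a \<langle>h\<rangle>) = cou H \<otimes>\<^sub>a \<langle>h\<rangle>"
    "mul H \<cdot> (\<langle>h\<rangle> \<otimes>\<^sub>a mul H) \<cdot> (\<langle>h\<rangle> \<otimes>\<^sub>a ant H \<otimes>\<^sub>a \<langle>h\<rangle>) \<cdot> (com H \<otimes>\<^sub>a \<langle>h\<rangle>) = cou H \<otimes>\<^sub>a \<langle>h\<rangle>"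
  proof -
    have "mul H \<cdot> (ant H \<otimes>\<^sub>a \<langle>h\<rangle>) \<cdot> (\<langle>h\<rangle> \<otimes>\<^sub>a mul H) \<cdot> (com H \<otimes>\<^sub>a \<langle>h\<rangle>)
        = mul H \<cdot> (\<langle>h\<rangle> \<otimes>\<^sub>a mul H) \<cdot> (ant H \<otimes>\<^sub>a \<langle>h \<otimes>\<^sub>o h\<rangle>) \<cdot> (com H \<otimes>\<^sub>a \<langle>h\<rangle>)"
      by (rule den_eqI, (rule den_intro | (simp; fail))+, simp add: diag tyi)
    also have "\<dots> = mul H \<cdot> (mul H \<otimes>\<^sub>a \<langle>h\<rangle>) \<cdot> (ant H \<otimes>\<^sub>a \<langle>h \<otimes>\<^sub>o h\<rangle>) \<cdot> (com H \<otimes>\<^sub>a \<langle>h\<rangle>)"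
      by (rule den_eqI, (rule den_intro | (simp; fail))+, simp add: diag tyi mul_assoc_r)
    also have "\<dots> = cou H \<otimes>\<^sub>a \<langle>h\<rangle>"
      by (rule den_eqI, (rule den_intro | (simp; fail))+, simp add: diag tyi mul_uni_r antipode_r)
    finally show "mul H \<cdot> (ant H \<otimes>\<^sub>a \<langle>h\<rangle>) \<cdot> (\<langle>h\<rangle> \<otimes>\<^sub>a mul H) \<cdot> (com H \<otimes>\<^sub>a \<langle>h\<rangle>) = cou H \<otimes>\<^sub>a \<langle>h\<rangle>" .
    show "mul H \<cdot> (\<langle>h\<rangle> \<otimes>\<^sub>a mul H) \<cdot> (\<langle>h\<rangle> \<otimes>\<^sub>a ant H \<otimes>\<^sub>a \<langle>h\<rangle>) \<cdot> (com H \<otimes>\<^sub>a \<langle>h\<rangle>) = cou H \<otimes>\<^sub>a \<langle>h\<rangle>"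
      by (rule den_eqI, (rule den_intro | (simp; fail))+, simp add: diag tyi hopf_simps mul_assoc_r[symmetric] antipode_r)
  qed
  show
  "has n [h, h] st \<Longrightarrow> app n [h,h] (mul H) [h] (app n [h] (ant H) [h]
     (app (Suc n) [h,h] (mul H) [h] (app n [h] (com H) [h,h] st))) = app n [h] (cou H) [] st"
    by ((rule den_rule[OF e(1)], (rule den_intro | (simp; fail))+)[1])
  show
  "has n [h, h] st \<Longrightarrow> app n [h,h] (mul H) [h] (app (Suc n) [h,h] (mul H) [h]
     (app (Suc n) [h] (ant H) [h] (app n [h] (com H) [h,h] st))) = app n [h] (cou H) [] st"
    by ((rule den_rule[OF e(2)], (rule den_intro | (simp; fail))+)[1])
qed

text \<open>The antipode axiom evaluated at the grouplike unit.\<close>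

lemma antipode_uni: "ant H \<cdot> uni H = uni H"
proof -
  have "ant H \<cdot> uni H = mul H \<cdot> (\<langle>h\<rangle> \<otimes>\<^sub>a ant H) \<cdot> com H \<cdot> uni H"
    by (rule den_eqI, (rule den_intro | (simp; fail))+, simp add: diag tyi hopf_simps)
  also have "\<dots> = uni H"
    by (rule den_eqI, (rule den_intro | (simp; fail))+, simp add: diag tyi antipode_r hopf_simps(4) del: com_uni_r)
  finally show ?thesis .
qed

text \<open>The arrow \<open>t\<close> below is \<open>a \<otimes> b \<otimes> c \<mapsto> a b\<^sub>1 c\<^sub>1 \<otimes> b\<^sub>2 \<otimes> c\<^sub>2\<close>. It is a split epimorphism, and after
  precomposition with it both sides of the claim, multiplied by \<open>a\<close>, become \<open>a \<epsilon>(b) \<epsilon>(c)\<close>.\<close>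

lemma antipode_mul: "ant H \<cdot> mul H = mul H \<cdot> (ant H \<otimes>\<^sub>a ant H) \<cdot> \<sigma> h h"
proof -
  define t where "t = (mul H \<otimes>\<^sub>a \<langle>h \<otimes>\<^sub>o h\<rangle>) \<cdot> (\<langle>h\<rangle> \<otimes>\<^sub>a \<sigma> h h \<otimes>\<^sub>a \<langle>h\<rangle>) \<cdot> (\<langle>h \<otimes>\<^sub>o h\<rangle> \<otimes>\<^sub>a com H)
    \<cdot> (mul H \<otimes>\<^sub>a \<langle>h \<otimes>\<^sub>o h\<rangle>) \<cdot> (\<langle>h\<rangle> \<otimes>\<^sub>a com H \<otimes>\<^sub>a \<langle>h\<rangle>)"
  \<comment> \<open>The section of \<open>t\<close>: up to braidings it sends the factors
    \<open>a\<close>, \<open>b\<close>, \<open>c\<close> to \<open>a S(c_1) S(b_1)\<close>,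
    \<open>b_2\<close>, \<open>c_2\<close>, so that the factors \<open>b_1 c_1\<close> inserted by
    \<open>t\<close> are cancelled from the inside out.\<close>
  define t' where "t' = (mul H \<otimes>\<^sub>a \<langle>h \<otimes>\<^sub>o h\<rangle>) \<cdot> (\<langle>h\<rangle> \<otimes>\<^sub>a ant H \<otimes>\<^sub>a \<langle>h \<otimes>\<^sub>o h\<rangle>) \<cdot> (\<langle>h\<rangle> \<otimes>\<^sub>a com H \<otimes>\<^sub>a \<langle>h\<rangle>)
    \<cdot> (mul H \<otimes>\<^sub>a \<langle>h \<otimes>\<^sub>o h\<rangle>) \<cdot> (\<langle>h\<rangle> \<otimes>\<^sub>a \<sigma> h h \<otimes>\<^sub>a \<langle>h\<rangle>) \<cdot> (\<langle>h \<otimes>\<^sub>o h\<rangle> \<otimes>\<^sub>a ant H \<otimes>\<^sub>a \<langle>h\<rangle>) \<cdot> (\<langle>h \<otimes>\<^sub>o h\<rangle> \<otimes>\<^sub>a com H)"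
  define f where "f = mul H \<cdot> (\<langle>h\<rangle> \<otimes>\<^sub>a ant H) \<cdot> (\<langle>h\<rangle> \<otimes>\<^sub>a mul H)"
  define g where "g = mul H \<cdot> (\<langle>h\<rangle> \<otimes>\<^sub>a mul H) \<cdot> (\<langle>h\<rangle> \<otimes>\<^sub>a ant H \<otimes>\<^sub>a ant H) \<cdot> (\<langle>h\<rangle> \<otimes>\<^sub>a \<sigma> h h)"
  have 1: "(\<langle>h\<rangle> \<otimes>\<^sub>a mul H) \<cdot> t = (mul H \<otimes>\<^sub>a \<langle>h\<rangle>) \<cdot> (\<langle>h\<rangle> \<otimes>\<^sub>a com H) \<cdot> (\<langle>h\<rangle> \<otimes>\<^sub>a mul H)"
    unfolding t_def by (rule den_eqI, (rule den_intro | (simp; fail))+, simp add: diag tyi hopf_simps mul_assoc_r)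
  have "f \<cdot> t = (mul H \<cdot> (\<langle>h\<rangle> \<otimes>\<^sub>a ant H)) \<cdot> ((\<langle>h\<rangle> \<otimes>\<^sub>a mul H) \<cdot> t)"
    unfolding f_def t_def by (rule den_eqI, (rule den_intro | (simp; fail))+)
  also have "\<dots> = \<langle>h\<rangle> \<otimes>\<^sub>a cou H \<otimes>\<^sub>a cou H"
    unfolding 1 by (rule den_eqI, (rule den_intro | (simp; fail))+, simp add: diag tyi antipode_r cou_mul_r mul_uni_r mul_assoc_r)
  also have "\<dots> = g \<cdot> t"
    unfolding g_def t_def by (rule den_eqI, (rule den_intro | (simp; fail))+, simp add: diag tyi hopf_simps mul_assoc_r, simp add: diag' tyi, simp add: diag tyi antipode_r antipode_z hopf_simps)
  finally have ft: "f \<cdot> t = g \<cdot> t" .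
  have tt: "t \<cdot> t' = \<langle>h \<otimes>\<^sub>o h \<otimes>\<^sub>o h\<rangle>"
    unfolding t_def t'_def
    by (rule den_eqI, (rule den_intro | (simp; fail))+, simp add: diag tyi hopf_simps mul_assoc_r com_coassoc_r[symmetric] antipode_r)
  have ty: "typed f [h,h,h] [h]" "typed g [h,h,h] [h]" "typed t [h,h,h] [h,h,h]" "typed t' [h,h,h] [h,h,h]"
    unfolding f_def g_def t_def t'_def
    by (rule den_typed, rule den_conv, (rule den_intro | (simp; fail))+)+
  have "f = g"
    using cancel_epi[OF ft tt, of h "h \<otimes>\<^sub>o h \<otimes>\<^sub>o h"] ty by (simp add: typed_def tob_Cons tensor_ob_unit)
  \<comment> \<open>Putting the unit into the first factor removes the auxiliary left
    multiplication.\<close>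
  then have "f \<cdot> (uni H \<otimes>\<^sub>a \<langle>h \<otimes>\<^sub>o h\<rangle>) = g \<cdot> (uni H \<otimes>\<^sub>a \<langle>h \<otimes>\<^sub>o h\<rangle>)"
    by simp
  moreover have "f \<cdot> (uni H \<otimes>\<^sub>a \<langle>h \<otimes>\<^sub>o h\<rangle>) = ant H \<cdot> mul H"
    unfolding f_def by (rule den_eqI, (rule den_intro | (simp; fail))+, simp add: diag tyi mul_uni_r)
  moreover have "g \<cdot> (uni H \<otimes>\<^sub>a \<langle>h \<otimes>\<^sub>o h\<rangle>) = mul H \<cdot> (ant H \<otimes>\<^sub>a ant H) \<cdot> \<sigma> h h"
    unfolding g_def by (rule den_eqI, (rule den_intro | (simp; fail))+, simp add: diag tyi mul_uni_r)
  ultimately show ?thesis by simp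
qed

lemma antipode_mul_r:
  "has n [h,h] st \<Longrightarrow> app n [h] (ant H) [h] (app n [h,h] (mul H) [h] st) = app n [h,h] (mul H) [h]
    (app n [h] (ant H) [h] (app (Suc n) [h] (ant H) [h] (app n [h,h] (\<sigma> h h) [h,h] st)))"
  by ((rule den_rule[OF antipode_mul], (rule den_intro | (simp; fail))+)[1])

lemma antipode_uni_r:
  "has n [] st \<Longrightarrow> app n [h] (ant H) [h] (app n [] (uni H) [h] st) = app n [] (uni H) [h] st"
  by ((rule den_rule[OF antipode_uni], (rule den_intro | (simp; fail))+)[1])

end

section \<open>Cancelling evaluations and undoing crossings\<close>

context braided_rigid_category
begin

lemma evr_cancel_hom:
  assumes X: "X \<in> Ob V" and f: "f \<in> Hom V Z (rdual V X)" "g \<in> Hom V Z (rdual V X)"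
    and e: "evr V X \<cdot> (\<langle>X\<rangle> \<otimes>\<^sub>a f) = evr V X \<cdot> (\<langle>X\<rangle> \<otimes>\<^sub>a g)"
  shows "f = g"
  using evr_cancel[of X Z "\<^bold>1" f g] assms hom_Ob[OF f(1)] unit_closed evr_hom[OF X]
  by (simp add: typed_def tob_Cons tensor_ob_unit tensor_ar_unit hom_Ar)

lemma evl_cancel_hom:
  assumes X: "X \<in> Ob V" and f: "f \<in> Hom V Z X" "g \<in> Hom V Z X"
    and e: "evl V X \<cdot> (\<langle>ldual V X\<rangle> \<otimes>\<^sub>a f) = evl V X \<cdot> (\<langle>ldual V X\<rangle> \<otimes>\<^sub>a g)"
  shows "f = g"
  using evl_cancel[of X Z "\<^bold>1" f g] assms hom_Ob[OF f(1)] unit_closed evl_hom[OF X]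
  by (simp add: typed_def tob_Cons tensor_ob_unit tensor_ar_unit hom_Ar)

lemma evl_cancel_left_hom:
  assumes X: "X \<in> Ob V" and f: "f \<in> Hom V Z (ldual V X)" "g \<in> Hom V Z (ldual V X)"
    and e: "evl V X \<cdot> (f \<otimes>\<^sub>a \<langle>X\<rangle>) = evl V X \<cdot> (g \<otimes>\<^sub>a \<langle>X\<rangle>)"
  shows "f = g"
  using evl_cancel_left[of X Z "\<^bold>1" f g] assms hom_Ob[OF f(1)] unit_closed evl_hom[OF X]
    tensor_hom[OF f(1) ident_hom[OF X]] tensor_hom[OF f(2) ident_hom[OF X]]
  by (simp add: typed_def tob_Cons tensor_ob_unit tensor_ar_unit hom_Ar)

text \<open>The inverse braiding, indexed by its source \<open>X \<otimes> Y\<close>.\<close>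

definition ibr :: "'a \<Rightarrow> 'a \<Rightarrow> 'b" where
  "ibr X Y = arr_inv V (\<sigma> Y X)"

lemma ibr:
  assumes "X \<in> Ob V" "Y \<in> Ob V"
  shows "ibr X Y \<in> Hom V (X \<otimes>\<^sub>o Y) (Y \<otimes>\<^sub>o X)" "ibr X Y \<cdot> \<sigma> Y X = \<langle>Y \<otimes>\<^sub>o X\<rangle>" "\<sigma> Y X \<cdot> ibr X Y = \<langle>X \<otimes>\<^sub>o Y\<rangle>"
  using arr_inv_eqs[OF braid_iso braid_hom, of Y X] assms by (simp_all add: ibr_def)

lemma typed_ibr [tyi]: "X \<in> Ob V \<Longrightarrow> Y \<in> Ob V \<Longrightarrow> typed (ibr X Y) [X, Y] [Y, X]"
  using ibr(1) by (simp add: typed_def tob_Cons tensor_ob_unit)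

lemmas [den_intro] = typed_ibr[THEN den_gen]

lemma ibr_r:
  "X \<in> Ob V \<Longrightarrow> Y \<in> Ob V \<Longrightarrow> has n [Y, X] st \<Longrightarrow>
     app n [X, Y] (ibr X Y) [Y, X] (app n [Y, X] (\<sigma> Y X) [X, Y] st) = st"
  "X \<in> Ob V \<Longrightarrow> Y \<in> Ob V \<Longrightarrow> has n [X, Y] st \<Longrightarrow>
     app n [Y, X] (\<sigma> Y X) [X, Y] (app n [X, Y] (ibr X Y) [Y, X] st) = st"
  apply -
  apply ((rule den_rule[OF ibr(2)[of X Y]], (rule den_intro | (simp; fail))+)[1])
  apply ((rule den_rule[OF ibr(3)[of X Y]], (rule den_intro | (simp; fail))+)[1])
  done

lemma ibr_natural:
  assumes f: "f \<in> Hom V A B" and g: "g \<in> Hom V X Y"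
  shows "ibr B Y \<cdot> (f \<otimes>\<^sub>a g) = (g \<otimes>\<^sub>a f) \<cdot> ibr A X"
proof -
  have o: "A \<in> Ob V" "B \<in> Ob V" "X \<in> Ob V" "Y \<in> Ob V" using f g hom_Ob by blast+
  note h = ibr(1)[OF o(2,4)] ibr(1)[OF o(1,3)] braid_hom[OF o(4,2)] braid_hom[OF o(3,1)] tensor_hom[OF f g] tensor_hom[OF g f]
  have "ibr B Y \<cdot> (f \<otimes>\<^sub>a g) = ibr B Y \<cdot> ((f \<otimes>\<^sub>a g) \<cdot> (\<sigma> X A \<cdot> ibr A X))"
    using cmp_ident[OF h(5)] ibr(3)[OF o(1,3)] by simp
  also have "(f \<otimes>\<^sub>a g) \<cdot> (\<sigma> X A \<cdot> ibr A X) = ((f \<otimes>\<^sub>a g) \<cdot> \<sigma> X A) \<cdot> ibr A X"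
    by (rule cmp_assoc[symmetric, OF h(2,4,5)])
  also have "(f \<otimes>\<^sub>a g) \<cdot> \<sigma> X A = \<sigma> Y B \<cdot> (g \<otimes>\<^sub>a f)"
    by (rule braid_natural[OF g f, symmetric])
  also have "(\<sigma> Y B \<cdot> (g \<otimes>\<^sub>a f)) \<cdot> ibr A X = \<sigma> Y B \<cdot> ((g \<otimes>\<^sub>a f) \<cdot> ibr A X)"
    by (rule cmp_assoc[OF h(2,6,3)])
  also have "ibr B Y \<cdot> \<dots> = (ibr B Y \<cdot> \<sigma> Y B) \<cdot> ((g \<otimes>\<^sub>a f) \<cdot> ibr A X)"
    by (rule cmp_assoc[symmetric, OF cmp_hom[OF h(2,6)] h(3,1)])
  finally show ?thesis
    using ibr(2)[OF o(2,4)] cmp_ident[OF cmp_hom[OF h(2,6)]] by simp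
qed

lemma ibr_nat_r:
  assumes f: "typed f [s] [t]" and h: "has n [s, y] st"
  shows "app n [t, y] (ibr t y) [y, t] (app n [s] f [t] st) = app (Suc n) [s] f [t] (app n [s, y] (ibr s y) [y, s] st)"
proof -
  have o [simp]: "s \<in> Ob V" "t \<in> Ob V" "y \<in> Ob V"
    using f h by (auto simp: typed_def elim: hasE)
  note [den_intro] = f[THEN den_gen]
  have "ibr t y \<cdot> (f \<otimes>\<^sub>a \<langle>y\<rangle>) = (\<langle>y\<rangle> \<otimes>\<^sub>a f) \<cdot> ibr s y"
    using ibr_natural[of f s t "\<langle>y\<rangle>" y y] f by (simp add: typed_def ident_hom)
  from this h show ?thesis
    by - (rule den_rule, assumption, (rule den_intro | (simp; fail))+)
qed

lemma ibr_nat_l: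
  assumes f: "typed f [s] [t]" and h: "has n [y, s] st"
  shows "app n [y, t] (ibr y t) [t, y] (app (Suc n) [s] f [t] st) = app n [s] f [t] (app n [y, s] (ibr y s) [s, y] st)"
proof -
  have o [simp]: "s \<in> Ob V" "t \<in> Ob V" "y \<in> Ob V"
    using f h by (auto simp: typed_def elim: hasE)
  note [den_intro] = f[THEN den_gen]
  have "ibr y t \<cdot> (\<langle>y\<rangle> \<otimes>\<^sub>a f) = (f \<otimes>\<^sub>a \<langle>y\<rangle>) \<cdot> ibr y s"
    using ibr_natural[of "\<langle>y\<rangle>" y y f s t] f by (simp add: typed_def ident_hom)
  from this h show ?thesis
    by - (rule den_rule, assumption, (rule den_intro | (simp; fail))+)
qed

lemmas ibr_rules = ibr_r ibr_nat_r ibr_nat_l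

end

section \<open>Linear pairings and the actions on duals\<close>

context hopf_algebra
begin

definition antinv :: 'm where "antinv = arr_inv V (ant H)"

lemma antinv: "antinv \<in> Hom V h h" "antinv \<cdot> ant H = \<langle>h\<rangle>" "ant H \<cdot> antinv = \<langle>h\<rangle>"
  using arr_inv_eqs[OF ant_iso ant_hom] by (simp_all add: antinv_def)

lemma typed_antinv [tyi]: "typed antinv [h] [h]"
  using antinv(1) by (simp add: typed_def)

lemmas [den_intro] = typed_antinv[THEN den_gen]

lemma antinv_r:
  "has n [h] st \<Longrightarrow> app n [h] antinv [h] (app n [h] (ant H) [h] st) = st"
  "has n [h] st \<Longrightarrow> app n [h] (ant H) [h] (app n [h] antinv [h] st) = st"
  apply -
  apply ((rule den_rule[OF antinv(2)], (rule den_intro | (simp; fail))+)[1])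
  apply ((rule den_rule[OF antinv(3)], (rule den_intro | (simp; fail))+)[1])
  done

abbreviation act :: "'o \<Rightarrow> 'm \<Rightarrow> 'o \<Rightarrow> 'm \<Rightarrow> 'm" where
  "act M r N s \<equiv> (r \<otimes>\<^sub>a s) \<cdot> (\<langle>M\<rangle> \<otimes>\<^sub>a \<sigma> N h \<otimes>\<^sub>a \<langle>h\<rangle>) \<cdot> (\<langle>M \<otimes>\<^sub>o N\<rangle> \<otimes>\<^sub>a com H)"

lemma H_linear_to_unit_iff:
  assumes "M \<in> Ob V" "N \<in> Ob V"
  shows "H_linear V H (mod_tensor V H (M, r) (N, s)) e (mod_unit V H)
     \<longleftrightarrow> typed e [M, N] [] \<and> e \<cdot> act M r N s = e \<otimes>\<^sub>a cou H"
proof (cases "e \<in> Hom V (M \<otimes>\<^sub>o N) \<^bold>1")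
  case True
  have "cou H \<cdot> (e \<otimes>\<^sub>a \<langle>h\<rangle>) = e \<otimes>\<^sub>a cou H"
    using interchange_l(1)[OF True cou_hom] by (simp add: tensor_ar_unit hom_Ar[OF cou_hom])
  then show ?thesis
    using assms True by (simp add: H_linear_def mod_tensor_def mod_unit_def typed_def tob_Cons tensor_ob_unit)
next
  case False
  then show ?thesis
    using assms by (simp add: H_linear_def mod_tensor_def mod_unit_def typed_def tob_Cons tensor_ob_unit)
qed

lemma H_linear_from_unit_iff:
  assumes "M \<in> Ob V" "N \<in> Ob V"
  shows "H_linear V H (mod_unit V H) e (mod_tensor V H (M, r) (N, s))
     \<longleftrightarrow> typed e [] [M, N] \<and> e \<cdot> cou H = act M r N s \<cdot> (e \<otimes>\<^sub>a \<langle>h\<rangle>)"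
  using assms by (auto simp: H_linear_def mod_tensor_def mod_unit_def typed_def tob_Cons tensor_ob_unit unit_closed)

context
  fixes M r N s e
  assumes m: "right_module V H (M, r)" and N [simp]: "N \<in> Ob V"
    and s: "typed s [N, h] [N]" and e: "typed e [M, N] []"
begin

lemma pairing_M [simp]: "M \<in> Ob V" by (rule right_moduleD(1)[OF m])

lemmas pairing_den = right_moduleD(2)[OF m, THEN den_gen] s[THEN den_gen] e[THEN den_gen]

text \<open>With elements, \<open>e(m, n h) = e(m S(h), n)\<close>: expand to
  \<open>e(m S(h_1) h_2, n h_3)\<close>, which collapses to the left side by the antipode axiom and
  to the right side by linearity.\<close>

lemma pairing_formula:
  assumes lin: "e \<cdot> act M r N s = e \<otimes>\<^sub>a cou H"
  shows "e \<cdot> (\<langle>M\<rangle> \<otimes>\<^sub>a s) = e \<cdot> (r \<otimes>\<^sub>a \<langle>N\<rangle>) \<cdot> (\<langle>M\<rangle> \<otimes>\<^sub>a \<sigma> N h) \<cdot> (\<langle>M\<rangle> \<otimes>\<^sub>a \<langle>N\<rangle> \<otimes>\<^sub>a ant H)"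
proof -
  note [den_intro] = pairing_den
  have "e \<cdot> (\<langle>M\<rangle> \<otimes>\<^sub>a s) = (e \<cdot> act M r N s) \<cdot> ((r \<otimes>\<^sub>a \<langle>N \<otimes>\<^sub>o h\<rangle>) \<cdot> (\<langle>M\<rangle> \<otimes>\<^sub>a \<sigma> N h \<otimes>\<^sub>a \<langle>h\<rangle>)
     \<cdot> (\<langle>M \<otimes>\<^sub>o N\<rangle> \<otimes>\<^sub>a ant H \<otimes>\<^sub>a \<langle>h\<rangle>) \<cdot> (\<langle>M \<otimes>\<^sub>o N\<rangle> \<otimes>\<^sub>a com H))"
    by (rule den_eqI, (rule den_intro | (simp; fail))+, simp add: diag tyi s e right_moduleD[OF m] com_coassoc_r[symmetric] antipode_r com_cou_r)
  also have "\<dots> = e \<cdot> (r \<otimes>\<^sub>a \<langle>N\<rangle>) \<cdot> (\<langle>M\<rangle> \<otimes>\<^sub>a \<sigma> N h) \<cdot> (\<langle>M\<rangle> \<otimes>\<^sub>a \<langle>N\<rangle> \<otimes>\<^sub>a ant H)"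
    unfolding lin by (rule den_eqI, (rule den_intro | (simp; fail))+, simp add: diag tyi s e right_moduleD[OF m] com_cou_r)
  finally show ?thesis .
qed

context
  assumes formula: "e \<cdot> (\<langle>M\<rangle> \<otimes>\<^sub>a s) = e \<cdot> (r \<otimes>\<^sub>a \<langle>N\<rangle>) \<cdot> (\<langle>M\<rangle> \<otimes>\<^sub>a \<sigma> N h) \<cdot> (\<langle>M\<rangle> \<otimes>\<^sub>a \<langle>N\<rangle> \<otimes>\<^sub>a ant H)"
begin

text \<open>The converse: \<open>e(m h_1, n h_2) = e(m h_1 S(h_2), n)\<close> reduces to the counit.
  Hence the formula can serve as the definition of an action that makes \<open>e\<close>
  linear.\<close>

lemma pairing_linear: "e \<cdot> act M r N s = e \<otimes>\<^sub>a cou H"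
proof -
  note [den_intro] = pairing_den
  have "e \<cdot> act M r N s = (e \<cdot> (\<langle>M\<rangle> \<otimes>\<^sub>a s)) \<cdot> (r \<otimes>\<^sub>a \<langle>N\<rangle> \<otimes>\<^sub>a \<langle>h\<rangle>) \<cdot> (\<langle>M\<rangle> \<otimes>\<^sub>a \<sigma> N h \<otimes>\<^sub>a \<langle>h\<rangle>) \<cdot> (\<langle>M \<otimes>\<^sub>o N\<rangle> \<otimes>\<^sub>a com H)"
    by (rule den_eqI, (rule den_intro | (simp; fail))+, simp add: diag tyi s e right_moduleD(1,2)[OF m])
  also have "\<dots> = e \<otimes>\<^sub>a cou H"
    unfolding formula
    by (rule den_eqI, (rule den_intro | (simp; fail))+, simp add: diag tyi s e right_moduleD[OF m] antipode_r,
        simp add: diag' tyi s e right_moduleD(1,2)[OF m], simp add: diag tyi s e right_moduleD[OF m] antipode_r mul_uni_r)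
  finally show ?thesis .
qed

text \<open>Both sides are the pairing of \<open>m S(y) S(x)\<close> with \<open>n\<close>; this is
  where the antipode has to reverse products.\<close>

lemma pairing_action_mul: "e \<cdot> (\<langle>M\<rangle> \<otimes>\<^sub>a (s \<cdot> (s \<otimes>\<^sub>a \<langle>h\<rangle>))) = e \<cdot> (\<langle>M\<rangle> \<otimes>\<^sub>a (s \<cdot> (\<langle>N\<rangle> \<otimes>\<^sub>a mul H)))"
proof -
  note [den_intro] = pairing_den
  have "e \<cdot> (\<langle>M\<rangle> \<otimes>\<^sub>a (s \<cdot> (s \<otimes>\<^sub>a \<langle>h\<rangle>))) = (e \<cdot> (\<langle>M\<rangle> \<otimes>\<^sub>a s)) \<cdot> (\<langle>M\<rangle> \<otimes>\<^sub>a s \<otimes>\<^sub>a \<langle>h\<rangle>)"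
    by (rule den_eqI, (rule den_intro | (simp; fail))+)
  also have "\<dots> = (e \<cdot> (r \<otimes>\<^sub>a \<langle>N\<rangle>) \<cdot> (\<langle>M\<rangle> \<otimes>\<^sub>a \<sigma> N h) \<cdot> (\<langle>M\<rangle> \<otimes>\<^sub>a \<langle>N\<rangle> \<otimes>\<^sub>a ant H)) \<cdot> (\<langle>M\<rangle> \<otimes>\<^sub>a s \<otimes>\<^sub>a \<langle>h\<rangle>)"
    by (simp only: formula)
  also have "\<dots> = (e \<cdot> (\<langle>M\<rangle> \<otimes>\<^sub>a s)) \<cdot> ((r \<otimes>\<^sub>a \<langle>N\<rangle> \<otimes>\<^sub>a \<langle>h\<rangle>) \<cdot> (\<langle>M\<rangle> \<otimes>\<^sub>a \<sigma> (N \<otimes>\<^sub>o h) h) \<cdot> (\<langle>M\<rangle> \<otimes>\<^sub>a \<langle>N\<rangle> \<otimes>\<^sub>a \<langle>h\<rangle> \<otimes>\<^sub>a ant H))"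
    by (rule den_eqI, (rule den_intro | (simp; fail))+, simp add: diag tyi s e right_moduleD(1,2)[OF m])
  also have "\<dots> = (e \<cdot> (\<langle>M\<rangle> \<otimes>\<^sub>a s)) \<cdot> (\<langle>M\<rangle> \<otimes>\<^sub>a \<langle>N\<rangle> \<otimes>\<^sub>a mul H)"
    unfolding formula by (rule den_eqI, (rule den_intro | (simp; fail))+, simp add: diag tyi s e right_moduleD[OF m] antipode_mul_r)
  also have "\<dots> = e \<cdot> (\<langle>M\<rangle> \<otimes>\<^sub>a (s \<cdot> (\<langle>N\<rangle> \<otimes>\<^sub>a mul H)))"
    by (rule den_eqI, (rule den_intro | (simp; fail))+)
  finally show ?thesis .
qed

lemma pairing_action_uni: "e \<cdot> (\<langle>M\<rangle> \<otimes>\<^sub>a (s \<cdot> (\<langle>N\<rangle> \<otimes>\<^sub>a uni H))) = e \<cdot> (\<langle>M\<rangle> \<otimes>\<^sub>a \<langle>N\<rangle>)"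
proof -
  note [den_intro] = pairing_den
  have "e \<cdot> (\<langle>M\<rangle> \<otimes>\<^sub>a (s \<cdot> (\<langle>N\<rangle> \<otimes>\<^sub>a uni H))) = (e \<cdot> (\<langle>M\<rangle> \<otimes>\<^sub>a s)) \<cdot> (\<langle>M\<rangle> \<otimes>\<^sub>a \<langle>N\<rangle> \<otimes>\<^sub>a uni H)"
    by (rule den_eqI, (rule den_intro | (simp; fail))+)
  also have "\<dots> = e \<cdot> (\<langle>M\<rangle> \<otimes>\<^sub>a \<langle>N\<rangle>)"
    unfolding formula by (rule den_eqI, (rule den_intro | (simp; fail))+, simp add: diag tyi s e right_moduleD[OF m] antipode_uni_r)
  finally show ?thesis .
qed

end

end

text \<open>Linearity of the evaluation forces \<open>e(m, n h) = e(m S(h), n)\<close>. The action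
  is therefore defined by bending this formula, and the module axioms and the linearity of
  \<open>coevr\<close> are verified after pairing with \<open>M\<close>.\<close>

lemma rdual_action_ex1:
  assumes m: "right_module V H (M, r)"
  shows "\<exists>!s. right_module V H (rdual V M, s)
       \<and> H_linear V H (mod_tensor V H (M, r) (rdual V M, s)) (evr V M) (mod_unit V H)
       \<and> H_linear V H (mod_unit V H) (coevr V M) (mod_tensor V H (rdual V M, s) (M, r))"
proof -
  let ?D = "rdual V M"
  have M [simp]: "M \<in> Ob V" by (rule right_moduleD(1)[OF m])
  have D: "?D \<in> Ob V" by simp
  have te: "typed (evr V M) [M, ?D] []" "typed (coevr V M) [] [?D, M]"
    using typed_dual[of M] by simp_all
  note sn = snake_r_r[of M, OF M]
  note [den_intro] = right_moduleD(2)[OF m, THEN den_gen]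
  let ?f = "evr V M \<cdot> (r \<otimes>\<^sub>a \<langle>?D\<rangle>) \<cdot> (\<langle>M\<rangle> \<otimes>\<^sub>a \<sigma> ?D h) \<cdot> (\<langle>M\<rangle> \<otimes>\<^sub>a \<langle>?D\<rangle> \<otimes>\<^sub>a ant H)"
  define s where "s = (\<langle>?D\<rangle> \<otimes>\<^sub>a ?f) \<cdot> (coevr V M \<otimes>\<^sub>a \<langle>?D \<otimes>\<^sub>o h\<rangle>)"
  have ts: "typed s [?D, h] [?D]"
    unfolding s_def by (rule den_typed, rule den_conv, (rule den_intro | (simp; fail))+)
  have f: "evr V M \<cdot> (\<langle>M\<rangle> \<otimes>\<^sub>a s) = ?f"
    unfolding s_def by (rule den_eqI, (rule den_intro | (simp; fail))+, simp add: diag' tyi te right_moduleD[OF m] sn)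
  note [den_intro] = ts[THEN den_gen]
  note c = evr_cancel_hom[of M _ "?D \<otimes>\<^sub>o h", OF M]
  have mod: "right_module V H (?D, s)"
    unfolding right_module_iff
  proof (intro conjI D ts)
    have "typed (s \<cdot> (s \<otimes>\<^sub>a \<langle>h\<rangle>)) [?D,h,h] [?D]" "typed (s \<cdot> (\<langle>?D\<rangle> \<otimes>\<^sub>a mul H)) [?D,h,h] [?D]"
      "typed (s \<cdot> (\<langle>?D\<rangle> \<otimes>\<^sub>a uni H)) [?D] [?D]"
      by (rule den_typed, rule den_conv, (rule den_intro | (simp; fail))+)+
    then show "s \<cdot> (s \<otimes>\<^sub>a \<langle>h\<rangle>) = s \<cdot> (\<langle>?D\<rangle> \<otimes>\<^sub>a mul H)" "s \<cdot> (\<langle>?D\<rangle> \<otimes>\<^sub>a uni H) = \<langle>?D\<rangle>"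
      using evr_cancel_hom[of M _ "tob [?D,h,h]", OF M _ _ pairing_action_mul[OF m D ts te(1) f]]
        evr_cancel_hom[of M _ ?D, OF M _ _ pairing_action_uni[OF m D ts te(1) f]]
      by (simp_all add: typed_def ident_hom)
  qed
  have "coevr V M \<cdot> cou H = act ?D s M r \<cdot> (coevr V M \<otimes>\<^sub>a \<langle>h\<rangle>)"
  proof (rule evr_cancel[where X = M and Z = h and W = M])
    show "typed (coevr V M \<cdot> cou H) [h] [?D, M]" "typed (act ?D s M r \<cdot> (coevr V M \<otimes>\<^sub>a \<langle>h\<rangle>)) [h] [?D, M]"
      by (rule den_typed, rule den_conv, (rule den_intro | (simp; fail))+)+
    have "(evr V M \<otimes>\<^sub>a \<langle>M\<rangle>) \<cdot> (\<langle>M\<rangle> \<otimes>\<^sub>a (act ?D s M r \<cdot> (coevr V M \<otimes>\<^sub>a \<langle>h\<rangle>)))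
       = ((evr V M \<cdot> (\<langle>M\<rangle> \<otimes>\<^sub>a s)) \<otimes>\<^sub>a \<langle>M\<rangle>) \<cdot> (\<langle>M\<rangle> \<otimes>\<^sub>a \<langle>?D\<rangle> \<otimes>\<^sub>a \<langle>h\<rangle> \<otimes>\<^sub>a r) \<cdot> (\<langle>M\<rangle> \<otimes>\<^sub>a \<langle>?D\<rangle> \<otimes>\<^sub>a \<sigma> M h \<otimes>\<^sub>a \<langle>h\<rangle>)
         \<cdot> (\<langle>M\<rangle> \<otimes>\<^sub>a coevr V M \<otimes>\<^sub>a com H)"
      by (rule den_eqI, (rule den_intro | (simp; fail))+, simp add: diag tyi te ts right_moduleD(1,2)[OF m])
    also have "\<dots> = \<langle>M\<rangle> \<otimes>\<^sub>a cou H"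
      unfolding f by (rule den_eqI, (rule den_intro | (simp; fail))+, (simp add: diag tyi te ts right_moduleD[OF m] sn antipode_r)?, simp add: diag' tyi te ts right_moduleD[OF m] sn antipode_r)
    also have "\<dots> = (evr V M \<otimes>\<^sub>a \<langle>M\<rangle>) \<cdot> (\<langle>M\<rangle> \<otimes>\<^sub>a (coevr V M \<cdot> cou H))"
      by (rule den_eqI, (rule den_intro | (simp; fail))+, simp add: diag tyi te right_moduleD(1,2)[OF m] sn)
    finally show "(evr V M \<otimes>\<^sub>a \<langle>M\<rangle>) \<cdot> (\<langle>M\<rangle> \<otimes>\<^sub>a (coevr V M \<cdot> cou H))
      = (evr V M \<otimes>\<^sub>a \<langle>M\<rangle>) \<cdot> (\<langle>M\<rangle> \<otimes>\<^sub>a (act ?D s M r \<cdot> (coevr V M \<otimes>\<^sub>a \<langle>h\<rangle>)))" by simp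
  qed simp_all
  then have ex: "right_module V H (?D, s)
       \<and> H_linear V H (mod_tensor V H (M, r) (?D, s)) (evr V M) (mod_unit V H)
       \<and> H_linear V H (mod_unit V H) (coevr V M) (mod_tensor V H (?D, s) (M, r))"
    using mod pairing_linear[OF m D ts te(1) f] te by (simp add: H_linear_to_unit_iff H_linear_from_unit_iff)
  have "s' = s" if "right_module V H (?D, s')" "H_linear V H (mod_tensor V H (M, r) (?D, s')) (evr V M) (mod_unit V H)" for s'
  proof -
    have ts': "typed s' [?D, h] [?D]" using right_moduleD(2)[OF that(1)] .
    have "evr V M \<cdot> (\<langle>M\<rangle> \<otimes>\<^sub>a s') = evr V M \<cdot> (\<langle>M\<rangle> \<otimes>\<^sub>a s)"
      unfolding f using pairing_formula[OF m D ts' te(1)] that(2) by (simp add: H_linear_to_unit_iff)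
    then show ?thesis
      using evr_cancel_hom[of M s' "tob [?D,h]" s] ts ts' by (simp add: typed_def)
  qed
  then show ?thesis
    using ex by blast
qed

text \<open>On this side the forced formula \<open>e(n, m h) = e(n S(h), m)\<close> contains the
  unknown action behind an antipode and a crossing. Solving for it takes the inverses
  \<open>antinv\<close> and \<open>ibr\<close>, and comparing two solutions requires cancelling the
  invertible \<open>?i\<close>.\<close>

lemma ldual_action_ex1:
  assumes m: "right_module V H (M, r)"
  shows "\<exists>!s. right_module V H (ldual V M, s)
       \<and> H_linear V H (mod_tensor V H (ldual V M, s) (M, r)) (evl V M) (mod_unit V H)
       \<and> H_linear V H (mod_unit V H) (coevl V M) (mod_tensor V H (M, r) (ldual V M, s))"
proof -
  let ?L = "ldual V M"
  have M [simp]: "M \<in> Ob V" by (rule right_moduleD(1)[OF m])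
  have L: "?L \<in> Ob V" by simp
  note te = typed_dual(1,2)[OF M]
  note sn = snake_l_r[of M, OF M]
  note [den_intro] = right_moduleD(2)[OF m, THEN den_gen]
  let ?i = "(\<langle>?L\<rangle> \<otimes>\<^sub>a \<sigma> M h) \<cdot> (\<langle>?L\<rangle> \<otimes>\<^sub>a \<langle>M\<rangle> \<otimes>\<^sub>a ant H)"
  define s where "s = ((evl V M \<cdot> (\<langle>?L\<rangle> \<otimes>\<^sub>a r) \<cdot> (\<langle>?L\<rangle> \<otimes>\<^sub>a \<langle>M\<rangle> \<otimes>\<^sub>a antinv) \<cdot> (\<langle>?L\<rangle> \<otimes>\<^sub>a ibr h M)) \<otimes>\<^sub>a \<langle>?L\<rangle>)
     \<cdot> (\<langle>?L \<otimes>\<^sub>o h\<rangle> \<otimes>\<^sub>a coevl V M)"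
  have ts: "typed s [?L, h] [?L]"
    unfolding s_def by (rule den_typed, rule den_conv, (rule den_intro | (simp; fail))+)
  have f: "evl V M \<cdot> (\<langle>?L\<rangle> \<otimes>\<^sub>a r) = evl V M \<cdot> (s \<otimes>\<^sub>a \<langle>M\<rangle>) \<cdot> ?i"
    unfolding s_def by (rule den_eqI, (rule den_intro | (simp; fail))+, simp add: diag tyi te right_moduleD[OF m] sn ibr_rules antinv_r)
  note [den_intro] = ts[THEN den_gen]
  have cancel: "g = g'" if g: "typed g [?L,h] [?L]" "typed g' [?L,h] [?L]"
    and eq: "evl V M \<cdot> (g \<otimes>\<^sub>a \<langle>M\<rangle>) \<cdot> ?i = evl V M \<cdot> (g' \<otimes>\<^sub>a \<langle>M\<rangle>) \<cdot> ?i" for g g'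
  proof -
    note [den_intro] = g[THEN den_gen]
    let ?j = "(\<langle>?L\<rangle> \<otimes>\<^sub>a \<langle>M\<rangle> \<otimes>\<^sub>a antinv) \<cdot> (\<langle>?L\<rangle> \<otimes>\<^sub>a ibr h M)"
    have "evl V M \<cdot> (x \<otimes>\<^sub>a \<langle>M\<rangle>) = (evl V M \<cdot> (x \<otimes>\<^sub>a \<langle>M\<rangle>) \<cdot> ?i) \<cdot> ?j" if "typed x [?L,h] [?L]" for x
      using that by - (rule den_eqI, (rule den_intro that[THEN den_gen] | (simp; fail))+, simp add: diag tyi antinv_r ibr_rules)
    then have "evl V M \<cdot> (g \<otimes>\<^sub>a \<langle>M\<rangle>) = evl V M \<cdot> (g' \<otimes>\<^sub>a \<langle>M\<rangle>)"
      using g eq by metis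
    then show ?thesis
      using evl_cancel_left_hom[of M g "tob [?L,h]" g'] g by (simp add: typed_def)
  qed
  have mod: "right_module V H (?L, s)"
    unfolding right_module_iff
  proof (intro conjI L ts)
    \<comment> \<open>The analogue of \<open>?i\<close> for two copies of \<open>h\<close>; the
      additional \<open>\<sigma> h h\<close> accounts for the antipode reversing products, and
      \<open>?j2\<close> is a right inverse.\<close>
    let ?i2 = "(\<langle>?L\<rangle> \<otimes>\<^sub>a \<sigma> M (h \<otimes>\<^sub>o h)) \<cdot> (\<langle>?L \<otimes>\<^sub>o M\<rangle> \<otimes>\<^sub>a ant H \<otimes>\<^sub>a ant H) \<cdot> (\<langle>?L \<otimes>\<^sub>o M\<rangle> \<otimes>\<^sub>a \<sigma> h h)"
    let ?j2 = "(\<langle>?L \<otimes>\<^sub>o M\<rangle> \<otimes>\<^sub>a ibr h h) \<cdot> (\<langle>?L \<otimes>\<^sub>o M\<rangle> \<otimes>\<^sub>a antinv \<otimes>\<^sub>a antinv) \<cdot> (\<langle>?L\<rangle> \<otimes>\<^sub>a ibr h M \<otimes>\<^sub>a \<langle>h\<rangle>)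
       \<cdot> (\<langle>?L\<rangle> \<otimes>\<^sub>a \<langle>h\<rangle> \<otimes>\<^sub>a ibr h M)"
    have ij: "?i2 \<cdot> ?j2 = \<langle>?L \<otimes>\<^sub>o h \<otimes>\<^sub>o h \<otimes>\<^sub>o M\<rangle>"
      by (rule den_eqI, (rule den_intro | (simp; fail))+, simp add: diag tyi antinv_r ibr_rules)
    have "(evl V M \<cdot> ((s \<cdot> (s \<otimes>\<^sub>a \<langle>h\<rangle>)) \<otimes>\<^sub>a \<langle>M\<rangle>)) \<cdot> ?i2
       = (evl V M \<cdot> (s \<otimes>\<^sub>a \<langle>M\<rangle>) \<cdot> ?i) \<cdot> ((s \<otimes>\<^sub>a \<langle>M\<rangle> \<otimes>\<^sub>a \<langle>h\<rangle>) \<cdot> (\<langle>?L\<rangle> \<otimes>\<^sub>a \<sigma> M h \<otimes>\<^sub>a \<langle>h\<rangle>)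
          \<cdot> (\<langle>?L \<otimes>\<^sub>o M\<rangle> \<otimes>\<^sub>a ant H \<otimes>\<^sub>a \<langle>h\<rangle>) \<cdot> (\<langle>?L \<otimes>\<^sub>o M\<rangle> \<otimes>\<^sub>a \<sigma> h h))"
      by (rule den_eqI, (rule den_intro | (simp; fail))+, simp add: diag tyi te ts)
    also have "\<dots> = (evl V M \<cdot> (s \<otimes>\<^sub>a \<langle>M\<rangle>) \<cdot> ?i) \<cdot> (\<langle>?L\<rangle> \<otimes>\<^sub>a r \<otimes>\<^sub>a \<langle>h\<rangle>)"
    proof -
      have "(evl V M \<cdot> (s \<otimes>\<^sub>a \<langle>M\<rangle>) \<cdot> ?i) \<cdot> ((s \<otimes>\<^sub>a \<langle>M\<rangle> \<otimes>\<^sub>a \<langle>h\<rangle>) \<cdot> (\<langle>?L\<rangle> \<otimes>\<^sub>a \<sigma> M h \<otimes>\<^sub>a \<langle>h\<rangle>)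
          \<cdot> (\<langle>?L \<otimes>\<^sub>o M\<rangle> \<otimes>\<^sub>a ant H \<otimes>\<^sub>a \<langle>h\<rangle>) \<cdot> (\<langle>?L \<otimes>\<^sub>o M\<rangle> \<otimes>\<^sub>a \<sigma> h h))
        = (evl V M \<cdot> (\<langle>?L\<rangle> \<otimes>\<^sub>a r)) \<cdot> ((s \<otimes>\<^sub>a \<langle>M\<rangle> \<otimes>\<^sub>a \<langle>h\<rangle>) \<cdot> (\<langle>?L\<rangle> \<otimes>\<^sub>a \<sigma> M h \<otimes>\<^sub>a \<langle>h\<rangle>)
          \<cdot> (\<langle>?L \<otimes>\<^sub>o M\<rangle> \<otimes>\<^sub>a ant H \<otimes>\<^sub>a \<langle>h\<rangle>) \<cdot> (\<langle>?L \<otimes>\<^sub>o M\<rangle> \<otimes>\<^sub>a \<sigma> h h))"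
        by (simp only: f)
      also have "\<dots> = (evl V M \<cdot> (s \<otimes>\<^sub>a \<langle>M\<rangle>) \<cdot> ?i) \<cdot> (\<langle>?L\<rangle> \<otimes>\<^sub>a r \<otimes>\<^sub>a \<langle>h\<rangle>)"
        by (rule den_eqI, (rule den_intro | (simp; fail))+, simp add: diag tyi te ts right_moduleD(1,2)[OF m])
      finally show ?thesis .
    qed
    also have "\<dots> = (evl V M \<cdot> (\<langle>?L\<rangle> \<otimes>\<^sub>a r)) \<cdot> (\<langle>?L\<rangle> \<otimes>\<^sub>a \<langle>M\<rangle> \<otimes>\<^sub>a mul H)"
      unfolding f[symmetric] by (rule den_eqI, (rule den_intro | (simp; fail))+, simp add: diag tyi te right_moduleD[OF m])
    also have "\<dots> = (evl V M \<cdot> ((s \<cdot> (\<langle>?L\<rangle> \<otimes>\<^sub>a mul H)) \<otimes>\<^sub>a \<langle>M\<rangle>)) \<cdot> ?i2"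
      unfolding f by (rule den_eqI, (rule den_intro | (simp; fail))+, simp add: diag tyi te ts antipode_mul_r)
    finally have eq: "(evl V M \<cdot> ((s \<cdot> (s \<otimes>\<^sub>a \<langle>h\<rangle>)) \<otimes>\<^sub>a \<langle>M\<rangle>)) \<cdot> ?i2 = (evl V M \<cdot> ((s \<cdot> (\<langle>?L\<rangle> \<otimes>\<^sub>a mul H)) \<otimes>\<^sub>a \<langle>M\<rangle>)) \<cdot> ?i2" .
    have t: "typed (s \<cdot> (s \<otimes>\<^sub>a \<langle>h\<rangle>)) [?L,h,h] [?L]" "typed (s \<cdot> (\<langle>?L\<rangle> \<otimes>\<^sub>a mul H)) [?L,h,h] [?L]"
      "typed (s \<cdot> (\<langle>?L\<rangle> \<otimes>\<^sub>a uni H)) [?L] [?L]"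
      "typed (evl V M \<cdot> ((s \<cdot> (s \<otimes>\<^sub>a \<langle>h\<rangle>)) \<otimes>\<^sub>a \<langle>M\<rangle>)) [?L,h,h,M] []"
      "typed (evl V M \<cdot> ((s \<cdot> (\<langle>?L\<rangle> \<otimes>\<^sub>a mul H)) \<otimes>\<^sub>a \<langle>M\<rangle>)) [?L,h,h,M] []"
      "typed ?i2 [?L,M,h,h] [?L,h,h,M]" "typed ?j2 [?L,h,h,M] [?L,M,h,h]"
      by (rule den_typed, rule den_conv, (rule den_intro | (simp; fail))+)+
    have "evl V M \<cdot> ((s \<cdot> (s \<otimes>\<^sub>a \<langle>h\<rangle>)) \<otimes>\<^sub>a \<langle>M\<rangle>) = evl V M \<cdot> ((s \<cdot> (\<langle>?L\<rangle> \<otimes>\<^sub>a mul H)) \<otimes>\<^sub>a \<langle>M\<rangle>)"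
      using cancel_epi[OF eq ij, of "\<^bold>1" "tob [?L,M,h,h]"] t by (simp add: typed_def tob_Cons tensor_ob_unit)
    then show "s \<cdot> (s \<otimes>\<^sub>a \<langle>h\<rangle>) = s \<cdot> (\<langle>?L\<rangle> \<otimes>\<^sub>a mul H)"
      using evl_cancel_left_hom[of M _ "tob [?L,h,h]"] t by (simp add: typed_def)
    have "evl V M \<cdot> ((s \<cdot> (\<langle>?L\<rangle> \<otimes>\<^sub>a uni H)) \<otimes>\<^sub>a \<langle>M\<rangle>) = (evl V M \<cdot> (\<langle>?L\<rangle> \<otimes>\<^sub>a r)) \<cdot> (\<langle>?L\<rangle> \<otimes>\<^sub>a \<langle>M\<rangle> \<otimes>\<^sub>a uni H)"
      unfolding f by (rule den_eqI, (rule den_intro | (simp; fail))+, simp add: diag tyi te ts antipode_uni_r)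
    also have "\<dots> = evl V M \<cdot> (\<langle>?L\<rangle> \<otimes>\<^sub>a \<langle>M\<rangle>)"
      by (rule den_eqI, (rule den_intro | (simp; fail))+, simp add: diag tyi te right_moduleD[OF m])
    finally show "s \<cdot> (\<langle>?L\<rangle> \<otimes>\<^sub>a uni H) = \<langle>?L\<rangle>"
      using evl_cancel_left_hom[of M _ ?L] t by (simp add: typed_def ident_hom)
  qed
  note ml = right_moduleD[OF mod]
  have lin: "evl V M \<cdot> act ?L s M r = evl V M \<otimes>\<^sub>a cou H"
  proof -
    have "evl V M \<cdot> act ?L s M r = (evl V M \<cdot> (\<langle>?L\<rangle> \<otimes>\<^sub>a r)) \<cdot> (s \<otimes>\<^sub>a \<langle>M\<rangle> \<otimes>\<^sub>a \<langle>h\<rangle>) \<cdot> (\<langle>?L\<rangle> \<otimes>\<^sub>a \<sigma> M h \<otimes>\<^sub>a \<langle>h\<rangle>)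
      \<cdot> (\<langle>?L \<otimes>\<^sub>o M\<rangle> \<otimes>\<^sub>a com H)"
      by (rule den_eqI, (rule den_intro | (simp; fail))+, simp add: diag tyi te ts right_moduleD(2)[OF m])
    also have "\<dots> = evl V M \<otimes>\<^sub>a cou H"
      unfolding f by (rule den_eqI, (rule den_intro | (simp; fail))+, (simp add: diag tyi te ts ml right_moduleD[OF m] antipode_r)?, simp add: diag' tyi te ts ml right_moduleD[OF m] antipode_r)
    finally show ?thesis .
  qed
  have "coevl V M \<cdot> cou H = act M r ?L s \<cdot> (coevl V M \<otimes>\<^sub>a \<langle>h\<rangle>)"
  proof (rule evl_cancel[where X = M and Z = h and W = ?L])
    show "typed (coevl V M \<cdot> cou H) [h] [M, ?L]" "typed (act M r ?L s \<cdot> (coevl V M \<otimes>\<^sub>a \<langle>h\<rangle>)) [h] [M, ?L]"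
      by (rule den_typed, rule den_conv, (rule den_intro | (simp; fail))+)+
    have "(evl V M \<otimes>\<^sub>a \<langle>?L\<rangle>) \<cdot> (\<langle>?L\<rangle> \<otimes>\<^sub>a (act M r ?L s \<cdot> (coevl V M \<otimes>\<^sub>a \<langle>h\<rangle>)))
       = ((evl V M \<cdot> (\<langle>?L\<rangle> \<otimes>\<^sub>a r)) \<otimes>\<^sub>a \<langle>?L\<rangle>) \<cdot> (\<langle>?L\<rangle> \<otimes>\<^sub>a \<langle>M\<rangle> \<otimes>\<^sub>a \<langle>h\<rangle> \<otimes>\<^sub>a s) \<cdot> (\<langle>?L\<rangle> \<otimes>\<^sub>a \<langle>M\<rangle> \<otimes>\<^sub>a \<sigma> ?L h \<otimes>\<^sub>a \<langle>h\<rangle>)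
         \<cdot> (\<langle>?L\<rangle> \<otimes>\<^sub>a coevl V M \<otimes>\<^sub>a com H)"
      by (rule den_eqI, (rule den_intro | (simp; fail))+, simp add: diag tyi te ts right_moduleD(2)[OF m])
    also have "\<dots> = \<langle>?L\<rangle> \<otimes>\<^sub>a cou H"
      unfolding f by (rule den_eqI, (rule den_intro | (simp; fail))+, (simp add: diag tyi te ts ml sn antipode_r)?, simp add: diag' tyi te ts ml sn antipode_r)
    also have "\<dots> = (evl V M \<otimes>\<^sub>a \<langle>?L\<rangle>) \<cdot> (\<langle>?L\<rangle> \<otimes>\<^sub>a (coevl V M \<cdot> cou H))"
      by (rule den_eqI, (rule den_intro | (simp; fail))+, simp add: diag tyi te sn)
    finally show "(evl V M \<otimes>\<^sub>a \<langle>?L\<rangle>) \<cdot> (\<langle>?L\<rangle> \<otimes>\<^sub>a (coevl V M \<cdot> cou H))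
      = (evl V M \<otimes>\<^sub>a \<langle>?L\<rangle>) \<cdot> (\<langle>?L\<rangle> \<otimes>\<^sub>a (act M r ?L s \<cdot> (coevl V M \<otimes>\<^sub>a \<langle>h\<rangle>)))" by simp
  qed simp_all
  then have ex: "right_module V H (?L, s)
       \<and> H_linear V H (mod_tensor V H (?L, s) (M, r)) (evl V M) (mod_unit V H)
       \<and> H_linear V H (mod_unit V H) (coevl V M) (mod_tensor V H (M, r) (?L, s))"
    using mod lin te by (simp add: H_linear_to_unit_iff H_linear_from_unit_iff)
  have "s' = s" if s': "right_module V H (?L, s')" "H_linear V H (mod_tensor V H (?L, s') (M, r)) (evl V M) (mod_unit V H)" for s'
  proof (rule cancel)
    show "typed s' [?L, h] [?L]" "typed s [?L, h] [?L]" using right_moduleD(2)[OF s'(1)] ts by auto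
    have "evl V M \<cdot> (\<langle>?L\<rangle> \<otimes>\<^sub>a r) = evl V M \<cdot> (s' \<otimes>\<^sub>a \<langle>M\<rangle>) \<cdot> ?i"
      using pairing_formula[OF s'(1) M right_moduleD(2)[OF m] te(1)] s'(2) by (simp add: H_linear_to_unit_iff)
    then show "evl V M \<cdot> (s' \<otimes>\<^sub>a \<langle>M\<rangle>) \<cdot> ?i = evl V M \<cdot> (s \<otimes>\<^sub>a \<langle>M\<rangle>) \<cdot> ?i"
      using f by simp
  qed
  then show ?thesis
    using ex by blast
qed

end

context braided_rigid_category
begin

lemma ldual_arr_typed [tyi]:
  assumes f: "typed f [X] [Y]"
  shows "typed (ldual_arr V f) [ldual V Y] [ldual V X]"
proof -
  have [simp]: "X \<in> Ob V" "Y \<in> Ob V" and st: "src V f = X" "tgt V f = Y"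
    using f by (auto simp: typed_def Hom_def)
  note [den_intro] = f[THEN den_gen]
  show ?thesis
    unfolding ldual_arr_def st Let_def by (rule den_typed, rule den_conv, (rule den_intro | (simp; fail))+)
qed

lemma ldual_arr_evl:
  assumes f: "typed f [X] [Y]"
  shows "evl V X \<cdot> (ldual_arr V f \<otimes>\<^sub>a \<langle>X\<rangle>) = evl V Y \<cdot> (\<langle>ldual V Y\<rangle> \<otimes>\<^sub>a f)"
proof -
  have [simp]: "X \<in> Ob V" "Y \<in> Ob V" and st: "src V f = X" "tgt V f = Y"
    using f by (auto simp: typed_def Hom_def)
  note [den_intro] = f[THEN den_gen]
  show ?thesis
    unfolding ldual_arr_def st Let_def by (rule den_eqI, (rule den_intro | (simp; fail))+, simp add: diag tyi f snakes)
qed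

end

section \<open>The coend\<close>

context coend
begin

lemma C_closed [simp]: "C \<in> Ob V" by (rule coend_closed)

lemma typed_iota [tyi]: "X \<in> Ob V \<Longrightarrow> typed (\<iota> X) [ldual V X, X] [C]"
  using coend_dinatural by (simp add: dinatural_def typed_def tob_Cons tensor_ob_unit)

lemmas [den_intro] = typed_iota[THEN den_gen]

abbreviation "\<delta> \<equiv> delta V \<iota>"

lemma typed_delta [tyi]: "X \<in> Ob V \<Longrightarrow> typed (\<delta> X) [X] [X, C]"
  unfolding delta_def by (rule den_typed, rule den_conv, (rule den_intro | (simp; fail))+)

text \<open>This is dinaturality of \<open>\<iota>\<close> after the dual arrow has been slid
  through \<open>coevl\<close> onto the other strand.\<close>

lemma delta_natural:
  assumes f: "f \<in> Hom V X Y"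
  shows "\<delta> Y \<cdot> f = (f \<otimes>\<^sub>a \<langle>C\<rangle>) \<cdot> \<delta> X"
proof -
  have [simp]: "X \<in> Ob V" "Y \<in> Ob V" and t: "typed f [X] [Y]"
    using f hom_Ob[OF f] by (auto simp: typed_def)
  note tl = ldual_arr_typed[OF t]
  note [den_intro] = t[THEN den_gen] tl[THEN den_gen]
  have di: "\<iota> Y \<cdot> (\<langle>ldual V Y\<rangle> \<otimes>\<^sub>a f) = \<iota> X \<cdot> (ldual_arr V f \<otimes>\<^sub>a \<langle>X\<rangle>)"
    using coend_dinatural f by (simp add: dinatural_def)
  have "\<delta> Y \<cdot> f = (\<langle>Y\<rangle> \<otimes>\<^sub>a (\<iota> Y \<cdot> (\<langle>ldual V Y\<rangle> \<otimes>\<^sub>a f))) \<cdot> (coevl V Y \<otimes>\<^sub>a \<langle>X\<rangle>)"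
    unfolding delta_def by (rule den_eqI, (rule den_intro | (simp; fail))+, simp add: diag tyi t)
  also have "\<dots> = (\<langle>Y\<rangle> \<otimes>\<^sub>a \<iota> X) \<cdot> (((\<langle>Y\<rangle> \<otimes>\<^sub>a ldual_arr V f) \<cdot> coevl V Y) \<otimes>\<^sub>a \<langle>X\<rangle>)"
    unfolding di by (rule den_eqI, (rule den_intro | (simp; fail))+)
  also have "(\<langle>Y\<rangle> \<otimes>\<^sub>a ldual_arr V f) \<cdot> coevl V Y = (f \<otimes>\<^sub>a \<langle>ldual V X\<rangle>) \<cdot> coevl V X"
  proof -
    have st: "src V f = X" "tgt V f = Y" using f by (auto simp: Hom_def)
    show ?thesis
      unfolding ldual_arr_def st Let_def by (rule den_eqI, (rule den_intro | (simp; fail))+, simp add: diag tyi t snakes)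
  qed
  also have "(\<langle>Y\<rangle> \<otimes>\<^sub>a \<iota> X) \<cdot> (((f \<otimes>\<^sub>a \<langle>ldual V X\<rangle>) \<cdot> coevl V X) \<otimes>\<^sub>a \<langle>X\<rangle>) = (f \<otimes>\<^sub>a \<langle>C\<rangle>) \<cdot> \<delta> X"
    unfolding delta_def by (rule den_eqI, (rule den_intro | (simp; fail))+, simp add: diag tyi t)
  finally show ?thesis .
qed

text \<open>In the next two lemmas the parameter \<open>Z\<close> is moved to the other side by its left dual; this
  replaces the fact that \<open>\<otimes> Z\<close> preserves coends.\<close>

lemma coend_eqI:
  assumes Z [simp]: "Z \<in> Ob V" and f: "f \<in> Hom V (C \<otimes>\<^sub>o Z) D" and g: "g \<in> Hom V (C \<otimes>\<^sub>o Z) D"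
    and eq: "\<And>X. X \<in> Ob V \<Longrightarrow> (\<langle>X\<rangle> \<otimes>\<^sub>a f) \<cdot> (\<delta> X \<otimes>\<^sub>a \<langle>Z\<rangle>) = (\<langle>X\<rangle> \<otimes>\<^sub>a g) \<cdot> (\<delta> X \<otimes>\<^sub>a \<langle>Z\<rangle>)"
  shows "f = g"
proof -
  let ?Z = "ldual V Z"
  have D [simp]: "D \<in> Ob V" using hom_Ob[OF f] by simp
  have t: "typed f [C,Z] [D]" "typed g [C,Z] [D]"
    using f g by (simp_all add: typed_def tob_Cons tensor_ob_unit)
  let ?h = "\<lambda>f. (f \<otimes>\<^sub>a \<langle>?Z\<rangle>) \<cdot> (\<langle>C\<rangle> \<otimes>\<^sub>a coevl V Z)"
  have hi: "?h f' \<cdot> \<iota> X = (evl V X \<otimes>\<^sub>a \<langle>D\<rangle> \<otimes>\<^sub>a \<langle>?Z\<rangle>) \<cdot> (\<langle>ldual V X\<rangle> \<otimes>\<^sub>a ((\<langle>X\<rangle> \<otimes>\<^sub>a f') \<cdot> (\<delta> X \<otimes>\<^sub>a \<langle>Z\<rangle>)) \<otimes>\<^sub>a \<langle>?Z\<rangle>)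
      \<cdot> (\<langle>ldual V X\<rangle> \<otimes>\<^sub>a \<langle>X\<rangle> \<otimes>\<^sub>a coevl V Z)" if t: "typed f' [C,Z] [D]" and [simp]: "X \<in> Ob V" for f' X
  proof -
    note [den_intro] = t[THEN den_gen]
    show ?thesis
      unfolding delta_def by (rule den_eqI, (rule den_intro | (simp; fail))+, simp add: diag tyi t snakes)
  qed
  have hH: "?h f' \<in> Hom V C (D \<otimes>\<^sub>o ?Z)" if t: "typed f' [C,Z] [D]" for f'
  proof -
    note [den_intro] = t[THEN den_gen]
    have "typed (?h f') [C] [D, ?Z]" by (rule den_typed, rule den_conv, (rule den_intro | (simp; fail))+)
    then show ?thesis by (simp add: typed_def tob_Cons tensor_ob_unit)
  qed
  have "dinatural V (D \<otimes>\<^sub>o ?Z) (\<lambda>X. ?h f \<cdot> \<iota> X)"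
    unfolding dinatural_def
  proof (intro conjI ballI)
    fix X assume X: "X \<in> Ob V"
    then show "?h f \<cdot> \<iota> X \<in> Hom V (ldual V X \<otimes>\<^sub>o X) (D \<otimes>\<^sub>o ?Z)"
      using coend_dinatural cmp_hom[OF _ hH[OF t(1)]] by (simp add: dinatural_def)
  next
    fix X Y k assume a: "X \<in> Ob V" "Y \<in> Ob V" "k \<in> Hom V X Y"
    have i: "\<iota> X \<in> Hom V (ldual V X \<otimes>\<^sub>o X) C" "\<iota> Y \<in> Hom V (ldual V Y \<otimes>\<^sub>o Y) C"
      and e: "\<iota> Y \<cdot> (\<langle>ldual V Y\<rangle> \<otimes>\<^sub>a k) = \<iota> X \<cdot> (ldual_arr V k \<otimes>\<^sub>a \<langle>X\<rangle>)"
      using coend_dinatural a by (auto simp: dinatural_def)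
    have k: "typed k [X] [Y]" using a by (simp add: typed_def)
    have h1: "\<langle>ldual V Y\<rangle> \<otimes>\<^sub>a k \<in> Hom V (ldual V Y \<otimes>\<^sub>o X) (ldual V Y \<otimes>\<^sub>o Y)"
      using a by (intro tensor_hom ident_hom) auto
    have h2: "ldual_arr V k \<otimes>\<^sub>a \<langle>X\<rangle> \<in> Hom V (ldual V Y \<otimes>\<^sub>o X) (ldual V X \<otimes>\<^sub>o X)"
      using a ldual_arr_typed[OF k] by (intro tensor_hom ident_hom) (auto simp: typed_def)
    show "(?h f \<cdot> \<iota> Y) \<cdot> (\<langle>ldual V Y\<rangle> \<otimes>\<^sub>a k) = (?h f \<cdot> \<iota> X) \<cdot> (ldual_arr V k \<otimes>\<^sub>a \<langle>X\<rangle>)"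
      using cmp_assoc[OF h1 i(2) hH[OF t(1)]] cmp_assoc[OF h2 i(1) hH[OF t(1)]] e by simp
  qed
  from coend_universal[OF tensor_closed[OF D dual_closed(1)[OF Z]] this]
  have ex1: "\<exists>!k. k \<in> Hom V C (D \<otimes>\<^sub>o ?Z) \<and> (\<forall>X\<in>Ob V. k \<cdot> \<iota> X = ?h f \<cdot> \<iota> X)" .
  have "?h g \<cdot> \<iota> X = ?h f \<cdot> \<iota> X" if "X \<in> Ob V" for X
    using hi[OF t(1) that] hi[OF t(2) that] eq[OF that] by simp
  then have eqs: "\<forall>X\<in>Ob V. ?h g \<cdot> \<iota> X = ?h f \<cdot> \<iota> X" by blast
  define P where "P k \<longleftrightarrow> k \<in> Hom V C (D \<otimes>\<^sub>o ?Z) \<and> (\<forall>X\<in>Ob V. k \<cdot> \<iota> X = ?h f \<cdot> \<iota> X)" for k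
  have "\<exists>!k. P k"
    unfolding P_def by (rule ex1)
  moreover have "P (?h f)" "P (?h g)"
    unfolding P_def using hH[OF t(1)] hH[OF t(2)] eqs by simp_all
  ultimately have hh: "?h f = ?h g"
    by blast
  have "f' = (\<langle>D\<rangle> \<otimes>\<^sub>a evl V Z) \<cdot> (?h f' \<otimes>\<^sub>a \<langle>Z\<rangle>)" if t: "typed f' [C,Z] [D]" for f'
  proof -
    note [den_intro] = t[THEN den_gen]
    show ?thesis
      by (rule den_eqI, (rule den_intro | (simp; fail))+, simp add: diag tyi t snakes)
  qed
  from this[OF t(1)] this[OF t(2)] hh show ?thesis by simp
qed

lemma coend_ex:
  assumes Z [simp]: "Z \<in> Ob V" and D [simp]: "D \<in> Ob V"
    and k: "\<And>X. X \<in> Ob V \<Longrightarrow> k X \<in> Hom V (X \<otimes>\<^sub>o Z) (X \<otimes>\<^sub>o D)"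
    and nat: "\<And>X Y f. f \<in> Hom V X Y \<Longrightarrow> k Y \<cdot> (f \<otimes>\<^sub>a \<langle>Z\<rangle>) = (f \<otimes>\<^sub>a \<langle>D\<rangle>) \<cdot> k X"
  shows "\<exists>f. f \<in> Hom V (C \<otimes>\<^sub>o Z) D \<and> (\<forall>X \<in> Ob V. (\<langle>X\<rangle> \<otimes>\<^sub>a f) \<cdot> (\<delta> X \<otimes>\<^sub>a \<langle>Z\<rangle>) = k X)"
proof -
  let ?Z = "ldual V Z"
  have tk: "X \<in> Ob V \<Longrightarrow> typed (k X) [X,Z] [X,D]" for X
    using k by (simp add: typed_def tob_Cons tensor_ob_unit)
  note [den_intro] = tk[THEN den_gen]
  define j where "j X = (evl V X \<otimes>\<^sub>a \<langle>D\<rangle> \<otimes>\<^sub>a \<langle>?Z\<rangle>) \<cdot> (\<langle>ldual V X\<rangle> \<otimes>\<^sub>a k X \<otimes>\<^sub>a \<langle>?Z\<rangle>)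
      \<cdot> (\<langle>ldual V X\<rangle> \<otimes>\<^sub>a \<langle>X\<rangle> \<otimes>\<^sub>a coevl V Z)" for X
  have tj: "typed (j X) [ldual V X, X] [D, ?Z]" if [simp]: "X \<in> Ob V" for X
    unfolding j_def by (rule den_typed, rule den_conv, (rule den_intro | (simp; fail))+)
  have "dinatural V (D \<otimes>\<^sub>o ?Z) j"
    unfolding dinatural_def
  proof (intro conjI ballI)
    fix X assume "X \<in> Ob V"
    then show "j X \<in> Hom V (ldual V X \<otimes>\<^sub>o X) (D \<otimes>\<^sub>o ?Z)"
      using tj by (simp add: typed_def tob_Cons tensor_ob_unit)
  next
    fix X Y f assume a [simp]: "X \<in> Ob V" "Y \<in> Ob V" and f: "f \<in> Hom V X Y"
    have t: "typed f [X] [Y]" using f by (simp add: typed_def)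
    note tl = ldual_arr_typed[OF t]
    note [den_intro] = t[THEN den_gen] tl[THEN den_gen]
    have "j Y \<cdot> (\<langle>ldual V Y\<rangle> \<otimes>\<^sub>a f) = (evl V Y \<otimes>\<^sub>a \<langle>D\<rangle> \<otimes>\<^sub>a \<langle>?Z\<rangle>) \<cdot> (\<langle>ldual V Y\<rangle> \<otimes>\<^sub>a (k Y \<cdot> (f \<otimes>\<^sub>a \<langle>Z\<rangle>)) \<otimes>\<^sub>a \<langle>?Z\<rangle>)
      \<cdot> (\<langle>ldual V Y\<rangle> \<otimes>\<^sub>a \<langle>X\<rangle> \<otimes>\<^sub>a coevl V Z)"
      unfolding j_def by (rule den_eqI, (rule den_intro | (simp; fail))+, simp add: diag tyi t tk)
    also have "\<dots> = ((evl V Y \<cdot> (\<langle>ldual V Y\<rangle> \<otimes>\<^sub>a f)) \<otimes>\<^sub>a \<langle>D\<rangle> \<otimes>\<^sub>a \<langle>?Z\<rangle>) \<cdot> (\<langle>ldual V Y\<rangle> \<otimes>\<^sub>a k X \<otimes>\<^sub>a \<langle>?Z\<rangle>)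
      \<cdot> (\<langle>ldual V Y\<rangle> \<otimes>\<^sub>a \<langle>X\<rangle> \<otimes>\<^sub>a coevl V Z)"
      unfolding nat[OF f] by (rule den_eqI, (rule den_intro | (simp; fail))+)
    also have "\<dots> = j X \<cdot> (ldual_arr V f \<otimes>\<^sub>a \<langle>X\<rangle>)"
      unfolding ldual_arr_evl[OF t, symmetric] j_def by (rule den_eqI, (rule den_intro | (simp; fail))+, (simp add: diag tyi t tl tk)?, simp add: diag' tyi t tl tk)
    finally show "j Y \<cdot> (\<langle>ldual V Y\<rangle> \<otimes>\<^sub>a f) = j X \<cdot> (ldual_arr V f \<otimes>\<^sub>a \<langle>X\<rangle>)" .
  qed
  from coend_universal[OF tensor_closed[OF D dual_closed(1)[OF Z]] this] obtain g where g: "g \<in> Hom V C (D \<otimes>\<^sub>o ?Z)" "\<And>X. X \<in> Ob V \<Longrightarrow> g \<cdot> \<iota> X = j X"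
    by blast
  have tg: "typed g [C] [D, ?Z]" using g(1) by (simp add: typed_def tob_Cons tensor_ob_unit)
  note [den_intro] = tg[THEN den_gen]
  let ?f = "(\<langle>D\<rangle> \<otimes>\<^sub>a evl V Z) \<cdot> (g \<otimes>\<^sub>a \<langle>Z\<rangle>)"
  have tf: "typed ?f [C,Z] [D]" by (rule den_typed, rule den_conv, (rule den_intro | (simp; fail))+)
  have "(\<langle>X\<rangle> \<otimes>\<^sub>a ?f) \<cdot> (\<delta> X \<otimes>\<^sub>a \<langle>Z\<rangle>) = k X" if [simp]: "X \<in> Ob V" for X
  proof -
    have "(\<langle>X\<rangle> \<otimes>\<^sub>a ?f) \<cdot> (\<delta> X \<otimes>\<^sub>a \<langle>Z\<rangle>) = (\<langle>X\<rangle> \<otimes>\<^sub>a \<langle>D\<rangle> \<otimes>\<^sub>a evl V Z) \<cdot> (\<langle>X\<rangle> \<otimes>\<^sub>a (g \<cdot> \<iota> X) \<otimes>\<^sub>a \<langle>Z\<rangle>) \<cdot> (coevl V X \<otimes>\<^sub>a \<langle>X\<rangle> \<otimes>\<^sub>a \<langle>Z\<rangle>)"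
      unfolding delta_def by (rule den_eqI, (rule den_intro | (simp; fail))+)
    also have "\<dots> = k X"
      unfolding g(2)[OF that] j_def by (rule den_eqI, (rule den_intro | (simp; fail))+, simp add: diag tyi tk snakes)
    finally show ?thesis .
  qed
  then show ?thesis
    using tf by (intro exI[of _ ?f]) (simp add: typed_def tob_Cons tensor_ob_unit)
qed

lemma typed_delta_obl: "obl X L \<Longrightarrow> typed (\<delta> X) L (L @ [C])"
  using typed_delta[of X] tob_closed[of L] by (auto simp: obl_def typed_def tob_append tob_Cons tensor_ob_unit)

lemma den_delta [den_intro]: "obl X L \<Longrightarrow> den (\<delta> X) L (L @ [C]) (\<lambda>n. app n L (\<delta> X) (L @ [C]))"
  by (rule den_gen, rule typed_delta_obl)

lemma delta_nat_r:
  assumes f: "typed f [X] [Y]" and h: "has n [X] st"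
  shows "app n [Y] (\<delta> Y) [Y, C] (app n [X] f [Y] st) = app n [X] f [Y] (app n [X] (\<delta> X) [X, C] st)"
proof -
  have [simp]: "X \<in> Ob V" "Y \<in> Ob V" using f by (auto simp: typed_def)
  note [den_intro] = f[THEN den_gen]
  have "\<delta> Y \<cdot> f = (f \<otimes>\<^sub>a \<langle>C\<rangle>) \<cdot> \<delta> X"
    using f delta_natural by (simp add: typed_def)
  from this h show ?thesis
    by - (rule den_rule, assumption, (rule den_intro | (simp; fail))+)
qed

end

section \<open>The braided category of modules\<close>

locale quasitriangular = coend V C \<iota> + hopf_algebra V H
  for V :: "('o, 'm) braided_rigid" (structure) and C :: 'o and \<iota> :: "'o \<Rightarrow> 'm"
    and H :: "('o, 'm) hopf" and R :: 'm +
  assumes R_mat: "R_matrix V C \<iota> H R"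
begin

abbreviation "Rn \<equiv> Rnat V C \<iota> H R"

lemma typed_R [tyi]: "typed R [C, C] [h, h]"
  using R_mat by (simp add: R_matrix_def typed_def tob_Cons tensor_ob_unit)

lemmas [den_intro] = typed_R[THEN den_gen]

lemma typed_Rn_obl:
  assumes X: "obl X LX" and Y: "obl Y LY"
  shows "typed (Rn X Y) (LX @ LY) (LY @ h # LX @ [h])"
proof -
  have [simp]: "X \<in> Ob V" "Y \<in> Ob V"
    using X Y tob_closed by (auto simp: obl_def)
  have "typed (Rn X Y) [X, Y] [Y, h, X, h]"
    unfolding Rnat_def delta2_def by (rule den_typed, rule den_conv, (rule den_intro | (simp; fail))+)
  then show ?thesis
    using X Y by (auto simp: obl_def typed_def tob_append tob_Cons tensor_ob_unit tensor_ob_assoc tob_closed tensor_closed)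
qed

text \<open>Only the typing is refined to wires. Unlike a braiding of \<open>V\<close>,
  \<open>Rn\<close> on composite objects stays a single box, because the R-matrix axioms resolve it
  only after a coproduct.\<close>

lemma den_Rn [den_intro]:
  "\<lbrakk>obl X LX; obl Y LY\<rbrakk> \<Longrightarrow> den (Rn X Y) (LX @ LY) (LY @ h # LX @ [h]) (\<lambda>n. app n (LX @ LY) (Rn X Y) (LY @ h # LX @ [h]))"
  by (rule den_gen, rule typed_Rn_obl)

lemma obl2: "X \<in> Ob V \<Longrightarrow> Y \<in> Ob V \<Longrightarrow> obl (X \<otimes>\<^sub>o Y) [X, Y]"
  by (simp add: obl_def tob_Cons tensor_ob_unit)

lemma typed_Rn [tyi]:
  assumes [simp]: "X \<in> Ob V" "Y \<in> Ob V"
  shows "typed (Rn X Y) [X, Y] [Y, h, X, h]"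
    "Z \<in> Ob V \<Longrightarrow> typed (Rn X (Y \<otimes>\<^sub>o Z)) [X, Y, Z] [Y, Z, h, X, h]"
    "Z \<in> Ob V \<Longrightarrow> typed (Rn (X \<otimes>\<^sub>o Y) Z) [X, Y, Z] [Z, h, X, Y, h]"
    "Z \<in> Ob V \<Longrightarrow> W \<in> Ob V \<Longrightarrow> typed (Rn (X \<otimes>\<^sub>o Y) (Z \<otimes>\<^sub>o W)) [X, Y, Z, W] [Z, W, h, X, Y, h]"
    "typed (Rn X \<^bold>1) [X] [h, X, h]" "typed (Rn \<^bold>1 X) [X] [X, h, h]"
  using typed_Rn_obl[OF obl_single obl_single, of X Y] typed_Rn_obl[OF obl_single obl2, of X Y Z]
    typed_Rn_obl[OF obl2 obl_single, of X Y Z] typed_Rn_obl[OF obl2 obl2, of X Y Z W]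
    typed_Rn_obl[OF obl_single obl_unit, of X] typed_Rn_obl[OF obl_unit obl_single, of X] by simp_all

lemma Rn_natural:
  assumes f: "f \<in> Hom V X X'" and g: "g \<in> Hom V Y Y'"
  shows "Rn X' Y' \<cdot> (f \<otimes>\<^sub>a g) = (g \<otimes>\<^sub>a \<langle>h\<rangle> \<otimes>\<^sub>a f \<otimes>\<^sub>a \<langle>h\<rangle>) \<cdot> Rn X Y"
proof -
  have [simp]: "X \<in> Ob V" "Y \<in> Ob V" "X' \<in> Ob V" "Y' \<in> Ob V" and t: "typed f [X] [X']" "typed g [Y] [Y']"
    using hom_Ob[OF f] hom_Ob[OF g] f g by (auto simp: typed_def)
  note [den_intro] = t[THEN den_gen]
  show ?thesis
    unfolding Rnat_def delta2_def by (rule den_eqI, (rule den_intro | (simp; fail))+, (simp add: diag tyi t delta_nat_r)?, simp add: diag' tyi t delta_nat_r)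
qed

abbreviation cbr :: "'o \<Rightarrow> 'm \<Rightarrow> 'o \<Rightarrow> 'm \<Rightarrow> 'm" where
  "cbr M r N s \<equiv> (s \<otimes>\<^sub>a r) \<cdot> Rn M N"

context
  fixes M r N s
  assumes m: "right_module V H (M, r)" "right_module V H (N, s)"
begin

lemma cbr_ob [simp]: "M \<in> Ob V" "N \<in> Ob V"
  using m[THEN right_moduleD(1)] by auto

lemmas cbr_ty = m[THEN right_moduleD(2)]

lemma typed_cbr: "typed (cbr M r N s) [M, N] [N, M]"
  by (rule den_typed, rule den_conv, (rule den_intro cbr_ty[THEN den_gen] | (simp; fail))+)

lemma cbr_natural:
  assumes m': "right_module V H (M', r')" "right_module V H (N', s')"
    and f: "H_linear V H (M, r) f (M', r')" and g: "H_linear V H (N, s) g (N', s')"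
  shows "cbr M' r' N' s' \<cdot> (f \<otimes>\<^sub>a g) = (g \<otimes>\<^sub>a f) \<cdot> cbr M r N s"
proof -
  note [simp] = m'[THEN right_moduleD(1)]
  note ty' = m'[THEN right_moduleD(2)]
  have t: "typed f [M] [M']" "typed g [N] [N']" and
    e: "r' \<cdot> (f \<otimes>\<^sub>a \<langle>h\<rangle>) = f \<cdot> r"  "s' \<cdot> (g \<otimes>\<^sub>a \<langle>h\<rangle>) = g \<cdot> s"
    using f g by (simp_all add: H_linear_def typed_def)
  note [den_intro] = t[THEN den_gen] ty'[THEN den_gen] cbr_ty[THEN den_gen]
  have "cbr M' r' N' s' \<cdot> (f \<otimes>\<^sub>a g) = (s' \<otimes>\<^sub>a r') \<cdot> (Rn M' N' \<cdot> (f \<otimes>\<^sub>a g))"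
    by (rule den_eqI, (rule den_intro | (simp; fail))+)
  also have "\<dots> = ((s' \<cdot> (g \<otimes>\<^sub>a \<langle>h\<rangle>)) \<otimes>\<^sub>a (r' \<cdot> (f \<otimes>\<^sub>a \<langle>h\<rangle>))) \<cdot> Rn M N"
    using Rn_natural[of f M M' g N N'] f g
    by (simp add: H_linear_def) (rule den_eqI, (rule den_intro | (simp; fail))+, simp add: diag tyi t cbr_ty ty')
  also have "\<dots> = (g \<otimes>\<^sub>a f) \<cdot> cbr M r N s"
    unfolding e by (rule den_eqI, (rule den_intro | (simp; fail))+, simp add: diag tyi t cbr_ty ty')
  finally show ?thesis .
qed

text \<open>The first R-matrix axiom, acted on by \<open>r\<close> and \<open>s\<close>. Naturality
  of \<open>Rn\<close> moves actions from before the braiding to after it, where two successive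
  actions are one action by a product.\<close>

lemma cbr_linear: "cbr M r N s \<cdot> act M r N s = act N s M r \<cdot> (cbr M r N s \<otimes>\<^sub>a \<langle>h\<rangle>)"
proof -
  note [den_intro] = cbr_ty[THEN den_gen]
  note ml = right_moduleD[OF m(1)] right_moduleD[OF m(2)]
  have rs: "r \<in> Hom V (M \<otimes>\<^sub>o h) M" "s \<in> Hom V (N \<otimes>\<^sub>o h) N"
    using cbr_ty by (simp_all add: typed_def tob_Cons tensor_ob_unit)
  have ax: "(\<langle>N\<rangle> \<otimes>\<^sub>a mul H \<otimes>\<^sub>a \<langle>M\<rangle> \<otimes>\<^sub>a mul H) \<cdot> Rn (M \<otimes>\<^sub>o h) (N \<otimes>\<^sub>o h)
          \<cdot> (\<langle>M\<rangle> \<otimes>\<^sub>a \<sigma> N h \<otimes>\<^sub>a \<langle>h\<rangle>) \<cdot> (\<langle>M\<rangle> \<otimes>\<^sub>a \<langle>N\<rangle> \<otimes>\<^sub>a com H)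
        = (\<langle>N\<rangle> \<otimes>\<^sub>a mul H \<otimes>\<^sub>a \<langle>M\<rangle> \<otimes>\<^sub>a mul H)
          \<cdot> (\<langle>N\<rangle> \<otimes>\<^sub>a \<langle>h\<rangle> \<otimes>\<^sub>a \<sigma> (M \<otimes>\<^sub>o h) h \<otimes>\<^sub>a \<langle>h\<rangle>) \<cdot> (Rn M N \<otimes>\<^sub>a com H)"
    using R_mat cbr_ob by (simp add: R_matrix_def)
  have "cbr M r N s \<cdot> act M r N s = (s \<otimes>\<^sub>a r) \<cdot> (Rn M N \<cdot> (r \<otimes>\<^sub>a s)) \<cdot> (\<langle>M\<rangle> \<otimes>\<^sub>a \<sigma> N h \<otimes>\<^sub>a \<langle>h\<rangle>) \<cdot> (\<langle>M \<otimes>\<^sub>o N\<rangle> \<otimes>\<^sub>a com H)"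
    by (rule den_eqI, (rule den_intro | (simp; fail))+)
  also have "\<dots> = (s \<otimes>\<^sub>a r) \<cdot> ((\<langle>N\<rangle> \<otimes>\<^sub>a mul H \<otimes>\<^sub>a \<langle>M\<rangle> \<otimes>\<^sub>a mul H) \<cdot> Rn (M \<otimes>\<^sub>o h) (N \<otimes>\<^sub>o h)
          \<cdot> (\<langle>M\<rangle> \<otimes>\<^sub>a \<sigma> N h \<otimes>\<^sub>a \<langle>h\<rangle>) \<cdot> (\<langle>M\<rangle> \<otimes>\<^sub>a \<langle>N\<rangle> \<otimes>\<^sub>a com H))"
    unfolding Rn_natural[OF rs] by (rule den_eqI, (rule den_intro | (simp; fail))+, simp add: diag tyi ml)
  also have "\<dots> = act N s M r \<cdot> (cbr M r N s \<otimes>\<^sub>a \<langle>h\<rangle>)"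
    unfolding ax by (rule den_eqI, (rule den_intro | (simp; fail))+, simp add: diag tyi ml)
  finally show ?thesis .
qed

end

text \<open>The second R-matrix axiom: the action on \<open>N \<otimes> P\<close> supplies its
  coproduct, and the product on the strand \<open>M\<close> splits into two actions, the inner one
  being moved back through \<open>Rn\<close>. The third axiom gives the other hexagon in the same
  way.\<close>

lemma cbr_hexagon_right:
  assumes m: "right_module V H (M, r)" "right_module V H (N, s)" "right_module V H (P, q)"
  shows "cbr M r (N \<otimes>\<^sub>o P) (act N s P q) = (\<langle>N\<rangle> \<otimes>\<^sub>a cbr M r P q) \<cdot> (cbr M r N s \<otimes>\<^sub>a \<langle>P\<rangle>)"
proof -
  note [simp] = m[THEN right_moduleD(1)]
  note [den_intro] = m[THEN right_moduleD(2), THEN den_gen]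
  note ml = right_moduleD[OF m(1)] right_moduleD[OF m(2)] right_moduleD[OF m(3)]
  have r: "r \<in> Hom V (M \<otimes>\<^sub>o h) M"
    using ml(2) by (simp_all add: typed_def tob_Cons tensor_ob_unit)
  have ax: "(\<langle>N\<rangle> \<otimes>\<^sub>a \<sigma> P h \<otimes>\<^sub>a \<langle>h\<rangle> \<otimes>\<^sub>a \<langle>M\<rangle> \<otimes>\<^sub>a \<langle>h\<rangle>)
          \<cdot> (\<langle>N\<rangle> \<otimes>\<^sub>a \<langle>P\<rangle> \<otimes>\<^sub>a com H \<otimes>\<^sub>a \<langle>M\<rangle> \<otimes>\<^sub>a \<langle>h\<rangle>) \<cdot> Rn M (N \<otimes>\<^sub>o P)
        = (\<langle>N\<rangle> \<otimes>\<^sub>a \<langle>h\<rangle> \<otimes>\<^sub>a \<langle>P\<rangle> \<otimes>\<^sub>a \<langle>h\<rangle> \<otimes>\<^sub>a \<langle>M\<rangle> \<otimes>\<^sub>a mul H)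
          \<cdot> (\<langle>N\<rangle> \<otimes>\<^sub>a \<langle>h\<rangle> \<otimes>\<^sub>a Rn (M \<otimes>\<^sub>o h) P) \<cdot> (Rn M N \<otimes>\<^sub>a \<langle>P\<rangle>)"
    using R_mat by (simp add: R_matrix_def)
  have "cbr M r (N \<otimes>\<^sub>o P) (act N s P q) = (s \<otimes>\<^sub>a q \<otimes>\<^sub>a r) \<cdot> ((\<langle>N\<rangle> \<otimes>\<^sub>a \<sigma> P h \<otimes>\<^sub>a \<langle>h\<rangle> \<otimes>\<^sub>a \<langle>M\<rangle> \<otimes>\<^sub>a \<langle>h\<rangle>)
          \<cdot> (\<langle>N\<rangle> \<otimes>\<^sub>a \<langle>P\<rangle> \<otimes>\<^sub>a com H \<otimes>\<^sub>a \<langle>M\<rangle> \<otimes>\<^sub>a \<langle>h\<rangle>) \<cdot> Rn M (N \<otimes>\<^sub>o P))"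
    by (rule den_eqI, (rule den_intro | (simp; fail))+, simp add: diag tyi ml)
  also have "\<dots> = (s \<otimes>\<^sub>a q \<otimes>\<^sub>a r) \<cdot> (\<langle>N\<rangle> \<otimes>\<^sub>a \<langle>h\<rangle> \<otimes>\<^sub>a ((\<langle>P\<rangle> \<otimes>\<^sub>a \<langle>h\<rangle> \<otimes>\<^sub>a r \<otimes>\<^sub>a \<langle>h\<rangle>) \<cdot> Rn (M \<otimes>\<^sub>o h) P)) \<cdot> (Rn M N \<otimes>\<^sub>a \<langle>P\<rangle>)"
    unfolding ax by (rule den_eqI, (rule den_intro | (simp; fail))+, simp add: diag tyi ml)
  also have "(\<langle>P\<rangle> \<otimes>\<^sub>a \<langle>h\<rangle> \<otimes>\<^sub>a r \<otimes>\<^sub>a \<langle>h\<rangle>) \<cdot> Rn (M \<otimes>\<^sub>o h) P = Rn M P \<cdot> (r \<otimes>\<^sub>a \<langle>P\<rangle>)"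
    using Rn_natural[OF r ident_hom[of P]] by simp
  also have "(s \<otimes>\<^sub>a q \<otimes>\<^sub>a r) \<cdot> (\<langle>N\<rangle> \<otimes>\<^sub>a \<langle>h\<rangle> \<otimes>\<^sub>a (Rn M P \<cdot> (r \<otimes>\<^sub>a \<langle>P\<rangle>))) \<cdot> (Rn M N \<otimes>\<^sub>a \<langle>P\<rangle>)
      = (\<langle>N\<rangle> \<otimes>\<^sub>a cbr M r P q) \<cdot> (cbr M r N s \<otimes>\<^sub>a \<langle>P\<rangle>)"
    by (rule den_eqI, (rule den_intro | (simp; fail))+, simp add: diag tyi ml)
  finally show ?thesis .
qed

lemma cbr_hexagon_left:
  assumes m: "right_module V H (M, r)" "right_module V H (N, s)" "right_module V H (P, q)"
  shows "cbr (M \<otimes>\<^sub>o N) (act M r N s) P q = (cbr M r P q \<otimes>\<^sub>a \<langle>N\<rangle>) \<cdot> (\<langle>M\<rangle> \<otimes>\<^sub>a cbr N s P q)"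
proof -
  note [simp] = m[THEN right_moduleD(1)]
  note [den_intro] = m[THEN right_moduleD(2), THEN den_gen]
  note ml = right_moduleD[OF m(1)] right_moduleD[OF m(2)] right_moduleD[OF m(3)]
  have q: "q \<in> Hom V (P \<otimes>\<^sub>o h) P"
    using right_moduleD(2)[OF m(3)] by (simp_all add: typed_def tob_Cons tensor_ob_unit)
  have ax: "(\<langle>P\<rangle> \<otimes>\<^sub>a \<langle>h\<rangle> \<otimes>\<^sub>a \<langle>M\<rangle> \<otimes>\<^sub>a \<sigma> N h \<otimes>\<^sub>a \<langle>h\<rangle>)
          \<cdot> (\<langle>P\<rangle> \<otimes>\<^sub>a \<langle>h\<rangle> \<otimes>\<^sub>a \<langle>M\<rangle> \<otimes>\<^sub>a \<langle>N\<rangle> \<otimes>\<^sub>a com H) \<cdot> Rn (M \<otimes>\<^sub>o N) P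
        = (\<langle>P\<rangle> \<otimes>\<^sub>a mul H \<otimes>\<^sub>a \<langle>M\<rangle> \<otimes>\<^sub>a \<langle>h\<rangle> \<otimes>\<^sub>a \<langle>N\<rangle> \<otimes>\<^sub>a \<langle>h\<rangle>)
          \<cdot> (Rn M (P \<otimes>\<^sub>o h) \<otimes>\<^sub>a \<langle>N\<rangle> \<otimes>\<^sub>a \<langle>h\<rangle>) \<cdot> (\<langle>M\<rangle> \<otimes>\<^sub>a Rn N P)"
    using R_mat by (simp add: R_matrix_def)
  have "cbr (M \<otimes>\<^sub>o N) (act M r N s) P q = (q \<otimes>\<^sub>a r \<otimes>\<^sub>a s) \<cdot> ((\<langle>P\<rangle> \<otimes>\<^sub>a \<langle>h\<rangle> \<otimes>\<^sub>a \<langle>M\<rangle> \<otimes>\<^sub>a \<sigma> N h \<otimes>\<^sub>a \<langle>h\<rangle>)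
          \<cdot> (\<langle>P\<rangle> \<otimes>\<^sub>a \<langle>h\<rangle> \<otimes>\<^sub>a \<langle>M\<rangle> \<otimes>\<^sub>a \<langle>N\<rangle> \<otimes>\<^sub>a com H) \<cdot> Rn (M \<otimes>\<^sub>o N) P)"
    by (rule den_eqI, (rule den_intro | (simp; fail))+)
  also have "\<dots> = (q \<otimes>\<^sub>a r \<otimes>\<^sub>a s) \<cdot> (((q \<otimes>\<^sub>a \<langle>h\<rangle> \<otimes>\<^sub>a \<langle>M\<rangle> \<otimes>\<^sub>a \<langle>h\<rangle>) \<cdot> Rn M (P \<otimes>\<^sub>o h)) \<otimes>\<^sub>a \<langle>N\<rangle> \<otimes>\<^sub>a \<langle>h\<rangle>) \<cdot> (\<langle>M\<rangle> \<otimes>\<^sub>a Rn N P)"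
    unfolding ax by (rule den_eqI, (rule den_intro | (simp; fail))+, simp add: diag tyi ml)
  also have "(q \<otimes>\<^sub>a \<langle>h\<rangle> \<otimes>\<^sub>a \<langle>M\<rangle> \<otimes>\<^sub>a \<langle>h\<rangle>) \<cdot> Rn M (P \<otimes>\<^sub>o h) = Rn M P \<cdot> (\<langle>M\<rangle> \<otimes>\<^sub>a q)"
    using Rn_natural[OF ident_hom[of M] q] by simp
  also have "(q \<otimes>\<^sub>a r \<otimes>\<^sub>a s) \<cdot> ((Rn M P \<cdot> (\<langle>M\<rangle> \<otimes>\<^sub>a q)) \<otimes>\<^sub>a \<langle>N\<rangle> \<otimes>\<^sub>a \<langle>h\<rangle>) \<cdot> (\<langle>M\<rangle> \<otimes>\<^sub>a Rn N P)
     = (cbr M r P q \<otimes>\<^sub>a \<langle>N\<rangle>) \<cdot> (\<langle>M\<rangle> \<otimes>\<^sub>a cbr N s P q)"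
    by (rule den_eqI, (rule den_intro | (simp; fail))+, simp add: diag tyi ml)
  finally show ?thesis .
qed

lemma cbr_unit:
  assumes m: "right_module V H (M, r)"
  shows "cbr \<^bold>1 (cou H) M r = \<langle>M\<rangle>"
proof -
  note [simp] = right_moduleD(1)[OF m]
  note ml = right_moduleD[OF m]
  note [den_intro] = ml(2)[THEN den_gen]
  have ax: "(\<langle>M\<rangle> \<otimes>\<^sub>a \<langle>h\<rangle> \<otimes>\<^sub>a cou H) \<cdot> Rn \<^bold>1 M = \<langle>M\<rangle> \<otimes>\<^sub>a uni H"
    using R_mat by (simp add: R_matrix_def)
  have "cbr \<^bold>1 (cou H) M r = r \<cdot> ((\<langle>M\<rangle> \<otimes>\<^sub>a \<langle>h\<rangle> \<otimes>\<^sub>a cou H) \<cdot> Rn \<^bold>1 M)"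
    by (rule den_eqI, (rule den_intro | (simp; fail))+)
  also have "\<dots> = \<langle>M\<rangle>"
    unfolding ax by (rule den_eqI, (rule den_intro | (simp; fail))+, simp add: diag tyi ml)
  finally show ?thesis .
qed

end

section \<open>Inverting a braiding by means of duals\<close>

context strict_monoidal_category
begin

text \<open>The inverse of \<open>c\<close> is the mate of the braiding \<open>d\<close> of the dual
  \<open>L\<close> past \<open>Y\<close>. The hypotheses on \<open>k\<close> and \<open>e\<close>
  say that coevaluation and evaluation pass through the braidings. No braided structure is
  presupposed, since the lemma serves to establish that of the modules.\<close>

lemma half_braiding_iso:
  assumes [simp]: "X \<in> Ob V" "Y \<in> Ob V" "L \<in> Ob V"
    and t: "typed e [L, X] []" "typed k [] [X, L]" "typed c [X, Y] [Y, X]" "typed d [L, Y] [Y, L]"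
    and snake1: "(\<langle>X\<rangle> \<otimes>\<^sub>a e) \<cdot> (k \<otimes>\<^sub>a \<langle>X\<rangle>) = \<langle>X\<rangle>"
    and k: "(c \<otimes>\<^sub>a \<langle>L\<rangle>) \<cdot> (\<langle>X\<rangle> \<otimes>\<^sub>a d) \<cdot> (k \<otimes>\<^sub>a \<langle>Y\<rangle>) = \<langle>Y\<rangle> \<otimes>\<^sub>a k"
    and e: "(\<langle>Y\<rangle> \<otimes>\<^sub>a e) \<cdot> (d \<otimes>\<^sub>a \<langle>X\<rangle>) \<cdot> (\<langle>L\<rangle> \<otimes>\<^sub>a c) = e \<otimes>\<^sub>a \<langle>Y\<rangle>"
  shows "is_iso V c"
proof -
  note [den_intro] = t[THEN den_gen]
  have s: "has n [X] st \<Longrightarrow> app (Suc n) [L, X] e [] (app n [] k [X, L] st) = st" for n st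
    by ((rule den_rule[OF snake1], (rule den_intro | (simp; fail))+)[1])
  let ?i = "(\<langle>X\<rangle> \<otimes>\<^sub>a \<langle>Y\<rangle> \<otimes>\<^sub>a e) \<cdot> (\<langle>X\<rangle> \<otimes>\<^sub>a d \<otimes>\<^sub>a \<langle>X\<rangle>) \<cdot> (k \<otimes>\<^sub>a \<langle>Y\<rangle> \<otimes>\<^sub>a \<langle>X\<rangle>)"
  have "c \<cdot> ?i = (\<langle>Y\<rangle> \<otimes>\<^sub>a \<langle>X\<rangle> \<otimes>\<^sub>a e) \<cdot> (((c \<otimes>\<^sub>a \<langle>L\<rangle>) \<cdot> (\<langle>X\<rangle> \<otimes>\<^sub>a d) \<cdot> (k \<otimes>\<^sub>a \<langle>Y\<rangle>)) \<otimes>\<^sub>a \<langle>X\<rangle>)"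
    by (rule den_eqI, (rule den_intro | (simp; fail))+, (simp add: exch_right exch_left has_def shp_app shp_init t)?)
  also have "\<dots> = \<langle>Y \<otimes>\<^sub>o X\<rangle>"
    unfolding k by (rule den_eqI, (rule den_intro | (simp; fail))+, (simp add: s exch_right exch_left has_def shp_app shp_init t)?)
  finally have 1: "c \<cdot> ?i = \<langle>Y \<otimes>\<^sub>o X\<rangle>" .
  have "?i \<cdot> c = (\<langle>X\<rangle> \<otimes>\<^sub>a ((\<langle>Y\<rangle> \<otimes>\<^sub>a e) \<cdot> (d \<otimes>\<^sub>a \<langle>X\<rangle>) \<cdot> (\<langle>L\<rangle> \<otimes>\<^sub>a c))) \<cdot> (k \<otimes>\<^sub>a \<langle>X\<rangle> \<otimes>\<^sub>a \<langle>Y\<rangle>)"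
    by (rule den_eqI, (rule den_intro | (simp; fail))+, (simp add: exch_right exch_left has_def shp_app shp_init t)?)
  also have "\<dots> = \<langle>X \<otimes>\<^sub>o Y\<rangle>"
    unfolding e by (rule den_eqI, (rule den_intro | (simp; fail))+, (simp add: s exch_right exch_left has_def shp_app shp_init t)?)
  finally have 2: "?i \<cdot> c = \<langle>X \<otimes>\<^sub>o Y\<rangle>" .
  have "typed ?i [Y, X] [X, Y]"
    by (rule den_typed, rule den_conv, (rule den_intro | (simp; fail))+)
  then show ?thesis
    using is_isoI[of c "X \<otimes>\<^sub>o Y" "Y \<otimes>\<^sub>o X" ?i] 1 2 t(3) by (simp add: typed_def tob_Cons tensor_ob_unit)
qed

end

section \<open>Modules handled as single objects\<close>

context hopf_algebra
begin

abbreviation "rmod \<equiv> right_module V H"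
abbreviation "lin \<equiv> H_linear V H"
abbreviation mt (infixr "\<odot>" 75) where "mt \<equiv> mod_tensor V H"

lemma mt_eq: "A \<odot> B = (fst A \<otimes>\<^sub>o fst B, act (fst A) (snd A) (fst B) (snd B))"
  by (simp add: mod_tensor_def case_prod_beta)

lemma fst_mt [simp]: "fst (A \<odot> B) = fst A \<otimes>\<^sub>o fst B"
  by (simp add: mod_tensor_def split: prod.splits)

lemma rmod_Ob [simp]: "rmod A \<Longrightarrow> fst A \<in> Ob V"
  by (rule right_moduleD(1)[of _ "snd A"]) (simp only: prod.collapse)

lemma rmod_mt: "rmod A \<Longrightarrow> rmod B \<Longrightarrow> rmod (A \<odot> B)"
  using mod_tensor_module[of "fst A" "snd A" "fst B" "snd B"] by (simp only: prod.collapse)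

lemma mt_assoc: "rmod A \<Longrightarrow> rmod B \<Longrightarrow> rmod D \<Longrightarrow> (A \<odot> B) \<odot> D = A \<odot> (B \<odot> D)"
  using mod_tensor_assoc[of "fst A" "snd A" "fst B" "snd B" "fst D" "snd D"] by (simp only: prod.collapse)

lemma mt_unit: "rmod A \<Longrightarrow> mod_unit V H \<odot> A = A" "rmod A \<Longrightarrow> A \<odot> mod_unit V H = A"
  using mod_tensor_unit[of "fst A" "snd A"] by (simp_all only: prod.collapse)

lemma lin_tensor: "\<lbrakk>rmod A; rmod B; rmod A'; rmod B'; lin A f A'; lin B g B'\<rbrakk> \<Longrightarrow> lin (A \<odot> B) (f \<otimes>\<^sub>a g) (A' \<odot> B')"
  using H_linear_tensor[of "fst A" "snd A" "fst B" "snd B" "fst A'" "snd A'" "fst B'" "snd B'" f g] by (simp only: prod.collapse)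

lemma lin_comp: "\<lbrakk>rmod A; rmod B; rmod D; lin A f B; lin B g D\<rbrakk> \<Longrightarrow> lin A (g \<cdot> f) D"
  using H_linear_comp[of "fst A" "snd A" "fst B" "snd B" "fst D" "snd D" f g] by (simp only: prod.collapse)

lemma lin_hom: "lin A f B \<Longrightarrow> f \<in> Hom V (fst A) (fst B)"
  by (simp add: H_linear_def)

lemma fst_mod_unit [simp]: "fst (mod_unit V H) = \<^bold>1"
  by (simp add: mod_unit_def)

lemma fst_mod_dual [simp]: "fst (mod_ldual V H A) = ldual V (fst A)" "fst (mod_rdual V H A) = rdual V (fst A)"
  by (simp_all add: mod_ldual_def mod_rdual_def Let_def)

lemma mod_ldual:
  assumes "rmod A"
  shows "rmod (mod_ldual V H A)" "lin (mod_ldual V H A \<odot> A) (evl V (fst A)) (mod_unit V H)"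
    "lin (mod_unit V H) (coevl V (fst A)) (A \<odot> mod_ldual V H A)"
proof -
  define P where "P s \<longleftrightarrow> rmod (ldual V (fst A), s) \<and> lin ((ldual V (fst A), s) \<odot> A) (evl V (fst A)) (mod_unit V H)
    \<and> lin (mod_unit V H) (coevl V (fst A)) (A \<odot> (ldual V (fst A), s))" for s
  have "\<exists>!s. P s"
    unfolding P_def using ldual_action_ex1[of "fst A" "snd A"] assms by (simp only: prod.collapse)
  then have "P (THE s. P s)"
    by (rule theI')
  moreover have "mod_ldual V H A = (ldual V (fst A), THE s. P s)"
    unfolding mod_ldual_def Let_def P_def by (rule refl)
  ultimately show "rmod (mod_ldual V H A)" "lin (mod_ldual V H A \<odot> A) (evl V (fst A)) (mod_unit V H)"
    "lin (mod_unit V H) (coevl V (fst A)) (A \<odot> mod_ldual V H A)"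
    by (simp_all only: P_def)
qed

lemma mod_rdual:
  assumes "rmod A"
  shows "rmod (mod_rdual V H A)" "lin (A \<odot> mod_rdual V H A) (evr V (fst A)) (mod_unit V H)"
    "lin (mod_unit V H) (coevr V (fst A)) (mod_rdual V H A \<odot> A)"
proof -
  define P where "P s \<longleftrightarrow> rmod (rdual V (fst A), s) \<and> lin (A \<odot> (rdual V (fst A), s)) (evr V (fst A)) (mod_unit V H)
    \<and> lin (mod_unit V H) (coevr V (fst A)) ((rdual V (fst A), s) \<odot> A)" for s
  have "\<exists>!s. P s"
    unfolding P_def using rdual_action_ex1[of "fst A" "snd A"] assms by (simp only: prod.collapse)
  then have "P (THE s. P s)"
    by (rule theI')
  moreover have "mod_rdual V H A = (rdual V (fst A), THE s. P s)"
    unfolding mod_rdual_def Let_def P_def by (rule refl)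
  ultimately show "rmod (mod_rdual V H A)" "lin (A \<odot> mod_rdual V H A) (evr V (fst A)) (mod_unit V H)"
    "lin (mod_unit V H) (coevr V (fst A)) (mod_rdual V H A \<odot> A)"
    by (simp_all only: P_def)
qed

end

section \<open>The modules as a braided rigid category\<close>

context quasitriangular
begin

definition W where "W = qt_modules V C \<iota> H R"

abbreviation mc :: "'o \<times> 'm \<Rightarrow> 'o \<times> 'm \<Rightarrow> 'm" where
  "mc A B \<equiv> cbr (fst A) (snd A) (fst B) (snd B)"

lemma W_simps [simp]:
  "Ob W = {A. rmod A}" "Ar W = {(A, f, B). rmod A \<and> rmod B \<and> lin A f B}"
  "src W (A, f, B) = A" "tgt W (A, f, B) = B" "ident W A = (A, \<langle>fst A\<rangle>, A)"
  "cmp W (B', g, D) (A, f, B) = (A, g \<cdot> f, D)" "tensor_ob W = (\<odot>)"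
  "tensor_ar W (A, f, B) (A', f', B') = (A \<odot> A', f \<otimes>\<^sub>a f', B \<odot> B')" "unit_ob W = mod_unit V H"
  "braid W A B = (A \<odot> B, mc A B, B \<odot> A)" "ldual W A = mod_ldual V H A"
  "evl W A = (mod_ldual V H A \<odot> A, evl V (fst A), mod_unit V H)"
  "coevl W A = (mod_unit V H, coevl V (fst A), A \<odot> mod_ldual V H A)"
  "rdual W A = mod_rdual V H A"
  "evr W A = (A \<odot> mod_rdual V H A, evr V (fst A), mod_unit V H)"
  "coevr W A = (mod_unit V H, coevr V (fst A), mod_rdual V H A \<odot> A)"
  by (simp_all add: W_def qt_modules_def module_category_def)

lemma Hom_W: "F \<in> Hom W A B \<longleftrightarrow> (\<exists>f. F = (A, f, B) \<and> rmod A \<and> rmod B \<and> lin A f B)"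
  by (cases F) (auto simp: Hom_def)

lemma W_monoidal: "strict_monoidal_category W"
proof
  fix f assume "f \<in> Ar W"
  then show "src W f \<in> Ob W \<and> tgt W f \<in> Ob W"
    by (cases f) simp
next
  fix X assume "X \<in> Ob W"
  then show "ident W X \<in> Hom W X X"
    by (simp add: Hom_W H_linear_ident)
next
  fix f X Y g Z assume "f \<in> Hom W X Y" "g \<in> Hom W Y Z"
  then show "cmp W g f \<in> Hom W X Z"
    by (auto simp: Hom_W intro: lin_comp)
next
  fix f X Y assume "f \<in> Hom W X Y"
  then show "cmp W f (ident W X) = f \<and> cmp W (ident W Y) f = f"
    by (auto simp: Hom_W dest!: lin_hom cmp_ident)
next
  fix f X Y g Z h' U assume "f \<in> Hom W U X" "g \<in> Hom W X Y" "h' \<in> Hom W Y Z"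
  then show "cmp W (cmp W h' g) f = cmp W h' (cmp W g f)"
    by (auto simp: Hom_W dest!: lin_hom intro: cmp_assoc)
next
  show "unit_ob W \<in> Ob W"
    by (simp add: mod_unit_module)
next
  fix X Y assume "X \<in> Ob W" "Y \<in> Ob W"
  then show "tensor_ob W X Y \<in> Ob W"
    by (simp add: rmod_mt)
next
  fix X Y Z assume "X \<in> Ob W" "Y \<in> Ob W" "Z \<in> Ob W"
  then show "tensor_ob W (tensor_ob W X Y) Z = tensor_ob W X (tensor_ob W Y Z)"
    by (simp add: mt_assoc)
next
  fix X assume "X \<in> Ob W"
  then show "tensor_ob W (unit_ob W) X = X \<and> tensor_ob W X (unit_ob W) = X"
    by (simp add: mt_unit)
next
  fix f X Y g X' Y' assume "f \<in> Hom W X Y" "g \<in> Hom W X' Y'"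
  then show "tensor_ar W f g \<in> Hom W (tensor_ob W X X') (tensor_ob W Y Y')"
    by (auto simp: Hom_W intro: rmod_mt lin_tensor)
next
  fix X Y assume "X \<in> Ob W" "Y \<in> Ob W"
  then show "tensor_ar W (ident W X) (ident W Y) = ident W (tensor_ob W X Y)"
    by (simp add: tensor_ident)
next
  fix f X Y g Z f' X' Y' g' Z'
  assume "f \<in> Hom W X Y" "g \<in> Hom W Y Z" "f' \<in> Hom W X' Y'" "g' \<in> Hom W Y' Z'"
  then show "tensor_ar W (cmp W g f) (cmp W g' f') = cmp W (tensor_ar W g g') (tensor_ar W f f')"
    by (auto simp: Hom_W dest!: lin_hom intro: interchange)
next
  fix f g h' assume "f \<in> Ar W" "g \<in> Ar W" "h' \<in> Ar W"
  then show "tensor_ar W (tensor_ar W f g) h' = tensor_ar W f (tensor_ar W g h')"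
    by (auto simp: mt_assoc dest!: lin_hom hom_Ar intro: tensor_ar_assoc)
next
  fix f assume "f \<in> Ar W"
  then show "tensor_ar W (ident W (unit_ob W)) f = f \<and> tensor_ar W f (ident W (unit_ob W)) = f"
    by (auto simp: mt_unit dest!: lin_hom hom_Ar tensor_ar_unit)
qed

interpretation W: strict_monoidal_category W
  by (rule W_monoidal)

lemma mc_lin: "rmod A \<Longrightarrow> rmod B \<Longrightarrow> lin (A \<odot> B) (mc A B) (B \<odot> A)"
  using cbr_linear[of "fst A" "snd A" "fst B" "snd B"] typed_cbr[of "fst A" "snd A" "fst B" "snd B"]
  by (simp add: H_linear_def mt_eq typed_def tob_Cons tensor_ob_unit)

lemma mc_natural: "\<lbrakk>rmod A; rmod B; rmod A'; rmod B'; lin A f A'; lin B g B'\<rbrakk>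
    \<Longrightarrow> mc A' B' \<cdot> (f \<otimes>\<^sub>a g) = (g \<otimes>\<^sub>a f) \<cdot> mc A B"
  using cbr_natural[of "fst A" "snd A" "fst B" "snd B" "fst A'" "snd A'" "fst B'" "snd B'" f g] by (simp only: prod.collapse)

lemma mc_hexagon_left: "\<lbrakk>rmod A; rmod B; rmod D\<rbrakk> \<Longrightarrow>
    mc (A \<odot> B) D = (mc A D \<otimes>\<^sub>a \<langle>fst B\<rangle>) \<cdot> (\<langle>fst A\<rangle> \<otimes>\<^sub>a mc B D)"
  using cbr_hexagon_left[of "fst A" "snd A" "fst B" "snd B" "fst D" "snd D"]
  by (simp add: mt_eq)

lemma mc_hexagon_right: "\<lbrakk>rmod A; rmod B; rmod D\<rbrakk> \<Longrightarrow>
    mc A (B \<odot> D) = (\<langle>fst B\<rangle> \<otimes>\<^sub>a mc A D) \<cdot> (mc A B \<otimes>\<^sub>a \<langle>fst D\<rangle>)"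
  using cbr_hexagon_right[of "fst A" "snd A" "fst B" "snd B" "fst D" "snd D"]
  by (simp add: mt_eq)

lemma mc_unit: "rmod A \<Longrightarrow> mc (mod_unit V H) A = \<langle>fst A\<rangle>"
  using cbr_unit[of "fst A" "snd A"] by (simp add: mod_unit_def)

text \<open>\<open>R_matrix\<close> contains no inverse of \<open>R\<close>. Invertibility is
  deduced inside \<open>W\<close> from the left dual of \<open>A\<close>, using the hexagon and
  naturality along evaluation and coevaluation.\<close>

lemma mc_iso:
  assumes A: "rmod A" and B: "rmod B"
  shows "is_iso W (braid W A B)"
proof (rule W.half_braiding_iso[where L = "mod_ldual V H A" and e = "evl W A" and k = "coevl W A" and d = "braid W (mod_ldual V H A) B"])
  let ?L = "mod_ldual V H A"
  note L = mod_ldual[OF A]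
  note o = A B L(1) mod_unit_module
  show "A \<in> Ob W" "B \<in> Ob W" "?L \<in> Ob W" using A B L by simp_all
  show "W.typed (evl W A) [?L, A] []" "W.typed (coevl W A) [] [A, ?L]"
     "W.typed (braid W A B) [A, B] [B, A]" "W.typed (braid W ?L B) [?L, B] [B, ?L]"
    using o L mc_lin[OF A B] mc_lin[OF L(1) B]
    by (simp_all add: W.typed_def W.tob_Cons Hom_W mt_unit rmod_mt)
  show "cmp W (tensor_ar W (ident W A) (evl W A)) (tensor_ar W (coevl W A) (ident W A)) = ident W A"
    using o by (simp add: mt_unit mt_assoc snake_l1)
  \<comment> \<open>Naturality along the linear coevaluation; braiding with the unit module is
    trivial, so only whiskering remains on the right.\<close>
  have "mc (A \<odot> ?L) B \<cdot> (coevl V (fst A) \<otimes>\<^sub>a \<langle>fst B\<rangle>) = (\<langle>fst B\<rangle> \<otimes>\<^sub>a coevl V (fst A)) \<cdot> mc (mod_unit V H) B"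
    by (rule mc_natural) (use o L H_linear_ident[OF B] in \<open>simp_all add: rmod_mt\<close>)
  moreover have "\<langle>fst B\<rangle> \<otimes>\<^sub>a coevl V (fst A) \<in> Hom V (fst B) (fst B \<otimes>\<^sub>o fst A \<otimes>\<^sub>o ldual V (fst A))"
    using tensor_hom[OF ident_hom coevl_hom, of "fst B" "fst A"] A B by (simp add: tensor_ob_unit)
  ultimately have 1: "mc (A \<odot> ?L) B \<cdot> (coevl V (fst A) \<otimes>\<^sub>a \<langle>fst B\<rangle>) = \<langle>fst B\<rangle> \<otimes>\<^sub>a coevl V (fst A)"
    using cmp_ident mc_unit[OF B] by simp
  have "mc (mod_unit V H) B \<cdot> (evl V (fst A) \<otimes>\<^sub>a \<langle>fst B\<rangle>) = (\<langle>fst B\<rangle> \<otimes>\<^sub>a evl V (fst A)) \<cdot> mc (?L \<odot> A) B"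
    by (rule mc_natural) (use o L H_linear_ident[OF B] in \<open>simp_all add: rmod_mt\<close>)
  moreover have "evl V (fst A) \<otimes>\<^sub>a \<langle>fst B\<rangle> \<in> Hom V (ldual V (fst A) \<otimes>\<^sub>o fst A \<otimes>\<^sub>o fst B) (fst B)"
    using tensor_hom[OF evl_hom ident_hom, of "fst A" "fst B"] A B by (simp add: tensor_ob_unit tensor_ob_assoc)
  ultimately have 2: "evl V (fst A) \<otimes>\<^sub>a \<langle>fst B\<rangle> = (\<langle>fst B\<rangle> \<otimes>\<^sub>a evl V (fst A)) \<cdot> mc (?L \<odot> A) B"
    using cmp_ident mc_unit[OF B] by simp
  have h: "coevl V (fst A) \<otimes>\<^sub>a \<langle>fst B\<rangle> \<in> Hom V (fst B) (fst A \<otimes>\<^sub>o ldual V (fst A) \<otimes>\<^sub>o fst B)"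
    using tensor_hom[OF coevl_hom ident_hom, of "fst A" "fst B"] A B by (simp add: tensor_ob_unit tensor_ob_assoc)
  have hc: "mc A B \<in> Hom V (fst A \<otimes>\<^sub>o fst B) (fst B \<otimes>\<^sub>o fst A)" "mc ?L B \<in> Hom V (ldual V (fst A) \<otimes>\<^sub>o fst B) (fst B \<otimes>\<^sub>o ldual V (fst A))"
    using lin_hom[OF mc_lin[OF A B]] lin_hom[OF mc_lin[OF L(1) B]] by simp_all
  have h1: "\<langle>fst A\<rangle> \<otimes>\<^sub>a mc ?L B \<in> Hom V (fst A \<otimes>\<^sub>o ldual V (fst A) \<otimes>\<^sub>o fst B) (fst A \<otimes>\<^sub>o fst B \<otimes>\<^sub>o ldual V (fst A))"
    using tensor_hom[OF ident_hom hc(2), of "fst A"] A by simp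
  have h2: "mc A B \<otimes>\<^sub>a \<langle>ldual V (fst A)\<rangle> \<in> Hom V (fst A \<otimes>\<^sub>o fst B \<otimes>\<^sub>o ldual V (fst A)) (fst B \<otimes>\<^sub>o fst A \<otimes>\<^sub>o ldual V (fst A))"
    using tensor_hom[OF hc(1) ident_hom, of "ldual V (fst A)"] A B by (simp add: tensor_ob_assoc)
  show "cmp W (tensor_ar W (braid W A B) (ident W ?L)) (cmp W (tensor_ar W (ident W A) (braid W ?L B)) (tensor_ar W (coevl W A) (ident W B)))
       = tensor_ar W (ident W B) (coevl W A)"
    using o 1 cmp_assoc[OF h h1 h2] mc_hexagon_left[OF A L(1) B]
    by (simp add: mt_unit mt_assoc)
  show "cmp W (tensor_ar W (ident W B) (evl W A)) (cmp W (tensor_ar W (braid W ?L B) (ident W A)) (tensor_ar W (ident W ?L) (braid W A B)))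
       = tensor_ar W (evl W A) (ident W B)"
    using o 2 mc_hexagon_left[OF L(1) A B] by (simp add: mt_unit mt_assoc)
qed

text \<open>This makes the general results on pairings and Drinfeld morphisms available for modules,
  with \<open>\<nu>\<close> in the role of \<open>\<mu>\<close>.\<close>

lemma W_rigid: "braided_rigid_category W"
proof
  fix X Y assume a: "X \<in> Ob W" "Y \<in> Ob W"
  show "braid W X Y \<in> Hom W (tensor_ob W X Y) (tensor_ob W Y X)"
    using a by (simp add: Hom_W rmod_mt mc_lin)
  show "is_iso W (braid W X Y)"
    using a mc_iso by simp
next
  fix f X X' g Y Y' assume "f \<in> Hom W X X'" "g \<in> Hom W Y Y'"
  then show "cmp W (braid W X' Y') (tensor_ar W f g) = cmp W (tensor_ar W g f) (braid W X Y)"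
    by (auto simp: Hom_W intro: mc_natural)
next
  fix X Y Z assume a: "X \<in> Ob W" "Y \<in> Ob W" "Z \<in> Ob W"
  show "braid W (tensor_ob W X Y) Z = cmp W (tensor_ar W (braid W X Z) (ident W Y)) (tensor_ar W (ident W X) (braid W Y Z))"
    using a mc_hexagon_left[of X Y Z] by (simp add: mt_assoc)
  show "braid W X (tensor_ob W Y Z) = cmp W (tensor_ar W (ident W Y) (braid W X Z)) (tensor_ar W (braid W X Y) (ident W Z))"
    using a mc_hexagon_right[of X Y Z] by (simp add: mt_assoc)
next
  fix X assume "X \<in> Ob W"
  then have X: "rmod X" "fst X \<in> Ob V" by simp_all
  note d = mod_ldual[OF X(1)] mod_rdual[OF X(1)]
  note s = X d mod_unit_module mt_unit mt_assoc rmod_mt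
  show "ldual W X \<in> Ob W" "rdual W X \<in> Ob W"
    "evl W X \<in> Hom W (tensor_ob W (ldual W X) X) (unit_ob W)" "coevl W X \<in> Hom W (unit_ob W) (tensor_ob W X (ldual W X))"
    "evr W X \<in> Hom W (tensor_ob W X (rdual W X)) (unit_ob W)" "coevr W X \<in> Hom W (unit_ob W) (tensor_ob W (rdual W X) X)"
    by (simp_all add: Hom_W s)
  show "cmp W (tensor_ar W (ident W X) (evl W X)) (tensor_ar W (coevl W X) (ident W X)) = ident W X"
    "cmp W (tensor_ar W (evl W X) (ident W (ldual W X))) (tensor_ar W (ident W (ldual W X)) (coevl W X)) = ident W (ldual W X)"
    "cmp W (tensor_ar W (evr W X) (ident W X)) (tensor_ar W (ident W X) (coevr W X)) = ident W X"
    "cmp W (tensor_ar W (ident W (rdual W X)) (evr W X)) (tensor_ar W (coevr W X) (ident W (rdual W X))) = ident W (rdual W X)"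
    by (simp_all add: s snake_l1 snake_l2 snake_r1 snake_r2)
qed (unfold_locales)

end

section \<open>Pairings and the Drinfeld morphism\<close>

context braided_category
begin

text \<open>A pure braid identity: the double braiding unlinks the strands of \<open>M\<close> and
  \<open>N\<close>, and the nested pairing of the product becomes two separately braided pairings.
  It is stated for any braided category because \<open>u_tensor\<close> uses it for
  \<open>\<sigma>\<close> in \<open>V\<close> and for the R-matrix braiding in
  \<open>W\<close>.\<close>

lemma pairing_tensor:
  assumes o [simp]: "M \<in> Ob V" "N \<in> Ob V" "M' \<in> Ob V" "N' \<in> Ob V"
    and e: "typed e [M, M'] []" and e': "typed e' [N, N'] []"
  shows "(e \<cdot> (\<langle>M\<rangle> \<otimes>\<^sub>a e' \<otimes>\<^sub>a \<langle>M'\<rangle>)) \<cdot> \<sigma> (N' \<otimes>\<^sub>o M') (M \<otimes>\<^sub>o N) \<cdot> (\<langle>N' \<otimes>\<^sub>o M'\<rangle> \<otimes>\<^sub>a (\<sigma> N M \<cdot> \<sigma> M N))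
     = e' \<cdot> \<sigma> N' N \<cdot> (\<langle>N'\<rangle> \<otimes>\<^sub>a (e \<cdot> \<sigma> M' M) \<otimes>\<^sub>a \<langle>N\<rangle>)"
proof -
  note [den_intro] = e[THEN den_gen] e'[THEN den_gen]
  let ?K = "\<sigma> N M \<cdot> \<sigma> M N" and ?D = "N' \<otimes>\<^sub>o M'"
  \<comment> \<open>Naming the braided pairing hides its crossing, so that it slides past other
    wires as a single box.\<close>
  define f where "f = e' \<cdot> \<sigma> N' N"
  have f: "typed f [N', N] []" unfolding f_def by (rule den_typed, rule den_conv, (rule den_intro | (simp; fail))+)
  note [den_intro] = f[THEN den_gen]
  have fr: "has n [N', N] st \<Longrightarrow> app n [N', N] f [] st = app n [N, N'] e' [] (app n [N', N] (\<sigma> N' N) [N, N'] st)" for n st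
    by ((rule den_rule[OF f_def], (rule den_intro | (simp; fail))+)[1])
  have K: "?K \<in> Hom V (M \<otimes>\<^sub>o N) (M \<otimes>\<^sub>o N)"
    by (rule cmp_hom[OF braid_hom[OF o(1,2)] braid_hom[OF o(2,1)]])
  have "(e \<cdot> (\<langle>M\<rangle> \<otimes>\<^sub>a e' \<otimes>\<^sub>a \<langle>M'\<rangle>)) \<cdot> \<sigma> ?D (M \<otimes>\<^sub>o N) \<cdot> (\<langle>?D\<rangle> \<otimes>\<^sub>a ?K)
      = (e \<cdot> (\<langle>M\<rangle> \<otimes>\<^sub>a e' \<otimes>\<^sub>a \<langle>M'\<rangle>)) \<cdot> (?K \<otimes>\<^sub>a \<langle>?D\<rangle>) \<cdot> \<sigma> ?D (M \<otimes>\<^sub>o N)"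
    using braid_natural[OF ident_hom K, of ?D] by (simp add: tensor_closed)
  also have "\<dots> = (e \<cdot> (\<langle>M\<rangle> \<otimes>\<^sub>a e' \<otimes>\<^sub>a \<langle>M'\<rangle>)) \<cdot> (((?K \<otimes>\<^sub>a \<langle>N'\<rangle>) \<cdot> \<sigma> N' (M \<otimes>\<^sub>o N)) \<otimes>\<^sub>a \<langle>M'\<rangle>) \<cdot> (\<langle>N'\<rangle> \<otimes>\<^sub>a \<sigma> M' (M \<otimes>\<^sub>o N))"
    by (rule den_eqI, (rule den_intro | (simp; fail))+, (simp add: exch_right exch_left tyi e e' has_def shp_app shp_init)?)
  also have "(?K \<otimes>\<^sub>a \<langle>N'\<rangle>) \<cdot> \<sigma> N' (M \<otimes>\<^sub>o N) = \<sigma> N' (M \<otimes>\<^sub>o N) \<cdot> (\<langle>N'\<rangle> \<otimes>\<^sub>a ?K)"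
    using braid_natural[OF ident_hom[OF o(4)] K] by simp
  also have "(e \<cdot> (\<langle>M\<rangle> \<otimes>\<^sub>a e' \<otimes>\<^sub>a \<langle>M'\<rangle>)) \<cdot> ((\<sigma> N' (M \<otimes>\<^sub>o N) \<cdot> (\<langle>N'\<rangle> \<otimes>\<^sub>a ?K)) \<otimes>\<^sub>a \<langle>M'\<rangle>) \<cdot> (\<langle>N'\<rangle> \<otimes>\<^sub>a \<sigma> M' (M \<otimes>\<^sub>o N))
     = e \<cdot> (((\<langle>M\<rangle> \<otimes>\<^sub>a f) \<cdot> (\<sigma> N' M \<otimes>\<^sub>a \<langle>N\<rangle>) \<cdot> (\<langle>N'\<rangle> \<otimes>\<^sub>a \<sigma> N M)) \<otimes>\<^sub>a \<langle>M'\<rangle>) \<cdot> (\<langle>N'\<rangle> \<otimes>\<^sub>a \<sigma> M N \<otimes>\<^sub>a \<langle>M'\<rangle>) \<cdot> (\<langle>N'\<rangle> \<otimes>\<^sub>a \<sigma> M' (M \<otimes>\<^sub>o N))"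
    by (rule den_eqI, (rule den_intro | (simp; fail))+, (simp add: tyi e e' f fr has_def shp_app shp_init)?)
  also have "(\<langle>M\<rangle> \<otimes>\<^sub>a f) \<cdot> (\<sigma> N' M \<otimes>\<^sub>a \<langle>N\<rangle>) \<cdot> (\<langle>N'\<rangle> \<otimes>\<^sub>a \<sigma> N M) = f \<otimes>\<^sub>a \<langle>M\<rangle>"
    by (rule den_eqI, (rule den_intro | (simp; fail))+, simp add: tyi f natR0 has_def shp_app shp_init)
  also have "e \<cdot> ((f \<otimes>\<^sub>a \<langle>M\<rangle>) \<otimes>\<^sub>a \<langle>M'\<rangle>) \<cdot> (\<langle>N'\<rangle> \<otimes>\<^sub>a \<sigma> M N \<otimes>\<^sub>a \<langle>M'\<rangle>) \<cdot> (\<langle>N'\<rangle> \<otimes>\<^sub>a \<sigma> M' (M \<otimes>\<^sub>o N))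
     = f \<cdot> (\<langle>N'\<rangle> \<otimes>\<^sub>a ((\<langle>N\<rangle> \<otimes>\<^sub>a e) \<cdot> (\<sigma> M N \<otimes>\<^sub>a \<langle>M'\<rangle>) \<cdot> (\<langle>M\<rangle> \<otimes>\<^sub>a \<sigma> M' N))) \<cdot> (\<langle>N'\<rangle> \<otimes>\<^sub>a \<sigma> M' M \<otimes>\<^sub>a \<langle>N\<rangle>)"
    by (rule den_eqI, (rule den_intro | (simp; fail))+, (simp add: exch_right exch_left tyi e f has_def shp_app shp_init)?, (simp add: exch_right' exch_left' tyi e f has_def shp_app shp_init)?)
  also have "(\<langle>N\<rangle> \<otimes>\<^sub>a e) \<cdot> (\<sigma> M N \<otimes>\<^sub>a \<langle>M'\<rangle>) \<cdot> (\<langle>M\<rangle> \<otimes>\<^sub>a \<sigma> M' N) = e \<otimes>\<^sub>a \<langle>N\<rangle>"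
    by (rule den_eqI, (rule den_intro | (simp; fail))+, simp add: tyi e natR0 has_def shp_app shp_init)
  also have "f \<cdot> (\<langle>N'\<rangle> \<otimes>\<^sub>a (e \<otimes>\<^sub>a \<langle>N\<rangle>)) \<cdot> (\<langle>N'\<rangle> \<otimes>\<^sub>a \<sigma> M' M \<otimes>\<^sub>a \<langle>N\<rangle>) = e' \<cdot> \<sigma> N' N \<cdot> (\<langle>N'\<rangle> \<otimes>\<^sub>a (e \<cdot> \<sigma> M' M) \<otimes>\<^sub>a \<langle>N\<rangle>)"
    by (rule den_eqI, (rule den_intro | (simp; fail))+, (simp add: tyi e f fr has_def shp_app shp_init)?)
  finally show ?thesis .
qed

end

context braided_rigid_category
begin

lemma evr_cancel_left_hom:
  assumes X [simp]: "X \<in> Ob V" and f: "f \<in> Hom V Z X" "g \<in> Hom V Z X"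
    and e: "evr V X \<cdot> (f \<otimes>\<^sub>a \<langle>rdual V X\<rangle>) = evr V X \<cdot> (g \<otimes>\<^sub>a \<langle>rdual V X\<rangle>)"
  shows "f = g"
proof -
  have [simp]: "Z \<in> Ob V" using hom_Ob[OF f(1)] by simp
  have "f' = ((evr V X \<cdot> (f' \<otimes>\<^sub>a \<langle>rdual V X\<rangle>)) \<otimes>\<^sub>a \<langle>X\<rangle>) \<cdot> (\<langle>Z\<rangle> \<otimes>\<^sub>a coevr V X)" if "f' \<in> Hom V Z X" for f'
  proof -
    have t: "typed f' [Z] [X]" using that by (simp add: typed_def)
    note [den_intro] = t[THEN den_gen]
    show ?thesis by (rule den_eqI, (rule den_intro | (simp; fail))+, simp add: diag tyi t snakes)
  qed
  from this[OF f(1)] this[OF f(2)] show ?thesis using e by simp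
qed

lemma typed_drinfeld: "X \<in> Ob V \<Longrightarrow> typed (drinfeld V X) [X] [rdual V (rdual V X)]"
  unfolding drinfeld_def Let_def by (rule den_typed, rule den_conv, (rule den_intro | (simp; fail))+)

text \<open>By nondegeneracy this characterises the Drinfeld morphism, and later arguments use this
  equation in place of the definition: under the evaluation, the passage to the double dual is one
  crossing.\<close>

lemma drinfeld_evr:
  "X \<in> Ob V \<Longrightarrow> evr V (rdual V X) \<cdot> (\<langle>rdual V X\<rangle> \<otimes>\<^sub>a drinfeld V X) = evr V X \<cdot> \<sigma> (rdual V X) X"
  unfolding drinfeld_def Let_def by (rule den_eqI, (rule den_intro | (simp; fail))+, (simp add: diag tyi snakes)?, simp add: diag' tyi snakes)

lemma drinfeld_inverse:
  assumes X [simp]: "X \<in> Ob V"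
  shows "arr_inv V (drinfeld V X) \<in> Hom V (rdual V (rdual V X)) X"
    "arr_inv V (drinfeld V X) \<cdot> drinfeld V X = \<langle>X\<rangle>"
    "drinfeld V X \<cdot> arr_inv V (drinfeld V X) = \<langle>rdual V (rdual V X)\<rangle>"
proof -
  let ?D = "rdual V X" let ?X = "rdual V ?D"
  note t = typed_drinfeld[OF X]
  note [den_intro] = t[THEN den_gen]
  \<comment> \<open>The mirror image of \<open>drinfeld_evr\<close>: \<open>p\<close> is bent so
    that its pairing with the dual is the evaluation after an inverse crossing.\<close>
  define p where "p = ((evr V ?D \<cdot> ibr ?X ?D) \<otimes>\<^sub>a \<langle>X\<rangle>) \<cdot> (\<langle>?X\<rangle> \<otimes>\<^sub>a coevr V X)"
  have tensor_coprod: "typed p [?X] [X]" unfolding p_def by (rule den_typed, rule den_conv, (rule den_intro | (simp; fail))+)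
  note [den_intro] = tensor_coprod[THEN den_gen]
  have p: "evr V X \<cdot> (p \<otimes>\<^sub>a \<langle>?D\<rangle>) = evr V ?D \<cdot> ibr ?X ?D"
    unfolding p_def by (rule den_eqI, (rule den_intro | (simp; fail))+, simp add: diag tyi snakes)
  have pd: "p \<cdot> drinfeld V X \<in> Hom V X X" "drinfeld V X \<cdot> p \<in> Hom V ?X ?X"
    using t tensor_coprod cmp_hom by (simp_all add: typed_def)
  have "evr V X \<cdot> ((p \<cdot> drinfeld V X) \<otimes>\<^sub>a \<langle>?D\<rangle>) = (evr V X \<cdot> (p \<otimes>\<^sub>a \<langle>?D\<rangle>)) \<cdot> (drinfeld V X \<otimes>\<^sub>a \<langle>?D\<rangle>)"
    by (rule den_eqI, (rule den_intro | (simp; fail))+)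
  also have "\<dots> = (evr V ?D \<cdot> (\<langle>?D\<rangle> \<otimes>\<^sub>a drinfeld V X)) \<cdot> ibr X ?D"
    unfolding p by (rule den_eqI, (rule den_intro | (simp; fail))+, simp add: diag tyi t ibr_rules)
  also have "\<dots> = evr V X \<cdot> (\<langle>X\<rangle> \<otimes>\<^sub>a \<langle>?D\<rangle>)"
    unfolding drinfeld_evr[OF X] by (rule den_eqI, (rule den_intro | (simp; fail))+, simp add: diag tyi ibr_rules)
  finally have 1: "p \<cdot> drinfeld V X = \<langle>X\<rangle>"
    using evr_cancel_left_hom[OF X pd(1) ident_hom[OF X]] by simp
  have "evr V ?D \<cdot> (\<langle>?D\<rangle> \<otimes>\<^sub>a (drinfeld V X \<cdot> p)) = (evr V ?D \<cdot> (\<langle>?D\<rangle> \<otimes>\<^sub>a drinfeld V X)) \<cdot> (\<langle>?D\<rangle> \<otimes>\<^sub>a p)"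
    by (rule den_eqI, (rule den_intro | (simp; fail))+)
  also have "\<dots> = (evr V X \<cdot> (p \<otimes>\<^sub>a \<langle>?D\<rangle>)) \<cdot> \<sigma> ?D ?X"
    unfolding drinfeld_evr[OF X] by (rule den_eqI, (rule den_intro | (simp; fail))+, simp add: diag tyi tensor_coprod)
  also have "\<dots> = evr V ?D \<cdot> (\<langle>?D\<rangle> \<otimes>\<^sub>a \<langle>?X\<rangle>)"
    unfolding p by (rule den_eqI, (rule den_intro | (simp; fail))+, simp add: diag tyi ibr_rules)
  finally have 2: "drinfeld V X \<cdot> p = \<langle>?X\<rangle>"
    using evr_cancel_hom[OF _ pd(2) ident_hom] X by simp
  have h: "drinfeld V X \<in> Hom V X ?X" "p \<in> Hom V ?X X"
    using t tensor_coprod by (simp_all add: typed_def)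
  show "arr_inv V (drinfeld V X) \<in> Hom V ?X X"
    "arr_inv V (drinfeld V X) \<cdot> drinfeld V X = \<langle>X\<rangle>"
    "drinfeld V X \<cdot> arr_inv V (drinfeld V X) = \<langle>?X\<rangle>"
    using arr_inv_unique[OF h 1 2] h 1 2 by simp_all
qed

lemma typed_can: "X \<in> Ob V \<Longrightarrow> typed (can_lr V X) [ldual V (rdual V X)] [X]"
  "X \<in> Ob V \<Longrightarrow> typed (can_rl V X) [rdual V (ldual V X)] [X]"
  unfolding can_lr_def can_rl_def by (rule den_typed, rule den_conv, (rule den_intro | (simp; fail))+)+

text \<open>The canonical isomorphisms are the ones that match left and right evaluations. In this
  form they can be eliminated from any expression under an evaluation.\<close>

lemma can_pairing:
  "X \<in> Ob V \<Longrightarrow> evr V X \<cdot> (can_lr V X \<otimes>\<^sub>a \<langle>rdual V X\<rangle>) = evl V (rdual V X)"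
  "X \<in> Ob V \<Longrightarrow> evl V X \<cdot> (\<langle>ldual V X\<rangle> \<otimes>\<^sub>a can_rl V X) = evr V (ldual V X)"
  unfolding can_lr_def can_rl_def by (rule den_eqI, (rule den_intro | (simp; fail))+, (simp add: diag tyi snakes)?, (simp add: diag' tyi snakes)?, (simp add: diag tyi snakes)?)+

lemma can_inverse:
  assumes X [simp]: "X \<in> Ob V"
  shows "arr_inv V (can_lr V X) \<in> Hom V X (ldual V (rdual V X))" "can_lr V X \<cdot> arr_inv V (can_lr V X) = \<langle>X\<rangle>"
    "arr_inv V (can_rl V X) \<in> Hom V X (rdual V (ldual V X))" "can_rl V X \<cdot> arr_inv V (can_rl V X) = \<langle>X\<rangle>"
proof -
  let ?p = "(evr V X \<otimes>\<^sub>a \<langle>ldual V (rdual V X)\<rangle>) \<cdot> (\<langle>X\<rangle> \<otimes>\<^sub>a coevl V (rdual V X))"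
  let ?q = "(\<langle>rdual V (ldual V X)\<rangle> \<otimes>\<^sub>a evl V X) \<cdot> (coevr V (ldual V X) \<otimes>\<^sub>a \<langle>X\<rangle>)"
  have t: "typed ?p [X] [ldual V (rdual V X)]" "typed ?q [X] [rdual V (ldual V X)]"
    by (rule den_typed, rule den_conv, (rule den_intro | (simp; fail))+)+
  have 1: "?p \<cdot> can_lr V X = \<langle>ldual V (rdual V X)\<rangle>" "can_lr V X \<cdot> ?p = \<langle>X\<rangle>"
    unfolding can_lr_def by (rule den_eqI, (rule den_intro | (simp; fail))+, (simp add: app_exchange[where os = "[]" and it = "[]"] tyi has_def shp_app shp_init)?, (simp add: exch_right tyi snakes has_def shp_app shp_init)?)+
  have 2: "?q \<cdot> can_rl V X = \<langle>rdual V (ldual V X)\<rangle>" "can_rl V X \<cdot> ?q = \<langle>X\<rangle>"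
    unfolding can_rl_def by (rule den_eqI, (rule den_intro | (simp; fail))+, (simp add: app_exchange_left[where os = "[]" and it = "[]"] tyi has_def shp_app shp_init)?, (simp add: exch_left' tyi snakes has_def shp_app shp_init)?)+
  show "arr_inv V (can_lr V X) \<in> Hom V X (ldual V (rdual V X))" "can_lr V X \<cdot> arr_inv V (can_lr V X) = \<langle>X\<rangle>"
    using arr_inv_unique[of "can_lr V X" "ldual V (rdual V X)" X ?p] 1 t(1) typed_can(1)[OF X] by (simp_all add: typed_def)
  show "arr_inv V (can_rl V X) \<in> Hom V X (rdual V (ldual V X))" "can_rl V X \<cdot> arr_inv V (can_rl V X) = \<langle>X\<rangle>"
    using arr_inv_unique[of "can_rl V X" "rdual V (ldual V X)" X ?q] 2 t(2) typed_can(2)[OF X] by (simp_all add: typed_def)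
qed

lemma typed_c0:
  assumes X [simp]: "X \<in> Ob V"
  shows "typed (c0 V X) [X] [X]"
proof -
  note t = typed_drinfeld[of X] typed_drinfeld[of "rdual V X"] typed_can(1)[of X]
  have "typed (arr_inv V (can_lr V (rdual V (rdual V X)))) [rdual V (rdual V X)] [ldual V (rdual V (rdual V (rdual V X)))]"
    using can_inverse(1)[of "rdual V (rdual V X)"] by (simp add: typed_def)
  note t' = t[OF _] this ldual_arr_typed[OF t(2)]
  show ?thesis
    unfolding c0_def drinfeld_shriek_def using t' by (intro typed_cmp) (assumption | simp)+
qed

text \<open>c_0 contains two Drinfeld morphisms, one of \<open>X\<close> and, transposed, one of its
  dual. Under the evaluation each contributes a crossing of the same two strands.\<close>

lemma c0_evr:
  assumes X [simp]: "X \<in> Ob V"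
  shows "evr V X \<cdot> (c0 V X \<otimes>\<^sub>a \<langle>rdual V X\<rangle>) = evr V X \<cdot> \<sigma> (rdual V X) X \<cdot> \<sigma> X (rdual V X)"
proof -
  let ?D = "rdual V X" let ?X = "rdual V ?D" let ?Y = "rdual V ?X"
  define m m' i l where d: "m = drinfeld V X" "m' = drinfeld V ?D" "i = arr_inv V (can_lr V ?X)" "l = ldual_arr V m'"
  have t: "typed m [X] [?X]" "typed m' [?D] [?Y]" "typed (can_lr V X) [ldual V ?D] [X]" "typed i [?X] [ldual V ?Y]"
    "typed (can_lr V ?X) [ldual V ?Y] [?X]"
    using typed_drinfeld[of X] typed_drinfeld[of ?D] typed_can(1)[of X] typed_can(1)[of ?X] can_inverse(1)[of ?X]
    by (simp_all add: d typed_def)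
  have tl: "typed l [ldual V ?Y] [ldual V ?D]"
    unfolding d(4) by (rule ldual_arr_typed[OF t(2)])
  note [den_intro] = t[THEN den_gen] tl[THEN den_gen]
  have "evr V X \<cdot> (c0 V X \<otimes>\<^sub>a \<langle>?D\<rangle>) = (evr V X \<cdot> (can_lr V X \<otimes>\<^sub>a \<langle>?D\<rangle>)) \<cdot> ((l \<cdot> i \<cdot> m) \<otimes>\<^sub>a \<langle>?D\<rangle>)"
    unfolding c0_def drinfeld_shriek_def d[symmetric] by (rule den_eqI, (rule den_intro | (simp; fail))+)
  also have "\<dots> = (evl V ?D \<cdot> (l \<otimes>\<^sub>a \<langle>?D\<rangle>)) \<cdot> ((i \<cdot> m) \<otimes>\<^sub>a \<langle>?D\<rangle>)"
    unfolding can_pairing(1)[OF X] by (rule den_eqI, (rule den_intro | (simp; fail))+)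
  also have "\<dots> = evl V ?Y \<cdot> ((i \<cdot> m) \<otimes>\<^sub>a m')"
    unfolding d(4) ldual_arr_evl[OF t(2)] by (rule den_eqI, (rule den_intro | (simp; fail))+, simp add: diag tyi t)
  also have "\<dots> = (evr V ?X \<cdot> ((can_lr V ?X \<cdot> i) \<otimes>\<^sub>a \<langle>?Y\<rangle>)) \<cdot> (m \<otimes>\<^sub>a m')"
    using can_pairing(1)[of ?X, symmetric] by simp (rule den_eqI, (rule den_intro | (simp; fail))+)
  also have "\<dots> = (evr V ?X \<cdot> (\<langle>?X\<rangle> \<otimes>\<^sub>a m')) \<cdot> (m \<otimes>\<^sub>a \<langle>?D\<rangle>)"
    unfolding d(3) using can_inverse(2)[of ?X] by simp (rule den_eqI, (rule den_intro | (simp; fail))+, simp add: diag tyi t)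
  also have "\<dots> = (evr V ?D \<cdot> (\<langle>?D\<rangle> \<otimes>\<^sub>a m)) \<cdot> \<sigma> X ?D"
    unfolding d(2) using drinfeld_evr[of ?D] by simp (rule den_eqI, (rule den_intro | (simp; fail))+, simp add: diag tyi t)
  also have "\<dots> = evr V X \<cdot> \<sigma> ?D X \<cdot> \<sigma> X ?D"
    unfolding d(1) drinfeld_evr[OF X] by (rule den_eqI, (rule den_intro | (simp; fail))+)
  finally show ?thesis .
qed

text \<open>Every pairing \<open>X \<otimes> Z \<rightarrow> 1\<close> is the evaluation precomposed with an arrow into the dual, so
  \<open>c\<^sub>0\<close> can be read off any pairing.\<close>

lemma pairing_via_evr:
  assumes X [simp]: "X \<in> Ob V" and Z [simp]: "Z \<in> Ob V" and e: "typed e [X, Z] []"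
  shows "e = evr V X \<cdot> (\<langle>X\<rangle> \<otimes>\<^sub>a ((\<langle>rdual V X\<rangle> \<otimes>\<^sub>a e) \<cdot> (coevr V X \<otimes>\<^sub>a \<langle>Z\<rangle>)))"
proof -
  note [den_intro] = e[THEN den_gen]
  show ?thesis by (rule den_eqI, (rule den_intro | (simp; fail))+, (simp add: diag tyi e snakes)?, simp add: diag' tyi e snakes)
qed

lemma c0_pairing:
  assumes X [simp]: "X \<in> Ob V" and Z [simp]: "Z \<in> Ob V" and e: "typed e [X, Z] []"
  shows "e \<cdot> (c0 V X \<otimes>\<^sub>a \<langle>Z\<rangle>) = e \<cdot> \<sigma> Z X \<cdot> \<sigma> X Z"
proof -
  define p where "p = (\<langle>rdual V X\<rangle> \<otimes>\<^sub>a e) \<cdot> (coevr V X \<otimes>\<^sub>a \<langle>Z\<rangle>)"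
  note [den_intro] = e[THEN den_gen]
  have p: "typed p [Z] [rdual V X]" unfolding p_def by (rule den_typed, rule den_conv, (rule den_intro | (simp; fail))+)
  note t = typed_c0[OF X]
  note [den_intro] = p[THEN den_gen] t[THEN den_gen]
  have ep: "e = evr V X \<cdot> (\<langle>X\<rangle> \<otimes>\<^sub>a p)" unfolding p_def by (rule pairing_via_evr[OF X Z e])
  have "e \<cdot> (c0 V X \<otimes>\<^sub>a \<langle>Z\<rangle>) = (evr V X \<cdot> (c0 V X \<otimes>\<^sub>a \<langle>rdual V X\<rangle>)) \<cdot> (\<langle>X\<rangle> \<otimes>\<^sub>a p)"
    unfolding ep by (rule den_eqI, (rule den_intro | (simp; fail))+, simp add: diag tyi p t)
  also have "\<dots> = e \<cdot> \<sigma> Z X \<cdot> \<sigma> X Z"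
    unfolding c0_evr[OF X] ep by (rule den_eqI, (rule den_intro | (simp; fail))+, simp add: diag tyi p)
  finally show ?thesis .
qed

text \<open>Precomposing with a crossing moves \<open>X\<close> to the left, where
  \<open>c0_pairing\<close> applies; the crossing is undone at the end.\<close>

lemma c0_pairing_right:
  assumes X [simp]: "X \<in> Ob V" and Z [simp]: "Z \<in> Ob V" and e: "typed e [Z, X] []"
  shows "e \<cdot> (\<langle>Z\<rangle> \<otimes>\<^sub>a c0 V X) = e \<cdot> \<sigma> X Z \<cdot> \<sigma> Z X"
proof -
  note t = typed_c0[OF X]
  note [den_intro] = e[THEN den_gen] t[THEN den_gen]
  define f where "f = e \<cdot> \<sigma> X Z"
  have f: "typed f [X, Z] []" unfolding f_def by (rule den_typed, rule den_conv, (rule den_intro | (simp; fail))+)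
  have "e \<cdot> (\<langle>Z\<rangle> \<otimes>\<^sub>a c0 V X) = (f \<cdot> (c0 V X \<otimes>\<^sub>a \<langle>Z\<rangle>)) \<cdot> ibr Z X"
    unfolding f_def by (rule den_eqI, (rule den_intro | (simp; fail))+, simp add: diag tyi t e ibr_rules)
  also have "\<dots> = e \<cdot> \<sigma> X Z \<cdot> \<sigma> Z X"
    unfolding c0_pairing[OF X Z f] unfolding f_def by (rule den_eqI, (rule den_intro | (simp; fail))+, simp add: diag tyi e ibr_r)
  finally show ?thesis .
qed

text \<open>Naturality is invisible in the definition, which mixes several duals. Under a pairing it
  is naturality of the double braiding.\<close>

lemma c0_natural:
  assumes f: "f \<in> Hom V X Y"
  shows "c0 V Y \<cdot> f = f \<cdot> c0 V X"
proof -
  have [simp]: "X \<in> Ob V" "Y \<in> Ob V" and t: "typed f [X] [Y]" using f hom_Ob by (auto simp: typed_def)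
  note tc = typed_c0[of X] typed_c0[of Y]
  note [den_intro] = t[THEN den_gen] tc[THEN den_gen]
  let ?D = "rdual V Y"
  let ?e = "evr V Y \<cdot> (f \<otimes>\<^sub>a \<langle>?D\<rangle>)"
  have te: "typed ?e [X, ?D] []" by (rule den_typed, rule den_conv, (rule den_intro | (simp; fail))+)
  have "evr V Y \<cdot> ((c0 V Y \<cdot> f) \<otimes>\<^sub>a \<langle>?D\<rangle>) = (evr V Y \<cdot> (c0 V Y \<otimes>\<^sub>a \<langle>?D\<rangle>)) \<cdot> (f \<otimes>\<^sub>a \<langle>?D\<rangle>)"
    by (rule den_eqI, (rule den_intro | (simp; fail))+)
  also have "\<dots> = ?e \<cdot> \<sigma> ?D X \<cdot> \<sigma> X ?D"
    using c0_evr[of Y] by simp (rule den_eqI, (rule den_intro | (simp; fail))+, simp add: diag tyi t)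
  also have "\<dots> = ?e \<cdot> (c0 V X \<otimes>\<^sub>a \<langle>?D\<rangle>)"
    using c0_pairing[OF _ _ te] by simp
  also have "\<dots> = evr V Y \<cdot> ((f \<cdot> c0 V X) \<otimes>\<^sub>a \<langle>?D\<rangle>)"
    by (rule den_eqI, (rule den_intro | (simp; fail))+)
  finally have eq: "evr V Y \<cdot> ((c0 V Y \<cdot> f) \<otimes>\<^sub>a \<langle>?D\<rangle>) = evr V Y \<cdot> ((f \<cdot> c0 V X) \<otimes>\<^sub>a \<langle>?D\<rangle>)" .
  have "c0 V X \<in> Hom V X X" "c0 V Y \<in> Hom V Y Y"
    using tc by (simp_all add: typed_def)
  then show ?thesis
    using evr_cancel_left_hom[OF _ cmp_hom[OF f] cmp_hom[OF _ f] eq] by simp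
qed

lemma c0_iso:
  assumes X [simp]: "X \<in> Ob V"
  obtains d where "typed d [X] [X]" "c0 V X \<cdot> d = \<langle>X\<rangle>" "d \<cdot> c0 V X = \<langle>X\<rangle>"
proof -
  let ?D = "rdual V X"
  note tc = typed_c0[OF X]
  note [den_intro] = tc[THEN den_gen]
  \<comment> \<open>The candidate inverse is bent from the evaluation after the inverse double
    braiding, the inverse counterpart of \<open>c0_evr\<close>.\<close>
  define d where "d = ((evr V X \<cdot> ibr ?D X \<cdot> ibr X ?D) \<otimes>\<^sub>a \<langle>X\<rangle>) \<cdot> (\<langle>X\<rangle> \<otimes>\<^sub>a coevr V X)"
  have td: "typed d [X] [X]" unfolding d_def by (rule den_typed, rule den_conv, (rule den_intro | (simp; fail))+)
  note [den_intro] = td[THEN den_gen]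
  have ed: "evr V X \<cdot> (d \<otimes>\<^sub>a \<langle>?D\<rangle>) = evr V X \<cdot> ibr ?D X \<cdot> ibr X ?D"
    unfolding d_def by (rule den_eqI, (rule den_intro | (simp; fail))+, simp add: diag tyi snakes)
  have h: "c0 V X \<cdot> d \<in> Hom V X X" "d \<cdot> c0 V X \<in> Hom V X X"
    using td tc cmp_hom by (simp_all add: typed_def)
  have "evr V X \<cdot> ((c0 V X \<cdot> d) \<otimes>\<^sub>a \<langle>?D\<rangle>) = (evr V X \<cdot> (c0 V X \<otimes>\<^sub>a \<langle>?D\<rangle>)) \<cdot> (d \<otimes>\<^sub>a \<langle>?D\<rangle>)"
    by (rule den_eqI, (rule den_intro | (simp; fail))+)
  also have "\<dots> = (evr V X \<cdot> (d \<otimes>\<^sub>a \<langle>?D\<rangle>)) \<cdot> \<sigma> ?D X \<cdot> \<sigma> X ?D"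
    unfolding c0_evr[OF X] by (rule den_eqI, (rule den_intro | (simp; fail))+, simp add: diag tyi td)
  also have "\<dots> = evr V X \<cdot> (\<langle>X\<rangle> \<otimes>\<^sub>a \<langle>?D\<rangle>)"
    unfolding ed by (rule den_eqI, (rule den_intro | (simp; fail))+, simp add: diag tyi ibr_r)
  finally have 1: "c0 V X \<cdot> d = \<langle>X\<rangle>"
    using evr_cancel_left_hom[OF X h(1) ident_hom[OF X]] by simp
  have "evr V X \<cdot> ((d \<cdot> c0 V X) \<otimes>\<^sub>a \<langle>?D\<rangle>) = (evr V X \<cdot> (d \<otimes>\<^sub>a \<langle>?D\<rangle>)) \<cdot> (c0 V X \<otimes>\<^sub>a \<langle>?D\<rangle>)"
    by (rule den_eqI, (rule den_intro | (simp; fail))+)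
  also have "\<dots> = (evr V X \<cdot> (c0 V X \<otimes>\<^sub>a \<langle>?D\<rangle>)) \<cdot> ibr ?D X \<cdot> ibr X ?D"
    unfolding ed by (rule den_eqI, (rule den_intro | (simp; fail))+, simp add: diag tyi tc ibr_rules)
  also have "\<dots> = evr V X \<cdot> (\<langle>X\<rangle> \<otimes>\<^sub>a \<langle>?D\<rangle>)"
    unfolding c0_evr[OF X] by (rule den_eqI, (rule den_intro | (simp; fail))+, simp add: diag tyi ibr_r)
  finally have 2: "d \<cdot> c0 V X = \<langle>X\<rangle>"
    using evr_cancel_left_hom[OF X h(2) ident_hom[OF X]] by simp
  show ?thesis using that td 1 2 .
qed

end

section \<open>Structure arrows of the coend\<close>

context coend
begin

lemma coend_eqI1:
  assumes f: "f \<in> Hom V C D" "g \<in> Hom V C D"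
    and eq: "\<And>X. X \<in> Ob V \<Longrightarrow> (\<langle>X\<rangle> \<otimes>\<^sub>a f) \<cdot> \<delta> X = (\<langle>X\<rangle> \<otimes>\<^sub>a g) \<cdot> \<delta> X"
  shows "f = g"
proof (rule coend_eqI[OF unit_closed])
  show "f \<in> Hom V (C \<otimes>\<^sub>o \<^bold>1) D" "g \<in> Hom V (C \<otimes>\<^sub>o \<^bold>1) D"
    using f by (simp_all add: tensor_ob_unit)
  fix X assume X: "X \<in> Ob V"
  have "\<delta> X \<in> Ar V"
    using den_hom[OF den_gen[OF typed_delta[OF X]]] by (rule hom_Ar)
  then show "(\<langle>X\<rangle> \<otimes>\<^sub>a f) \<cdot> (\<delta> X \<otimes>\<^sub>a \<langle>\<^bold>1\<rangle>) = (\<langle>X\<rangle> \<otimes>\<^sub>a g) \<cdot> (\<delta> X \<otimes>\<^sub>a \<langle>\<^bold>1\<rangle>)"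
    using eq[OF X] by (simp add: tensor_ar_unit)
qed

text \<open>The case of trivial parameter in \<open>coend_ex\<close>; uniqueness from
  \<open>coend_eqI1\<close> justifies the description in \<open>from_nat\<close>.\<close>

lemma from_nat:
  assumes D: "D \<in> Ob V" and h: "\<And>X. X \<in> Ob V \<Longrightarrow> h X \<in> Hom V X (X \<otimes>\<^sub>o D)"
    and nat: "\<And>X Y f. f \<in> Hom V X Y \<Longrightarrow> h Y \<cdot> f = (f \<otimes>\<^sub>a \<langle>D\<rangle>) \<cdot> h X"
  shows "from_nat V C \<iota> D h \<in> Hom V C D"
    and "\<And>X. X \<in> Ob V \<Longrightarrow> (\<langle>X\<rangle> \<otimes>\<^sub>a from_nat V C \<iota> D h) \<cdot> \<delta> X = h X"
proof -
  have "\<exists>f. f \<in> Hom V (C \<otimes>\<^sub>o \<^bold>1) D \<and> (\<forall>X \<in> Ob V. (\<langle>X\<rangle> \<otimes>\<^sub>a f) \<cdot> (\<delta> X \<otimes>\<^sub>a \<langle>\<^bold>1\<rangle>) = h X)"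
  proof (rule coend_ex[OF unit_closed D])
    fix X assume "X \<in> Ob V"
    then show "h X \<in> Hom V (X \<otimes>\<^sub>o \<^bold>1) (X \<otimes>\<^sub>o D)"
      using h by (simp add: tensor_ob_unit)
  next
    fix X Y f assume f: "f \<in> Hom V X Y"
    then show "h Y \<cdot> (f \<otimes>\<^sub>a \<langle>\<^bold>1\<rangle>) = (f \<otimes>\<^sub>a \<langle>D\<rangle>) \<cdot> h X"
      using nat[OF f] by (simp add: tensor_ar_unit hom_Ar[OF f])
  qed
  then obtain f where f: "f \<in> Hom V C D" and f2: "\<And>X. X \<in> Ob V \<Longrightarrow> (\<langle>X\<rangle> \<otimes>\<^sub>a f) \<cdot> (\<delta> X \<otimes>\<^sub>a \<langle>\<^bold>1\<rangle>) = h X"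
    by (auto simp: tensor_ob_unit)
  have f3: "(\<langle>X\<rangle> \<otimes>\<^sub>a f) \<cdot> \<delta> X = h X" if "X \<in> Ob V" for X
    using f2[OF that] hom_Ar[OF den_hom[OF den_gen[OF typed_delta[OF that]]]] by (simp add: tensor_ar_unit)
  have "from_nat V C \<iota> D h = f"
    unfolding from_nat_def
  proof (rule the_equality)
    show "f \<in> Hom V C D \<and> (\<forall>X\<in>Ob V. (\<langle>X\<rangle> \<otimes>\<^sub>a f) \<cdot> \<delta> X = h X)"
      using f f3 by simp
    fix g assume "g \<in> Hom V C D \<and> (\<forall>X\<in>Ob V. (\<langle>X\<rangle> \<otimes>\<^sub>a g) \<cdot> \<delta> X = h X)"
    then show "g = f"
      using f f3 by (intro coend_eqI1[of g D f]) simp_all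
  qed
  then show "from_nat V C \<iota> D h \<in> Hom V C D"
    "\<And>X. X \<in> Ob V \<Longrightarrow> (\<langle>X\<rangle> \<otimes>\<^sub>a from_nat V C \<iota> D h) \<cdot> \<delta> X = h X"
    using f f3 by simp_all
qed

abbreviation "\<delta>2 \<equiv> delta2 V C \<iota>"

text \<open>Crossing the first copy of \<open>C\<close> over turns the second coaction into the form
  \<open>\<delta> Y \<otimes> C\<close>, to which the universal property with parameter
  \<open>C\<close> applies.\<close>

lemma braid_delta:
  assumes [simp]: "Y \<in> Ob V" and f: "typed f [C, C] [D]"
  shows "(\<langle>Y\<rangle> \<otimes>\<^sub>a (f \<cdot> \<sigma> C C)) \<cdot> (\<sigma> C Y \<otimes>\<^sub>a \<langle>C\<rangle>) \<cdot> (\<langle>C\<rangle> \<otimes>\<^sub>a \<delta> Y) = (\<langle>Y\<rangle> \<otimes>\<^sub>a f) \<cdot> (\<delta> Y \<otimes>\<^sub>a \<langle>C\<rangle>) \<cdot> \<sigma> C Y"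
proof -
  note [den_intro] = f[THEN den_gen]
  show ?thesis by (rule den_eqI, (rule den_intro | (simp; fail))+, simp add: diag tyi f)
qed

lemma delta2_factor:
  assumes [simp]: "X \<in> Ob V" "Y \<in> Ob V" and f: "typed f [C, C] [D]"
  shows "(\<langle>X \<otimes>\<^sub>o Y\<rangle> \<otimes>\<^sub>a f) \<cdot> \<delta>2 X Y = (\<langle>X\<rangle> \<otimes>\<^sub>a ((\<langle>Y\<rangle> \<otimes>\<^sub>a f) \<cdot> (\<sigma> C Y \<otimes>\<^sub>a \<langle>C\<rangle>) \<cdot> (\<langle>C\<rangle> \<otimes>\<^sub>a \<delta> Y))) \<cdot> (\<delta> X \<otimes>\<^sub>a \<langle>Y\<rangle>)"
proof -
  note [den_intro] = f[THEN den_gen]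
  show ?thesis unfolding delta2_def by (rule den_eqI, (rule den_intro | (simp; fail))+, simp add: diag tyi f)
qed

text \<open>Two applications of \<open>coend_eqI\<close>: first in \<open>X\<close> with parameter
  \<open>Y\<close>, then, after \<open>braid_delta\<close>, in \<open>Y\<close> with parameter
  \<open>C\<close>. The inverse crossing is cancelled at the end.\<close>

lemma coend2_eqI:
  assumes f: "f \<in> Hom V (C \<otimes>\<^sub>o C) D" "g \<in> Hom V (C \<otimes>\<^sub>o C) D"
    and eq: "\<And>X Y. X \<in> Ob V \<Longrightarrow> Y \<in> Ob V \<Longrightarrow> (\<langle>X \<otimes>\<^sub>o Y\<rangle> \<otimes>\<^sub>a f) \<cdot> \<delta>2 X Y = (\<langle>X \<otimes>\<^sub>o Y\<rangle> \<otimes>\<^sub>a g) \<cdot> \<delta>2 X Y"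
  shows "f = g"
proof -
  have D [simp]: "D \<in> Ob V" using hom_Ob[OF f(1)] by simp
  have t: "typed f [C,C] [D]" "typed g [C,C] [D]"
    using f by (simp_all add: typed_def tob_Cons tensor_ob_unit)
  note [den_intro] = t[THEN den_gen]
  define F where "F f Y = (\<langle>Y\<rangle> \<otimes>\<^sub>a f) \<cdot> (\<sigma> C Y \<otimes>\<^sub>a \<langle>C\<rangle>) \<cdot> (\<langle>C\<rangle> \<otimes>\<^sub>a \<delta> Y)" for f Y
  have tF: "typed (F f' Y) [C,Y] [Y,D]" if "typed f' [C,C] [D]" and [simp]: "Y \<in> Ob V" for f' Y
  proof -
    note [den_intro] = that(1)[THEN den_gen]
    show ?thesis unfolding F_def by (rule den_typed, rule den_conv, (rule den_intro | (simp; fail))+)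
  qed
  have FF: "F f Y = F g Y" if Y [simp]: "Y \<in> Ob V" for Y
  proof (rule coend_eqI[OF Y])
    show "F f Y \<in> Hom V (C \<otimes>\<^sub>o Y) (Y \<otimes>\<^sub>o D)" "F g Y \<in> Hom V (C \<otimes>\<^sub>o Y) (Y \<otimes>\<^sub>o D)"
      using tF[OF t(1) Y] tF[OF t(2) Y] by (simp_all add: typed_def tob_Cons tensor_ob_unit)
    fix X assume X: "X \<in> Ob V"
    show "(\<langle>X\<rangle> \<otimes>\<^sub>a F f Y) \<cdot> (\<delta> X \<otimes>\<^sub>a \<langle>Y\<rangle>) = (\<langle>X\<rangle> \<otimes>\<^sub>a F g Y) \<cdot> (\<delta> X \<otimes>\<^sub>a \<langle>Y\<rangle>)"
      using eq[OF X Y] delta2_factor[OF X Y t(1)] delta2_factor[OF X Y t(2)] unfolding F_def by simp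
  qed
  have key: "(\<langle>Y\<rangle> \<otimes>\<^sub>a (f' \<cdot> ibr C C)) \<cdot> (\<delta> Y \<otimes>\<^sub>a \<langle>C\<rangle>) = F f' Y \<cdot> ibr Y C" if t: "typed f' [C,C] [D]" and Y [simp]: "Y \<in> Ob V" for f' Y
  proof -
    note [den_intro] = t[THEN den_gen]
    have t2: "typed (f' \<cdot> ibr C C) [C,C] [D]" by (rule den_typed, rule den_conv, (rule den_intro | (simp; fail))+)
    have "F f' Y = (\<langle>Y\<rangle> \<otimes>\<^sub>a ((f' \<cdot> ibr C C) \<cdot> \<sigma> C C)) \<cdot> (\<sigma> C Y \<otimes>\<^sub>a \<langle>C\<rangle>) \<cdot> (\<langle>C\<rangle> \<otimes>\<^sub>a \<delta> Y)"
      unfolding F_def by (rule den_eqI, (rule den_intro | (simp; fail))+, (simp add: t tyi ibr_r has_def shp_app shp_init)?)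
    then have "F f' Y = (\<langle>Y\<rangle> \<otimes>\<^sub>a (f' \<cdot> ibr C C)) \<cdot> (\<delta> Y \<otimes>\<^sub>a \<langle>C\<rangle>) \<cdot> \<sigma> C Y"
      unfolding braid_delta[OF Y t2] .
    then show ?thesis
      by simp (rule den_eqI, (rule den_intro | (simp; fail))+, (simp add: t tyi ibr_r has_def shp_app shp_init)?)
  qed
  have "f \<cdot> ibr C C = g \<cdot> ibr C C"
  proof (rule coend_eqI[OF C_closed])
    show "f \<cdot> ibr C C \<in> Hom V (C \<otimes>\<^sub>o C) D" "g \<cdot> ibr C C \<in> Hom V (C \<otimes>\<^sub>o C) D"
      using f ibr(1)[of C C] cmp_hom by auto
    show "(\<langle>X\<rangle> \<otimes>\<^sub>a (f \<cdot> ibr C C)) \<cdot> (\<delta> X \<otimes>\<^sub>a \<langle>C\<rangle>) = (\<langle>X\<rangle> \<otimes>\<^sub>a (g \<cdot> ibr C C)) \<cdot> (\<delta> X \<otimes>\<^sub>a \<langle>C\<rangle>)" if "X \<in> Ob V" for X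
      using key[OF t(1) that] key[OF t(2) that] FF[OF that] by simp
  qed
  then show ?thesis
    by (rule cancel_epi[where t = "ibr C C" and t' = "\<sigma> C C" and Y = "C \<otimes>\<^sub>o C" and X = "C \<otimes>\<^sub>o C"])
      (use f ibr[of C C] braid_hom[of C C] in simp_all)
qed

text \<open>The same two stages for existence: \<open>coend_ex\<close> in \<open>X\<close> yields an
  arrow \<open>G Y\<close> for each \<open>Y\<close>, and \<open>coend_ex\<close> in
  \<open>Y\<close>, applied to \<open>G Y\<close> after an inverse crossing, yields the arrow on
  \<open>C \<otimes> C\<close> up to a braiding.\<close>

lemma coend2_ex:
  assumes D [simp]: "D \<in> Ob V"
    and k: "\<And>X Y. X \<in> Ob V \<Longrightarrow> Y \<in> Ob V \<Longrightarrow> k X Y \<in> Hom V (X \<otimes>\<^sub>o Y) (X \<otimes>\<^sub>o Y \<otimes>\<^sub>o D)"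
    and nat: "\<And>X X' Y Y' f g. f \<in> Hom V X X' \<Longrightarrow> g \<in> Hom V Y Y' \<Longrightarrow>
       k X' Y' \<cdot> (f \<otimes>\<^sub>a g) = (f \<otimes>\<^sub>a g \<otimes>\<^sub>a \<langle>D\<rangle>) \<cdot> k X Y"
  shows "\<exists>f. f \<in> Hom V (C \<otimes>\<^sub>o C) D \<and> (\<forall>X \<in> Ob V. \<forall>Y \<in> Ob V. (\<langle>X \<otimes>\<^sub>o Y\<rangle> \<otimes>\<^sub>a f) \<cdot> \<delta>2 X Y = k X Y)"
proof -
  have "\<exists>g. g \<in> Hom V (C \<otimes>\<^sub>o Y) (Y \<otimes>\<^sub>o D) \<and> (\<forall>X \<in> Ob V. (\<langle>X\<rangle> \<otimes>\<^sub>a g) \<cdot> (\<delta> X \<otimes>\<^sub>a \<langle>Y\<rangle>) = k X Y)" if Y: "Y \<in> Ob V" for Y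
  proof (rule coend_ex[OF Y tensor_closed[OF Y D]])
    show "k X Y \<in> Hom V (X \<otimes>\<^sub>o Y) (X \<otimes>\<^sub>o Y \<otimes>\<^sub>o D)" if "X \<in> Ob V" for X
      using k that Y by simp
    show "k X' Y \<cdot> (f \<otimes>\<^sub>a \<langle>Y\<rangle>) = (f \<otimes>\<^sub>a \<langle>Y \<otimes>\<^sub>o D\<rangle>) \<cdot> k X Y" if "f \<in> Hom V X X'" for X X' f
      using nat[OF that ident_hom[OF Y]] Y by (simp add: tensor_ident)
  qed
  then obtain G where G: "\<And>Y. Y \<in> Ob V \<Longrightarrow> G Y \<in> Hom V (C \<otimes>\<^sub>o Y) (Y \<otimes>\<^sub>o D)"
    and Gk: "\<And>X Y. X \<in> Ob V \<Longrightarrow> Y \<in> Ob V \<Longrightarrow> (\<langle>X\<rangle> \<otimes>\<^sub>a G Y) \<cdot> (\<delta> X \<otimes>\<^sub>a \<langle>Y\<rangle>) = k X Y"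
    by metis
  have tG: "typed (G Y) [C,Y] [Y,D]" if "Y \<in> Ob V" for Y
    using G[OF that] that by (simp add: typed_def tob_Cons tensor_ob_unit)
  have tk: "typed (k X Y) [X,Y] [X,Y,D]" if "X \<in> Ob V" "Y \<in> Ob V" for X Y
    using k[OF that] that by (simp add: typed_def tob_Cons tensor_ob_unit)
  note [den_intro] = tG[THEN den_gen] tk[THEN den_gen]
  \<comment> \<open>The arrows \<open>G Y\<close> were chosen one by one; their naturality in
    \<open>Y\<close> is a consequence of uniqueness.\<close>
  have Gnat: "G Y' \<cdot> (\<langle>C\<rangle> \<otimes>\<^sub>a g) = (g \<otimes>\<^sub>a \<langle>D\<rangle>) \<cdot> G Y" if g: "g \<in> Hom V Y Y'" for g Y Y'
  proof -
    have [simp]: "Y \<in> Ob V" "Y' \<in> Ob V" and t: "typed g [Y] [Y']" using g hom_Ob by (auto simp: typed_def)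
    note [den_intro] = t[THEN den_gen]
    have tt: "typed (G Y' \<cdot> (\<langle>C\<rangle> \<otimes>\<^sub>a g)) [C,Y] [Y',D]" "typed ((g \<otimes>\<^sub>a \<langle>D\<rangle>) \<cdot> G Y) [C,Y] [Y',D]"
      by (rule den_typed, rule den_conv, (rule den_intro | (simp; fail))+)+
    show ?thesis
    proof (rule coend_eqI[where Z = Y and D = "Y' \<otimes>\<^sub>o D"])
      show "G Y' \<cdot> (\<langle>C\<rangle> \<otimes>\<^sub>a g) \<in> Hom V (C \<otimes>\<^sub>o Y) (Y' \<otimes>\<^sub>o D)" "(g \<otimes>\<^sub>a \<langle>D\<rangle>) \<cdot> G Y \<in> Hom V (C \<otimes>\<^sub>o Y) (Y' \<otimes>\<^sub>o D)"
        using tt by (simp_all add: typed_def tob_Cons tensor_ob_unit)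
      fix X assume X [simp]: "X \<in> Ob V"
      have "(\<langle>X\<rangle> \<otimes>\<^sub>a (G Y' \<cdot> (\<langle>C\<rangle> \<otimes>\<^sub>a g))) \<cdot> (\<delta> X \<otimes>\<^sub>a \<langle>Y\<rangle>) = ((\<langle>X\<rangle> \<otimes>\<^sub>a G Y') \<cdot> (\<delta> X \<otimes>\<^sub>a \<langle>Y'\<rangle>)) \<cdot> (\<langle>X\<rangle> \<otimes>\<^sub>a g)"
        by (rule den_eqI, (rule den_intro | (simp; fail))+, simp add: diag tyi tG t)
      also have "\<dots> = (\<langle>X\<rangle> \<otimes>\<^sub>a g \<otimes>\<^sub>a \<langle>D\<rangle>) \<cdot> ((\<langle>X\<rangle> \<otimes>\<^sub>a G Y) \<cdot> (\<delta> X \<otimes>\<^sub>a \<langle>Y\<rangle>))"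
        using nat[OF ident_hom[OF X] g] Gk[of X Y] Gk[of X Y'] by simp
      also have "\<dots> = (\<langle>X\<rangle> \<otimes>\<^sub>a ((g \<otimes>\<^sub>a \<langle>D\<rangle>) \<cdot> G Y)) \<cdot> (\<delta> X \<otimes>\<^sub>a \<langle>Y\<rangle>)"
        by (rule den_eqI, (rule den_intro | (simp; fail))+)
      finally show "(\<langle>X\<rangle> \<otimes>\<^sub>a (G Y' \<cdot> (\<langle>C\<rangle> \<otimes>\<^sub>a g))) \<cdot> (\<delta> X \<otimes>\<^sub>a \<langle>Y\<rangle>) = (\<langle>X\<rangle> \<otimes>\<^sub>a ((g \<otimes>\<^sub>a \<langle>D\<rangle>) \<cdot> G Y)) \<cdot> (\<delta> X \<otimes>\<^sub>a \<langle>Y\<rangle>)" .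
    qed simp
  qed
  have "\<exists>f. f \<in> Hom V (C \<otimes>\<^sub>o C) D \<and> (\<forall>Y \<in> Ob V. (\<langle>Y\<rangle> \<otimes>\<^sub>a f) \<cdot> (\<delta> Y \<otimes>\<^sub>a \<langle>C\<rangle>) = G Y \<cdot> ibr Y C)"
  proof (rule coend_ex[OF C_closed D])
    show "G Y \<cdot> ibr Y C \<in> Hom V (Y \<otimes>\<^sub>o C) (Y \<otimes>\<^sub>o D)" if "Y \<in> Ob V" for Y
      using cmp_hom[OF ibr(1) G[OF that]] that by simp
    show "(G Y' \<cdot> ibr Y' C) \<cdot> (f \<otimes>\<^sub>a \<langle>C\<rangle>) = (f \<otimes>\<^sub>a \<langle>D\<rangle>) \<cdot> G Y \<cdot> ibr Y C" if f: "f \<in> Hom V Y Y'" for Y Y' f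
    proof -
      have [simp]: "Y \<in> Ob V" "Y' \<in> Ob V" and t: "typed f [Y] [Y']" using f hom_Ob by (auto simp: typed_def)
      note [den_intro] = t[THEN den_gen]
      have "(G Y' \<cdot> ibr Y' C) \<cdot> (f \<otimes>\<^sub>a \<langle>C\<rangle>) = (G Y' \<cdot> (\<langle>C\<rangle> \<otimes>\<^sub>a f)) \<cdot> ibr Y C"
        by (rule den_eqI, (rule den_intro | (simp; fail))+, simp add: diag tyi tG t ibr_rules)
      also have "\<dots> = (f \<otimes>\<^sub>a \<langle>D\<rangle>) \<cdot> G Y \<cdot> ibr Y C"
        unfolding Gnat[OF f] by (rule den_eqI, (rule den_intro | (simp; fail))+)
      finally show ?thesis .
    qed
  qed
  then obtain f' where f': "f' \<in> Hom V (C \<otimes>\<^sub>o C) D" and fG: "\<And>Y. Y \<in> Ob V \<Longrightarrow> (\<langle>Y\<rangle> \<otimes>\<^sub>a f') \<cdot> (\<delta> Y \<otimes>\<^sub>a \<langle>C\<rangle>) = G Y \<cdot> ibr Y C"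
    by blast
  have tf: "typed f' [C,C] [D]" using f' by (simp add: typed_def tob_Cons tensor_ob_unit)
  note [den_intro] = tf[THEN den_gen]
  have tf2: "typed (f' \<cdot> \<sigma> C C) [C,C] [D]" by (rule den_typed, rule den_conv, (rule den_intro | (simp; fail))+)
  have "(\<langle>X \<otimes>\<^sub>o Y\<rangle> \<otimes>\<^sub>a (f' \<cdot> \<sigma> C C)) \<cdot> \<delta>2 X Y = k X Y" if X [simp]: "X \<in> Ob V" and Y [simp]: "Y \<in> Ob V" for X Y
  proof -
    have "(\<langle>Y\<rangle> \<otimes>\<^sub>a f') \<cdot> (\<delta> Y \<otimes>\<^sub>a \<langle>C\<rangle>) \<cdot> \<sigma> C Y = ((\<langle>Y\<rangle> \<otimes>\<^sub>a f') \<cdot> (\<delta> Y \<otimes>\<^sub>a \<langle>C\<rangle>)) \<cdot> \<sigma> C Y"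
      by (rule den_eqI, (rule den_intro | (simp; fail))+)
    also have "\<dots> = G Y"
      unfolding fG[OF Y] by (rule den_eqI, (rule den_intro | (simp; fail))+, (simp add: tG tyi ibr_r has_def shp_app shp_init)?)
    finally show ?thesis
      using delta2_factor[OF X Y tf2] braid_delta[OF Y tf] Gk[OF X Y] by simp
  qed
  then show ?thesis
    using tf2 by (intro exI[of _ "f' \<cdot> \<sigma> C C"]) (simp add: typed_def tob_Cons tensor_ob_unit)
qed

lemma from_nat2:
  assumes D: "D \<in> Ob V"
    and k: "\<And>X Y. X \<in> Ob V \<Longrightarrow> Y \<in> Ob V \<Longrightarrow> k X Y \<in> Hom V (X \<otimes>\<^sub>o Y) (X \<otimes>\<^sub>o Y \<otimes>\<^sub>o D)"
    and nat: "\<And>X X' Y Y' f g. f \<in> Hom V X X' \<Longrightarrow> g \<in> Hom V Y Y' \<Longrightarrow>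
       k X' Y' \<cdot> (f \<otimes>\<^sub>a g) = (f \<otimes>\<^sub>a g \<otimes>\<^sub>a \<langle>D\<rangle>) \<cdot> k X Y"
  shows "typed (from_nat2 V C \<iota> D k) [C, C] [D]"
    and "\<And>X Y. X \<in> Ob V \<Longrightarrow> Y \<in> Ob V \<Longrightarrow> (\<langle>X \<otimes>\<^sub>o Y\<rangle> \<otimes>\<^sub>a from_nat2 V C \<iota> D k) \<cdot> \<delta>2 X Y = k X Y"
proof -
  obtain f where f: "f \<in> Hom V (C \<otimes>\<^sub>o C) D" and f2: "\<forall>X \<in> Ob V. \<forall>Y \<in> Ob V. (\<langle>X \<otimes>\<^sub>o Y\<rangle> \<otimes>\<^sub>a f) \<cdot> \<delta>2 X Y = k X Y"
    using coend2_ex[OF D k nat] by blast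
  have "from_nat2 V C \<iota> D k = f"
    unfolding from_nat2_def
  proof (rule the_equality)
    show "f \<in> Hom V (C \<otimes>\<^sub>o C) D \<and> (\<forall>X\<in>Ob V. \<forall>Y\<in>Ob V. (\<langle>X \<otimes>\<^sub>o Y\<rangle> \<otimes>\<^sub>a f) \<cdot> \<delta>2 X Y = k X Y)"
      using f f2 by simp
    fix g assume "g \<in> Hom V (C \<otimes>\<^sub>o C) D \<and> (\<forall>X\<in>Ob V. \<forall>Y\<in>Ob V. (\<langle>X \<otimes>\<^sub>o Y\<rangle> \<otimes>\<^sub>a g) \<cdot> \<delta>2 X Y = k X Y)"
    then show "g = f"
      using f f2 by (intro coend2_eqI[of g D f]) simp_all
  qed
  then show "typed (from_nat2 V C \<iota> D k) [C, C] [D]"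
    and "\<And>X Y. X \<in> Ob V \<Longrightarrow> Y \<in> Ob V \<Longrightarrow> (\<langle>X \<otimes>\<^sub>o Y\<rangle> \<otimes>\<^sub>a from_nat2 V C \<iota> D k) \<cdot> \<delta>2 X Y = k X Y"
    using f f2 D by (simp_all add: typed_def tob_Cons tensor_ob_unit)
qed

abbreviation "\<Delta>C \<equiv> comC V C \<iota>"
abbreviation "\<epsilon>C \<equiv> couC V C \<iota>"
abbreviation "mC \<equiv> mulC V C \<iota>"
abbreviation "\<omega> \<equiv> omega V C \<iota>"
abbreviation "\<omega>b \<equiv> omega_bar V C \<iota>"

lemma delta_hom: "X \<in> Ob V \<Longrightarrow> \<delta> X \<in> Hom V X (X \<otimes>\<^sub>o C)"
  using typed_delta[of X] by (simp add: typed_def tob_Cons tensor_ob_unit)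

lemma comC: "typed \<Delta>C [C] [C, C]"
  "X \<in> Ob V \<Longrightarrow> (\<langle>X\<rangle> \<otimes>\<^sub>a \<Delta>C) \<cdot> \<delta> X = (\<delta> X \<otimes>\<^sub>a \<langle>C\<rangle>) \<cdot> \<delta> X"
proof -
  have 1: "(\<delta> X \<otimes>\<^sub>a \<langle>C\<rangle>) \<cdot> \<delta> X \<in> Hom V X (X \<otimes>\<^sub>o (C \<otimes>\<^sub>o C))" if X [simp]: "X \<in> Ob V" for X
    using cmp_hom[OF delta_hom[OF X] tensor_hom[OF delta_hom[OF X] ident_hom[OF C_closed]]] by (simp add: tensor_ob_assoc)
  have 2: "((\<delta> Y \<otimes>\<^sub>a \<langle>C\<rangle>) \<cdot> \<delta> Y) \<cdot> f = (f \<otimes>\<^sub>a \<langle>C \<otimes>\<^sub>o C\<rangle>) \<cdot> (\<delta> X \<otimes>\<^sub>a \<langle>C\<rangle>) \<cdot> \<delta> X" if f: "f \<in> Hom V X Y" for X Y f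
  proof -
    have [simp]: "X \<in> Ob V" "Y \<in> Ob V" and t: "typed f [X] [Y]" using f hom_Ob by (auto simp: typed_def)
    note [den_intro] = t[THEN den_gen]
    show ?thesis by (rule den_eqI, (rule den_intro | (simp; fail))+, simp add: diag tyi t delta_nat_r)
  qed
  note f = from_nat[OF tensor_closed[OF C_closed C_closed] 1 2, folded comC_def]
  show "typed \<Delta>C [C] [C, C]" using f(1) by (simp add: typed_def tob_Cons tensor_ob_unit)
  show "X \<in> Ob V \<Longrightarrow> (\<langle>X\<rangle> \<otimes>\<^sub>a \<Delta>C) \<cdot> \<delta> X = (\<delta> X \<otimes>\<^sub>a \<langle>C\<rangle>) \<cdot> \<delta> X" by (rule f(2))
qed

lemma couC: "typed \<epsilon>C [C] []" "X \<in> Ob V \<Longrightarrow> (\<langle>X\<rangle> \<otimes>\<^sub>a \<epsilon>C) \<cdot> \<delta> X = \<langle>X\<rangle>"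
proof -
  have 1: "\<langle>X\<rangle> \<in> Hom V X (X \<otimes>\<^sub>o \<^bold>1)" if "X \<in> Ob V" for X
    using ident_hom[OF that] that by (simp add: tensor_ob_unit)
  have 2: "\<langle>Y\<rangle> \<cdot> f = (f \<otimes>\<^sub>a \<langle>\<^bold>1\<rangle>) \<cdot> \<langle>X\<rangle>" if f: "f \<in> Hom V X Y" for X Y f
    using cmp_ident[OF f] hom_Ar[OF f] by (simp add: tensor_ar_unit)
  note f = from_nat[OF unit_closed 1 2, folded couC_def]
  show "typed \<epsilon>C [C] []" using f(1) by (simp add: typed_def tob_Cons tensor_ob_unit)
  show "X \<in> Ob V \<Longrightarrow> (\<langle>X\<rangle> \<otimes>\<^sub>a \<epsilon>C) \<cdot> \<delta> X = \<langle>X\<rangle>" by (rule f(2))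
qed

lemma mulC: "typed mC [C, C] [C]"
  "X \<in> Ob V \<Longrightarrow> Y \<in> Ob V \<Longrightarrow> (\<langle>X \<otimes>\<^sub>o Y\<rangle> \<otimes>\<^sub>a mC) \<cdot> \<delta>2 X Y = \<delta> (X \<otimes>\<^sub>o Y)"
proof -
  have 1: "\<delta> (X \<otimes>\<^sub>o Y) \<in> Hom V (X \<otimes>\<^sub>o Y) (X \<otimes>\<^sub>o Y \<otimes>\<^sub>o C)" if "X \<in> Ob V" "Y \<in> Ob V" for X Y
    using delta_hom[of "X \<otimes>\<^sub>o Y"] that by (simp add: tensor_closed tensor_ob_assoc)
  have 2: "\<delta> (X' \<otimes>\<^sub>o Y') \<cdot> (f \<otimes>\<^sub>a g) = (f \<otimes>\<^sub>a g \<otimes>\<^sub>a \<langle>C\<rangle>) \<cdot> \<delta> (X \<otimes>\<^sub>o Y)"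
    if f: "f \<in> Hom V X X'" and g: "g \<in> Hom V Y Y'" for X X' Y Y' f g
    using delta_natural[OF tensor_hom[OF f g]] hom_Ar[OF f] hom_Ar[OF g] by (simp add: tensor_ar_assoc ident_Ar)
  note f = from_nat2[OF C_closed 1 2, folded mulC_def]
  show "typed mC [C, C] [C]" by (rule f(1))
  show "X \<in> Ob V \<Longrightarrow> Y \<in> Ob V \<Longrightarrow> (\<langle>X \<otimes>\<^sub>o Y\<rangle> \<otimes>\<^sub>a mC) \<cdot> \<delta>2 X Y = \<delta> (X \<otimes>\<^sub>o Y)" by (rule f(2))
qed

lemma omega: "typed \<omega> [C, C] []"
  "X \<in> Ob V \<Longrightarrow> Y \<in> Ob V \<Longrightarrow> (\<langle>X \<otimes>\<^sub>o Y\<rangle> \<otimes>\<^sub>a \<omega>) \<cdot> \<delta>2 X Y = \<sigma> Y X \<cdot> \<sigma> X Y"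
proof -
  have 1: "\<sigma> Y X \<cdot> \<sigma> X Y \<in> Hom V (X \<otimes>\<^sub>o Y) (X \<otimes>\<^sub>o Y \<otimes>\<^sub>o \<^bold>1)" if "X \<in> Ob V" "Y \<in> Ob V" for X Y
    using cmp_hom[OF braid_hom[OF that] braid_hom[OF that(2,1)]] that by (simp add: tensor_ob_unit)
  have 2: "(\<sigma> Y' X' \<cdot> \<sigma> X' Y') \<cdot> (f \<otimes>\<^sub>a g) = (f \<otimes>\<^sub>a g \<otimes>\<^sub>a \<langle>\<^bold>1\<rangle>) \<cdot> \<sigma> Y X \<cdot> \<sigma> X Y"
    if f: "f \<in> Hom V X X'" and g: "g \<in> Hom V Y Y'" for X X' Y Y' f g
  proof -
    have [simp]: "X \<in> Ob V" "X' \<in> Ob V" "Y \<in> Ob V" "Y' \<in> Ob V" and t: "typed f [X] [X']" "typed g [Y] [Y']"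
      using f g hom_Ob by (auto simp: typed_def)
    note [den_intro] = t[THEN den_gen]
    show ?thesis by (rule den_eqI, (rule den_intro | (simp; fail))+, simp add: diag tyi t)
  qed
  note f = from_nat2[OF unit_closed 1 2, folded omega_def]
  show "typed \<omega> [C, C] []" using f(1) by (simp add: typed_def tensor_ob_unit tob_Cons unit_closed)
  show "X \<in> Ob V \<Longrightarrow> Y \<in> Ob V \<Longrightarrow> (\<langle>X \<otimes>\<^sub>o Y\<rangle> \<otimes>\<^sub>a \<omega>) \<cdot> \<delta>2 X Y = \<sigma> Y X \<cdot> \<sigma> X Y" by (rule f(2))
qed

lemma double_braid_inv:
  assumes [simp]: "X \<in> Ob V" "Y \<in> Ob V"
  shows "arr_inv V (\<sigma> Y X \<cdot> \<sigma> X Y) = ibr Y X \<cdot> ibr X Y"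
proof -
  have "typed (\<sigma> Y X \<cdot> \<sigma> X Y) [X, Y] [X, Y]" "typed (ibr Y X \<cdot> ibr X Y) [X, Y] [X, Y]"
    by (rule den_typed, rule den_conv, (rule den_intro | (simp; fail))+)+
  moreover have "(ibr Y X \<cdot> ibr X Y) \<cdot> \<sigma> Y X \<cdot> \<sigma> X Y = \<langle>X \<otimes>\<^sub>o Y\<rangle>" "(\<sigma> Y X \<cdot> \<sigma> X Y) \<cdot> ibr Y X \<cdot> ibr X Y = \<langle>X \<otimes>\<^sub>o Y\<rangle>"
    by (rule den_eqI, (rule den_intro | (simp; fail))+, (simp add: tyi ibr_r has_def shp_app shp_init)?)+
  ultimately show ?thesis
    by (intro arr_inv_unique) (simp_all add: typed_def tob_Cons tensor_ob_unit)
qed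

lemma omega_bar: "typed \<omega>b [C, C] []"
  "X \<in> Ob V \<Longrightarrow> Y \<in> Ob V \<Longrightarrow> (\<langle>X \<otimes>\<^sub>o Y\<rangle> \<otimes>\<^sub>a \<omega>b) \<cdot> \<delta>2 X Y = ibr Y X \<cdot> ibr X Y"
proof -
  have 1: "arr_inv V (\<sigma> Y X \<cdot> \<sigma> X Y) \<in> Hom V (X \<otimes>\<^sub>o Y) (X \<otimes>\<^sub>o Y \<otimes>\<^sub>o \<^bold>1)" if "X \<in> Ob V" "Y \<in> Ob V" for X Y
    using cmp_hom[OF ibr(1)[OF that] ibr(1)[OF that(2,1)]] that by (simp add: tensor_ob_unit double_braid_inv)
  have 2: "arr_inv V (\<sigma> Y' X' \<cdot> \<sigma> X' Y') \<cdot> (f \<otimes>\<^sub>a g) = (f \<otimes>\<^sub>a g \<otimes>\<^sub>a \<langle>\<^bold>1\<rangle>) \<cdot> arr_inv V (\<sigma> Y X \<cdot> \<sigma> X Y)"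
    if f: "f \<in> Hom V X X'" and g: "g \<in> Hom V Y Y'" for X X' Y Y' f g
  proof -
    have [simp]: "X \<in> Ob V" "X' \<in> Ob V" "Y \<in> Ob V" "Y' \<in> Ob V" and t: "typed f [X] [X']" "typed g [Y] [Y']"
      using f g hom_Ob by (auto simp: typed_def)
    note [den_intro] = t[THEN den_gen]
    show ?thesis by (simp add: double_braid_inv) (rule den_eqI, (rule den_intro | (simp; fail))+, simp add: diag tyi t ibr_rules)
  qed
  note f = from_nat2[OF unit_closed 1 2, folded omega_bar_def]
  show "typed \<omega>b [C, C] []" using f(1) by (simp add: typed_def tensor_ob_unit tob_Cons unit_closed)
  show "X \<in> Ob V \<Longrightarrow> Y \<in> Ob V \<Longrightarrow> (\<langle>X \<otimes>\<^sub>o Y\<rangle> \<otimes>\<^sub>a \<omega>b) \<cdot> \<delta>2 X Y = ibr Y X \<cdot> ibr X Y"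
    using f(2)[of X Y] double_braid_inv[of X Y] by simp
qed

lemmas C_typed [tyi] = comC(1) couC(1) mulC(1) omega(1) omega_bar(1)
lemmas [den_intro] = C_typed[THEN den_gen]

lemma comC_r: "X \<in> Ob V \<Longrightarrow> has n [X] st \<Longrightarrow> app (Suc n) [C] \<Delta>C [C, C] (app n [X] (\<delta> X) [X, C] st)
    = app n [X] (\<delta> X) [X, C] (app n [X] (\<delta> X) [X, C] st)"
  by ((rule den_rule[OF comC(2)[of X]], (rule den_intro | (simp; fail))+)[1])

lemma couC_r: "X \<in> Ob V \<Longrightarrow> has n [X] st \<Longrightarrow> app (Suc n) [C] \<epsilon>C [] (app n [X] (\<delta> X) [X, C] st) = st"
  by ((rule den_rule[OF couC(2)[of X]], (rule den_intro | (simp; fail))+)[1])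

lemma delta2_r:
  assumes [simp]: "X \<in> Ob V" "Y \<in> Ob V" and h: "has n [X, Y] st"
  shows "app (Suc (Suc n)) [C, C] mC [C] (app (Suc n) [C, Y] (\<sigma> C Y) [Y, C] (app n [X] (\<delta> X) [X, C] (app (Suc n) [Y] (\<delta> Y) [Y, C] st)))
     = app n [X, Y] (\<delta> (X \<otimes>\<^sub>o Y)) [X, Y, C] st"
    "app (Suc (Suc n)) [C, C] \<omega> [] (app (Suc n) [C, Y] (\<sigma> C Y) [Y, C] (app n [X] (\<delta> X) [X, C] (app (Suc n) [Y] (\<delta> Y) [Y, C] st)))
     = app n [Y, X] (\<sigma> Y X) [X, Y] (app n [X, Y] (\<sigma> X Y) [Y, X] st)"
    "app (Suc (Suc n)) [C, C] \<omega>b [] (app (Suc n) [C, Y] (\<sigma> C Y) [Y, C] (app n [X] (\<delta> X) [X, C] (app (Suc n) [Y] (\<delta> Y) [Y, C] st)))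
     = app n [Y, X] (ibr Y X) [X, Y] (app n [X, Y] (ibr X Y) [Y, X] st)"
proof -
  note e = mulC(2)[of X Y, unfolded delta2_def] omega(2)[of X Y, unfolded delta2_def] omega_bar(2)[of X Y, unfolded delta2_def]
  show "app (Suc (Suc n)) [C, C] mC [C] (app (Suc n) [C, Y] (\<sigma> C Y) [Y, C] (app n [X] (\<delta> X) [X, C] (app (Suc n) [Y] (\<delta> Y) [Y, C] st)))
     = app n [X, Y] (\<delta> (X \<otimes>\<^sub>o Y)) [X, Y, C] st"
    using h by - ((rule den_rule[OF e(1)], (rule den_intro | (simp; fail))+)[1])
  show "app (Suc (Suc n)) [C, C] \<omega> [] (app (Suc n) [C, Y] (\<sigma> C Y) [Y, C] (app n [X] (\<delta> X) [X, C] (app (Suc n) [Y] (\<delta> Y) [Y, C] st)))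
     = app n [Y, X] (\<sigma> Y X) [X, Y] (app n [X, Y] (\<sigma> X Y) [Y, X] st)"
    using h by - ((rule den_rule[OF e(2)], (rule den_intro | (simp; fail))+)[1])
  show "app (Suc (Suc n)) [C, C] \<omega>b [] (app (Suc n) [C, Y] (\<sigma> C Y) [Y, C] (app n [X] (\<delta> X) [X, C] (app (Suc n) [Y] (\<delta> Y) [Y, C] st)))
     = app n [Y, X] (ibr Y X) [X, Y] (app n [X, Y] (ibr X Y) [Y, X] st)"
    using h by - ((rule den_rule[OF e(3)], (rule den_intro | (simp; fail))+)[1])
qed

lemma typed_Sig:
  assumes [simp]: "X \<in> Ob V" and a: "typed a [C] ws"
  shows "typed (Sig V \<iota> a X) [X] (X # ws)"
proof -
  note [den_intro] = a[THEN den_gen]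
  show ?thesis unfolding Sig_def by (rule den_typed, rule den_conv, (rule den_intro | (simp; fail))+)
qed

end

section \<open>Elements acting on modules\<close>

context quasitriangular
begin

abbreviation "El \<equiv> C_elements V C \<iota> H"
abbreviation "sh a A \<equiv> sharp V (Sig V \<iota> a) A"
abbreviation "sg s X \<equiv> Sig V \<iota> s X"

lemma El_carrier: "a \<in> carrier El \<longleftrightarrow> typed a [C] [h]"
  by (simp add: C_elements_def typed_def)

lemma sh_def: "sh a A = snd A \<cdot> (\<langle>fst A\<rangle> \<otimes>\<^sub>a a) \<cdot> \<delta> (fst A)"
  by (simp add: sharp_def Sig_def)

lemma rmod_typed: "rmod A \<Longrightarrow> typed (snd A) [fst A, h] [fst A]"
  by (rule right_moduleD(2)) (simp only: prod.collapse)

lemma rmod_rules: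
  assumes "rmod A"
  shows "has n [fst A, h, h] st \<Longrightarrow> app n [fst A, h] (snd A) [fst A] (app n [fst A, h] (snd A) [fst A] st)
      = app n [fst A, h] (snd A) [fst A] (app (Suc n) [h, h] (mul H) [h] st)"
    and "has n [fst A] st \<Longrightarrow> app n [fst A, h] (snd A) [fst A] (app (Suc n) [] (uni H) [h] st) = st"
  using right_moduleD(3,4)[of "fst A" "snd A" n st] assms by (simp_all only: prod.collapse)

lemmas [den_intro] = rmod_typed[THEN den_gen]

lemma typed_sh:
  assumes A [simp]: "rmod A" and a: "typed a [C] [h]"
  shows "typed (sh a A) [fst A] [fst A]"
proof -
  note [den_intro] = a[THEN den_gen]
  show ?thesis unfolding sh_def by (rule den_typed, rule den_conv, (rule den_intro | (simp; fail))+)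
qed

lemma sh_hom: "rmod A \<Longrightarrow> a \<in> carrier El \<Longrightarrow> sh a A \<in> Hom V (fst A) (fst A)"
  using typed_sh[of A a] by (simp add: El_carrier typed_def)

lemma lin_r:
  assumes f: "lin A f B" and [simp]: "rmod A" "rmod B"
  shows "typed f [fst A] [fst B]"
    and "has n [fst A, h] st \<Longrightarrow> app n [fst A] f [fst B] (app n [fst A, h] (snd A) [fst A] st)
      = app n [fst B, h] (snd B) [fst B] (app n [fst A] f [fst B] st)"
proof -
  show t: "typed f [fst A] [fst B]"
    using f by (simp add: H_linear_def typed_def)
  have e: "f \<cdot> snd A = snd B \<cdot> (f \<otimes>\<^sub>a \<langle>h\<rangle>)"
    using f by (simp add: H_linear_def)
  note [den_intro] = t[THEN den_gen]
  show "has n [fst A, h] st \<Longrightarrow> app n [fst A] f [fst B] (app n [fst A, h] (snd A) [fst A] st)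
      = app n [fst B, h] (snd B) [fst B] (app n [fst A] f [fst B] st)"
    by ((rule den_rule[OF e], (rule den_intro | (simp; fail))+)[1])
qed

lemma sh_natural:
  assumes f: "lin A f B" and A [simp]: "rmod A" and B [simp]: "rmod B" and a: "a \<in> carrier El"
  shows "sh a B \<cdot> f = f \<cdot> sh a A"
proof -
  note t = a[unfolded El_carrier] lin_r(1)[OF f A B] rmod_typed[OF A] rmod_typed[OF B]
  note [den_intro] = t(1,2)[THEN den_gen]
  show ?thesis
    unfolding sh_def by (rule den_eqI, (rule den_intro | (simp; fail))+, simp add: diag tyi t delta_nat_r lin_r(2)[OF f A B])
qed

definition free :: "'o \<Rightarrow> 'o \<times> 'm" where
  "free X = (X \<otimes>\<^sub>o h, \<langle>X\<rangle> \<otimes>\<^sub>a mul H)"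

lemma free_simps [simp]: "fst (free X) = X \<otimes>\<^sub>o h" "snd (free X) = \<langle>X\<rangle> \<otimes>\<^sub>a mul H"
  by (simp_all add: free_def)

lemma rmod_free:
  assumes [simp]: "X \<in> Ob V"
  shows "rmod (free X)"
proof -
  have "(\<langle>X\<rangle> \<otimes>\<^sub>a mul H) \<cdot> ((\<langle>X\<rangle> \<otimes>\<^sub>a mul H) \<otimes>\<^sub>a \<langle>h\<rangle>) = (\<langle>X\<rangle> \<otimes>\<^sub>a mul H) \<cdot> (\<langle>X \<otimes>\<^sub>o h\<rangle> \<otimes>\<^sub>a mul H)"
    by (rule den_eqI, (rule den_intro | (simp; fail))+, simp add: diag tyi mul_assoc_r)
  moreover have "(\<langle>X\<rangle> \<otimes>\<^sub>a mul H) \<cdot> (\<langle>X \<otimes>\<^sub>o h\<rangle> \<otimes>\<^sub>a uni H) = \<langle>X \<otimes>\<^sub>o h\<rangle>"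
    by (rule den_eqI, (rule den_intro | (simp; fail))+, simp add: diag tyi mul_uni_r)
  moreover have "typed (\<langle>X\<rangle> \<otimes>\<^sub>a mul H) [X, h, h] [X, h]"
    by (rule den_typed, rule den_conv, (rule den_intro | (simp; fail))+)
  moreover have "typed (\<langle>X\<rangle> \<otimes>\<^sub>a mul H) [X \<otimes>\<^sub>o h, h] [X \<otimes>\<^sub>o h]"
    using calculation(3) by (simp add: typed_def tob_Cons tensor_ob_unit tensor_closed tensor_ob_assoc)
  ultimately show ?thesis
    unfolding free_def right_module_iff by (intro conjI tensor_closed obj_closed) simp_all
qed

lemma free_lin:
  assumes f: "f \<in> Hom V X Y"
  shows "lin (free X) (f \<otimes>\<^sub>a \<langle>h\<rangle>) (free Y)"
proof -
  have [simp]: "X \<in> Ob V" "Y \<in> Ob V" and t: "typed f [X] [Y]" using f hom_Ob by (auto simp: typed_def)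
  note [den_intro] = t[THEN den_gen]
  have "(f \<otimes>\<^sub>a \<langle>h\<rangle>) \<cdot> (\<langle>X\<rangle> \<otimes>\<^sub>a mul H) = (\<langle>Y\<rangle> \<otimes>\<^sub>a mul H) \<cdot> ((f \<otimes>\<^sub>a \<langle>h\<rangle>) \<otimes>\<^sub>a \<langle>h\<rangle>)"
    by (rule den_eqI, (rule den_intro | (simp; fail))+, simp add: diag tyi t)
  then show ?thesis
    using tensor_hom[OF f ident_hom[OF obj_closed]] by (simp add: H_linear_def)
qed

text \<open>The action presents every module as a quotient of a free one, and the unit splits this
  presentation in \<open>V\<close>. Naturality along it extends statements from free modules to all
  modules.\<close>

lemma act_lin:
  assumes A [simp]: "rmod A"
  shows "lin (free (fst A)) (snd A) A"
proof -
  have "snd A \<cdot> (\<langle>fst A\<rangle> \<otimes>\<^sub>a mul H) = snd A \<cdot> (snd A \<otimes>\<^sub>a \<langle>h\<rangle>)"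
    by (rule den_eqI, (rule den_intro | (simp; fail))+, simp add: diag tyi rmod_typed rmod_rules)
  then show ?thesis
    using rmod_typed[OF A] by (simp add: H_linear_def typed_def tob_Cons tensor_ob_unit)
qed

text \<open>Evaluating the action on the unit of a free module inverts \<open>sharp\<close>.\<close>

lemma sh_free:
  assumes [simp]: "X \<in> Ob V" and a: "a \<in> carrier El"
  shows "sh a (free X) \<cdot> (\<langle>X\<rangle> \<otimes>\<^sub>a uni H) = sg a X" "sh a (free X) = (\<langle>X\<rangle> \<otimes>\<^sub>a mul H) \<cdot> sg a (X \<otimes>\<^sub>o h)"
proof -
  note t = a[unfolded El_carrier]
  note [den_intro] = t[THEN den_gen]
  have u: "\<delta> (X \<otimes>\<^sub>o h) \<cdot> (\<langle>X\<rangle> \<otimes>\<^sub>a uni H) = (\<langle>X\<rangle> \<otimes>\<^sub>a uni H \<otimes>\<^sub>a \<langle>C\<rangle>) \<cdot> \<delta> X"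
    using delta_natural[of "\<langle>X\<rangle> \<otimes>\<^sub>a uni H" X "X \<otimes>\<^sub>o h"] tensor_hom[OF ident_hom[of X] uni_hom]
    by (simp add: tensor_ob_unit tensor_ar_assoc ident_Ar hom_Ar[OF uni_hom])
  show e: "sh a (free X) = (\<langle>X\<rangle> \<otimes>\<^sub>a mul H) \<cdot> sg a (X \<otimes>\<^sub>o h)"
    by (simp add: sharp_def)
  have "sh a (free X) \<cdot> (\<langle>X\<rangle> \<otimes>\<^sub>a uni H) = (\<langle>X\<rangle> \<otimes>\<^sub>a mul H) \<cdot> (\<langle>X \<otimes>\<^sub>o h\<rangle> \<otimes>\<^sub>a a) \<cdot> (\<delta> (X \<otimes>\<^sub>o h) \<cdot> (\<langle>X\<rangle> \<otimes>\<^sub>a uni H))"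
    unfolding e Sig_def by (rule den_eqI, (rule den_intro | (simp; fail))+)
  also have "\<dots> = sg a X"
    unfolding u Sig_def by (rule den_eqI, (rule den_intro | (simp; fail))+, simp add: diag tyi t mul_uni_r)
  finally show "sh a (free X) \<cdot> (\<langle>X\<rangle> \<otimes>\<^sub>a uni H) = sg a X" .
qed

text \<open>The free modules recover the natural family and the coend recovers the element. Later
  identities between C-elements are proved on modules through this lemma.\<close>

lemma sh_inj:
  assumes a: "a \<in> carrier El" and b: "b \<in> carrier El" and eq: "\<And>A. rmod A \<Longrightarrow> sh a A = sh b A"
  shows "a = b"
proof (rule coend_eqI1)
  show "a \<in> Hom V C h" "b \<in> Hom V C h" using a b by (simp_all add: C_elements_def)
  fix X assume X: "X \<in> Ob V"
  then have "sg a X = sg b X"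
    using sh_free(1)[OF X a] sh_free(1)[OF X b] eq[OF rmod_free[OF X]] by simp
  then show "(\<langle>X\<rangle> \<otimes>\<^sub>a a) \<cdot> \<delta> X = (\<langle>X\<rangle> \<otimes>\<^sub>a b) \<cdot> \<delta> X"
    by (simp add: Sig_def)
qed

text \<open>Surjectivity: naturality along the action \<open>free (fst A) \<rightarrow> A\<close>
  expresses the value at \<open>A\<close> by the value on a free module, which \<open>flat\<close>
  records.\<close>

lemma sh_from_nat:
  assumes F: "\<And>A. rmod A \<Longrightarrow> F A \<in> Hom V (fst A) (fst A)"
    and nat: "\<And>A B f. rmod A \<Longrightarrow> rmod B \<Longrightarrow> lin A f B \<Longrightarrow> F B \<cdot> f = f \<cdot> F A"
  shows "from_nat V C \<iota> h (flat V H F) \<in> carrier El"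
    and "rmod A \<Longrightarrow> sh (from_nat V C \<iota> h (flat V H F)) A = F A"
proof -
  have fl: "flat V H F X = F (free X) \<cdot> (\<langle>X\<rangle> \<otimes>\<^sub>a uni H)" for X
    by (simp add: flat_def free_def)
  have uh: "\<langle>X\<rangle> \<otimes>\<^sub>a uni H \<in> Hom V X (X \<otimes>\<^sub>o h)" if "X \<in> Ob V" for X
    using tensor_hom[OF ident_hom[OF that] uni_hom] that by (simp add: tensor_ob_unit)
  have Fh: "F (free X) \<in> Hom V (X \<otimes>\<^sub>o h) (X \<otimes>\<^sub>o h)" if "X \<in> Ob V" for X
    using F[OF rmod_free[OF that]] by simp
  have 1: "flat V H F X \<in> Hom V X (X \<otimes>\<^sub>o h)" if "X \<in> Ob V" for X
    unfolding fl by (rule cmp_hom[OF uh Fh]; fact)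
  have 2: "flat V H F Y \<cdot> f = (f \<otimes>\<^sub>a \<langle>h\<rangle>) \<cdot> flat V H F X" if f: "f \<in> Hom V X Y" for X Y f
  proof -
    have o [simp]: "X \<in> Ob V" "Y \<in> Ob V" using f hom_Ob by auto
    have fh: "f \<otimes>\<^sub>a \<langle>h\<rangle> \<in> Hom V (X \<otimes>\<^sub>o h) (Y \<otimes>\<^sub>o h)"
      using tensor_hom[OF f ident_hom] by simp
    have "flat V H F Y \<cdot> f = F (free Y) \<cdot> ((\<langle>Y\<rangle> \<otimes>\<^sub>a uni H) \<cdot> f)"
      unfolding fl by (rule cmp_assoc[OF f uh Fh]; simp)
    also have "(\<langle>Y\<rangle> \<otimes>\<^sub>a uni H) \<cdot> f = (f \<otimes>\<^sub>a \<langle>h\<rangle>) \<cdot> (\<langle>X\<rangle> \<otimes>\<^sub>a uni H)"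
      using interchange_l[OF f uni_hom] hom_Ar[OF f] by (simp add: tensor_ar_unit)
    also have "F (free Y) \<cdot> \<dots> = (F (free Y) \<cdot> (f \<otimes>\<^sub>a \<langle>h\<rangle>)) \<cdot> (\<langle>X\<rangle> \<otimes>\<^sub>a uni H)"
      by (rule cmp_assoc[OF uh fh Fh, symmetric]; simp)
    also have "F (free Y) \<cdot> (f \<otimes>\<^sub>a \<langle>h\<rangle>) = (f \<otimes>\<^sub>a \<langle>h\<rangle>) \<cdot> F (free X)"
      by (rule nat[OF rmod_free rmod_free free_lin[OF f]]; simp)
    also have "\<dots> \<cdot> (\<langle>X\<rangle> \<otimes>\<^sub>a uni H) = (f \<otimes>\<^sub>a \<langle>h\<rangle>) \<cdot> flat V H F X"
      unfolding fl by (rule cmp_assoc[OF uh Fh fh]; simp)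
    finally show ?thesis .
  qed
  have n1: "from_nat V C \<iota> h (flat V H F) \<in> Hom V C h"
    by (rule from_nat(1)[OF obj_closed 1 2])
  have n2: "(\<langle>X\<rangle> \<otimes>\<^sub>a from_nat V C \<iota> h (flat V H F)) \<cdot> \<delta> X = flat V H F X" if "X \<in> Ob V" for X
    by (rule from_nat(2)[OF obj_closed 1 2 that])
  show "from_nat V C \<iota> h (flat V H F) \<in> carrier El"
    using n1 by (simp add: C_elements_def)
  assume A: "rmod A"
  have o: "fst A \<in> Ob V" using A by simp
  have r: "snd A \<in> Hom V (fst A \<otimes>\<^sub>o h) (fst A)"
    using lin_hom[OF act_lin[OF A]] by simp
  have "sh (from_nat V C \<iota> h (flat V H F)) A = snd A \<cdot> F (free (fst A)) \<cdot> (\<langle>fst A\<rangle> \<otimes>\<^sub>a uni H)"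
    unfolding sharp_def Sig_def n2[OF o] fl by simp
  also have "\<dots> = (snd A \<cdot> F (free (fst A))) \<cdot> (\<langle>fst A\<rangle> \<otimes>\<^sub>a uni H)"
    by (rule cmp_assoc[OF uh[OF o] Fh[OF o] r, symmetric])
  also have "\<dots> = (F A \<cdot> snd A) \<cdot> (\<langle>fst A\<rangle> \<otimes>\<^sub>a uni H)"
    using nat[OF rmod_free[OF o] A act_lin[OF A]] by simp
  also have "\<dots> = F A \<cdot> (snd A \<cdot> (\<langle>fst A\<rangle> \<otimes>\<^sub>a uni H))"
    by (rule cmp_assoc[OF uh[OF o] r F[OF A]])
  also have "snd A \<cdot> (\<langle>fst A\<rangle> \<otimes>\<^sub>a uni H) = \<langle>fst A\<rangle>"
  proof -
    have "rmod (fst A, snd A)"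
      using A by (simp only: prod.collapse)
    then show ?thesis
      using right_module_iff[of "fst A" "snd A"] by blast
  qed
  finally show "sh (from_nat V C \<iota> h (flat V H F)) A = F A"
    using cmp_ident[OF F[OF A]] by simp
qed

end

section \<open>Transposes along evaluations\<close>

context braided_rigid_category
begin

lemma rdual_arr_evr:
  assumes f: "typed f [X] [X]"
  shows "typed (rdual_arr V f) [rdual V X] [rdual V X]"
    "evr V X \<cdot> (\<langle>X\<rangle> \<otimes>\<^sub>a rdual_arr V f) = evr V X \<cdot> (f \<otimes>\<^sub>a \<langle>rdual V X\<rangle>)"
proof -
  have [simp]: "X \<in> Ob V" and st: "src V f = X" "tgt V f = X"
    using f by (auto simp: typed_def Hom_def)
  note [den_intro] = f[THEN den_gen]
  show "typed (rdual_arr V f) [rdual V X] [rdual V X]"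
    unfolding rdual_arr_def st Let_def by (rule den_typed, rule den_conv, (rule den_intro | (simp; fail))+)
  show "evr V X \<cdot> (\<langle>X\<rangle> \<otimes>\<^sub>a rdual_arr V f) = evr V X \<cdot> (f \<otimes>\<^sub>a \<langle>rdual V X\<rangle>)"
    unfolding rdual_arr_def st Let_def by (rule den_eqI, (rule den_intro | (simp; fail))+, (simp add: diag tyi f snakes)?, simp add: diag' tyi f snakes)
qed

text \<open>The conjugated right dual in the definition of \<open>S_elem\<close> is simply the
  transpose along \<open>evl\<close>; the canonical isomorphisms disappear from here on.\<close>

lemma transpose_evl:
  assumes X [simp]: "X \<in> Ob V" and f: "typed f [ldual V X] [ldual V X]"
  defines "g \<equiv> can_rl V X \<cdot> rdual_arr V f \<cdot> arr_inv V (can_rl V X)"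
  shows "typed g [X] [X]" "evl V X \<cdot> (\<langle>ldual V X\<rangle> \<otimes>\<^sub>a g) = evl V X \<cdot> (f \<otimes>\<^sub>a \<langle>X\<rangle>)"
proof -
  let ?L = "ldual V X"
  define i where "i = arr_inv V (can_rl V X)"
  note t = typed_can(2)[OF X] rdual_arr_evr(1)[OF f] f
  have ti: "typed i [X] [rdual V ?L]"
    using can_inverse(3)[OF X] by (simp add: i_def typed_def)
  note [den_intro] = t[THEN den_gen] ti[THEN den_gen]
  show "typed g [X] [X]"
    unfolding g_def i_def[symmetric] by (rule den_typed, rule den_conv, (rule den_intro | (simp; fail))+)
  have "evl V X \<cdot> (\<langle>?L\<rangle> \<otimes>\<^sub>a g) = (evl V X \<cdot> (\<langle>?L\<rangle> \<otimes>\<^sub>a can_rl V X)) \<cdot> (\<langle>?L\<rangle> \<otimes>\<^sub>a (rdual_arr V f \<cdot> i))"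
    unfolding g_def i_def[symmetric] by (rule den_eqI, (rule den_intro | (simp; fail))+)
  also have "\<dots> = (evr V ?L \<cdot> (\<langle>?L\<rangle> \<otimes>\<^sub>a rdual_arr V f)) \<cdot> (\<langle>?L\<rangle> \<otimes>\<^sub>a i)"
    unfolding can_pairing(2)[OF X] by (rule den_eqI, (rule den_intro | (simp; fail))+)
  also have "\<dots> = (evl V X \<cdot> (\<langle>?L\<rangle> \<otimes>\<^sub>a (can_rl V X \<cdot> i))) \<cdot> (f \<otimes>\<^sub>a \<langle>X\<rangle>)"
    unfolding rdual_arr_evr(2)[OF f] using can_pairing(2)[OF X, symmetric]
    by simp (rule den_eqI, (rule den_intro | (simp; fail))+, simp add: diag tyi t ti)
  also have "\<dots> = evl V X \<cdot> (f \<otimes>\<^sub>a \<langle>X\<rangle>)"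
    unfolding i_def can_inverse(4)[OF X] by (rule den_eqI, (rule den_intro | (simp; fail))+)
  finally show "evl V X \<cdot> (\<langle>?L\<rangle> \<otimes>\<^sub>a g) = evl V X \<cdot> (f \<otimes>\<^sub>a \<langle>X\<rangle>)" .
qed

lemma pairing_via_evl:
  assumes X [simp]: "X \<in> Ob V" and Z [simp]: "Z \<in> Ob V" and e: "typed e [Z, X] []"
  shows "e = evl V X \<cdot> (((e \<otimes>\<^sub>a \<langle>ldual V X\<rangle>) \<cdot> (\<langle>Z\<rangle> \<otimes>\<^sub>a coevl V X)) \<otimes>\<^sub>a \<langle>X\<rangle>)"
proof -
  note [den_intro] = e[THEN den_gen]
  show ?thesis by (rule den_eqI, (rule den_intro | (simp; fail))+, simp add: diag tyi e snakes)
qed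

end

section \<open>The monoid of C-elements and its antipode\<close>

context quasitriangular
begin

lemma lin_ident: "rmod A \<Longrightarrow> lin A \<langle>fst A\<rangle> A"
  by (rule H_linear_ident)

lemma lin_pairing_typed: "rmod A \<Longrightarrow> rmod B \<Longrightarrow> lin (A \<odot> B) e (mod_unit V H) \<Longrightarrow> typed e [fst A, fst B] []"
  using lin_hom[of "A \<odot> B" e "mod_unit V H"] by (simp add: typed_def tob_Cons tensor_ob_unit)

text \<open>A pairing factors through an evaluation by a bent arrow. Its linearity is what allows
  naturality of \<open>sh\<close> and of the module braiding to be used along it.\<close>

lemma lin_pairing_dual:
  assumes A: "rmod A" and B: "rmod B" and e: "lin (B \<odot> A) e (mod_unit V H)"
  shows "lin B ((e \<otimes>\<^sub>a \<langle>ldual V (fst A)\<rangle>) \<cdot> (\<langle>fst B\<rangle> \<otimes>\<^sub>a coevl V (fst A))) (mod_ldual V H A)"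
    "lin A ((\<langle>rdual V (fst B)\<rangle> \<otimes>\<^sub>a e) \<cdot> (coevr V (fst B) \<otimes>\<^sub>a \<langle>fst A\<rangle>)) (mod_rdual V H B)"
proof -
  note L = mod_ldual[OF A] mod_rdual[OF B]
  note r = A B L(1,4) mod_unit_module rmod_mt
  have "lin (B \<odot> mod_unit V H) (\<langle>fst B\<rangle> \<otimes>\<^sub>a coevl V (fst A)) (B \<odot> (A \<odot> mod_ldual V H A))"
    by (rule lin_tensor[OF B _ B _ lin_ident[OF B] L(3)]) (simp_all add: r)
  moreover have "lin ((B \<odot> A) \<odot> mod_ldual V H A) (e \<otimes>\<^sub>a \<langle>fst (mod_ldual V H A)\<rangle>) (mod_unit V H \<odot> mod_ldual V H A)"
    by (rule lin_tensor[OF _ L(1) _ L(1) e lin_ident[OF L(1)]]) (simp_all add: r)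
  ultimately show "lin B ((e \<otimes>\<^sub>a \<langle>ldual V (fst A)\<rangle>) \<cdot> (\<langle>fst B\<rangle> \<otimes>\<^sub>a coevl V (fst A))) (mod_ldual V H A)"
    using lin_comp[of B "B \<odot> (A \<odot> mod_ldual V H A)" "mod_ldual V H A"] by (simp add: r mt_unit mt_assoc)
  have "lin (mod_unit V H \<odot> A) (coevr V (fst B) \<otimes>\<^sub>a \<langle>fst A\<rangle>) ((mod_rdual V H B \<odot> B) \<odot> A)"
    by (rule lin_tensor[OF _ A _ A L(6) lin_ident[OF A]]) (simp_all add: r)
  moreover have "lin (mod_rdual V H B \<odot> (B \<odot> A)) (\<langle>fst (mod_rdual V H B)\<rangle> \<otimes>\<^sub>a e) (mod_rdual V H B \<odot> mod_unit V H)"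
    by (rule lin_tensor[OF L(4) _ L(4) _ lin_ident[OF L(4)] e]) (simp_all add: r)
  ultimately show "lin A ((\<langle>rdual V (fst B)\<rangle> \<otimes>\<^sub>a e) \<cdot> (coevr V (fst B) \<otimes>\<^sub>a \<langle>fst A\<rangle>)) (mod_rdual V H B)"
    using lin_comp[of A "mod_rdual V H B \<odot> (B \<odot> A)" "mod_rdual V H B"] by (simp add: r mt_unit mt_assoc)
qed

lemma El_mult_closed: "a \<in> carrier El \<Longrightarrow> b \<in> carrier El \<Longrightarrow> a \<otimes>\<^bsub>El\<^esub> b \<in> carrier El"
proof -
  assume "a \<in> carrier El" "b \<in> carrier El"
  then have t: "typed a [C] [h]" "typed b [C] [h]" by (simp_all add: El_carrier)
  note [den_intro] = t[THEN den_gen]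
  have "typed (mul H \<cdot> (a \<otimes>\<^sub>a b) \<cdot> \<Delta>C) [C] [h]" by (rule den_typed, rule den_conv, (rule den_intro | (simp; fail))+)
  then show ?thesis by (simp add: El_carrier) (simp add: C_elements_def)
qed

lemma El_one_closed: "\<one>\<^bsub>El\<^esub> \<in> carrier El"
proof -
  have "typed (uni H \<cdot> \<epsilon>C) [C] [h]" by (rule den_typed, rule den_conv, (rule den_intro | (simp; fail))+)
  then show ?thesis by (simp add: El_carrier) (simp add: C_elements_def)
qed

lemma sh_one: "rmod A \<Longrightarrow> sh \<one>\<^bsub>El\<^esub> A = \<langle>fst A\<rangle>"
  unfolding sh_def C_elements_def monoid.simps
  by (rule den_eqI, (rule den_intro | (simp; fail))+, simp add: diag tyi couC_r rmod_rules rmod_typed)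

text \<open>The order is reversed because modules are right modules: in the product
  \<open>a b\<close>, the factor \<open>a\<close> acts first.\<close>

lemma sh_mult:
  assumes A [simp]: "rmod A" and a: "a \<in> carrier El" and b: "b \<in> carrier El"
  shows "sh (a \<otimes>\<^bsub>El\<^esub> b) A = sh b A \<cdot> sh a A"
proof -
  note t = a[unfolded El_carrier] b[unfolded El_carrier] rmod_typed[OF A] typed_sh[OF A a[unfolded El_carrier]]
  note [den_intro] = t(1,2)[THEN den_gen]
  have "sh (a \<otimes>\<^bsub>El\<^esub> b) A = snd A \<cdot> (snd A \<otimes>\<^sub>a \<langle>h\<rangle>) \<cdot> (\<langle>fst A\<rangle> \<otimes>\<^sub>a a \<otimes>\<^sub>a b) \<cdot> (\<delta> (fst A) \<otimes>\<^sub>a \<langle>C\<rangle>) \<cdot> \<delta> (fst A)"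
    unfolding sh_def C_elements_def monoid.simps
    by (rule den_eqI, (rule den_intro | (simp; fail))+, simp add: diag tyi t(1-3) comC_r rmod_rules[OF A])
  also have "\<dots> = snd A \<cdot> (\<langle>fst A\<rangle> \<otimes>\<^sub>a b) \<cdot> (sh a A \<otimes>\<^sub>a \<langle>C\<rangle>) \<cdot> \<delta> (fst A)"
    unfolding sh_def by (rule den_eqI, (rule den_intro | (simp; fail))+, simp add: diag tyi t(1-3))
  also have "\<dots> = snd A \<cdot> (\<langle>fst A\<rangle> \<otimes>\<^sub>a b) \<cdot> (\<delta> (fst A) \<cdot> sh a A)"
    using delta_natural[OF sh_hom[OF A a]] by simp
  also have "\<dots> = sh b A \<cdot> sh a A"
  proof -
    note [den_intro] = t(4)[THEN den_gen]
    show ?thesis unfolding sh_def[of b] by (rule den_eqI, (rule den_intro | (simp; fail))+)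
  qed
  finally show ?thesis .
qed

lemma El_monoid: "monoid El"
proof (rule monoidI)
  fix x y z assume x: "x \<in> carrier El" and y: "y \<in> carrier El" and z: "z \<in> carrier El"
  show "x \<otimes>\<^bsub>El\<^esub> y \<otimes>\<^bsub>El\<^esub> z = x \<otimes>\<^bsub>El\<^esub> (y \<otimes>\<^bsub>El\<^esub> z)"
    by (rule sh_inj)
      (simp_all add: El_mult_closed x y z sh_mult cmp_assoc[OF sh_hom[OF _ x] sh_hom[OF _ y] sh_hom[OF _ z]])
next
  fix x assume x: "x \<in> carrier El"
  show "\<one>\<^bsub>El\<^esub> \<otimes>\<^bsub>El\<^esub> x = x" "x \<otimes>\<^bsub>El\<^esub> \<one>\<^bsub>El\<^esub> = x"
    by (rule sh_inj; simp add: El_mult_closed El_one_closed x sh_mult sh_one cmp_ident[OF sh_hom[OF _ x]])+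
qed (simp_all add: El_mult_closed El_one_closed)

text \<open>Pointwise inverses suffice: inverses of a natural family are automatically natural,
  hence come from a C-element.\<close>

lemma El_inverse:
  assumes a: "a \<in> carrier El"
    and d: "\<And>A. rmod A \<Longrightarrow> \<exists>d. d \<in> Hom V (fst A) (fst A) \<and> d \<cdot> sh a A = \<langle>fst A\<rangle> \<and> sh a A \<cdot> d = \<langle>fst A\<rangle>"
  shows "a \<in> Units El" "inv\<^bsub>El\<^esub> a \<in> carrier El"
    "rmod A \<Longrightarrow> sh (inv\<^bsub>El\<^esub> a) A \<cdot> sh a A = \<langle>fst A\<rangle>" "rmod A \<Longrightarrow> sh a A \<cdot> sh (inv\<^bsub>El\<^esub> a) A = \<langle>fst A\<rangle>"
proof -
  interpret monoid El by (rule El_monoid)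
  obtain F where F: "\<And>A. rmod A \<Longrightarrow> F A \<in> Hom V (fst A) (fst A)"
    "\<And>A. rmod A \<Longrightarrow> F A \<cdot> sh a A = \<langle>fst A\<rangle>" "\<And>A. rmod A \<Longrightarrow> sh a A \<cdot> F A = \<langle>fst A\<rangle>"
    using d by metis
  have nat: "F B \<cdot> f = f \<cdot> F A" if A: "rmod A" and B: "rmod B" and f: "lin A f B" for A B f
  proof -
    note fh = lin_hom[OF f]
    have "F B \<cdot> f = F B \<cdot> (f \<cdot> (sh a A \<cdot> F A))"
      using F(3)[OF A] cmp_ident[OF fh] by simp
    also have "f \<cdot> (sh a A \<cdot> F A) = (f \<cdot> sh a A) \<cdot> F A"
      by (rule cmp_assoc[symmetric, OF F(1)[OF A] sh_hom[OF A a] fh])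
    also have "f \<cdot> sh a A = sh a B \<cdot> f"
      by (rule sh_natural[OF f A B a, symmetric])
    also have "(sh a B \<cdot> f) \<cdot> F A = sh a B \<cdot> (f \<cdot> F A)"
      by (rule cmp_assoc[OF F(1)[OF A] fh sh_hom[OF B a]])
    also have "F B \<cdot> \<dots> = (F B \<cdot> sh a B) \<cdot> (f \<cdot> F A)"
      by (rule cmp_assoc[symmetric, OF cmp_hom[OF F(1)[OF A] fh] sh_hom[OF B a] F(1)[OF B]])
    finally show ?thesis
      using F(2)[OF B] cmp_ident[OF cmp_hom[OF F(1)[OF A] fh]] by simp
  qed
  define b where "b = from_nat V C \<iota> h (flat V H F)"
  have b: "b \<in> carrier El" "\<And>A. rmod A \<Longrightarrow> sh b A = F A"
    unfolding b_def by (rule sh_from_nat[OF F(1) nat]; assumption)+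
  have ab: "a \<otimes>\<^bsub>El\<^esub> b = \<one>\<^bsub>El\<^esub>" "b \<otimes>\<^bsub>El\<^esub> a = \<one>\<^bsub>El\<^esub>"
    by (rule sh_inj; simp add: a b El_mult_closed El_one_closed sh_mult sh_one F)+
  show "a \<in> Units El"
    using a b(1) ab unfolding Units_def by blast
  have ib: "inv\<^bsub>El\<^esub> a = b"
    using inv_unique'[OF a b(1) ab] by simp
  show "inv\<^bsub>El\<^esub> a \<in> carrier El"
    "rmod A \<Longrightarrow> sh (inv\<^bsub>El\<^esub> a) A \<cdot> sh a A = \<langle>fst A\<rangle>" "rmod A \<Longrightarrow> sh a A \<cdot> sh (inv\<^bsub>El\<^esub> a) A = \<langle>fst A\<rangle>"
    unfolding ib using b(1) b(2)[of A] F(2,3)[of A] by simp_all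
qed

text \<open>The usable form of \<open>S\<close>: an element crosses any linear pairing at the price
  of \<open>S\<close>. The definition gives this for \<open>evl\<close> only; a general pairing
  factors through \<open>evl\<close> by a linear arrow, along which \<open>sh a\<close> is
  natural.\<close>

lemma S_elem:
  assumes a: "a \<in> carrier El"
  shows "S_elem V C \<iota> H a \<in> carrier El"
    and "\<lbrakk>rmod A; rmod B; lin (B \<odot> A) e (mod_unit V H)\<rbrakk> \<Longrightarrow>
      e \<cdot> (\<langle>fst B\<rangle> \<otimes>\<^sub>a sh (S_elem V C \<iota> H a) A) = e \<cdot> (sh a B \<otimes>\<^sub>a \<langle>fst A\<rangle>)"
proof -
  define F where "F A = can_rl V (fst A) \<cdot> rdual_arr V (sh a (mod_ldual V H A)) \<cdot> arr_inv V (can_rl V (fst A))" for A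
  have tl: "typed (sh a (mod_ldual V H A)) [ldual V (fst A)] [ldual V (fst A)]" if "rmod A" for A
    using typed_sh[OF mod_ldual(1)[OF that] a[unfolded El_carrier]] by simp
  have tF: "typed (F A) [fst A] [fst A]" and
    eF: "evl V (fst A) \<cdot> (\<langle>ldual V (fst A)\<rangle> \<otimes>\<^sub>a F A) = evl V (fst A) \<cdot> (sh a (mod_ldual V H A) \<otimes>\<^sub>a \<langle>fst A\<rangle>)" if "rmod A" for A
    unfolding F_def using transpose_evl[OF rmod_Ob[OF that] tl[OF that]] by simp_all
  have law: "e \<cdot> (\<langle>fst B\<rangle> \<otimes>\<^sub>a F A) = e \<cdot> (sh a B \<otimes>\<^sub>a \<langle>fst A\<rangle>)"
    if A [simp]: "rmod A" and B [simp]: "rmod B" and e: "lin (B \<odot> A) e (mod_unit V H)" for A B e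
  proof -
    note te = lin_pairing_typed[OF B A e]
    define p where "p = (e \<otimes>\<^sub>a \<langle>ldual V (fst A)\<rangle>) \<cdot> (\<langle>fst B\<rangle> \<otimes>\<^sub>a coevl V (fst A))"
    have ep: "e = evl V (fst A) \<cdot> (p \<otimes>\<^sub>a \<langle>fst A\<rangle>)"
      unfolding p_def by (rule pairing_via_evl) (use te in simp_all)
    have lp: "lin B p (mod_ldual V H A)"
      unfolding p_def by (rule lin_pairing_dual(1)[OF A B e])
    note t = lin_r(1)[OF lp B mod_ldual(1)[OF A], simplified] tF[OF A] tl[OF A] typed_sh[OF B a[unfolded El_carrier]]
    note [den_intro] = t[THEN den_gen]
    have "e \<cdot> (\<langle>fst B\<rangle> \<otimes>\<^sub>a F A) = (evl V (fst A) \<cdot> (\<langle>ldual V (fst A)\<rangle> \<otimes>\<^sub>a F A)) \<cdot> (p \<otimes>\<^sub>a \<langle>fst A\<rangle>)"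
      unfolding ep by (rule den_eqI, (rule den_intro | (simp; fail))+, simp add: diag tyi t)
    also have "\<dots> = evl V (fst A) \<cdot> ((sh a (mod_ldual V H A) \<cdot> p) \<otimes>\<^sub>a \<langle>fst A\<rangle>)"
      unfolding eF[OF A] by (rule den_eqI, (rule den_intro | (simp; fail))+)
    also have "sh a (mod_ldual V H A) \<cdot> p = p \<cdot> sh a B"
      by (rule sh_natural[OF lp B mod_ldual(1)[OF A] a])
    also have "evl V (fst A) \<cdot> ((p \<cdot> sh a B) \<otimes>\<^sub>a \<langle>fst A\<rangle>) = e \<cdot> (sh a B \<otimes>\<^sub>a \<langle>fst A\<rangle>)"
      unfolding ep by (rule den_eqI, (rule den_intro | (simp; fail))+)
    finally show ?thesis .
  qed
  have FH: "F A \<in> Hom V (fst A) (fst A)" if "rmod A" for A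
    using tF[OF that] that by (simp add: typed_def)
  \<comment> \<open>That the transposes form a natural family, so that \<open>S\<close> exists, is
    again the pairing law, applied to \<open>evl\<close> of \<open>B\<close> precomposed with
    \<open>f\<close>.\<close>
  have nat: "F B \<cdot> f = f \<cdot> F A" if A [simp]: "rmod A" and B [simp]: "rmod B" and f: "lin A f B" for A B f
  proof -
    let ?L = "mod_ldual V H B" let ?l = "ldual V (fst B)"
    note L = mod_ldual[OF B]
    note t = lin_r(1)[OF f A B] tF[OF A] tF[OF B] tl[OF B]
    note [den_intro] = t[THEN den_gen]
    have "lin (?L \<odot> A) (\<langle>fst ?L\<rangle> \<otimes>\<^sub>a f) (?L \<odot> B)"
      by (rule lin_tensor[OF L(1) A L(1) B lin_ident[OF L(1)] f])
    then have le: "lin (?L \<odot> A) (evl V (fst B) \<cdot> (\<langle>?l\<rangle> \<otimes>\<^sub>a f)) (mod_unit V H)"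
      using lin_comp[OF rmod_mt[OF L(1) A] rmod_mt[OF L(1) B] mod_unit_module _ L(2)] by simp
    have "evl V (fst B) \<cdot> (\<langle>?l\<rangle> \<otimes>\<^sub>a (F B \<cdot> f)) = (evl V (fst B) \<cdot> (\<langle>?l\<rangle> \<otimes>\<^sub>a F B)) \<cdot> (\<langle>?l\<rangle> \<otimes>\<^sub>a f)"
      by (rule den_eqI, (rule den_intro | (simp; fail))+)
    also have "\<dots> = (evl V (fst B) \<cdot> (\<langle>?l\<rangle> \<otimes>\<^sub>a f)) \<cdot> (sh a ?L \<otimes>\<^sub>a \<langle>fst A\<rangle>)"
      unfolding eF[OF B] by (rule den_eqI, (rule den_intro | (simp; fail))+, simp add: diag tyi t)
    also have "\<dots> = (evl V (fst B) \<cdot> (\<langle>?l\<rangle> \<otimes>\<^sub>a f)) \<cdot> (\<langle>?l\<rangle> \<otimes>\<^sub>a F A)"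
      using law[OF A L(1) le] by simp
    also have "\<dots> = evl V (fst B) \<cdot> (\<langle>?l\<rangle> \<otimes>\<^sub>a (f \<cdot> F A))"
      by (rule den_eqI, (rule den_intro | (simp; fail))+)
    finally have eq: "evl V (fst B) \<cdot> (\<langle>?l\<rangle> \<otimes>\<^sub>a (F B \<cdot> f)) = evl V (fst B) \<cdot> (\<langle>?l\<rangle> \<otimes>\<^sub>a (f \<cdot> F A))" .
    show ?thesis
      by (rule evl_cancel_hom[OF rmod_Ob[OF B] cmp_hom[OF lin_hom[OF f] FH[OF B]] cmp_hom[OF FH[OF A] lin_hom[OF f]] eq])
  qed
  define b where "b = from_nat V C \<iota> h (flat V H F)"
  have b: "b \<in> carrier El" "\<And>A. rmod A \<Longrightarrow> sh b A = F A"
    unfolding b_def by (rule sh_from_nat[OF FH nat]; assumption)+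
  have "S_elem V C \<iota> H a = b"
    unfolding S_elem_def F_def[symmetric]
  proof (rule the_equality)
    show "b \<in> carrier El \<and> (\<forall>A. rmod A \<longrightarrow> sh b A = F A)"
      using b by blast
    fix b' assume "b' \<in> carrier El \<and> (\<forall>A. rmod A \<longrightarrow> sh b' A = F A)"
    then have b': "b' \<in> carrier El" "\<And>A. rmod A \<Longrightarrow> sh b' A = F A"
      by blast+
    show "b' = b"
      by (rule sh_inj[OF b'(1) b(1)]) (simp add: b(2) b'(2))
  qed
  then have S: "S_elem V C \<iota> H a \<in> carrier El" "\<And>A. rmod A \<Longrightarrow> sh (S_elem V C \<iota> H a) A = F A"
    using b by simp_all
  show "S_elem V C \<iota> H a \<in> carrier El"
    by (rule S(1))
  show "\<lbrakk>rmod A; rmod B; lin (B \<odot> A) e (mod_unit V H)\<rbrakk> \<Longrightarrow>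
      e \<cdot> (\<langle>fst B\<rangle> \<otimes>\<^sub>a sh (S_elem V C \<iota> H a) A) = e \<cdot> (sh a B \<otimes>\<^sub>a \<langle>fst A\<rangle>)"
    using law[of A B e] S(2)[of A] by simp
qed

section \<open>The defining equations of pivotal and balanced elements, read on modules\<close>

lemma tensor_coend_eq_iff:
  assumes f: "typed f [C, h] [h]" "typed g [C, h] [h]"
  shows "f = g \<longleftrightarrow> (\<forall>X \<in> Ob V. (\<langle>X\<rangle> \<otimes>\<^sub>a f) \<cdot> (\<delta> X \<otimes>\<^sub>a \<langle>h\<rangle>) = (\<langle>X\<rangle> \<otimes>\<^sub>a g) \<cdot> (\<delta> X \<otimes>\<^sub>a \<langle>h\<rangle>))"
  using coend_eqI[of h f h g] f by (auto simp: typed_def tob_Cons tensor_ob_unit)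

text \<open>The common core of centrality, where \<open>Q\<close> is the identity, and pivotality,
  where \<open>Q\<close> is a double braiding with the squared antipode. One direction is naturality
  along the action, the other is evaluation at the unit of a free module.\<close>

lemma twisted_linear_iff:
  assumes a: "a \<in> carrier El" and Q: "\<And>X. X \<in> Ob V \<Longrightarrow> typed (Q X) [X, h] [X, h]"
    and nat: "\<And>X Y f. f \<in> Hom V X Y \<Longrightarrow> Q Y \<cdot> (f \<otimes>\<^sub>a \<langle>h\<rangle>) = (f \<otimes>\<^sub>a \<langle>h\<rangle>) \<cdot> Q X"
  shows "(\<forall>X \<in> Ob V. (\<langle>X\<rangle> \<otimes>\<^sub>a mul H) \<cdot> sg a (X \<otimes>\<^sub>o h) = (\<langle>X\<rangle> \<otimes>\<^sub>a mul H) \<cdot> (sg a X \<otimes>\<^sub>a \<langle>h\<rangle>) \<cdot> Q X)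
    \<longleftrightarrow> (\<forall>A. rmod A \<longrightarrow> sh a A \<cdot> snd A = snd A \<cdot> (sh a A \<otimes>\<^sub>a \<langle>h\<rangle>) \<cdot> Q (fst A))"
    (is "?l \<longleftrightarrow> ?r")
proof
  assume l: ?l
  show ?r
  proof (intro allI impI)
    fix A assume A [simp]: "rmod A"
    note t = rmod_typed[OF A] Q[of "fst A"] typed_Sig[OF _ a[unfolded El_carrier], of "fst A"]
    note [den_intro] = t[THEN den_gen]
    have "sh a A \<cdot> snd A = snd A \<cdot> sh a (free (fst A))"
      by (rule sh_natural[OF act_lin[OF A] rmod_free A a]) simp
    also have "\<dots> = snd A \<cdot> (\<langle>fst A\<rangle> \<otimes>\<^sub>a mul H) \<cdot> (sg a (fst A) \<otimes>\<^sub>a \<langle>h\<rangle>) \<cdot> Q (fst A)"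
      using l sh_free(2)[OF _ a] by simp
    also have "\<dots> = snd A \<cdot> (sh a A \<otimes>\<^sub>a \<langle>h\<rangle>) \<cdot> Q (fst A)"
      unfolding sharp_def by (rule den_eqI, (rule den_intro | (simp; fail))+, simp add: diag tyi t rmod_rules[OF A])
    finally show "sh a A \<cdot> snd A = snd A \<cdot> (sh a A \<otimes>\<^sub>a \<langle>h\<rangle>) \<cdot> Q (fst A)" .
  qed
next
  assume r: ?r
  show ?l
  proof
    fix X assume X [simp]: "X \<in> Ob V"
    note f = rmod_free[OF X]
    let ?u = "\<langle>X\<rangle> \<otimes>\<^sub>a uni H"
    define a' where "a' = sh a (free X)"
    have a': "typed a' [X, h] [X, h]"
      unfolding a'_def using sh_hom[OF f a] by (simp add: typed_def tob_Cons tensor_ob_unit)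
    have q: "typed (Q (X \<otimes>\<^sub>o h)) [X, h, h] [X, h, h]"
      using Q[of "X \<otimes>\<^sub>o h"] by (simp add: typed_def tob_Cons tensor_ob_unit tensor_closed tensor_ob_assoc)
    note t = Q[OF X] typed_Sig[OF X a[unfolded El_carrier]] a' q
    note [den_intro] = t[THEN den_gen]
    have u: "?u \<in> Hom V X (X \<otimes>\<^sub>o h)"
      using tensor_hom[OF ident_hom[OF X] uni_hom] by (simp add: tensor_ob_unit)
    have "(\<langle>X\<rangle> \<otimes>\<^sub>a mul H) \<cdot> sg a (X \<otimes>\<^sub>o h) = (a' \<cdot> (\<langle>X\<rangle> \<otimes>\<^sub>a mul H)) \<cdot> (?u \<otimes>\<^sub>a \<langle>h\<rangle>)"
      unfolding sh_free(2)[OF X a, symmetric] a'_def[symmetric] by (rule den_eqI, (rule den_intro | (simp; fail))+, simp add: diag tyi t mul_uni_r)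
    also have "\<dots> = ((\<langle>X\<rangle> \<otimes>\<^sub>a mul H) \<cdot> (a' \<otimes>\<^sub>a \<langle>h\<rangle>) \<cdot> Q (X \<otimes>\<^sub>o h)) \<cdot> (?u \<otimes>\<^sub>a \<langle>h\<rangle>)"
      using r[rule_format, OF f] unfolding a'_def by simp
    also have "\<dots> = (\<langle>X\<rangle> \<otimes>\<^sub>a mul H) \<cdot> (a' \<otimes>\<^sub>a \<langle>h\<rangle>) \<cdot> (Q (X \<otimes>\<^sub>o h) \<cdot> (?u \<otimes>\<^sub>a \<langle>h\<rangle>))"
      by (rule den_eqI, (rule den_intro | (simp; fail))+)
    also have "\<dots> = (\<langle>X\<rangle> \<otimes>\<^sub>a mul H) \<cdot> ((a' \<cdot> ?u) \<otimes>\<^sub>a \<langle>h\<rangle>) \<cdot> Q X"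
      unfolding nat[OF u] by (rule den_eqI, (rule den_intro | (simp; fail))+)
    also have "a' \<cdot> ?u = sg a X"
      unfolding a'_def by (rule sh_free(1)[OF X a])
    finally show "(\<langle>X\<rangle> \<otimes>\<^sub>a mul H) \<cdot> sg a (X \<otimes>\<^sub>o h) = (\<langle>X\<rangle> \<otimes>\<^sub>a mul H) \<cdot> (sg a X \<otimes>\<^sub>a \<langle>h\<rangle>) \<cdot> Q X" .
  qed
qed

text \<open>The left-hand side shared by centrality and pivotality: \<open>mulC\<close> merges the
  coactions of \<open>X\<close> and \<open>h\<close> into that of
  \<open>X \<otimes> h\<close>.\<close>

lemma left_mul_mulC:
  assumes X [simp]: "X \<in> Ob V" and a: "typed a [C] [h]"
  shows "(\<langle>X\<rangle> \<otimes>\<^sub>a (mul H \<cdot> (\<langle>h\<rangle> \<otimes>\<^sub>a (a \<cdot> mC)) \<cdot> (\<sigma> C h \<otimes>\<^sub>a \<langle>C\<rangle>) \<cdot> (\<langle>C\<rangle> \<otimes>\<^sub>a \<delta> h))) \<cdot> (\<delta> X \<otimes>\<^sub>a \<langle>h\<rangle>)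
    = (\<langle>X\<rangle> \<otimes>\<^sub>a mul H) \<cdot> sg a (X \<otimes>\<^sub>o h)"
proof -
  note [den_intro] = a[THEN den_gen]
  have "(\<langle>X\<rangle> \<otimes>\<^sub>a (mul H \<cdot> (\<langle>h\<rangle> \<otimes>\<^sub>a (a \<cdot> mC)) \<cdot> (\<sigma> C h \<otimes>\<^sub>a \<langle>C\<rangle>) \<cdot> (\<langle>C\<rangle> \<otimes>\<^sub>a \<delta> h))) \<cdot> (\<delta> X \<otimes>\<^sub>a \<langle>h\<rangle>)
     = (\<langle>X\<rangle> \<otimes>\<^sub>a (mul H \<cdot> (\<langle>h\<rangle> \<otimes>\<^sub>a a))) \<cdot> ((\<langle>X \<otimes>\<^sub>o h\<rangle> \<otimes>\<^sub>a mC) \<cdot> \<delta>2 X h)"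
    unfolding delta2_def by (rule den_eqI, (rule den_intro | (simp; fail))+, simp add: diag tyi a)
  also have "\<dots> = (\<langle>X\<rangle> \<otimes>\<^sub>a mul H) \<cdot> sg a (X \<otimes>\<^sub>o h)"
    unfolding mulC(2)[OF X obj_closed] Sig_def by (rule den_eqI, (rule den_intro | (simp; fail))+)
  finally show ?thesis .
qed

lemma central_iff:
  assumes a: "a \<in> carrier El"
  shows "mul H \<cdot> (\<langle>h\<rangle> \<otimes>\<^sub>a (a \<cdot> mC)) \<cdot> (\<sigma> C h \<otimes>\<^sub>a \<langle>C\<rangle>) \<cdot> (\<langle>C\<rangle> \<otimes>\<^sub>a \<delta> h) = mul H \<cdot> (a \<otimes>\<^sub>a \<langle>h\<rangle>)
    \<longleftrightarrow> (\<forall>A. rmod A \<longrightarrow> lin A (sh a A) A)"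
proof -
  have t: "typed a [C] [h]" using a by (simp add: El_carrier)
  note [den_intro] = t[THEN den_gen]
  let ?f = "mul H \<cdot> (\<langle>h\<rangle> \<otimes>\<^sub>a (a \<cdot> mC)) \<cdot> (\<sigma> C h \<otimes>\<^sub>a \<langle>C\<rangle>) \<cdot> (\<langle>C\<rangle> \<otimes>\<^sub>a \<delta> h)" and ?g = "mul H \<cdot> (a \<otimes>\<^sub>a \<langle>h\<rangle>)"
  have fg: "typed ?f [C, h] [h]" "typed ?g [C, h] [h]"
    by (rule den_typed, rule den_conv, (rule den_intro | (simp; fail))+)+
  have g: "(\<langle>X\<rangle> \<otimes>\<^sub>a ?g) \<cdot> (\<delta> X \<otimes>\<^sub>a \<langle>h\<rangle>) = (\<langle>X\<rangle> \<otimes>\<^sub>a mul H) \<cdot> (sg a X \<otimes>\<^sub>a \<langle>h\<rangle>) \<cdot> \<langle>X \<otimes>\<^sub>o h\<rangle>" if [simp]: "X \<in> Ob V" for X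
    unfolding Sig_def by (rule den_eqI, (rule den_intro | (simp; fail))+)
  have "?f = ?g \<longleftrightarrow> (\<forall>X \<in> Ob V. (\<langle>X\<rangle> \<otimes>\<^sub>a mul H) \<cdot> sg a (X \<otimes>\<^sub>o h) = (\<langle>X\<rangle> \<otimes>\<^sub>a mul H) \<cdot> (sg a X \<otimes>\<^sub>a \<langle>h\<rangle>) \<cdot> \<langle>X \<otimes>\<^sub>o h\<rangle>)"
    unfolding tensor_coend_eq_iff[OF fg] using left_mul_mulC[OF _ t] g by simp
  also have "\<dots> \<longleftrightarrow> (\<forall>A. rmod A \<longrightarrow> sh a A \<cdot> snd A = snd A \<cdot> (sh a A \<otimes>\<^sub>a \<langle>h\<rangle>) \<cdot> \<langle>fst A \<otimes>\<^sub>o h\<rangle>)"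
  proof (rule twisted_linear_iff[OF a])
    show "typed \<langle>X \<otimes>\<^sub>o h\<rangle> [X, h] [X, h]" if [simp]: "X \<in> Ob V" for X
      by (rule den_typed, rule den_conv, (rule den_intro | (simp; fail))+)
    show "\<langle>Y \<otimes>\<^sub>o h\<rangle> \<cdot> (f \<otimes>\<^sub>a \<langle>h\<rangle>) = (f \<otimes>\<^sub>a \<langle>h\<rangle>) \<cdot> \<langle>X \<otimes>\<^sub>o h\<rangle>" if f: "f \<in> Hom V X Y" for X Y f
      using cmp_ident[OF tensor_hom[OF f ident_hom[OF obj_closed]]] by simp
  qed
  also have "\<dots> \<longleftrightarrow> (\<forall>A. rmod A \<longrightarrow> lin A (sh a A) A)"
    using cmp_ident[OF tensor_hom[OF sh_hom[OF _ a] ident_hom[OF obj_closed]]] sh_hom[OF _ a]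
    by (auto simp: H_linear_def)
  finally show ?thesis .
qed

lemma pivotal_iff:
  assumes a: "a \<in> carrier El"
  shows "mul H \<cdot> (\<langle>h\<rangle> \<otimes>\<^sub>a (a \<cdot> mC)) \<cdot> (\<sigma> C h \<otimes>\<^sub>a \<langle>C\<rangle>) \<cdot> (\<langle>C\<rangle> \<otimes>\<^sub>a \<delta> h)
      = mul H \<cdot> (a \<otimes>\<^sub>a \<langle>h\<rangle> \<otimes>\<^sub>a \<omega>) \<cdot> (\<langle>C\<rangle> \<otimes>\<^sub>a \<sigma> C h \<otimes>\<^sub>a \<langle>C\<rangle>) \<cdot> (\<Delta>C \<otimes>\<^sub>a (\<delta> h \<cdot> ant H \<cdot> ant H))
    \<longleftrightarrow> (\<forall>A. rmod A \<longrightarrow> sh a A \<cdot> snd A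
          = snd A \<cdot> (sh a A \<otimes>\<^sub>a \<langle>h\<rangle>) \<cdot> \<sigma> h (fst A) \<cdot> \<sigma> (fst A) h \<cdot> (\<langle>fst A\<rangle> \<otimes>\<^sub>a (ant H \<cdot> ant H)))"
proof -
  have t: "typed a [C] [h]" using a by (simp add: El_carrier)
  note [den_intro] = t[THEN den_gen]
  let ?f = "mul H \<cdot> (\<langle>h\<rangle> \<otimes>\<^sub>a (a \<cdot> mC)) \<cdot> (\<sigma> C h \<otimes>\<^sub>a \<langle>C\<rangle>) \<cdot> (\<langle>C\<rangle> \<otimes>\<^sub>a \<delta> h)"
    and ?g = "mul H \<cdot> (a \<otimes>\<^sub>a \<langle>h\<rangle> \<otimes>\<^sub>a \<omega>) \<cdot> (\<langle>C\<rangle> \<otimes>\<^sub>a \<sigma> C h \<otimes>\<^sub>a \<langle>C\<rangle>) \<cdot> (\<Delta>C \<otimes>\<^sub>a (\<delta> h \<cdot> ant H \<cdot> ant H))"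
  let ?Q = "\<lambda>X. \<sigma> h X \<cdot> \<sigma> X h \<cdot> (\<langle>X\<rangle> \<otimes>\<^sub>a (ant H \<cdot> ant H))"
  have fg: "typed ?f [C, h] [h]" "typed ?g [C, h] [h]"
    by (rule den_typed, rule den_conv, (rule den_intro | (simp; fail))+)+
  \<comment> \<open>\<open>comC\<close> doubles the coaction of \<open>X\<close>; the second copy
    meets the coaction of \<open>h\<close> in \<open>\<omega>\<close>, which becomes the double
    braiding in \<open>?Q\<close>.\<close>
  have g: "(\<langle>X\<rangle> \<otimes>\<^sub>a ?g) \<cdot> (\<delta> X \<otimes>\<^sub>a \<langle>h\<rangle>) = (\<langle>X\<rangle> \<otimes>\<^sub>a mul H) \<cdot> (sg a X \<otimes>\<^sub>a \<langle>h\<rangle>) \<cdot> ?Q X" if [simp]: "X \<in> Ob V" for X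
    unfolding Sig_def
    by (rule den_eqI, (rule den_intro | (simp; fail))+, (simp add: exch_right exch_left comC_r delta2_r t tyi has_def shp_app shp_init)?)
  have "?f = ?g \<longleftrightarrow> (\<forall>X \<in> Ob V. (\<langle>X\<rangle> \<otimes>\<^sub>a mul H) \<cdot> sg a (X \<otimes>\<^sub>o h) = (\<langle>X\<rangle> \<otimes>\<^sub>a mul H) \<cdot> (sg a X \<otimes>\<^sub>a \<langle>h\<rangle>) \<cdot> ?Q X)"
    unfolding tensor_coend_eq_iff[OF fg] using left_mul_mulC[OF _ t] g by simp
  also have "\<dots> \<longleftrightarrow> (\<forall>A. rmod A \<longrightarrow> sh a A \<cdot> snd A = snd A \<cdot> (sh a A \<otimes>\<^sub>a \<langle>h\<rangle>) \<cdot> ?Q (fst A))"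
  proof (rule twisted_linear_iff[OF a])
    show "typed (?Q X) [X, h] [X, h]" if [simp]: "X \<in> Ob V" for X
      by (rule den_typed, rule den_conv, (rule den_intro | (simp; fail))+)
    show "?Q Y \<cdot> (f \<otimes>\<^sub>a \<langle>h\<rangle>) = (f \<otimes>\<^sub>a \<langle>h\<rangle>) \<cdot> ?Q X" if f: "f \<in> Hom V X Y" for X Y f
    proof -
      have [simp]: "X \<in> Ob V" "Y \<in> Ob V" and tf: "typed f [X] [Y]" using f hom_Ob by (auto simp: typed_def)
      note [den_intro] = tf[THEN den_gen]
      show ?thesis by (rule den_eqI, (rule den_intro | (simp; fail))+, simp add: diag tyi tf)
    qed
  qed
  finally show ?thesis .
qed

lemma counit_iff: "typed a [C] [h] \<Longrightarrow> cou H \<cdot> a \<cdot> uniC V \<iota> = \<langle>\<^bold>1\<rangle> \<longleftrightarrow> sh a (mod_unit V H) = \<langle>\<^bold>1\<rangle>"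
  by (simp add: sh_def mod_unit_def uniC_def tensor_ar_unit hom_Ar typed_def)

definition tensor_coprod :: "'m \<Rightarrow> 'o \<Rightarrow> 'o \<Rightarrow> 'm" where
  "tensor_coprod a X Y = (\<langle>X\<rangle> \<otimes>\<^sub>a \<langle>Y\<rangle> \<otimes>\<^sub>a com H) \<cdot> sg a (X \<otimes>\<^sub>o Y)"

lemma typed_sg_tensor:
  assumes [simp]: "X \<in> Ob V" "Y \<in> Ob V" and a: "a \<in> carrier El"
  shows "typed (sg a (X \<otimes>\<^sub>o Y)) [X, Y] [X, Y, h]"
  using typed_Sig[of "X \<otimes>\<^sub>o Y" a "[h]"] a by (simp add: El_carrier typed_def tob_Cons tensor_ob_unit tensor_closed tensor_ob_assoc)

lemma sh_tensor:
  assumes A [simp]: "rmod A" and B [simp]: "rmod B" and a: "a \<in> carrier El"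
  shows "sh a (A \<odot> B) = (snd A \<otimes>\<^sub>a snd B) \<cdot> (\<langle>fst A\<rangle> \<otimes>\<^sub>a \<sigma> (fst B) h \<otimes>\<^sub>a \<langle>h\<rangle>) \<cdot> tensor_coprod a (fst A) (fst B)"
proof -
  note t = typed_sg_tensor[OF rmod_Ob[OF A] rmod_Ob[OF B] a]
  note [den_intro] = t[THEN den_gen]
  show ?thesis
    unfolding sharp_def mt_eq fst_conv snd_conv tensor_coprod_def by (rule den_eqI, (rule den_intro | (simp; fail))+)
qed

lemma sg_natural:
  assumes a: "a \<in> carrier El" and f: "f \<in> Hom V X Y"
  shows "sg a Y \<cdot> f = (f \<otimes>\<^sub>a \<langle>h\<rangle>) \<cdot> sg a X"
proof -
  have [simp]: "X \<in> Ob V" "Y \<in> Ob V" and t: "typed f [X] [Y]" using f hom_Ob by (auto simp: typed_def)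
  note t = t a[unfolded El_carrier]
  note [den_intro] = t[THEN den_gen]
  have "sg a Y \<cdot> f = (\<langle>Y\<rangle> \<otimes>\<^sub>a a) \<cdot> (\<delta> Y \<cdot> f)"
    unfolding Sig_def by (rule den_eqI, (rule den_intro | (simp; fail))+)
  also have "\<dots> = (f \<otimes>\<^sub>a \<langle>h\<rangle>) \<cdot> sg a X"
    unfolding delta_natural[OF f] Sig_def by (rule den_eqI, (rule den_intro | (simp; fail))+, simp add: diag tyi t)
  finally show ?thesis .
qed

text \<open>The converse of \<open>sh_tensor\<close>: units inserted into free modules recover
  \<open>tensor_coprod\<close>, up to an invertible crossing.\<close>

lemma sh_tensor_free:
  assumes X [simp]: "X \<in> Ob V" and Y [simp]: "Y \<in> Ob V" and a: "a \<in> carrier El"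
  shows "sh a (free X \<odot> free Y) \<cdot> (\<langle>X\<rangle> \<otimes>\<^sub>a uni H \<otimes>\<^sub>a \<langle>Y\<rangle> \<otimes>\<^sub>a uni H) = (\<langle>X\<rangle> \<otimes>\<^sub>a \<sigma> Y h \<otimes>\<^sub>a \<langle>h\<rangle>) \<cdot> tensor_coprod a X Y"
proof -
  let ?u = "\<langle>X\<rangle> \<otimes>\<^sub>a uni H \<otimes>\<^sub>a \<langle>Y\<rangle> \<otimes>\<^sub>a uni H"
  have tu: "typed ?u [X, Y] [X, h, Y, h]" by (rule den_typed, rule den_conv, (rule den_intro | (simp; fail))+)
  then have u: "?u \<in> Hom V (X \<otimes>\<^sub>o Y) ((X \<otimes>\<^sub>o h) \<otimes>\<^sub>o (Y \<otimes>\<^sub>o h))"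
    by (simp add: typed_def tob_Cons tensor_ob_unit tensor_ob_assoc tensor_closed)
  have t1: "typed (sg a ((X \<otimes>\<^sub>o h) \<otimes>\<^sub>o (Y \<otimes>\<^sub>o h))) [X, h, Y, h] [X, h, Y, h, h]"
    using typed_sg_tensor[of "X \<otimes>\<^sub>o h" "Y \<otimes>\<^sub>o h" a] a by (simp add: typed_def tob_Cons tensor_ob_unit tensor_ob_assoc tensor_closed)
  note t = t1 typed_sg_tensor[OF X Y a]
  note [den_intro] = t[THEN den_gen]
  have "sh a (free X \<odot> free Y) \<cdot> ?u = (\<langle>X\<rangle> \<otimes>\<^sub>a mul H \<otimes>\<^sub>a \<langle>Y\<rangle> \<otimes>\<^sub>a mul H) \<cdot> (\<langle>X\<rangle> \<otimes>\<^sub>a \<langle>h\<rangle> \<otimes>\<^sub>a \<sigma> (Y \<otimes>\<^sub>o h) h \<otimes>\<^sub>a \<langle>h\<rangle>)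
     \<cdot> (\<langle>X\<rangle> \<otimes>\<^sub>a \<langle>h\<rangle> \<otimes>\<^sub>a \<langle>Y\<rangle> \<otimes>\<^sub>a \<langle>h\<rangle> \<otimes>\<^sub>a com H) \<cdot> (sg a ((X \<otimes>\<^sub>o h) \<otimes>\<^sub>o (Y \<otimes>\<^sub>o h)) \<cdot> ?u)"
    unfolding sh_tensor[OF rmod_free[OF X] rmod_free[OF Y] a] tensor_coprod_def free_simps
    by (rule den_eqI, (rule den_intro | (simp; fail))+)
  also have "\<dots> = (\<langle>X\<rangle> \<otimes>\<^sub>a \<sigma> Y h \<otimes>\<^sub>a \<langle>h\<rangle>) \<cdot> tensor_coprod a X Y"
    unfolding sg_natural[OF a u] tensor_coprod_def by (rule den_eqI, (rule den_intro | (simp; fail))+, simp add: diag tyi t mul_uni_r)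
  finally show ?thesis .
qed

text \<open>\<open>natR2\<close> read backwards: the splitting arrow is moved in front of the
  crossing. This brings \<open>comC\<close> next to the coaction, where \<open>comC_r\<close> can
  absorb it.\<close>

lemma braid_inward:
  "\<lbrakk>typed f [s] [t, u]; has n [s, y] st\<rbrakk> \<Longrightarrow>
    app (Suc n) [s] f [t, u] (app n [s, y] (\<sigma> s y) [y, s] st)
    = app n [t, y] (\<sigma> t y) [y, t] (app (Suc n) [u, y] (\<sigma> u y) [y, u] (app n [s] f [t, u] st))"
  using natR2[of f "[s]" t u n y st] by simp

lemma tensor_coprod_mulC:
  assumes o [simp]: "X \<in> Ob V" "Y \<in> Ob V" and a: "a \<in> carrier El"
  shows "(\<langle>X \<otimes>\<^sub>o Y\<rangle> \<otimes>\<^sub>a (com H \<cdot> a \<cdot> mC)) \<cdot> \<delta>2 X Y = tensor_coprod a X Y"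
proof -
  note t = a[unfolded El_carrier]
  note [den_intro] = t[THEN den_gen]
  have "(\<langle>X \<otimes>\<^sub>o Y\<rangle> \<otimes>\<^sub>a (com H \<cdot> a \<cdot> mC)) \<cdot> \<delta>2 X Y
     = (\<langle>X \<otimes>\<^sub>o Y\<rangle> \<otimes>\<^sub>a (com H \<cdot> a)) \<cdot> ((\<langle>X \<otimes>\<^sub>o Y\<rangle> \<otimes>\<^sub>a mC) \<cdot> \<delta>2 X Y)"
    unfolding delta2_def by (rule den_eqI, (rule den_intro | (simp; fail))+)
  also have "\<dots> = tensor_coprod a X Y"
    unfolding mulC(2)[OF o] tensor_coprod_def Sig_def by (rule den_eqI, (rule den_intro | (simp; fail))+)
  finally show ?thesis .
qed

text \<open>The two coproducts double the coactions of \<open>X\<close> and \<open>Y\<close>. One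
  pair feeds \<open>P\<close>, the other is consumed by \<open>\<omega>\<close> and becomes a double
  braiding performed first.\<close>

lemma omega_factor:
  assumes o [simp]: "X \<in> Ob V" "Y \<in> Ob V" and P: "typed P [C, C] [h, h]"
  shows "(\<langle>X \<otimes>\<^sub>o Y\<rangle> \<otimes>\<^sub>a ((P \<otimes>\<^sub>a \<omega>) \<cdot> (\<langle>C\<rangle> \<otimes>\<^sub>a \<sigma> C C \<otimes>\<^sub>a \<langle>C\<rangle>) \<cdot> (\<Delta>C \<otimes>\<^sub>a \<Delta>C))) \<cdot> \<delta>2 X Y
    = ((\<langle>X \<otimes>\<^sub>o Y\<rangle> \<otimes>\<^sub>a P) \<cdot> \<delta>2 X Y) \<cdot> \<sigma> Y X \<cdot> \<sigma> X Y"
proof -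
  note [den_intro] = P[THEN den_gen]
  \<comment> \<open>\<open>braid_inward\<close> orients naturality against \<open>diag\<close>, so
    the rewriting is staged: coproducts are absorbed first, and only then are crossings straightened
    and \<open>delta2_r\<close> applied.\<close>
  show ?thesis
    unfolding delta2_def
    by (rule den_eqI, (rule den_intro | (simp; fail))+, (simp add: exch_right exch_left comC_r braid_inward[OF comC(1)] tyi P has_def shp_app shp_init)?,
      (simp add: diag' comC_r tyi P)?, (simp add: diag delta2_r tyi P)?)
qed

text \<open>Here the universal coaction is taken on the object \<open>C\<close> itself, so the
  pairing produces the inverse double braiding of the wires \<open>C\<close> and
  \<open>Y\<close>.\<close>

lemma omega_bar_r:
  assumes [simp]: "X \<in> Ob V" "Y \<in> Ob V" and h: "has n [X, Y] st"
  shows "app (Suc (Suc (Suc n))) [C, C] \<omega>b [] (app (Suc (Suc n)) [C, Y] (\<sigma> C Y) [Y, C]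
      (app (Suc n) [C] (\<delta> C) [C, C] (app n [X] (\<delta> X) [X, C] (app (Suc n) [Y] (\<delta> Y) [Y, C] st))))
     = app (Suc n) [Y, C] (ibr Y C) [C, Y] (app (Suc n) [C, Y] (ibr C Y) [Y, C] (app n [X] (\<delta> X) [X, C] st))"
proof -
  have "(\<langle>X\<rangle> \<otimes>\<^sub>a ((\<langle>C \<otimes>\<^sub>o Y\<rangle> \<otimes>\<^sub>a \<omega>b) \<cdot> (\<langle>C\<rangle> \<otimes>\<^sub>a \<sigma> C Y \<otimes>\<^sub>a \<langle>C\<rangle>) \<cdot> (\<delta> C \<otimes>\<^sub>a \<delta> Y))) \<cdot> (\<delta> X \<otimes>\<^sub>a \<langle>Y\<rangle>)
     = (\<langle>X\<rangle> \<otimes>\<^sub>a \<langle>C\<rangle> \<otimes>\<^sub>a \<langle>Y\<rangle> \<otimes>\<^sub>a \<omega>b) \<cdot> (\<langle>X\<rangle> \<otimes>\<^sub>a \<langle>C\<rangle> \<otimes>\<^sub>a \<sigma> C Y \<otimes>\<^sub>a \<langle>C\<rangle>) \<cdot> (\<langle>X\<rangle> \<otimes>\<^sub>a \<delta> C \<otimes>\<^sub>a \<langle>Y\<rangle> \<otimes>\<^sub>a \<langle>C\<rangle>) \<cdot> (\<delta> X \<otimes>\<^sub>a \<delta> Y)"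
    by (rule den_eqI, (rule den_intro | (simp; fail))+, (simp add: exch_right exch_left tyi has_def shp_app shp_init)?)
  then have e: "(\<langle>X\<rangle> \<otimes>\<^sub>a \<langle>C\<rangle> \<otimes>\<^sub>a \<langle>Y\<rangle> \<otimes>\<^sub>a \<omega>b) \<cdot> (\<langle>X\<rangle> \<otimes>\<^sub>a \<langle>C\<rangle> \<otimes>\<^sub>a \<sigma> C Y \<otimes>\<^sub>a \<langle>C\<rangle>) \<cdot> (\<langle>X\<rangle> \<otimes>\<^sub>a \<delta> C \<otimes>\<^sub>a \<langle>Y\<rangle> \<otimes>\<^sub>a \<langle>C\<rangle>) \<cdot> (\<delta> X \<otimes>\<^sub>a \<delta> Y)
     = (\<langle>X\<rangle> \<otimes>\<^sub>a (ibr Y C \<cdot> ibr C Y)) \<cdot> (\<delta> X \<otimes>\<^sub>a \<langle>Y\<rangle>)"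
    using omega_bar(2)[OF C_closed, of Y] by (simp add: delta2_def)
  show ?thesis
    using h by - ((rule den_rule[OF e], (rule den_intro | (simp; fail))+)[1])
qed

text \<open>\<open>\<delta>2\<close> contributes one crossing of \<open>C\<close> over
  \<open>Y\<close>. The inverse double braiding from \<open>omega_bar_r\<close> cancels it and
  leaves one inverse crossing; this is the effect of the coaction on \<open>C\<close> in the
  definition of twisted grouplike elements.\<close>

lemma omega_bar_factor:
  assumes o [simp]: "X \<in> Ob V" "Y \<in> Ob V" and a: "a \<in> carrier El"
  shows "(\<langle>X \<otimes>\<^sub>o Y\<rangle> \<otimes>\<^sub>a ((a \<otimes>\<^sub>a a) \<cdot> (\<langle>C\<rangle> \<otimes>\<^sub>a \<omega>b \<otimes>\<^sub>a \<langle>C\<rangle>) \<cdot> (\<delta> C \<otimes>\<^sub>a \<Delta>C))) \<cdot> \<delta>2 X Y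
    = (\<langle>X\<rangle> \<otimes>\<^sub>a ibr h Y \<otimes>\<^sub>a \<langle>h\<rangle>) \<cdot> (sg a X \<otimes>\<^sub>a sg a Y)"
proof -
  note t = a[unfolded El_carrier]
  note [den_intro] = t[THEN den_gen]
  show ?thesis
    unfolding delta2_def Sig_def
    by (rule den_eqI, (rule den_intro | (simp; fail))+, (simp add: exch_right exch_left comC_r braid_inward[OF typed_delta[OF C_closed]] tyi t has_def shp_app shp_init)?,
      (simp add: exch_right exch_left omega_bar_r ibr_rules tyi t has_def shp_app shp_init)?)
qed

lemma twisted_mult_iff:
  assumes a: "a \<in> carrier El"
  shows "com H \<cdot> a \<cdot> mC = (((a \<otimes>\<^sub>a a) \<cdot> (\<langle>C\<rangle> \<otimes>\<^sub>a \<omega>b \<otimes>\<^sub>a \<langle>C\<rangle>) \<cdot> (\<delta> C \<otimes>\<^sub>a \<Delta>C)) \<otimes>\<^sub>a \<omega>)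
         \<cdot> (\<langle>C\<rangle> \<otimes>\<^sub>a \<sigma> C C \<otimes>\<^sub>a \<langle>C\<rangle>) \<cdot> (\<Delta>C \<otimes>\<^sub>a \<Delta>C)
    \<longleftrightarrow> (\<forall>X \<in> Ob V. \<forall>Y \<in> Ob V. tensor_coprod a X Y = ((\<langle>X\<rangle> \<otimes>\<^sub>a ibr h Y \<otimes>\<^sub>a \<langle>h\<rangle>) \<cdot> (sg a X \<otimes>\<^sub>a sg a Y)) \<cdot> \<sigma> Y X \<cdot> \<sigma> X Y)"
    (is "?f = ?g \<longleftrightarrow> ?r")
proof -
  note t = a[unfolded El_carrier]
  note [den_intro] = t[THEN den_gen]
  have P: "typed ((a \<otimes>\<^sub>a a) \<cdot> (\<langle>C\<rangle> \<otimes>\<^sub>a \<omega>b \<otimes>\<^sub>a \<langle>C\<rangle>) \<cdot> (\<delta> C \<otimes>\<^sub>a \<Delta>C)) [C, C] [h, h]"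
    by (rule den_typed, rule den_conv, (rule den_intro | (simp; fail))+)
  have "typed ?f [C, C] [h, h]" "typed ?g [C, C] [h, h]"
    by (rule den_typed, rule den_conv, (rule den_intro | (simp; fail))+)+
  then have fg: "?f \<in> Hom V (C \<otimes>\<^sub>o C) (h \<otimes>\<^sub>o h)" "?g \<in> Hom V (C \<otimes>\<^sub>o C) (h \<otimes>\<^sub>o h)"
    by (simp_all add: typed_def tob_Cons tensor_ob_unit)
  have g: "(\<langle>X \<otimes>\<^sub>o Y\<rangle> \<otimes>\<^sub>a ?g) \<cdot> \<delta>2 X Y = ((\<langle>X\<rangle> \<otimes>\<^sub>a ibr h Y \<otimes>\<^sub>a \<langle>h\<rangle>) \<cdot> (sg a X \<otimes>\<^sub>a sg a Y)) \<cdot> \<sigma> Y X \<cdot> \<sigma> X Y"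
    if X: "X \<in> Ob V" and Y: "Y \<in> Ob V" for X Y
    using omega_factor[OF X Y P] unfolding omega_bar_factor[OF X Y a] .
  show ?thesis
  proof
    assume "?f = ?g"
    then show ?r using tensor_coprod_mulC[OF _ _ a] g by metis
  next
    assume r: ?r
    show "?f = ?g"
      by (rule coend2_eqI[OF fg]) (simp add: tensor_coprod_mulC[OF _ _ a] g r)
  qed
qed

text \<open>The inverse crossing left by \<open>omega_bar_factor\<close> cancels the crossing in the
  action on a tensor product, so on modules only the double braiding from \<open>\<omega>\<close>
  survives.\<close>

lemma twisted_tensor_iff:
  assumes a: "a \<in> carrier El"
  shows "com H \<cdot> a \<cdot> mC = (((a \<otimes>\<^sub>a a) \<cdot> (\<langle>C\<rangle> \<otimes>\<^sub>a \<omega>b \<otimes>\<^sub>a \<langle>C\<rangle>) \<cdot> (\<delta> C \<otimes>\<^sub>a \<Delta>C)) \<otimes>\<^sub>a \<omega>)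
         \<cdot> (\<langle>C\<rangle> \<otimes>\<^sub>a \<sigma> C C \<otimes>\<^sub>a \<langle>C\<rangle>) \<cdot> (\<Delta>C \<otimes>\<^sub>a \<Delta>C)
    \<longleftrightarrow> (\<forall>A B. rmod A \<longrightarrow> rmod B \<longrightarrow>
          sh a (A \<odot> B) = (sh a A \<otimes>\<^sub>a sh a B) \<cdot> \<sigma> (fst B) (fst A) \<cdot> \<sigma> (fst A) (fst B))"
  unfolding twisted_mult_iff[OF a]
proof (intro iffI allI impI ballI)
  fix A B
  assume l: "\<forall>X \<in> Ob V. \<forall>Y \<in> Ob V. tensor_coprod a X Y = ((\<langle>X\<rangle> \<otimes>\<^sub>a ibr h Y \<otimes>\<^sub>a \<langle>h\<rangle>) \<cdot> (sg a X \<otimes>\<^sub>a sg a Y)) \<cdot> \<sigma> Y X \<cdot> \<sigma> X Y"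
    and A [simp]: "rmod A" and B [simp]: "rmod B"
  note t = typed_Sig[OF rmod_Ob[OF A] a[unfolded El_carrier]] typed_Sig[OF rmod_Ob[OF B] a[unfolded El_carrier]]
  note [den_intro] = t[THEN den_gen]
  show "sh a (A \<odot> B) = (sh a A \<otimes>\<^sub>a sh a B) \<cdot> \<sigma> (fst B) (fst A) \<cdot> \<sigma> (fst A) (fst B)"
    unfolding sh_tensor[OF A B a] l[rule_format, OF rmod_Ob[OF A] rmod_Ob[OF B]]
    unfolding sharp_def by (rule den_eqI, (rule den_intro | (simp; fail))+, (simp add: exch_right exch_left ibr_r tyi t rmod_typed has_def shp_app shp_init)?)
next
  fix X Y
  assume r: "\<forall>A B. rmod A \<longrightarrow> rmod B \<longrightarrow>
      sh a (A \<odot> B) = (sh a A \<otimes>\<^sub>a sh a B) \<cdot> \<sigma> (fst B) (fst A) \<cdot> \<sigma> (fst A) (fst B)"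
    and X [simp]: "X \<in> Ob V" and Y [simp]: "Y \<in> Ob V"
  have tf: "typed (sh a (free Z)) [Z, h] [Z, h]" if "Z \<in> Ob V" for Z
    using sh_hom[OF rmod_free[OF that] a] that by (simp add: typed_def tob_Cons tensor_ob_unit)
  have tensor_coprod: "typed (tensor_coprod a X Y) [X, Y] [X, Y, h, h]"
  proof -
    note t = typed_sg_tensor[OF X Y a]
    note [den_intro] = t[THEN den_gen]
    show ?thesis unfolding tensor_coprod_def by (rule den_typed, rule den_conv, (rule den_intro | (simp; fail))+)
  qed
  note t = tf[OF X] tf[OF Y] tensor_coprod
  note [den_intro] = t[THEN den_gen]
  let ?u = "\<langle>X\<rangle> \<otimes>\<^sub>a uni H \<otimes>\<^sub>a \<langle>Y\<rangle> \<otimes>\<^sub>a uni H"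
  have "tensor_coprod a X Y = (\<langle>X\<rangle> \<otimes>\<^sub>a ibr h Y \<otimes>\<^sub>a \<langle>h\<rangle>) \<cdot> ((\<langle>X\<rangle> \<otimes>\<^sub>a \<sigma> Y h \<otimes>\<^sub>a \<langle>h\<rangle>) \<cdot> tensor_coprod a X Y)"
    by (rule den_eqI, (rule den_intro | (simp; fail))+, (simp add: exch_right exch_left ibr_r tyi t has_def shp_app shp_init)?)
  also have "\<dots> = (\<langle>X\<rangle> \<otimes>\<^sub>a ibr h Y \<otimes>\<^sub>a \<langle>h\<rangle>) \<cdot> ((sh a (free X) \<otimes>\<^sub>a sh a (free Y)) \<cdot> \<sigma> (Y \<otimes>\<^sub>o h) (X \<otimes>\<^sub>o h) \<cdot> \<sigma> (X \<otimes>\<^sub>o h) (Y \<otimes>\<^sub>o h)) \<cdot> ?u"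
    unfolding sh_tensor_free[OF X Y a, symmetric] r[rule_format, OF rmod_free[OF X] rmod_free[OF Y]] free_simps
    by (rule den_eqI, (rule den_intro | (simp; fail))+)
  also have "\<dots> = ((\<langle>X\<rangle> \<otimes>\<^sub>a ibr h Y \<otimes>\<^sub>a \<langle>h\<rangle>) \<cdot> ((sh a (free X) \<cdot> (\<langle>X\<rangle> \<otimes>\<^sub>a uni H)) \<otimes>\<^sub>a (sh a (free Y) \<cdot> (\<langle>Y\<rangle> \<otimes>\<^sub>a uni H)))) \<cdot> \<sigma> Y X \<cdot> \<sigma> X Y"
    by (rule den_eqI, (rule den_intro | (simp; fail))+, simp add: diag tyi t)
  finally show "tensor_coprod a X Y = ((\<langle>X\<rangle> \<otimes>\<^sub>a ibr h Y \<otimes>\<^sub>a \<langle>h\<rangle>) \<cdot> (sg a X \<otimes>\<^sub>a sg a Y)) \<cdot> \<sigma> Y X \<cdot> \<sigma> X Y"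
    unfolding sh_free(1)[OF X a] sh_free(1)[OF Y a] .
qed

text \<open>(CT3) is the module identity on two free modules, evaluated at the units: the products
  after the first braiding then vanish, while those after the second remain.\<close>

lemma balanced_tensor_iff:
  assumes a: "a \<in> carrier El"
  shows "(\<forall>X \<in> Ob V. \<forall>Y \<in> Ob V.
          (\<langle>X\<rangle> \<otimes>\<^sub>a \<sigma> Y h \<otimes>\<^sub>a \<langle>h\<rangle>) \<cdot> (\<langle>X\<rangle> \<otimes>\<^sub>a \<langle>Y\<rangle> \<otimes>\<^sub>a com H) \<cdot> sg a (X \<otimes>\<^sub>o Y)
          = (Lmul V H (Sig V \<iota> a) X \<otimes>\<^sub>a Lmul V H (Sig V \<iota> a) Y) \<cdot> (\<langle>X\<rangle> \<otimes>\<^sub>a mul H \<otimes>\<^sub>a \<langle>Y\<rangle> \<otimes>\<^sub>a mul H)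
            \<cdot> Rn (Y \<otimes>\<^sub>o h) (X \<otimes>\<^sub>o h) \<cdot> Rn X Y)
    \<longleftrightarrow> (\<forall>A B. rmod A \<longrightarrow> rmod B \<longrightarrow> sh a (A \<odot> B) = (sh a A \<otimes>\<^sub>a sh a B) \<cdot> mc B A \<cdot> mc A B)"
    (is "?l \<longleftrightarrow> ?r")
proof -
  have L: "Lmul V H (Sig V \<iota> a) X = sh a (free X)" if "X \<in> Ob V" for X
    using sh_free(2)[OF that a] by (simp add: Lmul_def)
  have tf: "typed (sh a (free Z)) [Z, h] [Z, h]" if "Z \<in> Ob V" for Z
    using sh_hom[OF rmod_free[OF that] a] that by (simp add: typed_def tob_Cons tensor_ob_unit)
  have "?l \<longleftrightarrow> (\<forall>X \<in> Ob V. \<forall>Y \<in> Ob V. (\<langle>X\<rangle> \<otimes>\<^sub>a \<sigma> Y h \<otimes>\<^sub>a \<langle>h\<rangle>) \<cdot> tensor_coprod a X Y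
        = (sh a (free X) \<otimes>\<^sub>a sh a (free Y)) \<cdot> (\<langle>X\<rangle> \<otimes>\<^sub>a mul H \<otimes>\<^sub>a \<langle>Y\<rangle> \<otimes>\<^sub>a mul H) \<cdot> Rn (Y \<otimes>\<^sub>o h) (X \<otimes>\<^sub>o h) \<cdot> Rn X Y)"
    by (simp add: L tensor_coprod_def)
  also have "\<dots> \<longleftrightarrow> ?r"
  proof (intro iffI allI impI ballI)
    fix A B
    assume l: "\<forall>X \<in> Ob V. \<forall>Y \<in> Ob V. (\<langle>X\<rangle> \<otimes>\<^sub>a \<sigma> Y h \<otimes>\<^sub>a \<langle>h\<rangle>) \<cdot> tensor_coprod a X Y
        = (sh a (free X) \<otimes>\<^sub>a sh a (free Y)) \<cdot> (\<langle>X\<rangle> \<otimes>\<^sub>a mul H \<otimes>\<^sub>a \<langle>Y\<rangle> \<otimes>\<^sub>a mul H) \<cdot> Rn (Y \<otimes>\<^sub>o h) (X \<otimes>\<^sub>o h) \<cdot> Rn X Y"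
      and A [simp]: "rmod A" and B [simp]: "rmod B"
    define M N r s where d: "M = fst A" "N = fst B" "r = snd A" "s = snd B"
    have o [simp]: "M \<in> Ob V" "N \<in> Ob V" using A B by (simp_all add: d)
    have tr: "typed r [M, h] [M]" "typed s [N, h] [N]"
      using rmod_typed[OF A] rmod_typed[OF B] by (simp_all add: d)
    have hr: "r \<in> Hom V (M \<otimes>\<^sub>o h) M" "s \<in> Hom V (N \<otimes>\<^sub>o h) N"
      using tr by (simp_all add: typed_def tob_Cons tensor_ob_unit)
    have n: "r \<cdot> sh a (free M) = sh a A \<cdot> r" "s \<cdot> sh a (free N) = sh a B \<cdot> s"
      using sh_natural[OF act_lin[OF A] rmod_free A a] sh_natural[OF act_lin[OF B] rmod_free B a] by (simp_all add: d)
    note rr = rmod_rules[OF A, folded d] rmod_rules[OF B, folded d]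
    note t = tr tf[OF o(1)] tf[OF o(2)] typed_sh[OF A a[unfolded El_carrier], folded d] typed_sh[OF B a[unfolded El_carrier], folded d]
    note [den_intro] = t[THEN den_gen]
    have "sh a (A \<odot> B) = (r \<otimes>\<^sub>a s) \<cdot> ((sh a (free M) \<otimes>\<^sub>a sh a (free N)) \<cdot> (\<langle>M\<rangle> \<otimes>\<^sub>a mul H \<otimes>\<^sub>a \<langle>N\<rangle> \<otimes>\<^sub>a mul H) \<cdot> Rn (N \<otimes>\<^sub>o h) (M \<otimes>\<^sub>o h) \<cdot> Rn M N)"
      using l[rule_format, OF o] by (simp add: sh_tensor[OF A B a] flip: d)
    also have "\<dots> = ((r \<cdot> sh a (free M)) \<otimes>\<^sub>a (s \<cdot> sh a (free N))) \<cdot> (\<langle>M\<rangle> \<otimes>\<^sub>a mul H \<otimes>\<^sub>a \<langle>N\<rangle> \<otimes>\<^sub>a mul H) \<cdot> Rn (N \<otimes>\<^sub>o h) (M \<otimes>\<^sub>o h) \<cdot> Rn M N"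
      by (rule den_eqI, (rule den_intro | (simp; fail))+, simp add: diag tyi t)
    also have "\<dots> = (sh a A \<otimes>\<^sub>a sh a B) \<cdot> (r \<otimes>\<^sub>a s) \<cdot> ((r \<otimes>\<^sub>a \<langle>h\<rangle> \<otimes>\<^sub>a s \<otimes>\<^sub>a \<langle>h\<rangle>) \<cdot> Rn (N \<otimes>\<^sub>o h) (M \<otimes>\<^sub>o h)) \<cdot> Rn M N"
      unfolding n by (rule den_eqI, (rule den_intro | (simp; fail))+, simp add: diag tyi t rr)
    also have "\<dots> = (sh a A \<otimes>\<^sub>a sh a B) \<cdot> mc B A \<cdot> mc A B"
      unfolding Rn_natural[OF hr(2,1), symmetric] d[symmetric] by (rule den_eqI, (rule den_intro | (simp; fail))+)
    finally show "sh a (A \<odot> B) = (sh a A \<otimes>\<^sub>a sh a B) \<cdot> mc B A \<cdot> mc A B" .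
  next
    fix X Y
    assume r: ?r and X [simp]: "X \<in> Ob V" and Y [simp]: "Y \<in> Ob V"
    note t = tf[OF X] tf[OF Y]
    note [den_intro] = t[THEN den_gen]
    let ?u = "\<langle>X\<rangle> \<otimes>\<^sub>a uni H \<otimes>\<^sub>a \<langle>Y\<rangle> \<otimes>\<^sub>a uni H"
    have u: "\<langle>Z\<rangle> \<otimes>\<^sub>a uni H \<in> Hom V Z (Z \<otimes>\<^sub>o h)" if "Z \<in> Ob V" for Z
      using tensor_hom[OF ident_hom[OF that] uni_hom] that by (simp add: tensor_ob_unit)
    have "(\<langle>X\<rangle> \<otimes>\<^sub>a \<sigma> Y h \<otimes>\<^sub>a \<langle>h\<rangle>) \<cdot> tensor_coprod a X Y = (sh a (free X) \<otimes>\<^sub>a sh a (free Y)) \<cdot> (\<langle>X\<rangle> \<otimes>\<^sub>a mul H \<otimes>\<^sub>a \<langle>Y\<rangle> \<otimes>\<^sub>a mul H) \<cdot> Rn (Y \<otimes>\<^sub>o h) (X \<otimes>\<^sub>o h)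
       \<cdot> (\<langle>Y\<rangle> \<otimes>\<^sub>a mul H \<otimes>\<^sub>a \<langle>X\<rangle> \<otimes>\<^sub>a mul H) \<cdot> (Rn (X \<otimes>\<^sub>o h) (Y \<otimes>\<^sub>o h) \<cdot> ((\<langle>X\<rangle> \<otimes>\<^sub>a uni H) \<otimes>\<^sub>a (\<langle>Y\<rangle> \<otimes>\<^sub>a uni H)))"
      unfolding sh_tensor_free[OF X Y a, symmetric] r[rule_format, OF rmod_free[OF X] rmod_free[OF Y]] free_simps
      by (rule den_eqI, (rule den_intro | (simp; fail))+)
    also have "\<dots> = (sh a (free X) \<otimes>\<^sub>a sh a (free Y)) \<cdot> (\<langle>X\<rangle> \<otimes>\<^sub>a mul H \<otimes>\<^sub>a \<langle>Y\<rangle> \<otimes>\<^sub>a mul H) \<cdot> Rn (Y \<otimes>\<^sub>o h) (X \<otimes>\<^sub>o h) \<cdot> Rn X Y"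
      unfolding Rn_natural[OF u[OF X] u[OF Y]] by (rule den_eqI, (rule den_intro | (simp; fail))+, simp add: diag tyi t mul_uni_r)
    finally show "(\<langle>X\<rangle> \<otimes>\<^sub>a \<sigma> Y h \<otimes>\<^sub>a \<langle>h\<rangle>) \<cdot> tensor_coprod a X Y = (sh a (free X) \<otimes>\<^sub>a sh a (free Y)) \<cdot> (\<langle>X\<rangle> \<otimes>\<^sub>a mul H \<otimes>\<^sub>a \<langle>Y\<rangle> \<otimes>\<^sub>a mul H) \<cdot> Rn (Y \<otimes>\<^sub>o h) (X \<otimes>\<^sub>o h) \<cdot> Rn X Y" .
  qed
  finally show ?thesis .
qed

lemma balanced_iff:
  "C_balanced V C \<iota> H R a \<longleftrightarrow> a \<in> carrier El \<and> (\<forall>A. rmod A \<longrightarrow> lin A (sh a A) A)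
    \<and> sh a (mod_unit V H) = \<langle>\<^bold>1\<rangle>
    \<and> (\<forall>A B. rmod A \<longrightarrow> rmod B \<longrightarrow> sh a (A \<odot> B) = (sh a A \<otimes>\<^sub>a sh a B) \<cdot> mc B A \<cdot> mc A B)"
proof (cases "a \<in> carrier El")
  case True
  show ?thesis
    unfolding C_balanced_def central_iff[OF True] counit_iff[OF True[unfolded El_carrier]] balanced_tensor_iff[OF True] ..
qed (simp add: C_balanced_def)

lemma pivotal_element_iff:
  "C_pivotal V C \<iota> H a \<longleftrightarrow> a \<in> carrier El \<and> sh a (mod_unit V H) = \<langle>\<^bold>1\<rangle>
    \<and> (\<forall>A B. rmod A \<longrightarrow> rmod B \<longrightarrow>
          sh a (A \<odot> B) = (sh a A \<otimes>\<^sub>a sh a B) \<cdot> \<sigma> (fst B) (fst A) \<cdot> \<sigma> (fst A) (fst B))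
    \<and> (\<forall>A. rmod A \<longrightarrow> sh a A \<cdot> snd A
          = snd A \<cdot> (sh a A \<otimes>\<^sub>a \<langle>h\<rangle>) \<cdot> \<sigma> h (fst A) \<cdot> \<sigma> (fst A) h \<cdot> (\<langle>fst A\<rangle> \<otimes>\<^sub>a (ant H \<cdot> ant H)))"
proof (cases "a \<in> carrier El")
  case True
  show ?thesis
    unfolding C_pivotal_def twisted_grouplike_def pivotal_iff[OF True] twisted_tensor_iff[OF True] counit_iff[OF True[unfolded El_carrier]]
    by blast
qed (simp add: C_pivotal_def twisted_grouplike_def)

end

section \<open>The Drinfeld element\<close>

context braided_rigid_category
begin

text \<open>Twisting by an invertible crossing keeps the evaluation nondegenerate. The laws of
  \<open>\<uu>\<close> are stated for this twisted evaluation.\<close>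

lemma evr_braid_cancel:
  assumes X [simp]: "X \<in> Ob V" and f: "f \<in> Hom V Z X" "g \<in> Hom V Z X"
    and e: "evr V X \<cdot> \<sigma> (rdual V X) X \<cdot> (\<langle>rdual V X\<rangle> \<otimes>\<^sub>a f) = evr V X \<cdot> \<sigma> (rdual V X) X \<cdot> (\<langle>rdual V X\<rangle> \<otimes>\<^sub>a g)"
  shows "f = g"
proof -
  have [simp]: "Z \<in> Ob V" using hom_Ob[OF f(1)] by simp
  have "evr V X \<cdot> (f' \<otimes>\<^sub>a \<langle>rdual V X\<rangle>) = (evr V X \<cdot> \<sigma> (rdual V X) X \<cdot> (\<langle>rdual V X\<rangle> \<otimes>\<^sub>a f')) \<cdot> ibr Z (rdual V X)" if "f' \<in> Hom V Z X" for f'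
  proof -
    have t: "typed f' [Z] [X]" using that by (simp add: typed_def)
    note [den_intro] = t[THEN den_gen]
    show ?thesis by (rule den_eqI, (rule den_intro | (simp; fail))+, simp add: diag tyi t ibr_rules)
  qed
  then show ?thesis
    using evr_cancel_left_hom[OF X f] f e by simp
qed

text \<open>The chosen dual of \<open>X \<otimes> Y\<close> may differ from the product of the
  chosen duals, so nondegeneracy is shown directly for the nested evaluation, with the nested
  coevaluation \<open>?k\<close>.\<close>

lemma pairing_tensor_cancel:
  assumes X [simp]: "X \<in> Ob V" and Y [simp]: "Y \<in> Ob V" and f: "typed f [X, Y] [X, Y]" "typed g [X, Y] [X, Y]"
    and e: "(evr V X \<cdot> (\<langle>X\<rangle> \<otimes>\<^sub>a evr V Y \<otimes>\<^sub>a \<langle>rdual V X\<rangle>)) \<cdot> \<sigma> (rdual V Y \<otimes>\<^sub>o rdual V X) (X \<otimes>\<^sub>o Y) \<cdot> (\<langle>rdual V Y \<otimes>\<^sub>o rdual V X\<rangle> \<otimes>\<^sub>a f)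
      = (evr V X \<cdot> (\<langle>X\<rangle> \<otimes>\<^sub>a evr V Y \<otimes>\<^sub>a \<langle>rdual V X\<rangle>)) \<cdot> \<sigma> (rdual V Y \<otimes>\<^sub>o rdual V X) (X \<otimes>\<^sub>o Y) \<cdot> (\<langle>rdual V Y \<otimes>\<^sub>o rdual V X\<rangle> \<otimes>\<^sub>a g)"
  shows "f = g"
proof -
  let ?e = "evr V X \<cdot> (\<langle>X\<rangle> \<otimes>\<^sub>a evr V Y \<otimes>\<^sub>a \<langle>rdual V X\<rangle>)" and ?D = "rdual V Y \<otimes>\<^sub>o rdual V X"
  let ?k = "(\<langle>rdual V Y\<rangle> \<otimes>\<^sub>a coevr V X \<otimes>\<^sub>a \<langle>Y\<rangle>) \<cdot> coevr V Y"
  have "f' = ((?e \<cdot> \<sigma> ?D (X \<otimes>\<^sub>o Y) \<cdot> (\<langle>?D\<rangle> \<otimes>\<^sub>a f')) \<otimes>\<^sub>a \<langle>X \<otimes>\<^sub>o Y\<rangle>) \<cdot> (arr_inv V (\<sigma> ?D (X \<otimes>\<^sub>o Y)) \<otimes>\<^sub>a \<langle>X \<otimes>\<^sub>o Y\<rangle>) \<cdot> (\<langle>X \<otimes>\<^sub>o Y\<rangle> \<otimes>\<^sub>a ?k)"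
    if t: "typed f' [X, Y] [X, Y]" for f'
  proof -
    have o [simp]: "X \<otimes>\<^sub>o Y \<in> Ob V" "?D \<in> Ob V" by (simp_all add: tensor_closed rdual_closed)
    have i: "ibr (X \<otimes>\<^sub>o Y) ?D \<in> Hom V ((X \<otimes>\<^sub>o Y) \<otimes>\<^sub>o ?D) (?D \<otimes>\<^sub>o (X \<otimes>\<^sub>o Y))" "\<sigma> ?D (X \<otimes>\<^sub>o Y) \<cdot> ibr (X \<otimes>\<^sub>o Y) ?D = \<langle>(X \<otimes>\<^sub>o Y) \<otimes>\<^sub>o ?D\<rangle>"
      using ibr(1,3)[OF o] by simp_all
    have ti: "typed (ibr (X \<otimes>\<^sub>o Y) ?D) [X, Y, rdual V Y, rdual V X] [rdual V Y, rdual V X, X, Y]"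
      using i(1) by (simp add: typed_def tob_Cons tensor_ob_unit tensor_ob_assoc tensor_closed rdual_closed)
    have f': "f' \<in> Hom V (X \<otimes>\<^sub>o Y) (X \<otimes>\<^sub>o Y)"
      using t by (simp add: typed_def tob_Cons tensor_ob_unit)
    note [den_intro] = t[THEN den_gen] ti[THEN den_gen]
    have "((?e \<cdot> \<sigma> ?D (X \<otimes>\<^sub>o Y) \<cdot> (\<langle>?D\<rangle> \<otimes>\<^sub>a f')) \<otimes>\<^sub>a \<langle>X \<otimes>\<^sub>o Y\<rangle>) \<cdot> (ibr (X \<otimes>\<^sub>o Y) ?D \<otimes>\<^sub>a \<langle>X \<otimes>\<^sub>o Y\<rangle>) \<cdot> (\<langle>X \<otimes>\<^sub>o Y\<rangle> \<otimes>\<^sub>a ?k)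
       = ((?e \<cdot> ((\<sigma> ?D (X \<otimes>\<^sub>o Y) \<cdot> (\<langle>?D\<rangle> \<otimes>\<^sub>a f')) \<cdot> ibr (X \<otimes>\<^sub>o Y) ?D)) \<otimes>\<^sub>a \<langle>X \<otimes>\<^sub>o Y\<rangle>) \<cdot> (\<langle>X \<otimes>\<^sub>o Y\<rangle> \<otimes>\<^sub>a ?k)"
      by (rule den_eqI, (rule den_intro | (simp; fail))+)
    also have "(\<sigma> ?D (X \<otimes>\<^sub>o Y) \<cdot> (\<langle>?D\<rangle> \<otimes>\<^sub>a f')) \<cdot> ibr (X \<otimes>\<^sub>o Y) ?D = (f' \<otimes>\<^sub>a \<langle>?D\<rangle>) \<cdot> (\<sigma> ?D (X \<otimes>\<^sub>o Y) \<cdot> ibr (X \<otimes>\<^sub>o Y) ?D)"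
      unfolding braid_natural[OF ident_hom[OF o(2)] f'] by (rule den_eqI, (rule den_intro | (simp; fail))+)
    also have "((?e \<cdot> \<dots>) \<otimes>\<^sub>a \<langle>X \<otimes>\<^sub>o Y\<rangle>) \<cdot> (\<langle>X \<otimes>\<^sub>o Y\<rangle> \<otimes>\<^sub>a ?k) = f'"
      unfolding i(2) by (rule den_eqI, (rule den_intro | (simp; fail))+, simp add: diag tyi t snakes)
    finally show ?thesis by (simp add: ibr_def)
  qed
  from this[OF f(1)] this[OF f(2)] show ?thesis
    unfolding e by simp
qed

end

context quasitriangular
begin

interpretation W: braided_rigid_category W
  by (rule W_rigid)

abbreviation "\<uu> \<equiv> drinfeld_elem V C \<iota> H R"

definition drinfeld_mod :: "'o \<times> 'm \<Rightarrow> 'm" where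
  "drinfeld_mod A = fst (snd (drinfeld W A))"

lemma drinfeld_W:
  assumes A: "rmod A"
  shows "drinfeld W A = (A, drinfeld_mod A, mod_rdual V H (mod_rdual V H A))"
    "lin A (drinfeld_mod A) (mod_rdual V H (mod_rdual V H A))"
    "evr V (rdual V (fst A)) \<cdot> (\<langle>rdual V (fst A)\<rangle> \<otimes>\<^sub>a drinfeld_mod A) = evr V (fst A) \<cdot> mc (mod_rdual V H A) A"
proof -
  note r = mod_rdual(1)[OF A]
  note rr = mod_rdual(1)[OF r]
  have "drinfeld W A \<in> Hom W A (mod_rdual V H (mod_rdual V H A))"
    using W.typed_drinfeld[of A] A r rr
    by (simp add: W.typed_def W.tob_Cons W.tob_Nil mt_unit)
  then show d: "drinfeld W A = (A, drinfeld_mod A, mod_rdual V H (mod_rdual V H A))"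
    "lin A (drinfeld_mod A) (mod_rdual V H (mod_rdual V H A))"
    by (auto simp: Hom_W drinfeld_mod_def)
  show "evr V (rdual V (fst A)) \<cdot> (\<langle>rdual V (fst A)\<rangle> \<otimes>\<^sub>a drinfeld_mod A) = evr V (fst A) \<cdot> mc (mod_rdual V H A) A"
    using W.drinfeld_evr[of A] A by (simp add: d(1))
qed

text \<open>The inverse of \<open>\<mu>\<close> after \<open>\<nu>\<close>, as an endomorphism of
  the forgetful functor; its C-element is \<open>\<uu>\<close>.\<close>

definition drinfeld_ratio :: "'o \<times> 'm \<Rightarrow> 'm" where
  "drinfeld_ratio A = arr_inv V (drinfeld V (fst A)) \<cdot> drinfeld_mod A"

lemma drinfeld_ratio_hom: "rmod A \<Longrightarrow> drinfeld_ratio A \<in> Hom V (fst A) (fst A)"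
  unfolding drinfeld_ratio_def by (rule cmp_hom[OF lin_hom[OF drinfeld_W(2)]]) (simp_all add: drinfeld_inverse)

text \<open>The characterisation of Drinfeld morphisms is used in both categories: in
  \<open>V\<close> it introduces \<open>\<mu>\<close>, which cancels its inverse, and in
  \<open>W\<close> it evaluates \<open>\<nu>\<close>.\<close>

lemma drinfeld_ratio_evr:
  assumes A [simp]: "rmod A"
  shows "evr V (fst A) \<cdot> \<sigma> (rdual V (fst A)) (fst A) \<cdot> (\<langle>rdual V (fst A)\<rangle> \<otimes>\<^sub>a drinfeld_ratio A) = evr V (fst A) \<cdot> mc (mod_rdual V H A) A"
proof -
  let ?M = "fst A" let ?D = "rdual V ?M"
  have t: "typed (arr_inv V (drinfeld V ?M)) [rdual V ?D] [?M]" "typed (drinfeld_mod A) [?M] [rdual V ?D]" "typed (drinfeld V ?M) [?M] [rdual V ?D]" "typed (drinfeld_ratio A) [?M] [?M]"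
    using drinfeld_inverse(1)[of ?M] lin_hom[OF drinfeld_W(2)[OF A]] typed_drinfeld[of ?M] drinfeld_ratio_hom[OF A] by (simp_all add: typed_def rdual_closed)
  note [den_intro] = t[THEN den_gen]
  have "evr V ?M \<cdot> \<sigma> ?D ?M \<cdot> (\<langle>?D\<rangle> \<otimes>\<^sub>a drinfeld_ratio A) = (evr V ?M \<cdot> \<sigma> ?D ?M) \<cdot> (\<langle>?D\<rangle> \<otimes>\<^sub>a drinfeld_ratio A)"
    by (rule den_eqI, (rule den_intro | (simp; fail))+)
  also have "\<dots> = evr V ?D \<cdot> (\<langle>?D\<rangle> \<otimes>\<^sub>a ((drinfeld V ?M \<cdot> arr_inv V (drinfeld V ?M)) \<cdot> drinfeld_mod A))"
    unfolding drinfeld_evr[OF rmod_Ob[OF A], symmetric] drinfeld_ratio_def by (rule den_eqI, (rule den_intro | (simp; fail))+)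
  also have "\<dots> = evr V ?D \<cdot> (\<langle>?D\<rangle> \<otimes>\<^sub>a drinfeld_mod A)"
    unfolding drinfeld_inverse(3)[OF rmod_Ob[OF A]] by (rule den_eqI, (rule den_intro | (simp; fail))+)
  finally show ?thesis
    by (simp add: drinfeld_W(3))
qed

lemma typed_mc: "rmod A \<Longrightarrow> rmod B \<Longrightarrow> typed (mc A B) [fst A, fst B] [fst B, fst A]"
  using lin_hom[OF mc_lin] by (simp add: typed_def tob_Cons tensor_ob_unit)

text \<open>The pairing factors through \<open>evr\<close> by a linear arrow, and both crossings are
  natural along it.\<close>

lemma drinfeld_ratio_pairing:
  assumes A [simp]: "rmod A" and D [simp]: "rmod D" and e: "lin (A \<odot> D) e (mod_unit V H)"
  shows "e \<cdot> \<sigma> (fst D) (fst A) \<cdot> (\<langle>fst D\<rangle> \<otimes>\<^sub>a drinfeld_ratio A) = e \<cdot> mc D A"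
proof -
  let ?M = "fst A" let ?N = "fst D" let ?L = "rdual V ?M"
  note te = lin_pairing_typed[OF A D e]
  note [simp] = mod_rdual(1)[OF A]
  define p where "p = (\<langle>?L\<rangle> \<otimes>\<^sub>a e) \<cdot> (coevr V ?M \<otimes>\<^sub>a \<langle>?N\<rangle>)"
  have ep: "e = evr V ?M \<cdot> (\<langle>?M\<rangle> \<otimes>\<^sub>a p)"
    unfolding p_def by (rule pairing_via_evr) (use te in simp_all)
  have lp: "lin D p (mod_rdual V H A)"
    unfolding p_def by (rule lin_pairing_dual(2)[OF D A e])
  have "typed (drinfeld_ratio A) [?M] [?M]"
    using drinfeld_ratio_hom[OF A] by (simp add: typed_def)
  note t = this lin_r(1)[OF lp D mod_rdual(1)[OF A], simplified] typed_mc[OF D A] typed_mc[OF mod_rdual(1)[OF A] A, simplified]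
  note [den_intro] = t[THEN den_gen]
  have "e \<cdot> \<sigma> ?N ?M \<cdot> (\<langle>?N\<rangle> \<otimes>\<^sub>a drinfeld_ratio A) = (evr V ?M \<cdot> \<sigma> ?L ?M \<cdot> (\<langle>?L\<rangle> \<otimes>\<^sub>a drinfeld_ratio A)) \<cdot> (p \<otimes>\<^sub>a \<langle>?M\<rangle>)"
    unfolding ep by (rule den_eqI, (rule den_intro | (simp; fail))+, simp add: diag tyi t)
  also have "\<dots> = evr V ?M \<cdot> (mc (mod_rdual V H A) A \<cdot> (p \<otimes>\<^sub>a \<langle>?M\<rangle>))"
    unfolding drinfeld_ratio_evr[OF A] by (rule den_eqI, (rule den_intro | (simp; fail))+)
  also have "\<dots> = e \<cdot> mc D A"
    unfolding mc_natural[OF D A mod_rdual(1)[OF A] A lp lin_ident[OF A]] ep by (rule den_eqI, (rule den_intro | (simp; fail))+)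
  finally show ?thesis .
qed

text \<open>Naturality would involve the double dual of \<open>f\<close>; under the pairing law it
  becomes naturality of the module braiding. It is needed for the C-element \<open>\<uu>\<close> to
  represent the family.\<close>

lemma drinfeld_ratio_natural:
  assumes A [simp]: "rmod A" and B [simp]: "rmod B" and f: "lin A f B"
  shows "drinfeld_ratio B \<cdot> f = f \<cdot> drinfeld_ratio A"
proof -
  let ?M = "fst A" let ?N = "fst B" let ?L = "rdual V ?N"
  note L = mod_rdual[OF B]
  note [simp] = L(1)
  let ?e = "evr V ?N \<cdot> (f \<otimes>\<^sub>a \<langle>?L\<rangle>)"
  have "typed (drinfeld_ratio A) [?M] [?M]" "typed (drinfeld_ratio B) [?N] [?N]"
    using drinfeld_ratio_hom[OF A] drinfeld_ratio_hom[OF B] by (simp_all add: typed_def)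
  note t = this lin_r(1)[OF f A B] typed_mc[OF L(1) A, simplified] typed_mc[OF L(1) B, simplified]
  note [den_intro] = t[THEN den_gen]
  have le: "lin (A \<odot> mod_rdual V H B) ?e (mod_unit V H)"
    using lin_comp[OF rmod_mt[OF A L(1)] rmod_mt[OF B L(1)] mod_unit_module lin_tensor[OF A L(1) B L(1) f lin_ident[OF L(1)]] L(2)] by simp
  have "evr V ?N \<cdot> \<sigma> ?L ?N \<cdot> (\<langle>?L\<rangle> \<otimes>\<^sub>a (drinfeld_ratio B \<cdot> f)) = (evr V ?N \<cdot> \<sigma> ?L ?N \<cdot> (\<langle>?L\<rangle> \<otimes>\<^sub>a drinfeld_ratio B)) \<cdot> (\<langle>?L\<rangle> \<otimes>\<^sub>a f)"
    by (rule den_eqI, (rule den_intro | (simp; fail))+)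
  also have "\<dots> = evr V ?N \<cdot> (mc (mod_rdual V H B) B \<cdot> (\<langle>?L\<rangle> \<otimes>\<^sub>a f))"
    unfolding drinfeld_ratio_evr[OF B] by (rule den_eqI, (rule den_intro | (simp; fail))+)
  also have "mc (mod_rdual V H B) B \<cdot> (\<langle>?L\<rangle> \<otimes>\<^sub>a f) = (f \<otimes>\<^sub>a \<langle>?L\<rangle>) \<cdot> mc (mod_rdual V H B) A"
    using mc_natural[OF L(1) A L(1) B lin_ident[OF L(1)] f] by simp
  also have "evr V ?N \<cdot> \<dots> = ?e \<cdot> mc (mod_rdual V H B) A"
    by (rule den_eqI, (rule den_intro | (simp; fail))+)
  also have "\<dots> = ?e \<cdot> \<sigma> ?L ?M \<cdot> (\<langle>?L\<rangle> \<otimes>\<^sub>a drinfeld_ratio A)"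
    using drinfeld_ratio_pairing[OF A L(1) le] by simp
  also have "\<dots> = evr V ?N \<cdot> \<sigma> ?L ?N \<cdot> (\<langle>?L\<rangle> \<otimes>\<^sub>a (f \<cdot> drinfeld_ratio A))"
    by (rule den_eqI, (rule den_intro | (simp; fail))+, simp add: diag tyi t)
  finally have eq: "evr V ?N \<cdot> \<sigma> ?L ?N \<cdot> (\<langle>?L\<rangle> \<otimes>\<^sub>a (drinfeld_ratio B \<cdot> f)) = evr V ?N \<cdot> \<sigma> ?L ?N \<cdot> (\<langle>?L\<rangle> \<otimes>\<^sub>a (f \<cdot> drinfeld_ratio A))" .
  show ?thesis
    by (rule evr_braid_cancel[OF rmod_Ob[OF B] cmp_hom[OF lin_hom[OF f] drinfeld_ratio_hom[OF B]] cmp_hom[OF drinfeld_ratio_hom[OF A] lin_hom[OF f]] eq])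
qed

lemma u_elem: "\<uu> \<in> carrier El" "rmod A \<Longrightarrow> sh \<uu> A = drinfeld_ratio A"
proof -
  have "\<uu> = from_nat V C \<iota> h (flat V H drinfeld_ratio)"
    unfolding drinfeld_elem_def W_def[symmetric] by (simp add: drinfeld_ratio_def[abs_def] drinfeld_mod_def)
  then show "\<uu> \<in> carrier El" "rmod A \<Longrightarrow> sh \<uu> A = drinfeld_ratio A"
    using sh_from_nat[OF drinfeld_ratio_hom drinfeld_ratio_natural] by simp_all
qed

lemma u_pairing:
  "\<lbrakk>rmod A; rmod D; lin (A \<odot> D) e (mod_unit V H)\<rbrakk> \<Longrightarrow> e \<cdot> \<sigma> (fst D) (fst A) \<cdot> (\<langle>fst D\<rangle> \<otimes>\<^sub>a sh \<uu> A) = e \<cdot> mc D A"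
  by (simp add: u_elem drinfeld_ratio_pairing)

text \<open>The inverse is \<open>\<mu>\<close> followed by the inverse of \<open>\<nu>\<close>. The
  latter is taken in \<open>W\<close>, and its middle component is an inverse in
  \<open>V\<close>.\<close>

lemma u_inverse:
  assumes A: "rmod A"
  shows "\<exists>d. d \<in> Hom V (fst A) (fst A) \<and> d \<cdot> sh \<uu> A = \<langle>fst A\<rangle> \<and> sh \<uu> A \<cdot> d = \<langle>fst A\<rangle>"
proof -
  let ?M = "fst A" and ?R = "mod_rdual V H (mod_rdual V H A)"
  have o: "?M \<in> Ob V" using A by simp
  note i = drinfeld_inverse[OF o]
  have "arr_inv W (drinfeld W A) \<in> Hom W ?R A"
    using W.drinfeld_inverse(1)[of A] A by simp
  then obtain g where g: "arr_inv W (drinfeld W A) = (?R, g, A)" "lin ?R g A"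
    by (auto simp: Hom_W)
  have gi: "g \<cdot> drinfeld_mod A = \<langle>?M\<rangle>" "drinfeld_mod A \<cdot> g = \<langle>fst ?R\<rangle>"
    using W.drinfeld_inverse(2,3)[of A] A by (simp_all add: g(1)[unfolded drinfeld_W(1)[OF A]] drinfeld_W(1))
  have hg: "g \<in> Hom V (fst ?R) ?M" "drinfeld_mod A \<in> Hom V ?M (fst ?R)" "drinfeld V ?M \<in> Hom V ?M (fst ?R)" "arr_inv V (drinfeld V ?M) \<in> Hom V (fst ?R) ?M"
    using lin_hom[OF g(2)] lin_hom[OF drinfeld_W(2)[OF A]] i(1) typed_drinfeld[OF o] by (simp_all add: typed_def tob_Cons tensor_ob_unit rdual_closed o)
  let ?d = "g \<cdot> drinfeld V ?M"
  have "?d \<cdot> drinfeld_ratio A = g \<cdot> ((drinfeld V ?M \<cdot> arr_inv V (drinfeld V ?M)) \<cdot> drinfeld_mod A)"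
    unfolding drinfeld_ratio_def
    using cmp_assoc[OF cmp_hom[OF hg(2,4)] hg(3,1)] cmp_assoc[OF hg(2,4,3)] by simp
  also have "\<dots> = \<langle>?M\<rangle>"
    using i(3) gi(1) cmp_ident[OF hg(2)] by simp
  finally have 1: "?d \<cdot> drinfeld_ratio A = \<langle>?M\<rangle>" .
  have "drinfeld_ratio A \<cdot> ?d = arr_inv V (drinfeld V ?M) \<cdot> ((drinfeld_mod A \<cdot> g) \<cdot> drinfeld V ?M)"
    unfolding drinfeld_ratio_def
    using cmp_assoc[OF cmp_hom[OF hg(3,1)] hg(2,4)] cmp_assoc[OF hg(3,1,2)] by simp
  also have "\<dots> = \<langle>?M\<rangle>"
    using i(2) gi(2) cmp_ident[OF hg(3)] by simp
  finally show ?thesis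
    using 1 cmp_hom[OF hg(3,1)] u_elem(2)[OF A] by auto
qed

lemma u_inv:
  "\<uu> \<in> Units El" "inv\<^bsub>El\<^esub> \<uu> \<in> carrier El"
  "rmod A \<Longrightarrow> sh (inv\<^bsub>El\<^esub> \<uu>) A \<cdot> sh \<uu> A = \<langle>fst A\<rangle>"
  "rmod A \<Longrightarrow> sh \<uu> A \<cdot> sh (inv\<^bsub>El\<^esub> \<uu>) A = \<langle>fst A\<rangle>"
  by (rule El_inverse[OF u_elem(1) u_inverse]; assumption)+

text \<open>The pairing law for the identity, viewed as a pairing of the unit module with
  itself.\<close>

lemma u_unit: "sh \<uu> (mod_unit V H) = \<langle>\<^bold>1\<rangle>"
proof -
  let ?I = "mod_unit V H"
  have "lin (?I \<odot> ?I) \<langle>\<^bold>1\<rangle> ?I"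
    using lin_ident[OF mod_unit_module] by (simp add: mt_unit mod_unit_module)
  from u_pairing[OF mod_unit_module mod_unit_module this]
  have "\<langle>\<^bold>1\<rangle> \<cdot> \<langle>\<^bold>1\<rangle> \<cdot> (\<langle>\<^bold>1\<rangle> \<otimes>\<^sub>a sh \<uu> ?I) = \<langle>\<^bold>1\<rangle> \<cdot> \<langle>\<^bold>1\<rangle>"
    using mc_unit[OF mod_unit_module] by (simp add: braid_unit unit_closed)
  moreover have "sh \<uu> ?I \<in> Hom V \<^bold>1 \<^bold>1"
    using sh_hom[OF mod_unit_module u_elem(1)] by simp
  ultimately show ?thesis
    using cmp_ident ident_hom[OF unit_closed] by (simp add: tensor_ar_unit hom_Ar)
qed

lemma lin_pairing_antipode:
  assumes A: "rmod A" and B: "rmod B" and e: "lin (A \<odot> B) e (mod_unit V H)"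
  shows "e \<cdot> (\<langle>fst A\<rangle> \<otimes>\<^sub>a snd B) = e \<cdot> (snd A \<otimes>\<^sub>a \<langle>fst B\<rangle>) \<cdot> (\<langle>fst A\<rangle> \<otimes>\<^sub>a \<sigma> (fst B) h) \<cdot> (\<langle>fst A\<rangle> \<otimes>\<^sub>a \<langle>fst B\<rangle> \<otimes>\<^sub>a ant H)"
proof -
  have m: "rmod (fst A, snd A)"
    using A by (simp only: prod.collapse)
  have l: "e \<cdot> act (fst A) (snd A) (fst B) (snd B) = e \<otimes>\<^sub>a cou H"
    using e H_linear_to_unit_iff[OF rmod_Ob[OF A] rmod_Ob[OF B], of "snd A" "snd B" e] by (simp add: mod_tensor_def case_prod_beta)
  show ?thesis
    by (rule pairing_formula[OF m rmod_Ob[OF B] rmod_typed[OF B] lin_pairing_typed[OF A B e] l])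
qed

text \<open>An action on \<open>A\<close> is moved to the dual across the braided evaluation and
  back across the plain one. Each passage costs an antipode, hence the square, and the crossings of
  \<open>h\<close> add up to the double braiding.\<close>

lemma u_twisted:
  assumes A [simp]: "rmod A"
  shows "sh \<uu> A \<cdot> snd A = snd A \<cdot> (sh \<uu> A \<otimes>\<^sub>a \<langle>h\<rangle>) \<cdot> \<sigma> h (fst A) \<cdot> \<sigma> (fst A) h \<cdot> (\<langle>fst A\<rangle> \<otimes>\<^sub>a (ant H \<cdot> ant H))"
proof -
  define M N r s e U where d: "M = fst A" "N = rdual V M" "r = snd A" "s = snd (mod_rdual V H A)" "e = evr V M" "U = sh \<uu> A"
  note L = mod_rdual[OF A]
  have o [simp]: "M \<in> Ob V" "N \<in> Ob V" by (simp_all add: d rdual_closed)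
  have t: "typed r [M, h] [M]" "typed s [N, h] [N]" "typed e [M, N] []" "typed U [M] [M]" "typed (mc (mod_rdual V H A) A) [N, M] [M, N]"
    using rmod_typed[OF A] rmod_typed[OF L(1)] tyi(1) lin_pairing_typed[OF A L(1,2)] typed_sh[OF A u_elem(1)[unfolded El_carrier]] typed_mc[OF L(1) A]
    by (simp_all add: d)
  define c where "c = mc (mod_rdual V H A) A"
  note t = t[folded c_def]
  note [den_intro] = t[THEN den_gen]
  \<comment> \<open>The braided evaluation is again a linear pairing, now with the dual on the left,
    so the antipode rule applies to it as well.\<close>
  have f: "lin (mod_rdual V H A \<odot> A) (e \<cdot> c) (mod_unit V H)"
    unfolding d c_def by (rule lin_comp[OF rmod_mt[OF L(1) A] rmod_mt[OF A L(1)] mod_unit_module mc_lin[OF L(1) A] L(2)])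
  have fU: "e \<cdot> \<sigma> N M \<cdot> (\<langle>N\<rangle> \<otimes>\<^sub>a U) = e \<cdot> c"
    using u_pairing[OF A L(1,2)] by (simp add: d c_def)
  have P1: "e \<cdot> (\<langle>M\<rangle> \<otimes>\<^sub>a s) = e \<cdot> (r \<otimes>\<^sub>a \<langle>N\<rangle>) \<cdot> (\<langle>M\<rangle> \<otimes>\<^sub>a \<sigma> N h) \<cdot> (\<langle>M\<rangle> \<otimes>\<^sub>a \<langle>N\<rangle> \<otimes>\<^sub>a ant H)"
    using lin_pairing_antipode[OF A L(1,2)] by (simp add: d)
  have P2: "(e \<cdot> c) \<cdot> (\<langle>N\<rangle> \<otimes>\<^sub>a r) = (e \<cdot> c) \<cdot> (s \<otimes>\<^sub>a \<langle>M\<rangle>) \<cdot> (\<langle>N\<rangle> \<otimes>\<^sub>a \<sigma> M h) \<cdot> (\<langle>N\<rangle> \<otimes>\<^sub>a \<langle>M\<rangle> \<otimes>\<^sub>a ant H)"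
    using lin_pairing_antipode[OF L(1) A f] by (simp add: d)
  let ?S = "ant H"
  have "e \<cdot> \<sigma> N M \<cdot> (\<langle>N\<rangle> \<otimes>\<^sub>a (U \<cdot> r)) = (e \<cdot> \<sigma> N M \<cdot> (\<langle>N\<rangle> \<otimes>\<^sub>a U)) \<cdot> (\<langle>N\<rangle> \<otimes>\<^sub>a r)"
    by (rule den_eqI, (rule den_intro | (simp; fail))+)
  also have "\<dots> = (e \<cdot> \<sigma> N M \<cdot> (\<langle>N\<rangle> \<otimes>\<^sub>a U)) \<cdot> (s \<otimes>\<^sub>a \<langle>M\<rangle>) \<cdot> (\<langle>N\<rangle> \<otimes>\<^sub>a \<sigma> M h) \<cdot> (\<langle>N\<rangle> \<otimes>\<^sub>a \<langle>M\<rangle> \<otimes>\<^sub>a ?S)"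
    unfolding fU by (rule P2)
  also have "\<dots> = (e \<cdot> (\<langle>M\<rangle> \<otimes>\<^sub>a s)) \<cdot> (\<sigma> N M \<otimes>\<^sub>a \<langle>h\<rangle>) \<cdot> (\<langle>N\<rangle> \<otimes>\<^sub>a \<sigma> h M) \<cdot> (\<langle>N\<rangle> \<otimes>\<^sub>a \<langle>h\<rangle> \<otimes>\<^sub>a U) \<cdot> (\<langle>N\<rangle> \<otimes>\<^sub>a \<sigma> M h) \<cdot> (\<langle>N\<rangle> \<otimes>\<^sub>a \<langle>M\<rangle> \<otimes>\<^sub>a ?S)"
    by (rule den_eqI, (rule den_intro | (simp; fail))+, simp add: diag tyi t)
  also have "\<dots> = e \<cdot> \<sigma> N M \<cdot> (\<langle>N\<rangle> \<otimes>\<^sub>a (r \<cdot> (U \<otimes>\<^sub>a \<langle>h\<rangle>) \<cdot> \<sigma> h M \<cdot> \<sigma> M h \<cdot> (\<langle>M\<rangle> \<otimes>\<^sub>a (?S \<cdot> ?S))))"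
    unfolding P1 by (rule den_eqI, (rule den_intro | (simp; fail))+, simp add: diag tyi t)
  finally have eq: "e \<cdot> \<sigma> N M \<cdot> (\<langle>N\<rangle> \<otimes>\<^sub>a (U \<cdot> r)) = e \<cdot> \<sigma> N M \<cdot> (\<langle>N\<rangle> \<otimes>\<^sub>a (r \<cdot> (U \<otimes>\<^sub>a \<langle>h\<rangle>) \<cdot> \<sigma> h M \<cdot> \<sigma> M h \<cdot> (\<langle>M\<rangle> \<otimes>\<^sub>a (?S \<cdot> ?S))))" .
  have "typed (U \<cdot> r) [M, h] [M]" "typed (r \<cdot> (U \<otimes>\<^sub>a \<langle>h\<rangle>) \<cdot> \<sigma> h M \<cdot> \<sigma> M h \<cdot> (\<langle>M\<rangle> \<otimes>\<^sub>a (?S \<cdot> ?S))) [M, h] [M]"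
    by (rule den_typed, rule den_conv, (rule den_intro | (simp; fail))+)+
  then have "U \<cdot> r \<in> Hom V (M \<otimes>\<^sub>o h) M" "r \<cdot> (U \<otimes>\<^sub>a \<langle>h\<rangle>) \<cdot> \<sigma> h M \<cdot> \<sigma> M h \<cdot> (\<langle>M\<rangle> \<otimes>\<^sub>a (?S \<cdot> ?S)) \<in> Hom V (M \<otimes>\<^sub>o h) M"
    by (simp_all add: typed_def tob_Cons tensor_ob_unit)
  from evr_braid_cancel[OF o(1) this] eq show ?thesis
    by (simp add: d)
qed

text \<open>\<open>pairing_tensor\<close> is applied twice, in \<open>W\<close> and in
  \<open>V\<close>, to the same nested evaluation. The pairing law of \<open>\<uu>\<close> at the
  product and at both factors exchanges the two kinds of crossings.\<close>

lemma u_tensor: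
  assumes A [simp]: "rmod A" and B [simp]: "rmod B"
  shows "sh \<uu> (A \<odot> B) \<cdot> mc B A \<cdot> mc A B = (sh \<uu> A \<otimes>\<^sub>a sh \<uu> B) \<cdot> \<sigma> (fst B) (fst A) \<cdot> \<sigma> (fst A) (fst B)"
proof -
  define A' B' M N M' N' e e' where d: "A' = mod_rdual V H A" "B' = mod_rdual V H B" "M = fst A" "N = fst B" "M' = rdual V M" "N' = rdual V N"
    "e = evr V M" "e' = evr V N"
  note LA = mod_rdual[OF A, folded d] and LB = mod_rdual[OF B, folded d]
  note [simp] = LA(1) LB(1) rmod_mt
  have o [simp]: "M \<in> Ob V" "N \<in> Ob V" "M' \<in> Ob V" "N' \<in> Ob V" by (simp_all add: d rdual_closed)
  have fd: "fst A = M" "fst B = N" "fst A' = M'" "fst B' = N'" by (simp_all add: d)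
  define c k1 k2 k3 k4 U where c: "c = mc (B' \<odot> A') (A \<odot> B)" "k1 = mc B A" "k2 = mc A B" "k3 = mc B' B" "k4 = mc A' A" "U = sh \<uu> (A \<odot> B)"
  define UA UB where cU: "UA = sh \<uu> A" "UB = sh \<uu> B"
  let ?E = "e \<cdot> (\<langle>M\<rangle> \<otimes>\<^sub>a e' \<otimes>\<^sub>a \<langle>M'\<rangle>)" and ?D = "N' \<otimes>\<^sub>o M'"
  have t: "typed c [N', M', M, N] [M, N, N', M']" "typed k1 [N, M] [M, N]" "typed k2 [M, N] [N, M]" "typed k3 [N', N] [N, N']" "typed k4 [M', M] [M, M']"
    "typed U [M, N] [M, N]" "typed UA [M] [M]" "typed UB [N] [N]" "typed e [M, M'] []" "typed e' [N, N'] []"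
    using typed_mc[of "B' \<odot> A'" "A \<odot> B"] typed_mc[of B A] typed_mc[of A B] typed_mc[of B' B] typed_mc[of A' A]
      sh_hom[OF rmod_mt[OF A B] u_elem(1)] sh_hom[OF A u_elem(1)] sh_hom[OF B u_elem(1)]
      lin_pairing_typed[OF A LA(1,2)] lin_pairing_typed[OF B LB(1,2)]
    by (simp_all add: typed_def tob_Cons tensor_ob_unit tensor_closed tensor_ob_assoc c(1-5) fd flip: c(6) cU d)
  note [den_intro] = t[THEN den_gen]
  have "lin (B \<odot> B') e' (mod_unit V H)" "lin (A \<odot> A') e (mod_unit V H)"
    using LA(2) LB(2) by (simp_all add: d)
  then have "lin (A \<odot> ((B \<odot> B') \<odot> A')) (\<langle>M\<rangle> \<otimes>\<^sub>a (e' \<otimes>\<^sub>a \<langle>M'\<rangle>)) (A \<odot> (mod_unit V H \<odot> A'))"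
    using lin_ident[OF A] lin_ident[OF LA(1)] by (intro lin_tensor) (simp_all add: mod_unit_module fd)
  then have E: "lin ((A \<odot> B) \<odot> (B' \<odot> A')) ?E (mod_unit V H)"
    using lin_comp[of "A \<odot> ((B \<odot> B') \<odot> A')" "A \<odot> A'" "mod_unit V H"] \<open>lin (A \<odot> A') e (mod_unit V H)\<close>
    by (simp add: mt_unit mt_assoc mod_unit_module)
  have eW: "?E \<cdot> c \<cdot> (\<langle>?D\<rangle> \<otimes>\<^sub>a (k1 \<cdot> k2)) = e' \<cdot> k3 \<cdot> (\<langle>N'\<rangle> \<otimes>\<^sub>a (e \<cdot> k4) \<otimes>\<^sub>a \<langle>N\<rangle>)"
  proof -
    have tW: "W.typed (evr W A) [A, A'] []" "W.typed (evr W B) [B, B'] []"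
      using W.evr_hom[of A] W.evr_hom[of B] by (simp_all add: W.typed_def W.tob_Cons W.tob_Nil mt_unit mod_unit_module flip: d)
    \<comment> \<open>Arrows of \<open>W\<close> are triples; the middle component of the identity
      in \<open>W\<close> is the required equation in \<open>V\<close>.\<close>
    show ?thesis
      using arg_cong[OF W.pairing_tensor[OF _ _ _ _ tW], of "\<lambda>x. fst (snd x)"] by (simp add: c d mod_rdual(1)[OF A] mod_rdual(1)[OF B])
  qed
  have uE: "?E \<cdot> \<sigma> ?D (M \<otimes>\<^sub>o N) \<cdot> (\<langle>?D\<rangle> \<otimes>\<^sub>a U) = ?E \<cdot> c"
    using u_pairing[OF rmod_mt[OF A B] rmod_mt[OF LB(1) LA(1)] E] by (simp add: c fd)
  have uA: "e \<cdot> k4 = e \<cdot> \<sigma> M' M \<cdot> (\<langle>M'\<rangle> \<otimes>\<^sub>a UA)" and uB: "e' \<cdot> k3 = e' \<cdot> \<sigma> N' N \<cdot> (\<langle>N'\<rangle> \<otimes>\<^sub>a UB)"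
    using u_pairing[OF A LA(1,2)] u_pairing[OF B LB(1,2)] by (simp_all add: c cU d)
  have "?E \<cdot> \<sigma> ?D (M \<otimes>\<^sub>o N) \<cdot> (\<langle>?D\<rangle> \<otimes>\<^sub>a (U \<cdot> k1 \<cdot> k2)) = (?E \<cdot> \<sigma> ?D (M \<otimes>\<^sub>o N) \<cdot> (\<langle>?D\<rangle> \<otimes>\<^sub>a U)) \<cdot> (\<langle>?D\<rangle> \<otimes>\<^sub>a (k1 \<cdot> k2))"
    by (rule den_eqI, (rule den_intro | (simp; fail))+)
  also have "\<dots> = ?E \<cdot> c \<cdot> (\<langle>?D\<rangle> \<otimes>\<^sub>a (k1 \<cdot> k2))"
    unfolding uE by (rule den_eqI, (rule den_intro | (simp; fail))+)
  also have "\<dots> = (e' \<cdot> k3) \<cdot> (\<langle>N'\<rangle> \<otimes>\<^sub>a (e \<cdot> k4) \<otimes>\<^sub>a \<langle>N\<rangle>)"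
    unfolding eW by (rule den_eqI, (rule den_intro | (simp; fail))+)
  also have "\<dots> = (e' \<cdot> \<sigma> N' N \<cdot> (\<langle>N'\<rangle> \<otimes>\<^sub>a (e \<cdot> \<sigma> M' M) \<otimes>\<^sub>a \<langle>N\<rangle>)) \<cdot> (\<langle>?D\<rangle> \<otimes>\<^sub>a UA \<otimes>\<^sub>a UB)"
    unfolding uA uB by (rule den_eqI, (rule den_intro | (simp; fail))+, (simp add: diag tyi t)?, simp add: diag' tyi t)
  also have "\<dots> = ?E \<cdot> \<sigma> ?D (M \<otimes>\<^sub>o N) \<cdot> (\<langle>?D\<rangle> \<otimes>\<^sub>a ((UA \<otimes>\<^sub>a UB) \<cdot> \<sigma> N M \<cdot> \<sigma> M N))"
    unfolding pairing_tensor[OF o t(9,10), symmetric] by (rule den_eqI, (rule den_intro | (simp; fail))+, simp add: diag tyi t)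
  finally have eq: "?E \<cdot> \<sigma> ?D (M \<otimes>\<^sub>o N) \<cdot> (\<langle>?D\<rangle> \<otimes>\<^sub>a (U \<cdot> k1 \<cdot> k2)) = ?E \<cdot> \<sigma> ?D (M \<otimes>\<^sub>o N) \<cdot> (\<langle>?D\<rangle> \<otimes>\<^sub>a ((UA \<otimes>\<^sub>a UB) \<cdot> \<sigma> N M \<cdot> \<sigma> M N))" .
  have t2: "typed (U \<cdot> k1 \<cdot> k2) [M, N] [M, N]" "typed ((UA \<otimes>\<^sub>a UB) \<cdot> \<sigma> N M \<cdot> \<sigma> M N) [M, N] [M, N]"
    by (rule den_typed, rule den_conv, (rule den_intro | (simp; fail))+)+
  have "U \<cdot> k1 \<cdot> k2 = (UA \<otimes>\<^sub>a UB) \<cdot> \<sigma> N M \<cdot> \<sigma> M N"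
    by (rule pairing_tensor_cancel[OF o(1,2) t2]) (use eq in \<open>simp only: d\<close>)
  then show ?thesis
    by (simp only: c cU d)
qed

end

section \<open>Balanced, pivotal and ribbon elements\<close>

text \<open>Pure monoid algebra. Centrality and \<open>t k s = 1\<close> make \<open>t\<close> and
  \<open>k\<close> invertible, so \<open>s = t\<close> means \<open>k t^2 = 1\<close>. This is the
  inverse of \<open>t^2\<close> being \<open>k\<close>; and since
  \<open>(t u)^2 = t^2 u^2 = k t^2 q\<close> with \<open>q\<close> invertible, it is also
  \<open>(t u)^2 = q\<close>.\<close>

lemma (in monoid) ribbon_criterion:
  assumes c [simp]: "t \<in> carrier G" "k \<in> carrier G" "s \<in> carrier G" "u \<in> Units G" "q \<in> carrier G"
    and t: "\<And>x. x \<in> carrier G \<Longrightarrow> t \<otimes> x = x \<otimes> t" and k: "\<And>x. x \<in> carrier G \<Longrightarrow> k \<otimes> x = x \<otimes> k"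
    and tks: "t \<otimes> k \<otimes> s = \<one>" and kq: "k \<otimes> q = u \<otimes> u"
  shows "s = t \<longleftrightarrow> t [^] (-2 :: int) = k" "s = t \<longleftrightarrow> (t \<otimes> u) [^] (2 :: nat) = q"
proof -
  have u [simp]: "u \<in> carrier G" by (simp add: Units_closed)
  have t1: "t \<otimes> (k \<otimes> s) = \<one>" "(k \<otimes> s) \<otimes> t = \<one>"
    using tks t[of "k \<otimes> s"] by (simp_all add: m_assoc)
  then have tU: "t \<in> Units G" unfolding Units_def by auto
  have "k \<otimes> (s \<otimes> t) = \<one>" "(s \<otimes> t) \<otimes> k = \<one>"
    using t1 k[of "s \<otimes> t"] by (simp_all add: m_assoc)
  then have kU: "k \<in> Units G" unfolding Units_def by (auto intro!: bexI[of _ "s \<otimes> t"])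
  have ttk: "s = t \<longleftrightarrow> k \<otimes> (t \<otimes> t) = \<one>"
  proof
    assume "s = t"
    then show "k \<otimes> (t \<otimes> t) = \<one>" using t1(2) by (simp add: m_assoc)
  next
    assume "k \<otimes> (t \<otimes> t) = \<one>"
    then have "(k \<otimes> t) \<otimes> s = (k \<otimes> t) \<otimes> t"
      using tks t[of k] by (simp add: m_assoc)
    then show "s = t" using Units_m_closed[OF kU tU] by simp
  qed
  have ttU: "t \<otimes> t \<in> Units G" using tU by simp
  \<comment> \<open>A negative power unfolds to the inverse of a positive one. In a mere monoid this
    is meaningful because \<open>t\<close> has been shown to be a unit.\<close>
  have "t [^] (-2 :: int) = inv (t \<otimes> t)"
    by (simp add: int_pow_def2 numeral_2_eq_2)
  moreover have "inv (t \<otimes> t) = k \<longleftrightarrow> k \<otimes> (t \<otimes> t) = \<one>"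
  proof
    assume "inv (t \<otimes> t) = k"
    then show "k \<otimes> (t \<otimes> t) = \<one>" using Units_l_inv[OF ttU] by simp
  next
    assume "k \<otimes> (t \<otimes> t) = \<one>"
    then show "inv (t \<otimes> t) = k" using k[of "t \<otimes> t"] inv_unique'[of "t \<otimes> t" k] by simp
  qed
  ultimately show "s = t \<longleftrightarrow> t [^] (-2 :: int) = k" using ttk by simp
  \<comment> \<open>\<open>q\<close> is the inverse of \<open>k\<close> times the square of the unit
    \<open>u\<close>.\<close>
  have qU: "q \<in> Units G"
  proof -
    have "q = inv k \<otimes> (u \<otimes> u)" using kU kq[symmetric] by (simp add: m_assoc[symmetric])
    then show ?thesis using kU by simp
  qed
  have "t \<otimes> u \<otimes> (t \<otimes> u) = t \<otimes> (u \<otimes> t) \<otimes> u" by (simp add: m_assoc)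
  also have "\<dots> = (t \<otimes> t) \<otimes> (u \<otimes> u)" unfolding t[OF u, symmetric] by (simp add: m_assoc)
  also have "\<dots> = (k \<otimes> (t \<otimes> t)) \<otimes> q" unfolding kq[symmetric] using k[of "t \<otimes> t"] by (simp add: m_assoc[symmetric])
  finally have p: "(t \<otimes> u) [^] (2 :: nat) = (k \<otimes> (t \<otimes> t)) \<otimes> q" by (simp add: numeral_2_eq_2)
  have "(k \<otimes> (t \<otimes> t)) \<otimes> q = q \<longleftrightarrow> k \<otimes> (t \<otimes> t) = \<one>"
  proof
    assume "(k \<otimes> (t \<otimes> t)) \<otimes> q = q"
    then have "(k \<otimes> (t \<otimes> t)) \<otimes> q \<otimes> inv q = q \<otimes> inv q" by simp
    then show "k \<otimes> (t \<otimes> t) = \<one>" using qU by (simp add: m_assoc)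
  qed simp
  then show "s = t \<longleftrightarrow> (t \<otimes> u) [^] (2 :: nat) = q" using ttk p by simp
qed

section \<open>From balanced to pivotal elements and back\<close>

context quasitriangular
begin

lemma double_mc_natural:
  assumes A [simp]: "rmod A" and B [simp]: "rmod B" and f: "lin A f A" and g: "lin B g B"
  shows "mc B A \<cdot> mc A B \<cdot> (f \<otimes>\<^sub>a g) = (f \<otimes>\<^sub>a g) \<cdot> mc B A \<cdot> mc A B"
proof -
  define k1 k2 where k: "k1 = mc B A" "k2 = mc A B"
  note t = typed_mc[OF B A, folded k] typed_mc[OF A B, folded k] lin_r(1)[OF f A A] lin_r(1)[OF g B B]
  note [den_intro] = t[THEN den_gen]
  have n: "k1 \<cdot> (g \<otimes>\<^sub>a f) = (f \<otimes>\<^sub>a g) \<cdot> k1" "k2 \<cdot> (f \<otimes>\<^sub>a g) = (g \<otimes>\<^sub>a f) \<cdot> k2"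
    unfolding k by (rule mc_natural[OF B A B A g f], rule mc_natural[OF A B A B f g])
  have "k1 \<cdot> k2 \<cdot> (f \<otimes>\<^sub>a g) = (k1 \<cdot> (g \<otimes>\<^sub>a f)) \<cdot> k2"
    unfolding n(2) by (rule den_eqI, (rule den_intro | (simp; fail))+)
  also have "\<dots> = (f \<otimes>\<^sub>a g) \<cdot> k1 \<cdot> k2"
    unfolding n(1) by (rule den_eqI, (rule den_intro | (simp; fail))+)
  finally show ?thesis unfolding k .
qed

lemma u_inv_unit: "sh (inv\<^bsub>El\<^esub> \<uu>) (mod_unit V H) = \<langle>\<^bold>1\<rangle>"
  using u_inv(4)[OF mod_unit_module] sh_hom[OF mod_unit_module u_inv(2)] by (simp add: u_unit cmp_ident)

lemma balanced_to_pivotal: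
  assumes b: "C_balanced V C \<iota> H R t"
  shows "C_pivotal V C \<iota> H (t \<otimes>\<^bsub>El\<^esub> \<uu>)"
proof -
  have tE: "t \<in> carrier El" and lt: "\<And>A. rmod A \<Longrightarrow> lin A (sh t A) A" and t1: "sh t (mod_unit V H) = \<langle>\<^bold>1\<rangle>"
    and tt: "\<And>A B. rmod A \<Longrightarrow> rmod B \<Longrightarrow> sh t (A \<odot> B) = (sh t A \<otimes>\<^sub>a sh t B) \<cdot> mc B A \<cdot> mc A B"
    using b unfolding balanced_iff by blast+
  note sp = sh_mult[OF _ tE u_elem(1)]
  show ?thesis
    unfolding pivotal_element_iff
  proof (intro conjI allI impI)
    show "t \<otimes>\<^bsub>El\<^esub> \<uu> \<in> carrier El" by (rule El_mult_closed[OF tE u_elem(1)])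
    show "sh (t \<otimes>\<^bsub>El\<^esub> \<uu>) (mod_unit V H) = \<langle>\<^bold>1\<rangle>"
      using ident_hom[OF unit_closed] by (simp add: sp[OF mod_unit_module] u_unit t1 cmp_ident)
  next
    fix A B assume A [simp]: "rmod A" and B [simp]: "rmod B"
    define M N k T1 T2 U1 U2 U where d: "M = fst A" "N = fst B" "k = mc B A \<cdot> mc A B" "T1 = sh t A" "T2 = sh t B" "U1 = sh \<uu> A" "U2 = sh \<uu> B" "U = sh \<uu> (A \<odot> B)"
    have o [simp]: "M \<in> Ob V" "N \<in> Ob V" by (simp_all add: d)
    have t: "typed T1 [M] [M]" "typed T2 [N] [N]" "typed U1 [M] [M]" "typed U2 [N] [N]" "typed U [M, N] [M, N]" "typed k [M, N] [M, N]"
      using sh_hom[OF A tE] sh_hom[OF B tE] sh_hom[OF A u_elem(1)] sh_hom[OF B u_elem(1)] sh_hom[OF rmod_mt[OF A B] u_elem(1)]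
        cmp_hom[OF lin_hom[OF mc_lin[OF A B]] lin_hom[OF mc_lin[OF B A]]]
      by (simp_all add: typed_def tob_Cons tensor_ob_unit d)
    note [den_intro] = t[THEN den_gen]
    \<comment> \<open>Here the centrality of \<open>t\<close> enters the tensor law: the module
      braiding commutes with linear endomorphisms only.\<close>
    have 1: "k \<cdot> (T1 \<otimes>\<^sub>a T2) = (T1 \<otimes>\<^sub>a T2) \<cdot> k"
    proof -
      have h: "mc A B \<in> Hom V (M \<otimes>\<^sub>o N) (N \<otimes>\<^sub>o M)" "mc B A \<in> Hom V (N \<otimes>\<^sub>o M) (M \<otimes>\<^sub>o N)" "T1 \<otimes>\<^sub>a T2 \<in> Hom V (M \<otimes>\<^sub>o N) (M \<otimes>\<^sub>o N)"
        using lin_hom[OF mc_lin[OF A B]] lin_hom[OF mc_lin[OF B A]] tensor_hom[OF sh_hom[OF A tE] sh_hom[OF B tE]] by (simp_all add: d)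
      show ?thesis
        using double_mc_natural[OF A B lt[OF A] lt[OF B]] cmp_assoc[OF h(3,1,2)] by (simp add: d)
    qed
    have 2: "U \<cdot> k = (U1 \<otimes>\<^sub>a U2) \<cdot> \<sigma> N M \<cdot> \<sigma> M N"
      using u_tensor[OF A B] by (simp add: d)
    have "U \<cdot> (T1 \<otimes>\<^sub>a T2) \<cdot> k = (U \<cdot> k) \<cdot> (T1 \<otimes>\<^sub>a T2)"
      unfolding 1[symmetric] by (rule den_eqI, (rule den_intro | (simp; fail))+)
    also have "\<dots> = ((U1 \<cdot> T1) \<otimes>\<^sub>a (U2 \<cdot> T2)) \<cdot> \<sigma> N M \<cdot> \<sigma> M N"
      unfolding 2 by (rule den_eqI, (rule den_intro | (simp; fail))+, simp add: diag tyi t)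
    finally show "sh (t \<otimes>\<^bsub>El\<^esub> \<uu>) (A \<odot> B) = (sh (t \<otimes>\<^bsub>El\<^esub> \<uu>) A \<otimes>\<^sub>a sh (t \<otimes>\<^bsub>El\<^esub> \<uu>) B) \<cdot> \<sigma> (fst B) (fst A) \<cdot> \<sigma> (fst A) (fst B)"
      by (simp add: sp A B rmod_mt tt d)
  next
    fix A assume A [simp]: "rmod A"
    define M r T U where d: "M = fst A" "r = snd A" "T = sh t A" "U = sh \<uu> A"
    have o [simp]: "M \<in> Ob V" by (simp add: d)
    have t: "typed T [M] [M]" "typed U [M] [M]" "typed r [M, h] [M]"
      using sh_hom[OF A tE] sh_hom[OF A u_elem(1)] rmod_typed[OF A] by (simp_all add: typed_def tob_Cons tensor_ob_unit d)
    note [den_intro] = t[THEN den_gen]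
    have T: "T \<cdot> r = r \<cdot> (T \<otimes>\<^sub>a \<langle>h\<rangle>)"
      using lt[OF A] by (simp add: H_linear_def d)
    have "(U \<cdot> T) \<cdot> r = U \<cdot> (T \<cdot> r)" by (rule den_eqI, (rule den_intro | (simp; fail))+)
    also have "\<dots> = (U \<cdot> r) \<cdot> (T \<otimes>\<^sub>a \<langle>h\<rangle>)" unfolding T by (rule den_eqI, (rule den_intro | (simp; fail))+)
    also have "U \<cdot> r = r \<cdot> (U \<otimes>\<^sub>a \<langle>h\<rangle>) \<cdot> \<sigma> h M \<cdot> \<sigma> M h \<cdot> (\<langle>M\<rangle> \<otimes>\<^sub>a (ant H \<cdot> ant H))"
      using u_twisted[OF A] by (simp add: d)
    also have "(r \<cdot> (U \<otimes>\<^sub>a \<langle>h\<rangle>) \<cdot> \<sigma> h M \<cdot> \<sigma> M h \<cdot> (\<langle>M\<rangle> \<otimes>\<^sub>a (ant H \<cdot> ant H))) \<cdot> (T \<otimes>\<^sub>a \<langle>h\<rangle>)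
       = r \<cdot> ((U \<cdot> T) \<otimes>\<^sub>a \<langle>h\<rangle>) \<cdot> \<sigma> h M \<cdot> \<sigma> M h \<cdot> (\<langle>M\<rangle> \<otimes>\<^sub>a (ant H \<cdot> ant H))"
      by (rule den_eqI, (rule den_intro | (simp; fail))+, simp add: diag tyi t)
    finally show "sh (t \<otimes>\<^bsub>El\<^esub> \<uu>) A \<cdot> snd A = snd A \<cdot> (sh (t \<otimes>\<^bsub>El\<^esub> \<uu>) A \<otimes>\<^sub>a \<langle>h\<rangle>) \<cdot> \<sigma> h (fst A) \<cdot> \<sigma> (fst A) h \<cdot> (\<langle>fst A\<rangle> \<otimes>\<^sub>a (ant H \<cdot> ant H))"
      by (simp add: sp A d)
  qed
qed

lemma pivotal_to_balanced:
  assumes p: "C_pivotal V C \<iota> H p"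
  shows "C_balanced V C \<iota> H R (p \<otimes>\<^bsub>El\<^esub> inv\<^bsub>El\<^esub> \<uu>)"
proof -
  have pE: "p \<in> carrier El" and p1: "sh p (mod_unit V H) = \<langle>\<^bold>1\<rangle>"
    and pp: "\<And>A B. rmod A \<Longrightarrow> rmod B \<Longrightarrow> sh p (A \<odot> B) = (sh p A \<otimes>\<^sub>a sh p B) \<cdot> \<sigma> (fst B) (fst A) \<cdot> \<sigma> (fst A) (fst B)"
    and pl: "\<And>A. rmod A \<Longrightarrow> sh p A \<cdot> snd A = snd A \<cdot> (sh p A \<otimes>\<^sub>a \<langle>h\<rangle>) \<cdot> \<sigma> h (fst A) \<cdot> \<sigma> (fst A) h \<cdot> (\<langle>fst A\<rangle> \<otimes>\<^sub>a (ant H \<cdot> ant H))"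
    using p unfolding pivotal_element_iff by blast+
  define t v where d0: "t = p \<otimes>\<^bsub>El\<^esub> inv\<^bsub>El\<^esub> \<uu>" "v = inv\<^bsub>El\<^esub> \<uu>"
  have tE: "t \<in> carrier El" unfolding d0 by (rule El_mult_closed[OF pE u_inv(2)])
  note sp = sh_mult[OF _ pE u_inv(2), folded d0]
  \<comment> \<open>Linearity comes first, because the tensor law below moves \<open>t\<close>
    through the module braiding.\<close>
  have lt: "lin A (sh t A) A" if A [simp]: "rmod A" for A
  proof -
    define M r P U U' where d: "M = fst A" "r = snd A" "P = sh p A" "U = sh \<uu> A" "U' = sh v A"
    have o [simp]: "M \<in> Ob V" by (simp add: d)
    have t: "typed P [M] [M]" "typed U [M] [M]" "typed U' [M] [M]" "typed r [M, h] [M]"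
      using sh_hom[OF A pE] sh_hom[OF A u_elem(1)] sh_hom[OF A u_inv(2)] rmod_typed[OF A] by (simp_all add: typed_def tob_Cons tensor_ob_unit d d0)
    note [den_intro] = t[THEN den_gen]
    have i: "U' \<cdot> U = \<langle>M\<rangle>" "U \<cdot> U' = \<langle>M\<rangle>" using u_inv(3,4)[OF A] by (simp_all add: d d0)
    let ?Q = "\<sigma> h M \<cdot> \<sigma> M h \<cdot> (\<langle>M\<rangle> \<otimes>\<^sub>a (ant H \<cdot> ant H))"
    have "(U' \<cdot> P) \<cdot> r = U' \<cdot> (P \<cdot> r)" by (rule den_eqI, (rule den_intro | (simp; fail))+)
    also have "P \<cdot> r = r \<cdot> (P \<otimes>\<^sub>a \<langle>h\<rangle>) \<cdot> ?Q" using pl[OF A] by (simp add: d)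
    \<comment> \<open>Inserting \<open>U\<close> and its inverse produces the right-hand side of
      \<open>u_twisted\<close>, which absorbs the twist \<open>?Q\<close>.\<close>
    also have "U' \<cdot> (r \<cdot> (P \<otimes>\<^sub>a \<langle>h\<rangle>) \<cdot> ?Q) = U' \<cdot> (r \<cdot> (((U \<cdot> U') \<cdot> P) \<otimes>\<^sub>a \<langle>h\<rangle>) \<cdot> ?Q)"
      unfolding i by (rule den_eqI, (rule den_intro | (simp; fail))+)
    also have "\<dots> = U' \<cdot> (r \<cdot> (U \<otimes>\<^sub>a \<langle>h\<rangle>) \<cdot> ?Q) \<cdot> ((U' \<cdot> P) \<otimes>\<^sub>a \<langle>h\<rangle>)"
      by (rule den_eqI, (rule den_intro | (simp; fail))+, simp add: diag tyi t)
    also have "r \<cdot> (U \<otimes>\<^sub>a \<langle>h\<rangle>) \<cdot> ?Q = U \<cdot> r" using u_twisted[OF A] by (simp add: d)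
    also have "U' \<cdot> (U \<cdot> r) \<cdot> ((U' \<cdot> P) \<otimes>\<^sub>a \<langle>h\<rangle>) = (U' \<cdot> U) \<cdot> r \<cdot> ((U' \<cdot> P) \<otimes>\<^sub>a \<langle>h\<rangle>)"
      by (rule den_eqI, (rule den_intro | (simp; fail))+)
    also have "\<dots> = r \<cdot> ((U' \<cdot> P) \<otimes>\<^sub>a \<langle>h\<rangle>)"
      unfolding i by (rule den_eqI, (rule den_intro | (simp; fail))+)
    finally show ?thesis
      using sh_hom[OF A tE] by (simp add: H_linear_def sp[OF A] d)
  qed
  have tt: "sh t (A \<odot> B) = (sh t A \<otimes>\<^sub>a sh t B) \<cdot> mc B A \<cdot> mc A B" if A [simp]: "rmod A" and B [simp]: "rmod B" for A B
  proof -
    define M N k P1 P2 U1 U2 U V1 V2 V0 where d: "M = fst A" "N = fst B" "k = mc B A \<cdot> mc A B" "P1 = sh p A" "P2 = sh p B" "U1 = sh \<uu> A" "U2 = sh \<uu> B" "U = sh \<uu> (A \<odot> B)"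
      "V1 = sh v A" "V2 = sh v B" "V0 = sh v (A \<odot> B)"
    have o [simp]: "M \<in> Ob V" "N \<in> Ob V" by (simp_all add: d)
    have t: "typed P1 [M] [M]" "typed P2 [N] [N]" "typed U1 [M] [M]" "typed U2 [N] [N]" "typed U [M, N] [M, N]" "typed k [M, N] [M, N]"
      "typed V1 [M] [M]" "typed V2 [N] [N]" "typed V0 [M, N] [M, N]"
      using sh_hom[OF A pE] sh_hom[OF B pE] sh_hom[OF A u_elem(1)] sh_hom[OF B u_elem(1)] sh_hom[OF rmod_mt[OF A B] u_elem(1)]
        sh_hom[OF A u_inv(2)] sh_hom[OF B u_inv(2)] sh_hom[OF rmod_mt[OF A B] u_inv(2)]
        cmp_hom[OF lin_hom[OF mc_lin[OF A B]] lin_hom[OF mc_lin[OF B A]]]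
      by (simp_all add: typed_def tob_Cons tensor_ob_unit d d0)
    note [den_intro] = t[THEN den_gen]
    have i: "U1 \<cdot> V1 = \<langle>M\<rangle>" "U2 \<cdot> V2 = \<langle>N\<rangle>" "V0 \<cdot> U = \<langle>M \<otimes>\<^sub>o N\<rangle>"
      using u_inv(4)[OF A] u_inv(4)[OF B] u_inv(3)[OF rmod_mt[OF A B]] by (simp_all add: d d0)
    have h: "mc A B \<in> Hom V (M \<otimes>\<^sub>o N) (N \<otimes>\<^sub>o M)" "mc B A \<in> Hom V (N \<otimes>\<^sub>o M) (M \<otimes>\<^sub>o N)" "sh t A \<otimes>\<^sub>a sh t B \<in> Hom V (M \<otimes>\<^sub>o N) (M \<otimes>\<^sub>o N)"
      using lin_hom[OF mc_lin[OF A B]] lin_hom[OF mc_lin[OF B A]] tensor_hom[OF sh_hom[OF A tE] sh_hom[OF B tE]] by (simp_all add: d)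
    have 1: "k \<cdot> (sh t A \<otimes>\<^sub>a sh t B) = (sh t A \<otimes>\<^sub>a sh t B) \<cdot> k"
      using double_mc_natural[OF A B lt[OF A] lt[OF B]] cmp_assoc[OF h(3,1,2)] by (simp add: d)
    have 2: "(U1 \<otimes>\<^sub>a U2) \<cdot> \<sigma> N M \<cdot> \<sigma> M N = U \<cdot> k"
      using u_tensor[OF A B] by (simp add: d)
    have "sh t (A \<odot> B) = V0 \<cdot> (P1 \<otimes>\<^sub>a P2) \<cdot> \<sigma> N M \<cdot> \<sigma> M N"
      by (simp add: sp A B rmod_mt pp d)
    also have "\<dots> = V0 \<cdot> (((U1 \<cdot> V1) \<cdot> P1) \<otimes>\<^sub>a ((U2 \<cdot> V2) \<cdot> P2)) \<cdot> \<sigma> N M \<cdot> \<sigma> M N"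
      unfolding i by (rule den_eqI, (rule den_intro | (simp; fail))+)
    also have "\<dots> = V0 \<cdot> ((U1 \<otimes>\<^sub>a U2) \<cdot> \<sigma> N M \<cdot> \<sigma> M N) \<cdot> ((V1 \<cdot> P1) \<otimes>\<^sub>a (V2 \<cdot> P2))"
      by (rule den_eqI, (rule den_intro | (simp; fail))+, simp add: diag tyi t)
    also have "\<dots> = (V0 \<cdot> U) \<cdot> k \<cdot> ((V1 \<cdot> P1) \<otimes>\<^sub>a (V2 \<cdot> P2))"
      unfolding 2 by (rule den_eqI, (rule den_intro | (simp; fail))+)
    also have "\<dots> = k \<cdot> ((V1 \<cdot> P1) \<otimes>\<^sub>a (V2 \<cdot> P2))"
      unfolding i by (rule den_eqI, (rule den_intro | (simp; fail))+)
    also have "\<dots> = k \<cdot> (sh t A \<otimes>\<^sub>a sh t B)"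
      by (simp add: sp A B d)
    finally show ?thesis unfolding 1 by (simp add: d)
  qed
  have "sh t (mod_unit V H) = \<langle>\<^bold>1\<rangle>"
    unfolding sp[OF mod_unit_module] p1 using ident_hom[OF unit_closed] u_inv_unit by (simp add: cmp_ident d0(2))
  then show ?thesis
    unfolding d0(1)[symmetric] balanced_iff using tE lt tt by blast
qed

lemma balanced_pivotal_bij:
  "bij_betw (\<lambda>t. t \<otimes>\<^bsub>El\<^esub> \<uu>) (CBal V C \<iota> H R) (CPiv V C \<iota> H)"
proof -
  interpret monoid El by (rule El_monoid)
  note uU = u_inv(1)
  show ?thesis
  proof (rule bij_betw_byWitness[where f' = "\<lambda>p. p \<otimes>\<^bsub>El\<^esub> inv\<^bsub>El\<^esub> \<uu>"])
    have "t \<otimes>\<^bsub>El\<^esub> \<uu> \<otimes>\<^bsub>El\<^esub> inv\<^bsub>El\<^esub> \<uu> = t" "t \<otimes>\<^bsub>El\<^esub> inv\<^bsub>El\<^esub> \<uu> \<otimes>\<^bsub>El\<^esub> \<uu> = t" if "t \<in> carrier El" for t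
      using m_assoc[OF that Units_closed[OF uU] Units_inv_closed[OF uU]] m_assoc[OF that Units_inv_closed[OF uU] Units_closed[OF uU]]
        Units_r_inv[OF uU] Units_l_inv[OF uU] r_one[OF that] by simp_all
    moreover have "t \<in> carrier El" if "t \<in> CBal V C \<iota> H R \<or> t \<in> CPiv V C \<iota> H" for t
      using that unfolding CBal_def CPiv_def mem_Collect_eq balanced_iff pivotal_element_iff by blast
    ultimately show "\<forall>t \<in> CBal V C \<iota> H R. t \<otimes>\<^bsub>El\<^esub> \<uu> \<otimes>\<^bsub>El\<^esub> inv\<^bsub>El\<^esub> \<uu> = t"
      "\<forall>p \<in> CPiv V C \<iota> H. p \<otimes>\<^bsub>El\<^esub> inv\<^bsub>El\<^esub> \<uu> \<otimes>\<^bsub>El\<^esub> \<uu> = p"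
      by blast+
  qed (auto simp: CBal_def CPiv_def balanced_to_pivotal pivotal_to_balanced)
qed

end

section \<open>Scalars: natural endomorphisms of the identity functor\<close>

context coend
begin

abbreviation "Sc \<equiv> C_scalars V C \<iota>"

lemma Sc_carrier: "s \<in> carrier Sc \<longleftrightarrow> typed s [C] []"
  by (simp add: C_scalars_def typed_def)

lemma scalar_hom: "X \<in> Ob V \<Longrightarrow> s \<in> carrier Sc \<Longrightarrow> Sig V \<iota> s X \<in> Hom V X X"
  using typed_Sig[of X s "[]"] by (simp add: Sc_carrier typed_def tob_Cons tensor_ob_unit)

lemma scalar_natural:
  assumes s: "s \<in> carrier Sc" and f: "f \<in> Hom V X Y"
  shows "Sig V \<iota> s Y \<cdot> f = f \<cdot> Sig V \<iota> s X"
proof -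
  have [simp]: "X \<in> Ob V" "Y \<in> Ob V" and t: "typed f [X] [Y]" using f hom_Ob by (auto simp: typed_def)
  note t = t s[unfolded Sc_carrier]
  note [den_intro] = t[THEN den_gen]
  have "Sig V \<iota> s Y \<cdot> f = (\<langle>Y\<rangle> \<otimes>\<^sub>a s) \<cdot> (\<delta> Y \<cdot> f)"
    unfolding Sig_def by (rule den_eqI, (rule den_intro | (simp; fail))+)
  also have "\<dots> = f \<cdot> Sig V \<iota> s X"
    unfolding delta_natural[OF f] Sig_def by (rule den_eqI, (rule den_intro | (simp; fail))+, simp add: diag tyi t)
  finally show ?thesis .
qed

lemma scalar_inj:
  "\<lbrakk>s \<in> carrier Sc; t \<in> carrier Sc; \<And>X. X \<in> Ob V \<Longrightarrow> Sig V \<iota> s X = Sig V \<iota> t X\<rbrakk> \<Longrightarrow> s = t"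
  by (rule coend_eqI1) (simp_all add: C_scalars_def Sig_def)

lemma scalar_from_nat:
  assumes F: "\<And>X. X \<in> Ob V \<Longrightarrow> F X \<in> Hom V X X"
    and nat: "\<And>X Y f. f \<in> Hom V X Y \<Longrightarrow> F Y \<cdot> f = f \<cdot> F X"
  shows "from_nat V C \<iota> \<^bold>1 F \<in> carrier Sc" "X \<in> Ob V \<Longrightarrow> Sig V \<iota> (from_nat V C \<iota> \<^bold>1 F) X = F X"
proof -
  have 1: "F X \<in> Hom V X (X \<otimes>\<^sub>o \<^bold>1)" if "X \<in> Ob V" for X
    using F[OF that] that by (simp add: tensor_ob_unit)
  have 2: "F Y \<cdot> f = (f \<otimes>\<^sub>a \<langle>\<^bold>1\<rangle>) \<cdot> F X" if "f \<in> Hom V X Y" for X Y f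
    using nat[OF that] hom_Ar[OF that] by (simp add: tensor_ar_unit)
  note f = from_nat[OF unit_closed 1 2]
  show "from_nat V C \<iota> \<^bold>1 F \<in> carrier Sc"
    using f(1) by (simp add: C_scalars_def)
  show "X \<in> Ob V \<Longrightarrow> Sig V \<iota> (from_nat V C \<iota> \<^bold>1 F) X = F X"
    unfolding Sig_def by (rule f(2))
qed

lemma scalar_mult:
  assumes s: "s \<in> carrier Sc" and t: "t \<in> carrier Sc"
  shows "s \<otimes>\<^bsub>Sc\<^esub> t \<in> carrier Sc" "X \<in> Ob V \<Longrightarrow> Sig V \<iota> (s \<otimes>\<^bsub>Sc\<^esub> t) X = Sig V \<iota> s X \<cdot> Sig V \<iota> t X"
proof -
  note ty = s[unfolded Sc_carrier] t[unfolded Sc_carrier]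
  note [den_intro] = ty[THEN den_gen]
  have "typed ((s \<otimes>\<^sub>a t) \<cdot> \<Delta>C) [C] []"
    by (rule den_typed, rule den_conv, (rule den_intro | (simp; fail))+)
  then show "s \<otimes>\<^bsub>Sc\<^esub> t \<in> carrier Sc"
    by (simp only: Sc_carrier) (simp add: C_scalars_def)
  assume [simp]: "X \<in> Ob V"
  have "Sig V \<iota> ((s \<otimes>\<^sub>a t) \<cdot> \<Delta>C) X = Sig V \<iota> s X \<cdot> Sig V \<iota> t X"
    unfolding Sig_def by (rule den_eqI, (rule den_intro | (simp; fail))+, simp add: diag tyi ty comC_r)
  then show "Sig V \<iota> (s \<otimes>\<^bsub>Sc\<^esub> t) X = Sig V \<iota> s X \<cdot> Sig V \<iota> t X"
    by (simp add: C_scalars_def)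
qed

lemma scalar_one: "\<one>\<^bsub>Sc\<^esub> \<in> carrier Sc" "X \<in> Ob V \<Longrightarrow> Sig V \<iota> \<one>\<^bsub>Sc\<^esub> X = \<langle>X\<rangle>"
  using couC by (simp_all add: C_scalars_def Sig_def typed_def)

lemma scalar_monoid: "monoid Sc"
proof (rule monoidI)
  fix x y z assume x: "x \<in> carrier Sc" and y: "y \<in> carrier Sc" and z: "z \<in> carrier Sc"
  show "x \<otimes>\<^bsub>Sc\<^esub> y \<otimes>\<^bsub>Sc\<^esub> z = x \<otimes>\<^bsub>Sc\<^esub> (y \<otimes>\<^bsub>Sc\<^esub> z)"
    by (rule scalar_inj) (simp_all add: scalar_mult x y z cmp_assoc[OF scalar_hom[OF _ z] scalar_hom[OF _ y] scalar_hom[OF _ x]])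
next
  fix x assume x: "x \<in> carrier Sc"
  show "\<one>\<^bsub>Sc\<^esub> \<otimes>\<^bsub>Sc\<^esub> x = x" "x \<otimes>\<^bsub>Sc\<^esub> \<one>\<^bsub>Sc\<^esub> = x"
    by (rule scalar_inj; simp add: scalar_mult scalar_one x cmp_ident[OF scalar_hom[OF _ x]])+
qed (simp_all add: scalar_mult scalar_one)

abbreviation "\<cc> \<equiv> c0_elem V C \<iota>"

lemma c0_hom: "X \<in> Ob V \<Longrightarrow> c0 V X \<in> Hom V X X"
  using typed_c0[of X] by (simp add: typed_def tob_Cons tensor_ob_unit)

lemma c0_elem: "\<cc> \<in> carrier Sc" "X \<in> Ob V \<Longrightarrow> Sig V \<iota> \<cc> X = c0 V X"
  unfolding c0_elem_def by (rule scalar_from_nat[OF c0_hom c0_natural]; assumption)+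

text \<open>As for C-elements, the pointwise inverses of a natural family are natural and are
  therefore represented.\<close>

lemma c0_elem_inv:
  "inv\<^bsub>Sc\<^esub> \<cc> \<in> carrier Sc"
  "X \<in> Ob V \<Longrightarrow> c0 V X \<cdot> Sig V \<iota> (inv\<^bsub>Sc\<^esub> \<cc>) X = \<langle>X\<rangle>"
proof -
  interpret Sc: monoid Sc by (rule scalar_monoid)
  obtain F where F: "\<And>X. X \<in> Ob V \<Longrightarrow> F X \<in> Hom V X X" "\<And>X. X \<in> Ob V \<Longrightarrow> F X \<cdot> c0 V X = \<langle>X\<rangle>" "\<And>X. X \<in> Ob V \<Longrightarrow> c0 V X \<cdot> F X = \<langle>X\<rangle>"
  proof -
    have "\<exists>d. d \<in> Hom V X X \<and> d \<cdot> c0 V X = \<langle>X\<rangle> \<and> c0 V X \<cdot> d = \<langle>X\<rangle>" if X: "X \<in> Ob V" for X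
      by (rule c0_iso[OF X]) (use X in \<open>auto simp: typed_def tob_Cons tensor_ob_unit\<close>)
    then show ?thesis using that by metis
  qed
  have nat: "F Y \<cdot> f = f \<cdot> F X" if f: "f \<in> Hom V X Y" for X Y f
  proof -
    have o: "X \<in> Ob V" "Y \<in> Ob V" using hom_Ob[OF f] by auto
    have "F Y \<cdot> f = F Y \<cdot> (f \<cdot> (c0 V X \<cdot> F X))"
      using F(3)[OF o(1)] cmp_ident[OF f] by simp
    also have "f \<cdot> (c0 V X \<cdot> F X) = (c0 V Y \<cdot> f) \<cdot> F X"
      unfolding c0_natural[OF f] by (rule cmp_assoc[symmetric, OF F(1)[OF o(1)] c0_hom[OF o(1)] f])
    also have "\<dots> = c0 V Y \<cdot> (f \<cdot> F X)"
      by (rule cmp_assoc[OF F(1)[OF o(1)] f c0_hom[OF o(2)]])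
    also have "F Y \<cdot> \<dots> = (F Y \<cdot> c0 V Y) \<cdot> (f \<cdot> F X)"
      by (rule cmp_assoc[symmetric, OF cmp_hom[OF F(1)[OF o(1)] f] c0_hom[OF o(2)] F(1)[OF o(2)]])
    finally show ?thesis
      using F(2)[OF o(2)] cmp_ident[OF cmp_hom[OF F(1)[OF o(1)] f]] by simp
  qed
  note b = scalar_from_nat[of F, OF F(1) nat]
  have ab: "\<cc> \<otimes>\<^bsub>Sc\<^esub> from_nat V C \<iota> \<^bold>1 F = \<one>\<^bsub>Sc\<^esub>" "from_nat V C \<iota> \<^bold>1 F \<otimes>\<^bsub>Sc\<^esub> \<cc> = \<one>\<^bsub>Sc\<^esub>"
    by (rule scalar_inj; simp add: b scalar_mult scalar_one c0_elem F)+
  have i: "inv\<^bsub>Sc\<^esub> \<cc> = from_nat V C \<iota> \<^bold>1 F"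
    using Sc.inv_unique'[OF c0_elem(1) b(1) ab] by simp
  show "inv\<^bsub>Sc\<^esub> \<cc> \<in> carrier Sc"
    "X \<in> Ob V \<Longrightarrow> c0 V X \<cdot> Sig V \<iota> (inv\<^bsub>Sc\<^esub> \<cc>) X = \<langle>X\<rangle>"
    unfolding i using b F by simp_all
qed

end

section \<open>The elements \<open>c_mu\<close> and \<open>q_mu\<close>\<close>

context quasitriangular
begin

lemma sh_scalar:
  assumes a: "a \<in> carrier El" and s: "s \<in> carrier Sc"
  shows "(a \<otimes>\<^sub>a s) \<cdot> \<Delta>C \<in> carrier El"
    "rmod A \<Longrightarrow> sh ((a \<otimes>\<^sub>a s) \<cdot> \<Delta>C) A = sh a A \<cdot> sg s (fst A)"
proof -
  note t = a[unfolded El_carrier] s[unfolded Sc_carrier]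
  note [den_intro] = t[THEN den_gen]
  show "(a \<otimes>\<^sub>a s) \<cdot> \<Delta>C \<in> carrier El"
    unfolding El_carrier by (rule den_typed, rule den_conv, (rule den_intro | (simp; fail))+)
  assume A [simp]: "rmod A"
  show "sh ((a \<otimes>\<^sub>a s) \<cdot> \<Delta>C) A = sh a A \<cdot> sg s (fst A)"
    unfolding sharp_def Sig_def by (rule den_eqI, (rule den_intro | (simp; fail))+, simp add: diag tyi t rmod_typed comC_r)
qed

abbreviation "Sel \<equiv> S_elem V C \<iota> H"
abbreviation "\<kk> \<equiv> c_mu V C \<iota> H R"
abbreviation "\<qq> \<equiv> q_mu V C \<iota> H R"

lemma S_evl:
  assumes A: "rmod A" and a: "a \<in> carrier El"
  shows "evl V (fst A) \<cdot> (\<langle>ldual V (fst A)\<rangle> \<otimes>\<^sub>a sh (Sel a) A) = evl V (fst A) \<cdot> (sh a (mod_ldual V H A) \<otimes>\<^sub>a \<langle>fst A\<rangle>)"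
  using S_elem(2)[OF a A mod_ldual(1,2)[OF A]] by simp

text \<open>Transposition along \<open>evl\<close> reverses composites, so \<open>S\<close> carries
  inverse elements to inverse elements.\<close>

lemma S_inverse:
  assumes A [simp]: "rmod A" and a: "a \<in> carrier El" and b: "b \<in> carrier El"
    and ab: "\<And>B. rmod B \<Longrightarrow> sh b B \<cdot> sh a B = \<langle>fst B\<rangle>"
  shows "sh (Sel a) A \<cdot> sh (Sel b) A = \<langle>fst A\<rangle>"
proof -
  note L = mod_ldual(1)[OF A]
  define M D e f g a' b' where d: "M = fst A" "D = ldual V M" "e = evl V M" "f = sh (Sel a) A" "g = sh (Sel b) A" "a' = sh a (mod_ldual V H A)" "b' = sh b (mod_ldual V H A)"
  have o [simp]: "M \<in> Ob V" "D \<in> Ob V" by (simp_all add: d ldual_closed)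
  have t: "typed f [M] [M]" "typed g [M] [M]" "typed a' [D] [D]" "typed b' [D] [D]" "typed e [D, M] []"
    using sh_hom[OF A S_elem(1)[OF a]] sh_hom[OF A S_elem(1)[OF b]] sh_hom[OF L a] sh_hom[OF L b] evl_hom[of M]
    by (simp_all add: typed_def tob_Cons tensor_ob_unit d ldual_closed)
  note [den_intro] = t[THEN den_gen]
  have e: "e \<cdot> (\<langle>D\<rangle> \<otimes>\<^sub>a f) = e \<cdot> (a' \<otimes>\<^sub>a \<langle>M\<rangle>)" "e \<cdot> (\<langle>D\<rangle> \<otimes>\<^sub>a g) = e \<cdot> (b' \<otimes>\<^sub>a \<langle>M\<rangle>)"
    using S_evl[OF A a] S_evl[OF A b] by (simp_all add: d)
  have i: "b' \<cdot> a' = \<langle>D\<rangle>"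
    using ab[OF L] by (simp add: d)
  have "e \<cdot> (\<langle>D\<rangle> \<otimes>\<^sub>a (f \<cdot> g)) = (e \<cdot> (\<langle>D\<rangle> \<otimes>\<^sub>a f)) \<cdot> (\<langle>D\<rangle> \<otimes>\<^sub>a g)" by (rule den_eqI, (rule den_intro | (simp; fail))+)
  also have "\<dots> = (e \<cdot> (\<langle>D\<rangle> \<otimes>\<^sub>a g)) \<cdot> (a' \<otimes>\<^sub>a \<langle>M\<rangle>)" unfolding e(1) by (rule den_eqI, (rule den_intro | (simp; fail))+, simp add: diag tyi t)
  also have "\<dots> = e \<cdot> ((b' \<cdot> a') \<otimes>\<^sub>a \<langle>M\<rangle>)" unfolding e(2) by (rule den_eqI, (rule den_intro | (simp; fail))+)
  also have "\<dots> = e \<cdot> (\<langle>D\<rangle> \<otimes>\<^sub>a \<langle>M\<rangle>)" unfolding i ..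
  finally have eq: "e \<cdot> (\<langle>D\<rangle> \<otimes>\<^sub>a (f \<cdot> g)) = e \<cdot> (\<langle>D\<rangle> \<otimes>\<^sub>a \<langle>M\<rangle>)" .
  show ?thesis
    by (rule evl_cancel_hom[OF rmod_Ob[OF A] cmp_hom[OF sh_hom[OF A S_elem(1)[OF b]] sh_hom[OF A S_elem(1)[OF a]]] ident_hom[OF rmod_Ob[OF A]]])
      (use eq in \<open>simp add: d\<close>)
qed

lemma S_drinfeld_elem: "Sel \<uu> \<in> carrier El" "Sel (inv\<^bsub>El\<^esub> \<uu>) \<in> carrier El"
  by (rule S_elem(1)[OF u_elem(1)], rule S_elem(1)[OF u_inv(2)])

lemma c_mu: "\<kk> \<in> carrier El" "rmod A \<Longrightarrow> sh \<kk> A = (sh (Sel \<uu>) A \<cdot> sh \<uu> A) \<cdot> c0 V (fst A)"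
  unfolding c_mu_def
  by (simp_all add: sh_scalar[OF El_mult_closed[OF u_elem(1) S_drinfeld_elem(1)] c0_elem(1)] sh_mult[OF _ u_elem(1) S_drinfeld_elem(1)] c0_elem(2))

lemma q_mu: "\<qq> \<in> carrier El"
  "rmod A \<Longrightarrow> sh \<qq> A = (sh (Sel (inv\<^bsub>El\<^esub> \<uu>)) A \<cdot> sh \<uu> A) \<cdot> sg (inv\<^bsub>Sc\<^esub> \<cc>) (fst A)"
  unfolding q_mu_def
  by (simp_all add: sh_scalar[OF El_mult_closed[OF u_elem(1) S_drinfeld_elem(2)] c0_elem_inv(1)] sh_mult[OF _ u_elem(1) S_drinfeld_elem(2)])

text \<open>\<open>S(u)\<close> crosses the pairing and becomes \<open>u\<close> on
  \<open>D\<close>. c_0 then supplies two crossings of \<open>\<sigma>\<close>: one is consumed by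
  the pairing law of \<open>u\<close> on \<open>D\<close> for \<open>e\<close>, the other by that of
  \<open>u\<close> on \<open>A\<close> for the braided pairing.\<close>

lemma c_mu_pairing:
  assumes A [simp]: "rmod A" and D [simp]: "rmod D" and e: "lin (D \<odot> A) e (mod_unit V H)"
  shows "e \<cdot> (\<langle>fst D\<rangle> \<otimes>\<^sub>a sh \<kk> A) = e \<cdot> mc A D \<cdot> mc D A"
proof -
  define M N c U US U' k1 k2 where d: "M = fst A" "N = fst D" "c = c0 V M" "U = sh \<uu> A" "US = sh (Sel \<uu>) A" "U' = sh \<uu> D" "k1 = mc A D" "k2 = mc D A"
  have o [simp]: "M \<in> Ob V" "N \<in> Ob V" by (simp_all add: d)
  have t: "typed e [N, M] []" "typed c [M] [M]" "typed U [M] [M]" "typed US [M] [M]" "typed U' [N] [N]" "typed k1 [M, N] [N, M]" "typed k2 [N, M] [M, N]"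
    using lin_pairing_typed[OF D A e] typed_c0[OF o(1)] sh_hom[OF A u_elem(1)] sh_hom[OF D u_elem(1)] sh_hom[OF A S_drinfeld_elem(1)] typed_mc[OF A D] typed_mc[OF D A]
    by (simp_all add: typed_def tob_Cons tensor_ob_unit d)
  note [den_intro] = t[THEN den_gen]
  have f: "lin (A \<odot> D) (e \<cdot> k1) (mod_unit V H)"
    unfolding d by (rule lin_comp[OF rmod_mt[OF A D] rmod_mt[OF D A] mod_unit_module mc_lin[OF A D] e])
  have 1: "e \<cdot> (\<langle>N\<rangle> \<otimes>\<^sub>a US) = e \<cdot> (U' \<otimes>\<^sub>a \<langle>M\<rangle>)"
    using S_elem(2)[OF u_elem(1) A D e] by (simp add: d)
  have 2: "(e \<cdot> (U' \<otimes>\<^sub>a \<langle>M\<rangle>)) \<cdot> (\<langle>N\<rangle> \<otimes>\<^sub>a c) = (e \<cdot> (U' \<otimes>\<^sub>a \<langle>M\<rangle>)) \<cdot> \<sigma> M N \<cdot> \<sigma> N M"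
    unfolding d(3) by (rule c0_pairing_right[OF o]) (rule den_typed, rule den_conv, (rule den_intro | (simp; fail))+)
  have 3: "e \<cdot> \<sigma> M N \<cdot> (\<langle>M\<rangle> \<otimes>\<^sub>a U') = e \<cdot> k1" "(e \<cdot> k1) \<cdot> \<sigma> N M \<cdot> (\<langle>N\<rangle> \<otimes>\<^sub>a U) = (e \<cdot> k1) \<cdot> k2"
    using u_pairing[OF D A e] u_pairing[OF A D f] by (simp_all add: d)
  have n: "U \<cdot> c = c \<cdot> U"
    using c0_natural[OF sh_hom[OF A u_elem(1)]] by (simp add: d)
  have "e \<cdot> (\<langle>N\<rangle> \<otimes>\<^sub>a ((US \<cdot> U) \<cdot> c)) = (e \<cdot> (\<langle>N\<rangle> \<otimes>\<^sub>a US)) \<cdot> (\<langle>N\<rangle> \<otimes>\<^sub>a (U \<cdot> c))" by (rule den_eqI, (rule den_intro | (simp; fail))+)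
  also have "\<dots> = ((e \<cdot> (U' \<otimes>\<^sub>a \<langle>M\<rangle>)) \<cdot> (\<langle>N\<rangle> \<otimes>\<^sub>a c)) \<cdot> (\<langle>N\<rangle> \<otimes>\<^sub>a U)" unfolding 1 n by (rule den_eqI, (rule den_intro | (simp; fail))+)
  also have "\<dots> = (e \<cdot> \<sigma> M N \<cdot> (\<langle>M\<rangle> \<otimes>\<^sub>a U')) \<cdot> \<sigma> N M \<cdot> (\<langle>N\<rangle> \<otimes>\<^sub>a U)" unfolding 2 by (rule den_eqI, (rule den_intro | (simp; fail))+, simp add: diag tyi t)
  also have "\<dots> = (e \<cdot> k1) \<cdot> k2" unfolding 3(1) by (rule 3(2))
  also have "\<dots> = e \<cdot> k1 \<cdot> k2" by (rule den_eqI, (rule den_intro | (simp; fail))+)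
  finally show ?thesis by (simp add: c_mu(2) d)
qed

text \<open>By the pairing formula the action is bent from a pairing composed of linear arrows only;
  the nonlinear ingredients \<open>u\<close> and c_0 have disappeared.\<close>

lemma c_mu_linear:
  assumes A [simp]: "rmod A"
  shows "lin A (sh \<kk> A) A"
proof -
  let ?L = "mod_ldual V H A"
  note L = mod_ldual[OF A]
  note [simp] = L(1) mod_unit_module
  define M D f k where d: "M = fst A" "D = ldual V M" "f = evl V M \<cdot> mc A ?L \<cdot> mc ?L A" "k = sh \<kk> A"
  have o [simp]: "M \<in> Ob V" "D \<in> Ob V" by (simp_all add: d ldual_closed)
  have lf: "lin (?L \<odot> A) f (mod_unit V H)"
    unfolding d
    by (rule lin_comp[OF _ _ _ lin_comp[OF _ _ _ mc_lin[OF L(1) A] mc_lin[OF A L(1)]] L(2)]) (simp_all add: rmod_mt)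
  have t: "typed f [D, M] []" "typed k [M] [M]"
    using lin_pairing_typed[OF L(1) A lf] sh_hom[OF A c_mu(1)] by (simp_all add: typed_def d)
  note [den_intro] = t[THEN den_gen]
  have fk: "f = evl V M \<cdot> (\<langle>D\<rangle> \<otimes>\<^sub>a k)"
    using c_mu_pairing[OF A L(1,2)] by (simp add: d)
  have "lin (mod_unit V H \<odot> A) (coevl V M \<otimes>\<^sub>a \<langle>M\<rangle>) ((A \<odot> ?L) \<odot> A)"
    using lin_tensor[OF mod_unit_module A _ A L(3) lin_ident[OF A]] by (simp add: rmod_mt d)
  moreover have "lin (A \<odot> (?L \<odot> A)) (\<langle>M\<rangle> \<otimes>\<^sub>a f) (A \<odot> mod_unit V H)"
    using lin_tensor[OF A _ A mod_unit_module lin_ident[OF A] lf] by (simp add: rmod_mt d)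
  ultimately have "lin A ((\<langle>M\<rangle> \<otimes>\<^sub>a f) \<cdot> (coevl V M \<otimes>\<^sub>a \<langle>M\<rangle>)) A"
    using lin_comp[of A "A \<odot> (?L \<odot> A)" A] by (simp add: rmod_mt mt_unit mt_assoc)
  also have "(\<langle>M\<rangle> \<otimes>\<^sub>a f) \<cdot> (coevl V M \<otimes>\<^sub>a \<langle>M\<rangle>) = k"
    unfolding fk d(2) by (rule den_eqI, (rule den_intro | (simp; fail))+, simp add: diag tyi t snakes)
  finally show ?thesis by (simp add: d)
qed

text \<open>The family of \<open>x\<close> is natural along the linear endomorphism given by
  \<open>a\<close>.\<close>

lemma linear_central:
  assumes a: "a \<in> carrier El" and l: "\<And>A. rmod A \<Longrightarrow> lin A (sh a A) A" and x: "x \<in> carrier El"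
  shows "a \<otimes>\<^bsub>El\<^esub> x = x \<otimes>\<^bsub>El\<^esub> a"
  by (rule sh_inj) (simp_all add: El_mult_closed a x sh_mult sh_natural[OF l _ _ x])

text \<open>Naturality of \<open>t\<close> along the linear evaluation, together with its value on
  the unit, makes the evaluation absorb \<open>t\<close> on the tensor product. The tensor law
  splits this into \<open>t\<close> on both factors and a double braiding; under the evaluation the
  former include \<open>S(t)\<close> and the latter is \<open>c_mu\<close>.\<close>

lemma balanced_S:
  assumes b: "C_balanced V C \<iota> H R t"
  shows "t \<otimes>\<^bsub>El\<^esub> \<kk> \<otimes>\<^bsub>El\<^esub> Sel t = \<one>\<^bsub>El\<^esub>"
proof -
  have tE: "t \<in> carrier El" and lt: "\<And>A. rmod A \<Longrightarrow> lin A (sh t A) A" and t1: "sh t (mod_unit V H) = \<langle>\<^bold>1\<rangle>"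
    and tt: "\<And>A B. rmod A \<Longrightarrow> rmod B \<Longrightarrow> sh t (A \<odot> B) = (sh t A \<otimes>\<^sub>a sh t B) \<cdot> mc B A \<cdot> mc A B"
    using b unfolding balanced_iff by blast+
  note SE = S_elem(1)[OF tE]
  show ?thesis
  proof (rule sh_inj)
    fix A assume A [simp]: "rmod A"
    note L = mod_ldual(1,2)[OF A]
    define M D e k1 k2 T T' S K where d: "M = fst A" "D = ldual V M" "e = evl V M" "k1 = mc A (mod_ldual V H A)" "k2 = mc (mod_ldual V H A) A"
      "T = sh t A" "T' = sh t (mod_ldual V H A)" "S = sh (Sel t) A" "K = sh \<kk> A"
    have o [simp]: "M \<in> Ob V" "D \<in> Ob V" by (simp_all add: d ldual_closed)
    have t: "typed e [D, M] []" "typed k1 [M, D] [D, M]" "typed k2 [D, M] [M, D]" "typed T [M] [M]" "typed T' [D] [D]" "typed S [M] [M]" "typed K [M] [M]"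
      using evl_hom[of M] typed_mc[OF A L(1)] typed_mc[OF L(1) A] sh_hom[OF A tE] sh_hom[OF L(1) tE] sh_hom[OF A SE] sh_hom[OF A c_mu(1)]
      by (simp_all add: typed_def tob_Cons tensor_ob_unit d ldual_closed)
    note [den_intro] = t[THEN den_gen]
    have 1: "e \<cdot> (\<langle>D\<rangle> \<otimes>\<^sub>a S) = e \<cdot> (T' \<otimes>\<^sub>a \<langle>M\<rangle>)"
      using S_evl[OF A tE] by (simp add: d)
    have 2: "e \<cdot> (\<langle>D\<rangle> \<otimes>\<^sub>a K) = e \<cdot> k1 \<cdot> k2"
      using c_mu_pairing[OF A L] by (simp add: d)
    have 3: "k1 \<cdot> k2 \<cdot> (T' \<otimes>\<^sub>a T) = (T' \<otimes>\<^sub>a T) \<cdot> k1 \<cdot> k2"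
      using double_mc_natural[OF L(1) A lt[OF L(1)] lt[OF A]] by (simp add: d)
    have "e \<cdot> (\<langle>D\<rangle> \<otimes>\<^sub>a (S \<cdot> K \<cdot> T)) = (e \<cdot> (\<langle>D\<rangle> \<otimes>\<^sub>a S)) \<cdot> (\<langle>D\<rangle> \<otimes>\<^sub>a (K \<cdot> T))" by (rule den_eqI, (rule den_intro | (simp; fail))+)
    also have "\<dots> = (e \<cdot> (\<langle>D\<rangle> \<otimes>\<^sub>a K)) \<cdot> (T' \<otimes>\<^sub>a T)" unfolding 1 by (rule den_eqI, (rule den_intro | (simp; fail))+, simp add: diag tyi t)
    also have "\<dots> = e \<cdot> (k1 \<cdot> k2 \<cdot> (T' \<otimes>\<^sub>a T))" unfolding 2 by (rule den_eqI, (rule den_intro | (simp; fail))+)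
    also have "\<dots> = e \<cdot> sh t (mod_ldual V H A \<odot> A)" unfolding 3 using tt[OF L(1) A] by (simp add: d)
    also have "\<dots> = sh t (mod_unit V H) \<cdot> e"
      unfolding d(3) using sh_natural[OF L(2) rmod_mt[OF L(1) A] mod_unit_module tE] by (simp add: d)
    also have "\<dots> = e \<cdot> (\<langle>D\<rangle> \<otimes>\<^sub>a \<langle>M\<rangle>)" unfolding t1 by (rule den_eqI, (rule den_intro | (simp; fail))+)
    finally have eq: "e \<cdot> (\<langle>D\<rangle> \<otimes>\<^sub>a (S \<cdot> K \<cdot> T)) = e \<cdot> (\<langle>D\<rangle> \<otimes>\<^sub>a \<langle>M\<rangle>)" .
    have "S \<cdot> K \<cdot> T = \<langle>M\<rangle>"
    proof (rule evl_cancel_hom[OF o(1) _ ident_hom[OF o(1)]])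
      have "typed (S \<cdot> K \<cdot> T) [M] [M]" by (rule den_typed, rule den_conv, (rule den_intro | (simp; fail))+)
      then show "S \<cdot> K \<cdot> T \<in> Hom V M M" by (simp add: typed_def tob_Cons tensor_ob_unit)
    qed (use eq in \<open>simp only: d(2,3)\<close>)
    then show "sh (t \<otimes>\<^bsub>El\<^esub> \<kk> \<otimes>\<^bsub>El\<^esub> Sel t) A = sh \<one>\<^bsub>El\<^esub> A"
      by (simp add: sh_mult El_mult_closed tE c_mu(1) SE sh_one d)
  qed (simp_all add: El_mult_closed El_one_closed tE SE c_mu(1))
qed

text \<open>The factors c_0 and \<open>S(u)\<close> cancel against their inverses in
  \<open>q_mu\<close>, leaving two copies of \<open>u\<close>. They stand apart at first; linearity
  of \<open>c_mu\<close> brings them together.\<close>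

lemma c_mu_q_mu: "\<kk> \<otimes>\<^bsub>El\<^esub> \<qq> = \<uu> \<otimes>\<^bsub>El\<^esub> \<uu>"
proof (rule sh_inj)
  fix A assume A [simp]: "rmod A"
  define M U S S' c c' where d: "M = fst A" "U = sh \<uu> A" "S = sh (Sel \<uu>) A" "S' = sh (Sel (inv\<^bsub>El\<^esub> \<uu>)) A" "c = c0 V M" "c' = sg (inv\<^bsub>Sc\<^esub> \<cc>) M"
  have o [simp]: "M \<in> Ob V" by (simp add: d)
  have t: "typed U [M] [M]" "typed S [M] [M]" "typed S' [M] [M]" "typed c [M] [M]" "typed c' [M] [M]"
    using sh_hom[OF A u_elem(1)] sh_hom[OF A S_drinfeld_elem(1)] sh_hom[OF A S_drinfeld_elem(2)] typed_c0[OF o] scalar_hom[OF o c0_elem_inv(1)]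
    by (simp_all add: typed_def tob_Cons tensor_ob_unit d)
  note [den_intro] = t[THEN den_gen]
  have i: "c \<cdot> c' = \<langle>M\<rangle>" "S' \<cdot> S = \<langle>M\<rangle>"
    using c0_elem_inv(2)[OF o] S_inverse[OF A u_inv(2) u_elem(1) u_inv(4)] by (simp_all add: d)
  have ku: "U \<cdot> ((S \<cdot> U) \<cdot> c) = ((S \<cdot> U) \<cdot> c) \<cdot> U"
    using sh_natural[OF c_mu_linear[OF A] A A u_elem(1)] by (simp add: c_mu(2) d)
  let ?K = "(S \<cdot> U) \<cdot> c"
  have K: "?K \<in> Hom V M M"
    using sh_hom[OF A c_mu(1)] by (simp add: c_mu(2) d)
  have n: "c' \<cdot> ?K = ?K \<cdot> c'" "c \<cdot> U = U \<cdot> c"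
    using scalar_natural[OF c0_elem_inv(1) K] c0_natural[OF sh_hom[OF A u_elem(1)]] by (simp_all add: d)
  have "((S' \<cdot> U) \<cdot> c') \<cdot> ?K = S' \<cdot> U \<cdot> (c' \<cdot> ?K)" by (rule den_eqI, (rule den_intro | (simp; fail))+)
  also have "\<dots> = S' \<cdot> (U \<cdot> ?K) \<cdot> c'" unfolding n(1) by (rule den_eqI, (rule den_intro | (simp; fail))+)
  also have "\<dots> = (S' \<cdot> S) \<cdot> U \<cdot> (c \<cdot> U) \<cdot> c'" unfolding ku by (rule den_eqI, (rule den_intro | (simp; fail))+)
  also have "\<dots> = U \<cdot> U \<cdot> (c \<cdot> c')" unfolding i(2) n(2) by (rule den_eqI, (rule den_intro | (simp; fail))+)
  also have "\<dots> = U \<cdot> U" unfolding i(1) by (rule den_eqI, (rule den_intro | (simp; fail))+)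
  finally show "sh (\<kk> \<otimes>\<^bsub>El\<^esub> \<qq>) A = sh (\<uu> \<otimes>\<^bsub>El\<^esub> \<uu>) A"
    by (simp add: sh_mult u_elem(1) c_mu q_mu d)
qed (simp_all add: El_mult_closed u_elem(1) c_mu(1) q_mu(1))

lemma balanced_ribbon_iff:
  assumes t: "t \<in> CBal V C \<iota> H R"
  shows "C_ribbon V C \<iota> H R t \<longleftrightarrow> t [^]\<^bsub>El\<^esub> (-2 :: int) = \<kk>"
    "C_ribbon V C \<iota> H R t \<longleftrightarrow> (t \<otimes>\<^bsub>El\<^esub> \<uu>) [^]\<^bsub>El\<^esub> (2 :: nat) = \<qq>"
proof -
  have b: "C_balanced V C \<iota> H R t"
    using t by (simp add: CBal_def)
  then have tE: "t \<in> carrier El" and lt: "\<And>A. rmod A \<Longrightarrow> lin A (sh t A) A"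
    unfolding balanced_iff by blast+
  have r: "C_ribbon V C \<iota> H R t \<longleftrightarrow> Sel t = t"
    using b by (simp add: C_ribbon_def)
  note crit = monoid.ribbon_criterion[OF El_monoid tE c_mu(1) S_elem(1)[OF tE] u_inv(1) q_mu(1)
      linear_central[OF tE lt] linear_central[OF c_mu(1) c_mu_linear] balanced_S[OF b] c_mu_q_mu]
  show "C_ribbon V C \<iota> H R t \<longleftrightarrow> t [^]\<^bsub>El\<^esub> (-2 :: int) = \<kk>"
    "C_ribbon V C \<iota> H R t \<longleftrightarrow> (t \<otimes>\<^bsub>El\<^esub> \<uu>) [^]\<^bsub>El\<^esub> (2 :: nat) = \<qq>"
    unfolding r by (rule crit; assumption)+
qed

end

theorem theorem1p3:
  fixes V :: "('o, 'm) braided_rigid" and C :: 'o and \<iota> :: "'o \<Rightarrow> 'm"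
    and H :: "('o, 'm) hopf" and R :: 'm
  assumes "braided_rigid_category V"
    and "coend V C \<iota>"
    and "hopf_algebra V H"
    and "R_matrix V C \<iota> H R"
  shows "bij_betw (\<lambda>t. t \<otimes>\<^bsub>C_elements V C \<iota> H\<^esub> drinfeld_elem V C \<iota> H R)
           (CBal V C \<iota> H R) (CPiv V C \<iota> H)
    \<and> (\<forall>t \<in> CBal V C \<iota> H R.
         (C_ribbon V C \<iota> H R t \<longleftrightarrow> t [^]\<^bsub>C_elements V C \<iota> H\<^esub> (-2 :: int) = c_mu V C \<iota> H R)
       \<and> (C_ribbon V C \<iota> H R t \<longleftrightarrow>
            (t \<otimes>\<^bsub>C_elements V C \<iota> H\<^esub> drinfeld_elem V C \<iota> H R) [^]\<^bsub>C_elements V C \<iota> H\<^esub> (2 :: nat)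
              = q_mu V C \<iota> H R))"
proof -
  interpret quasitriangular V C \<iota> H R
    using assms by (intro quasitriangular.intro quasitriangular_axioms.intro)
  show ?thesis
    using balanced_pivotal_bij balanced_ribbon_iff by blast
qed

end
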